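(* In the setting of the context, assume that there exists some $M=M(t,v)\in\mathscr{D}(\mathcal{Z}_h)$ with $M(t,v)>0$ for almost every $(t,v)\in\mathbb{R}_+\times V$ and such that the detailed balance condition $$b(t,v,v')M(t,v')=b(t,v',v)M(t,v)$$ holds for any $t\ge0$ and $\mu$-almost every $v,v'\in V$. If there is some $\lambda>0$ such that $$\lambda M(t,v)+\frac{\partial M}{\partial t}(t,v)\ge0\qquad\forall t\ge0\text{ and }\mu\text{-a.e. }v\in V,$$ then the evolution family $(\mathbf{V}_h(t,s))_{t\ge s\ge0}$ is honest in $\mathcal{E}_h$.
   Context: Let $\mu$ be a Borel measure on $\mathbb{R}^d$ ($d\ge1$) with support $V$ and $\mathcal{E}_h=L^1(V,\mathrm{d}\mu)$, with its usual norm and order. Assume: (1) $(t,v)\in\mathbb{R}_+\times V\mapsto\Sigma(t,v)$ is measurable and non-negative and, for $\mu$-a.e. $v$, $t\mapsto\Sigma(t,v)$ is locally integrable on $\mathbb{R}_+$; (2) $(t,v,v')\in\mathbb{R}_+\times V\times V\mapsto b(t,v,v')$ is measurable and non-negative and $\int_Vb(t,v,v')\,\mathrm{d}\mu(v)\le\Sigma(t,v')$ for a.e. $(t,v')\in\mathbb{R}_+\times V$. Put $\sigma(t,v)=\int_Vb(t,v',v)\,\mathrm{d}\mu(v')$. For $\varphi\in\mathcal{E}_h$ and $t\ge s\ge0$ let $[\mathbf{U}_h(t,s)\varphi](v)=\exp\big(-\int_s^t\Sigma(\tau,v)\,\mathrm{d}\tau\big)\varphi(v)$, and let $[\mathbf{B}_h(t)\varphi](v)=\int_Vb(t,v,v')\varphi(v')\,\mathrm{d}\mu(v')$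 with domain $\mathscr{D}(\mathbf{B}_h(t))=L^1(V,\mathrm{d}\mu)\cap L^1(V,\sigma(t,v)\,\mathrm{d}\mu(v))$. For any $\varphi\in\mathcal{E}_h$, $s\ge 0$, one has $\mathbf{U}_h(t,s)\varphi\in\mathscr{D}(\mathbf{B}_h(t))$ for a.e. $t\ge s$. Define $\mathbf{V}_{0,h}=\mathbf{U}_h$, $\mathbf{V}_{n+1,h}(t,s)\varphi=\int_s^t\mathbf{V}_{n,h}(t,r)\mathbf{B}_h(r)\mathbf{U}_h(r,s)\varphi\,\mathrm{d}r$, and $\mathbf{V}_h(t,s)\varphi=\sum_{n\ge0}\mathbf{V}_{n,h}(t,s)\varphi$; the series converges and $(\mathbf{V}_h(t,s))_{t\ge s\ge0}$ is a strongly continuous evolution family of positive operators with $\|\mathbf{V}_h(t,s)\varphi\|\le\|\varphi\|$ for $\varphi\ge0$. Let $\mathfrak{X}=L^1(\mathbb{R}_+,\mathcal{E}_h)=L^1(\mathbb{R}_+\times V,\mathrm{d}t\,\mathrm{d}\mu(v))$, $\mathfrak{X}_+$ its cone of a.e. non-negative functions, and $\langle\mathbf{\Psi},f\rangle=\int_0^\infty\int_Vf\,\mathrm{d}\mu\,\mathrm{d}t$. For $n\ge0$ put $[\mathcal{T}_{n,h}(t)f](s)=\mathbf{V}_{n,h}(s,s-t)f(s-t)$ if $s\ge t$, $0$ if $0\le s<t$, and $[\mathcal{T}_h(t)f](s)=\mathbf{V}_h(s,s-t)f(s-t)$ if $s\ge t$, $0$ if $0\le s<t$. $(\mathcal{T}_{0,h}(t))_{t\ge0}$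 and $(\mathcal{T}_h(t))_{t\ge0}$ are $C_0$-semigroups on $\mathfrak{X}$ with generators $\mathcal{Z}_h$ and $\mathcal{G}_h$ respectively. One has $\mathcal{Z}_hg=-\frac{\partial g}{\partial t}-\Sigma g$ with $\mathscr{D}(\mathcal{Z}_h)$ the set of $g\in\mathfrak{X}$ such that for $\mu$-a.e. $v$ the map $t\ge0\mapsto g(t,v)$ is absolutely continuous with $g(0,v)=0$, $\frac{\partial g}{\partial t}\in\mathfrak{X}$ and $\Sigma g\in\mathfrak{X}$. Moreover $\mathscr{D}(\mathcal{Z}_h)\subset\mathscr{D}(\mathcal{G}_h)$; let $\widehat{\mathfrak{B}}f=\mathcal{G}_hf-\mathcal{Z}_hf$ for $f\in\mathscr{D}(\mathcal{Z}_h)$. Honesty: for $f\in\mathscr{D}(\mathcal{Z}_h)$ put $\mathfrak{a}(f)=-\langle\mathbf{\Psi},\mathcal{Z}_hf+\widehat{\mathfrak{B}}f\rangle$; for $f\in\mathscr{D}(\mathcal{G}_h)$ the limit $\widehat{\mathfrak{a}}(f)=\lim_{t\to0^+}\frac1t\sum_{n=0}^\infty\mathfrak{a}\big(\int_0^t\mathcal{T}_{n,h}(s)f\,\mathrm{d}s\big)$ exists (known). $(\mathcal{T}_h(t))_{t\ge0}$ is honest if $\|\mathcal{T}_h(t)f\|_{\mathfrak{X}}=\|f\|_{\mathfrak{X}}-\widehat{\mathfrak{a}}\big(\int_0^t\mathcal{T}_h(s)f\,\mathrm{d}s\big)$ for all $f\in\mathfrak{X}_+$, $t\ge0$; $(\mathbf{V}_h(t,s))_{t\ge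 s\ge0}$ is honest in $\mathcal{E}_h$ if $(\mathcal{T}_h(t))_{t\ge0}$ is honest in $\mathfrak{X}$. *)

theory Defs
  imports "HOL-Analysis.Analysis"
begin

text \<open>
  Elements of an \<open>L\<^sup>1\<close> space are represented by integrable functions; equality in \<open>L\<^sup>1\<close> is
  equality almost everywhere, and every notion below that concerns \<open>L\<^sup>1\<close> depends on the
  representatives only up to null sets.  Under the identification of \<open>L\<^sup>1(\<real>\<^sub>+, E)\<close> with
  \<open>L\<^sup>1(\<real>\<^sub>+ \<times> V)\<close>, the vector-valued integrals and series are written pointwise in the remaining
  variables: the value of the Bochner integral of a family \<open>r \<mapsto> g\<^sub>r\<close> is \<open>v \<mapsto> \<integral> g\<^sub>r(v) dr\<close>.
\<close>

definition supp :: "('a::topological_space) measure \<Rightarrow> 'a set" where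
  "supp \<mu> = {x. \<forall>U. open U \<longrightarrow> x \<in> U \<longrightarrow> emeasure \<mu> U \<noteq> 0}"

text \<open>The half line with Lebesgue measure, \<open>\<mu>\<close> on its support \<open>V\<close>, and \<open>\<real>\<^sub>+ \<times> V\<close> with
  \<open>dt d\<mu>\<close>; thus \<open>E\<^sub>h\<close> is \<open>L\<^sup>1\<close> of \<^term>\<open>vmeas \<mu>\<close> and \<open>\<XX>\<close> is \<open>L\<^sup>1\<close> of \<^term>\<open>tvmeas \<mu>\<close>.\<close>

definition tmeas :: "real measure" where
  "tmeas = restrict_space lborel {0..}"

definition vmeas :: "('a::topological_space) measure \<Rightarrow> 'a measure" where
  "vmeas \<mu> = restrict_space \<mu> (supp \<mu>)"

definition tvmeas :: "('a::topological_space) measure \<Rightarrow> (real \<times> 'a) measure" where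
  "tvmeas \<mu> = tmeas \<Otimes>\<^sub>M vmeas \<mu>"

definition L1_norm :: "'b measure \<Rightarrow> ('b \<Rightarrow> real) \<Rightarrow> real" where
  "L1_norm N f = (\<integral>x. \<bar>f x\<bar> \<partial>N)"

definition absolutely_continuous_fun_on :: "real set \<Rightarrow> (real \<Rightarrow> real) \<Rightarrow> bool" where
  "absolutely_continuous_fun_on I f \<longleftrightarrow>
    (\<forall>\<epsilon>>0. \<exists>\<delta>>0. \<forall>(n::nat) a b.
      (\<forall>i<n. a i \<le> b i \<and> {a i..b i} \<subseteq> I) \<longrightarrow>
      (\<forall>i<n. \<forall>j<n. i \<noteq> j \<longrightarrow> {a i<..<b i} \<inter> {a j<..<b j} = {}) \<longrightarrow>
      (\<Sum>i<n. b i - a i) < \<delta> \<longrightarrow> (\<Sum>i<n. \<bar>f (b i) - f (a i)\<bar>) < \<epsilon>)"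


definition U_h :: "(real \<times> 'a \<Rightarrow> real) \<Rightarrow> real \<Rightarrow> real \<Rightarrow> ('a \<Rightarrow> real) \<Rightarrow> 'a \<Rightarrow> real" where
  "U_h Sig t s \<phi> v = exp (- (LBINT \<tau>:{s..t}. Sig (\<tau>, v))) * \<phi> v"

text \<open>Extended-valued: \<open>\<sigma>(t,v)\<close> is only known to be finite for almost every \<open>(t,v)\<close>.\<close>

definition sigma_h ::
  "('a::topological_space) measure \<Rightarrow> (real \<times> 'a \<times> 'a \<Rightarrow> real) \<Rightarrow> real \<Rightarrow> 'a \<Rightarrow> ennreal" where
  "sigma_h \<mu> b t v = (\<integral>\<^sup>+ v'. ennreal (b (t, v', v)) \<partial>vmeas \<mu>)"

definition dom_B_h ::
  "('a::topological_space) measure \<Rightarrow> (real \<times> 'a \<times> 'a \<Rightarrow> real) \<Rightarrow> real \<Rightarrow> ('a \<Rightarrow> real) set" where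
  "dom_B_h \<mu> b t =
    {\<phi>. integrable (vmeas \<mu>) \<phi> \<and> integrable (density (vmeas \<mu>) (sigma_h \<mu> b t)) \<phi>}"

text \<open>The value \<open>0\<close> off the domain is immaterial: for \<open>\<phi> \<in> E\<^sub>h\<close>, \<open>U\<^sub>h(r,s)\<phi>\<close> lies in the
  domain of \<open>B\<^sub>h(r)\<close> for almost every \<open>r\<close>, and only these values are integrated below.\<close>

definition B_h ::
  "('a::topological_space) measure \<Rightarrow> (real \<times> 'a \<times> 'a \<Rightarrow> real) \<Rightarrow>
    real \<Rightarrow> ('a \<Rightarrow> real) \<Rightarrow> 'a \<Rightarrow> real" where
  "B_h \<mu> b t \<phi> v =
    (if \<phi> \<in> dom_B_h \<mu> b t then \<integral>v'. b (t, v, v') * \<phi> v' \<partial>vmeas \<mu> else 0)"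

primrec Vn_h ::
  "('a::topological_space) measure \<Rightarrow> (real \<times> 'a \<Rightarrow> real) \<Rightarrow> (real \<times> 'a \<times> 'a \<Rightarrow> real) \<Rightarrow>
    nat \<Rightarrow> real \<Rightarrow> real \<Rightarrow> ('a \<Rightarrow> real) \<Rightarrow> 'a \<Rightarrow> real" where
  "Vn_h \<mu> Sig b 0 = U_h Sig"
| "Vn_h \<mu> Sig b (Suc n) = (\<lambda>t s \<phi> v.
    LBINT r:{s..t}. Vn_h \<mu> Sig b n t r (B_h \<mu> b r (U_h Sig r s \<phi>)) v)"

text \<open>For \<open>\<phi> \<ge> 0\<close> all terms are nonnegative, so the pointwise series agrees almost everywhere
  with the series in \<open>E\<^sub>h\<close>; the general case follows by linearity.\<close>

definition V_h ::
  "('a::topological_space) measure \<Rightarrow> (real \<times> 'a \<Rightarrow> real) \<Rightarrow> (real \<times> 'a \<times> 'a \<Rightarrow> real) \<Rightarrow>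
    real \<Rightarrow> real \<Rightarrow> ('a \<Rightarrow> real) \<Rightarrow> 'a \<Rightarrow> real" where
  "V_h \<mu> Sig b t s \<phi> v = (\<Sum>n. Vn_h \<mu> Sig b n t s \<phi> v)"


definition lift_evol ::
  "(real \<Rightarrow> real \<Rightarrow> ('a \<Rightarrow> real) \<Rightarrow> 'a \<Rightarrow> real) \<Rightarrow>
    real \<Rightarrow> (real \<times> 'a \<Rightarrow> real) \<Rightarrow> real \<times> 'a \<Rightarrow> real" where
  "lift_evol W t f = (\<lambda>(s, v). if t \<le> s then W s (s - t) (\<lambda>w. f (s - t, w)) v else 0)"

definition Tn_h ::
  "('a::topological_space) measure \<Rightarrow> (real \<times> 'a \<Rightarrow> real) \<Rightarrow> (real \<times> 'a \<times> 'a \<Rightarrow> real) \<Rightarrow>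
    nat \<Rightarrow> real \<Rightarrow> (real \<times> 'a \<Rightarrow> real) \<Rightarrow> real \<times> 'a \<Rightarrow> real" where
  "Tn_h \<mu> Sig b n = lift_evol (Vn_h \<mu> Sig b n)"

definition T_h ::
  "('a::topological_space) measure \<Rightarrow> (real \<times> 'a \<Rightarrow> real) \<Rightarrow> (real \<times> 'a \<times> 'a \<Rightarrow> real) \<Rightarrow>
    real \<Rightarrow> (real \<times> 'a \<Rightarrow> real) \<Rightarrow> real \<times> 'a \<Rightarrow> real" where
  "T_h \<mu> Sig b = lift_evol (V_h \<mu> Sig b)"

text \<open>The generator of a semigroup \<open>T\<close> on \<open>L\<^sup>1\<close> of \<open>N\<close>: its graph, its domain, and its value, which
  is determined up to equality almost everywhere.\<close>

definition generates_to ::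
  "'b measure \<Rightarrow> (real \<Rightarrow> ('b \<Rightarrow> real) \<Rightarrow> 'b \<Rightarrow> real) \<Rightarrow> ('b \<Rightarrow> real) \<Rightarrow> ('b \<Rightarrow> real) \<Rightarrow> bool" where
  "generates_to N T f g \<longleftrightarrow> integrable N f \<and> integrable N g \<and>
    ((\<lambda>t. L1_norm N (\<lambda>x. (T t f x - f x) / t - g x)) \<longlongrightarrow> 0) (at_right 0)"

definition gen_dom ::
  "'b measure \<Rightarrow> (real \<Rightarrow> ('b \<Rightarrow> real) \<Rightarrow> 'b \<Rightarrow> real) \<Rightarrow> ('b \<Rightarrow> real) set" where
  "gen_dom N T = {f. \<exists>g. generates_to N T f g}"

definition gen_op ::
  "'b measure \<Rightarrow> (real \<Rightarrow> ('b \<Rightarrow> real) \<Rightarrow> 'b \<Rightarrow> real) \<Rightarrow> ('b \<Rightarrow> real) \<Rightarrow> 'b \<Rightarrow> real" where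
  "gen_op N T f = (SOME g. generates_to N T f g)"

definition dom_Z_h ::
  "('a::topological_space) measure \<Rightarrow> (real \<times> 'a \<Rightarrow> real) \<Rightarrow> (real \<times> 'a \<times> 'a \<Rightarrow> real) \<Rightarrow>
    (real \<times> 'a \<Rightarrow> real) set" where
  "dom_Z_h \<mu> Sig b = gen_dom (tvmeas \<mu>) (Tn_h \<mu> Sig b 0)"

definition Z_h ::
  "('a::topological_space) measure \<Rightarrow> (real \<times> 'a \<Rightarrow> real) \<Rightarrow> (real \<times> 'a \<times> 'a \<Rightarrow> real) \<Rightarrow>
    (real \<times> 'a \<Rightarrow> real) \<Rightarrow> real \<times> 'a \<Rightarrow> real" where
  "Z_h \<mu> Sig b = gen_op (tvmeas \<mu>) (Tn_h \<mu> Sig b 0)"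

definition G_h ::
  "('a::topological_space) measure \<Rightarrow> (real \<times> 'a \<Rightarrow> real) \<Rightarrow> (real \<times> 'a \<times> 'a \<Rightarrow> real) \<Rightarrow>
    (real \<times> 'a \<Rightarrow> real) \<Rightarrow> real \<times> 'a \<Rightarrow> real" where
  "G_h \<mu> Sig b = gen_op (tvmeas \<mu>) (T_h \<mu> Sig b)"

text \<open>\<open>\<BB>\<close>-hat and the functional \<open>\<aa>\<close>, both meant on \<^term>\<open>dom_Z_h \<mu> Sig b\<close>.\<close>

definition B_hat ::
  "('a::topological_space) measure \<Rightarrow> (real \<times> 'a \<Rightarrow> real) \<Rightarrow> (real \<times> 'a \<times> 'a \<Rightarrow> real) \<Rightarrow>
    (real \<times> 'a \<Rightarrow> real) \<Rightarrow> real \<times> 'a \<Rightarrow> real" where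
  "B_hat \<mu> Sig b f = (\<lambda>x. G_h \<mu> Sig b f x - Z_h \<mu> Sig b f x)"

definition a_fun ::
  "('a::topological_space) measure \<Rightarrow> (real \<times> 'a \<Rightarrow> real) \<Rightarrow> (real \<times> 'a \<times> 'a \<Rightarrow> real) \<Rightarrow>
    (real \<times> 'a \<Rightarrow> real) \<Rightarrow> real" where
  "a_fun \<mu> Sig b f = - (\<integral>x. Z_h \<mu> Sig b f x + B_hat \<mu> Sig b f x \<partial>tvmeas \<mu>)"

definition a_hat ::
  "('a::topological_space) measure \<Rightarrow> (real \<times> 'a \<Rightarrow> real) \<Rightarrow> (real \<times> 'a \<times> 'a \<Rightarrow> real) \<Rightarrow>
    (real \<times> 'a \<Rightarrow> real) \<Rightarrow> real" where
  "a_hat \<mu> Sig b f = Lim (at_right 0)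
    (\<lambda>t. 1 / t * (\<Sum>n. a_fun \<mu> Sig b (\<lambda>x. LBINT s:{0..t}. Tn_h \<mu> Sig b n s f x)))"

definition honest_semigroup ::
  "('a::topological_space) measure \<Rightarrow> (real \<times> 'a \<Rightarrow> real) \<Rightarrow> (real \<times> 'a \<times> 'a \<Rightarrow> real) \<Rightarrow> bool" where
  "honest_semigroup \<mu> Sig b \<longleftrightarrow>
    (\<forall>f t. integrable (tvmeas \<mu>) f \<longrightarrow> (AE x in tvmeas \<mu>. 0 \<le> f x) \<longrightarrow> 0 \<le> t \<longrightarrow>
      L1_norm (tvmeas \<mu>) (T_h \<mu> Sig b t f) =
      L1_norm (tvmeas \<mu>) f - a_hat \<mu> Sig b (\<lambda>x. LBINT s:{0..t}. T_h \<mu> Sig b s f x))"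

definition honest_evolution ::
  "('a::topological_space) measure \<Rightarrow> (real \<times> 'a \<Rightarrow> real) \<Rightarrow> (real \<times> 'a \<times> 'a \<Rightarrow> real) \<Rightarrow> bool" where
  "honest_evolution \<mu> Sig b \<longleftrightarrow> honest_semigroup \<mu> Sig b"

end

theory Submission
  imports Defs
begin

text \<open>
  Honesty compares two ways of counting mass, and the proof reduces it to the decay of a single
  sequence of masses.  Write \<open>T\<^sub>n(u)\<close> for the Dyson--Phillips terms of the lifted semigroup,
  \<open>J\<^sub>n = \<integral>\<^sub>0\<^sup>u T\<^sub>n(s) f ds\<close> for a nonnegative \<open>f\<close>, and \<open>B\<close> for the scattering operator acting at each time.
  The particles with exactly \<open>n\<close> scatterings that appear during \<open>[0, u]\<close> form \<open>source\<^sub>0 = f\<close> or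
  \<open>source\<^sub>n = B J\<^sub>n\<^sub>-\<^sub>1\<close>.  They survive as \<open>T\<^sub>n(u) f\<close>, are scattered once more, making up \<open>B J\<^sub>n\<close>, or are absorbed, and
  \<open>\<aa>(J\<^sub>n) = mass(source\<^sub>n) - mass(T\<^sub>n(u) f) - mass(B J\<^sub>n)\<close> counts the absorbed ones (\<open>a_fun_J\<close>).  The sum over \<open>n\<close> telescopes:
  up to \<open>k\<close> it equals \<open>mass f - \<Sum>\<^sub>n\<^sub>\<le>\<^sub>k mass(T\<^sub>n(u) f) - mass(B J\<^sub>k)\<close>.  Hence if \<open>mass(B J\<^sub>k)\<close> tends to \<open>0\<close>,
  the functional defining \<open>\<aa>\<close>-hat is exactly the loss of mass of the full semigroup, which is honesty
  (\<open>honest_if_gain_vanishes\<close>).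

  The weight \<open>M\<close> forces this decay.  The hypothesis on \<open>\<partial>M/\<partial>t\<close> makes \<open>exp(\<lambda>t) M(t,v)\<close> nondecreasing in \<open>t\<close>
  (\<open>ac_exp_mono\<close>), and detailed balance gives \<open>B M = \<sigma> M \<le> \<Sigma> M\<close>.  With \<open>R\<close> the resolvent at \<open>\<lambda> + 1\<close> of the
  transport without scattering, these two facts give \<open>R B M \<le> M\<close> (\<open>supersolution_RB_le\<close>).  The
  iterates \<open>f\<^sub>n = (R B)\<^sup>n M\<close> therefore stay below \<open>M\<close>, and the mass balance of the resolvent reads
  \<open>(\<lambda> + 1) mass f\<^sub>n\<^sub>+\<^sub>1 + mass(\<Sigma> f\<^sub>n\<^sub>+\<^sub>1) \<le> mass(\<Sigma> f\<^sub>n)\<close>.  Since \<open>\<Sigma> M\<close> is integrable, the masses of the \<open>f\<^sub>n\<close> are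
  summable, so \<open>f\<^sub>n\<close> tends to \<open>0\<close> almost everywhere, and domination by \<open>\<Sigma> M\<close> yields
  \<open>mass(B f\<^sub>n) \<rightarrow> 0\<close> (\<open>supersolution_gain_vanishes\<close>).  As \<open>M > 0\<close>, a general \<open>f\<close> is the limit of \<open>min f (k M)\<close>; the
  remainder is harmless because \<open>B (R B)\<^sup>n R\<close> does not increase mass, and \<open>J\<^sub>n \<le> exp((\<lambda> + 1) u) (R B)\<^sup>n R f\<close>
  transfers the decay to \<open>J\<^sub>n\<close> (\<open>gain_vanishes\<close>).

  Two points need the generators.  Integrability of \<open>\<Sigma> M\<close> is extracted from membership of \<open>M\<close> in the domain
  of the generator of \<open>T\<^sub>0\<close>: the mass lost along \<open>T\<^sub>0\<close> during time \<open>\<tau>\<close> is at most \<open>C \<tau>\<close>, but it is also about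
  \<open>\<tau> mass(\<Sigma> M)\<close> (\<open>Sg_mass_bound\<close>).  The value of the generator of the full semigroup at \<open>J\<^sub>n\<close> is found by
  writing \<open>J\<^sub>n\<close> as a difference of two resolvents of integrable functions (\<open>resolvent_window\<close>), since on the range of
  the resolvent the difference quotients converge in mass (\<open>resolvent_generator_limit\<close>).

  All estimates are carried out for functions with values in \<open>[0, \<infinity>]\<close> on the whole line times \<open>V\<close>, where sums
  and integrals may be exchanged freely and translation in time preserves mass.  The relation \<open>Rep\<close>
  connects them with the real-valued functions on \<open>\<real>\<^sub>+ \<times> V\<close> for which the theorem is stated.
\<close>

section \<open>Exponential rates\<close>

lemma indicator_Icc_measurable[measurable (raw)]:
  fixes S T R :: "'q \<Rightarrow> real"
  assumes [measurable]: "S \<in> borel_measurable Q" "T \<in> borel_measurable Q" "R \<in> borel_measurable Q"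
  shows "(\<lambda>q. indicator {S q..T q} (R q) :: 'c :: {real_normed_algebra_1, second_countable_topology}) \<in> borel_measurable Q"
    and "(\<lambda>q. indicator {S q..T q} (R q) :: ennreal) \<in> borel_measurable Q"
  unfolding indicator_def atLeastAtMost_iff by measurable

lemma tonelli:
  assumes "sigma_finite_measure A" "sigma_finite_measure B"
    and "case_prod f \<in> borel_measurable (A \<Otimes>\<^sub>M B)"
  shows "(\<integral>\<^sup>+ x. \<integral>\<^sup>+ y. f x y \<partial>B \<partial>A) = (\<integral>\<^sup>+ y. \<integral>\<^sup>+ x. f x y \<partial>A \<partial>B)"
proof -
  interpret A: sigma_finite_measure A by fact
  interpret B: sigma_finite_measure B by fact
  interpret pair_sigma_finite A B ..
  show ?thesis using Fubini'[OF assms(3)] by simp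
qed

lemma exp_minus_tail:
  "ennreal (exp (- x)) = (\<integral>\<^sup>+y. indicator {x..} y * ennreal (exp (- y)) \<partial>lborel)"
proof -
  have "(\<integral>\<^sup>+y. ennreal (exp (- y)) * indicator {x..} y \<partial>lborel) = ennreal (0 - (- exp (- x)))"
  proof (rule nn_integral_FTC_atLeast)
    show "((\<lambda>x. - exp (- x)) \<longlongrightarrow> (0::real)) at_top"
      using tendsto_minus[OF filterlim_compose[OF exp_at_bot filterlim_uminus_at_bot_at_top]] by simp
  qed (auto intro!: derivative_eq_intros)
  thus ?thesis by (simp add: mult.commute)
qed

text \<open>
  Slicing \<open>exp (- H)\<close> into its level sets compares \<open>H\<close> with the identity on \<open>[0, m]\<close>, \<open>m\<close> the total mass, for which
  equality holds.  It serves to integrate \<open>g exp (- \<integral> g)\<close> when \<open>g\<close> is merely integrable and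
  no chain rule is at hand.
\<close>

lemma layer_cake_exp:
  assumes fin: "finite_measure \<rho>" and H[measurable]: "H \<in> borel_measurable \<rho>"
    and nn: "\<And>x. x \<in> space \<rho> \<Longrightarrow> 0 \<le> H x"
    and sub: "\<And>y. 0 \<le> y \<Longrightarrow> emeasure \<rho> {x \<in> space \<rho>. H x \<le> y} \<le> ennreal y"
  shows "(\<integral>\<^sup>+x. ennreal (exp (- H x)) \<partial>\<rho>) + ennreal (exp (- measure \<rho> (space \<rho>))) \<le> 1"
proof -
  interpret finite_measure \<rho> by fact
  define m where "m = measure \<rho> (space \<rho>)"
  have m: "0 \<le> m" unfolding m_def by simp
  have "(\<integral>\<^sup>+x. ennreal (exp (- H x)) \<partial>\<rho>) =
      (\<integral>\<^sup>+x. \<integral>\<^sup>+y. indicator {H x..} y * ennreal (exp (- y)) \<partial>lborel \<partial>\<rho>)"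
    by (subst exp_minus_tail) simp
  also have "\<dots> = (\<integral>\<^sup>+y. \<integral>\<^sup>+x. indicator {H x..} y * ennreal (exp (- y)) \<partial>\<rho> \<partial>lborel)"
    by (rule tonelli) (unfold_locales, auto simp: indicator_def atLeast_def)
  also have "\<dots> \<le> (\<integral>\<^sup>+y. \<integral>\<^sup>+x. indicator {0..m} x * (indicator {x..} y * ennreal (exp (- y))) \<partial>lborel \<partial>lborel)"
  proof (rule nn_integral_mono)
    fix y :: real
    have e: "(\<integral>\<^sup>+x. indicator {H x..} y * ennreal (exp (- y)) \<partial>\<rho>) =
        emeasure \<rho> {x \<in> space \<rho>. H x \<le> y} * ennreal (exp (- y))"
    proof -
      have "(\<integral>\<^sup>+x. indicator {H x..} y * ennreal (exp (- y)) \<partial>\<rho>)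
         = (\<integral>\<^sup>+x. indicator {x \<in> space \<rho>. H x \<le> y} x * ennreal (exp (- y)) \<partial>\<rho>)"
        by (rule nn_integral_cong) (auto simp: indicator_def)
      also have "\<dots> = emeasure \<rho> {x \<in> space \<rho>. H x \<le> y} * ennreal (exp (- y))"
        by (subst nn_integral_multc) auto
      finally show ?thesis .
    qed
    have e2: "(\<integral>\<^sup>+x. indicator {0..m} x * (indicator {x..} y * ennreal (exp (- y))) \<partial>lborel) =
       emeasure lborel {0..min m y} * ennreal (exp (- y))"
    proof -
      have "(\<integral>\<^sup>+x. indicator {0..m} x * (indicator {x..} y * ennreal (exp (- y))) \<partial>lborel) =
        (\<integral>\<^sup>+x. indicator {0..min m y} x * ennreal (exp (- y)) \<partial>lborel)"
        by (rule nn_integral_cong) (auto simp: indicator_def)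
      thus ?thesis by (simp add: nn_integral_multc)
    qed
    have "emeasure \<rho> {x \<in> space \<rho>. H x \<le> y} \<le> emeasure lborel {0..min m y}"
    proof (cases "0 \<le> y")
      case True
      have "emeasure \<rho> {x \<in> space \<rho>. H x \<le> y} \<le> emeasure \<rho> (space \<rho>)"
        by (rule emeasure_mono) auto
      hence "emeasure \<rho> {x \<in> space \<rho>. H x \<le> y} \<le> ennreal m"
        unfolding m_def by (simp add: emeasure_eq_measure)
      with sub[OF True] True m show ?thesis by (simp add: min_def)
    next
      case False
      hence "{x \<in> space \<rho>. H x \<le> y} = {}" using nn by force
      thus ?thesis by (simp only: emeasure_empty zero_le)
    qed
    thus "(\<integral>\<^sup>+x. indicator {H x..} y * ennreal (exp (- y)) \<partial>\<rho>) \<le>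
       (\<integral>\<^sup>+x. indicator {0..m} x * (indicator {x..} y * ennreal (exp (- y))) \<partial>lborel)"
      unfolding e e2 by (rule mult_right_mono) simp
  qed
  also have "\<dots> = (\<integral>\<^sup>+x. \<integral>\<^sup>+y. indicator {0..m} x * (indicator {x..} y * ennreal (exp (- y))) \<partial>lborel \<partial>lborel)"
    by (rule tonelli) (unfold_locales, auto simp: indicator_def[of "atLeast _"] atLeast_def)
  also have "\<dots> = (\<integral>\<^sup>+x. ennreal (exp (- x)) * indicator {0..m} x \<partial>lborel)"
    by (rule nn_integral_cong) (subst exp_minus_tail, subst nn_integral_cmult, auto simp: mult.commute)
  also have "\<dots> = ennreal (- exp (- m) - (- exp (- 0)))"
    by (rule nn_integral_FTC_Icc) (auto intro!: derivative_eq_intros m)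
  finally have "(\<integral>\<^sup>+x. ennreal (exp (- H x)) \<partial>\<rho>) + ennreal (exp (- m)) \<le>
     ennreal (1 - exp (- m)) + ennreal (exp (- m))" by (simp add: add_right_mono)
  also have "\<dots> = 1" using m by (simp flip: ennreal_plus)
  finally show ?thesis unfolding m_def .
qed

text \<open>
  For continuous \<open>g\<close> both integrands are derivatives of exponentials and equality holds.  For
  integrable \<open>g\<close> the layer cake bound is applied to the measure with density \<open>g\<close>: the sublevel
  sets of the primitive are intervals of \<open>g\<close>-mass at most the level.
\<close>

lemma exp_rate_le:
  fixes g :: "real \<Rightarrow> real"
  assumes [measurable]: "g \<in> borel_measurable borel" and nn: "\<And>t. 0 \<le> g t"
    and int: "set_integrable lborel {a..b} g" and ab: "a \<le> b"
  shows "(\<integral>\<^sup>+t. indicator {a..b} t * (ennreal (g t) * ennreal (exp (- (LBINT \<tau>:{a..t}. g \<tau>)))) \<partial>lborel)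
           + ennreal (exp (- (LBINT \<tau>:{a..b}. g \<tau>))) \<le> 1" (is "?F")
    and "(\<integral>\<^sup>+t. indicator {a..b} t * (ennreal (g t) * ennreal (exp (- (LBINT \<tau>:{t..b}. g \<tau>)))) \<partial>lborel)
           + ennreal (exp (- (LBINT \<tau>:{a..b}. g \<tau>))) \<le> 1" (is "?G")
proof -
  define \<rho> where "\<rho> = density lborel (\<lambda>t. indicator {a..b} t * ennreal (g t))"
  have sub: "set_integrable lborel {s..t} g" if "a \<le> s" "t \<le> b" for s t
    by (rule set_integrable_subset[OF int]) (use that in auto)
  have mass: "(\<integral>\<^sup>+\<tau>. indicator {s..t} \<tau> * ennreal (g \<tau>) \<partial>lborel) = ennreal (LBINT \<tau>:{s..t}. g \<tau>)"
    if "a \<le> s" "t \<le> b" for s t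
  proof -
    have "(\<integral>\<^sup>+\<tau>. indicator {s..t} \<tau> * ennreal (g \<tau>) \<partial>lborel) =
       (\<integral>\<^sup>+\<tau>. ennreal (indicator {s..t} \<tau> *\<^sub>R g \<tau>) \<partial>lborel)"
      by (rule nn_integral_cong) (auto simp: indicator_def)
    also have "\<dots> = ennreal (LBINT \<tau>:{s..t}. g \<tau>)"
      unfolding set_lebesgue_integral_def
      by (rule nn_integral_eq_integral) (use sub[OF that] nn in \<open>auto simp: set_integrable_def\<close>)
    finally show ?thesis .
  qed
  have em: "emeasure \<rho> A = (\<integral>\<^sup>+\<tau>. indicator {a..b} \<tau> * ennreal (g \<tau>) * indicator A \<tau> \<partial>lborel)"
    if "A \<in> sets borel" for A unfolding \<rho>_def by (subst emeasure_density) (use that in auto)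
  have tot: "emeasure \<rho> (space \<rho>) = ennreal (LBINT \<tau>:{a..b}. g \<tau>)"
    using mass[of a b] em[of UNIV] by (simp add: \<rho>_def)
  have tot': "measure \<rho> (space \<rho>) = (LBINT \<tau>:{a..b}. g \<tau>)"
    using tot nn by (simp add: measure_def set_lebesgue_integral_def integral_nonneg_AE)
  have fin: "finite_measure \<rho>" by (rule finite_measureI) (simp add: tot)
  have [measurable_cong, simp]: "sets \<rho> = sets borel" and [simp]: "space \<rho> = UNIV" by (auto simp: \<rho>_def)
  have HK: "(LBINT \<tau>:{s..t}. g \<tau>) = integral {s..t} g" if "a \<le> s" "t \<le> b" for s t
    using sub[OF that] by (rule set_borel_integral_eq_integral)
  have iab: "g integrable_on {a..b}" using int by (rule set_borel_integral_eq_integral)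
  have key: "(\<integral>\<^sup>+t. indicator {a..b} t * (ennreal (g t) * ennreal (exp (- H t))) \<partial>lborel)
           + ennreal (exp (- (LBINT \<tau>:{a..b}. g \<tau>))) \<le> 1"
    if [measurable]: "H \<in> borel_measurable borel" and "\<And>x. 0 \<le> H x"
    and lev: "\<And>y. 0 \<le> y \<Longrightarrow> \<exists>s t. a \<le> s \<and> t \<le> b \<and> {x\<in>{a..b}. H x \<le> y} \<subseteq> {s..t} \<and> (LBINT \<tau>:{s..t}. g \<tau>) \<le> y"
    for H
  proof -
    have "(\<integral>\<^sup>+x. ennreal (exp (- H x)) \<partial>\<rho>) + ennreal (exp (- measure \<rho> (space \<rho>))) \<le> 1"
    proof (rule layer_cake_exp[OF fin])
      fix y :: real assume "0 \<le> y"
      from lev[OF this] obtain s t where st: "a \<le> s" "t \<le> b" "{x\<in>{a..b}. H x \<le> y} \<subseteq> {s..t}"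
        "(LBINT \<tau>:{s..t}. g \<tau>) \<le> y" by blast
      have "emeasure \<rho> {x \<in> space \<rho>. H x \<le> y} \<le> (\<integral>\<^sup>+\<tau>. indicator {s..t} \<tau> * ennreal (g \<tau>) \<partial>lborel)"
        by (subst em, simp, rule nn_integral_mono) (use st(3) in \<open>auto simp: indicator_def\<close>)
      also have "\<dots> \<le> ennreal y" using st by (simp add: mass ennreal_leI)
      finally show "emeasure \<rho> {x \<in> space \<rho>. H x \<le> y} \<le> ennreal y" .
    qed (use that in auto)
    also have "(\<integral>\<^sup>+x. ennreal (exp (- H x)) \<partial>\<rho>) =
      (\<integral>\<^sup>+t. indicator {a..b} t * (ennreal (g t) * ennreal (exp (- H t))) \<partial>lborel)"
      unfolding \<rho>_def by (subst nn_integral_density) (auto simp: mult.assoc)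
    finally show ?thesis unfolding tot' .
  qed
  have nnL: "0 \<le> (LBINT \<tau>:{s..t}. g \<tau>)" for s t
    unfolding set_lebesgue_integral_def by (rule integral_nonneg_AE) (use nn in auto)
  show ?F
  proof (rule key)
    show "(\<lambda>t. LBINT \<tau>:{a..t}. g \<tau>) \<in> borel_measurable borel"
      unfolding set_lebesgue_integral_def by measurable
    fix y :: real assume y: "0 \<le> y"
    \<comment> \<open>The sublevel set is compact, so its largest element bounds an interval of mass at most \<open>y\<close>.\<close>
    define A where "A = {x\<in>{a..b}. (LBINT \<tau>:{a..x}. g \<tau>) \<le> y}"
    have A': "A = {x\<in>{a..b}. integral {a..x} g \<le> y}" using HK by (auto simp: A_def)
    have cl: "compact A"
    proof -
      have "closed A" unfolding A'
        by (rule continuous_on_closed_Collect_le[OF indefinite_integral_continuous_1[OF iab]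
            continuous_on_const closed_atLeastAtMost])
      moreover have "bounded A"
        by (rule bounded_subset[OF bounded_closed_interval[of a b]]) (auto simp: A_def)
      ultimately show ?thesis by (simp add: compact_eq_bounded_closed)
    qed
    have "A \<noteq> {}" using ab y by (auto simp: A' intro!: exI[of _ a])
    from compact_attains_sup[OF cl this] obtain t where "t \<in> A" "\<And>x. x \<in> A \<Longrightarrow> x \<le> t" by blast
    thus "\<exists>s t. a \<le> s \<and> t \<le> b \<and> {x\<in>{a..b}. (LBINT \<tau>:{a..x}. g \<tau>) \<le> y} \<subseteq> {s..t} \<and> (LBINT \<tau>:{s..t}. g \<tau>) \<le> y"
      unfolding A_def by (intro exI[of _ a] exI[of _ t]) auto
  qed (rule nnL)
  show ?G
  proof (rule key)
    show "(\<lambda>t. LBINT \<tau>:{t..b}. g \<tau>) \<in> borel_measurable borel"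
      unfolding set_lebesgue_integral_def by measurable
    fix y :: real assume y: "0 \<le> y"
    define A where "A = {x\<in>{a..b}. (LBINT \<tau>:{x..b}. g \<tau>) \<le> y}"
    have A': "A = {x\<in>{a..b}. integral {x..b} g \<le> y}" using HK by (auto simp: A_def)
    have cl: "compact A"
    proof -
      have "closed A" unfolding A'
        by (rule continuous_on_closed_Collect_le[OF indefinite_integral_continuous_1'[OF iab]
            continuous_on_const closed_atLeastAtMost])
      moreover have "bounded A"
        by (rule bounded_subset[OF bounded_closed_interval[of a b]]) (auto simp: A_def)
      ultimately show ?thesis by (simp add: compact_eq_bounded_closed)
    qed
    have "A \<noteq> {}" using ab y by (auto simp: A' intro!: exI[of _ b])
    from compact_attains_inf[OF cl this] obtain t where "t \<in> A" "\<And>x. x \<in> A \<Longrightarrow> t \<le> x" by blast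
    thus "\<exists>s t. a \<le> s \<and> t \<le> b \<and> {x\<in>{a..b}. (LBINT \<tau>:{x..b}. g \<tau>) \<le> y} \<subseteq> {s..t} \<and> (LBINT \<tau>:{s..t}. g \<tau>) \<le> y"
      unfolding A_def by (intro exI[of _ t] exI[of _ b]) auto
  qed (rule nnL)
qed

section \<open>Iterated scattering\<close>

text \<open>
  Time runs over the whole line and the rate \<open>b\<close> takes values in \<open>[0, \<infinity>]\<close>; in this form all
  operators below are kernels to which Tonelli's theorem applies without side conditions.
\<close>

locale kinetic = sigma_finite_measure N for N :: "'a measure" +
  fixes Sg :: "real \<Rightarrow> 'a \<Rightarrow> real" and b :: "real \<Rightarrow> 'a \<Rightarrow> 'a \<Rightarrow> ennreal"
  assumes Sg_meas[measurable]: "case_prod Sg \<in> borel_measurable (borel \<Otimes>\<^sub>M N)"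
    and Sg_nn: "\<And>t v. 0 \<le> Sg t v"
    and Sg_int: "\<And>s t v. set_integrable lborel {s..t} (\<lambda>\<tau>. Sg \<tau> v)"
    and b_meas: "(\<lambda>(t, v, w). b t v w) \<in> borel_measurable (borel \<Otimes>\<^sub>M N \<Otimes>\<^sub>M N)"
    and loss: "AE t in lborel. AE w in N. (\<integral>\<^sup>+ v. b t v w \<partial>N) \<le> ennreal (Sg t w)"
begin

lemma sf: "sigma_finite_measure N" ..

lemma b_measurable[measurable (raw)]:
  assumes [measurable]: "T \<in> borel_measurable Q" "V \<in> measurable Q N" "W \<in> measurable Q N"
  shows "(\<lambda>q. b (T q) (V q) (W q)) \<in> borel_measurable Q"
proof -
  have "(\<lambda>q. (T q, V q, W q)) \<in> measurable Q (borel \<Otimes>\<^sub>M N \<Otimes>\<^sub>M N)" by measurable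
  from measurable_compose[OF this b_meas] show ?thesis by simp
qed

definition E :: "real \<Rightarrow> real \<Rightarrow> 'a \<Rightarrow> ennreal" where
  "E s t v = ennreal (exp (- (LBINT \<tau>:{s..t}. Sg \<tau> v)))"

lemma E_measurable[measurable (raw)]:
  assumes [measurable]: "S \<in> borel_measurable Q" "T \<in> borel_measurable Q" "V \<in> measurable Q N"
  shows "(\<lambda>q. E (S q) (T q) (V q)) \<in> borel_measurable Q"
  unfolding E_def set_lebesgue_integral_def by measurable

lemma Sg_LBINT_nn: "0 \<le> (LBINT \<tau>:{s..t}. Sg \<tau> v)"
  unfolding set_lebesgue_integral_def by (rule integral_nonneg_AE) (use Sg_nn in auto)

lemma E_le_1: "E s t v \<le> 1"
  unfolding E_def using Sg_LBINT_nn[of s t v] by simp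

lemma E_neq_top[simp]: "E s t v \<noteq> top" "E s t v < top" and E_neq_0[simp]: "E s t v \<noteq> 0"
  unfolding E_def by (auto simp: ennreal_eq_0_iff not_le)

lemma E_refl[simp]: "E t t v = 1"
  unfolding E_def set_lebesgue_integral_def
  by (simp add: integral_eq_zero_AE[OF AE_mp[OF AE_lborel_singleton[of t]]])

lemma E_mult: assumes "s \<le> t" "t \<le> u" shows "E s t v * E t u v = E s u v"
proof -
  have "(LBINT \<tau>:{s..u}. Sg \<tau> v) = (LBINT \<tau>:{s..t}. Sg \<tau> v) + (LBINT \<tau>:{t..u}. Sg \<tau> v)"
  proof -
    have "(LBINT \<tau>:{s..t} \<union> {t..u}. Sg \<tau> v) = (LBINT \<tau>:{s..t}. Sg \<tau> v) + (LBINT \<tau>:{t..u}. Sg \<tau> v)"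
    proof (rule set_integral_Un_AE)
      show "AE x in lborel. \<not> (x \<in> {s..t} \<and> x \<in> {t..u})"
        using AE_lborel_singleton[of t] by eventually_elim auto
    qed (use Sg_int in auto)
    thus ?thesis using ivl_disj_un_two_touch(4)[OF assms] by simp
  qed
  thus ?thesis unfolding E_def by (simp add: ennreal_mult'[symmetric] exp_add[symmetric])
qed

lemma Sg_section[measurable]: "v \<in> space N \<Longrightarrow> (\<lambda>t. Sg t v) \<in> borel_measurable borel"
  by measurable

lemma E_rate_forward:
  assumes v: "v \<in> space N" and "a \<le> c"
  shows "(\<integral>\<^sup>+t. indicator {a..c} t * (ennreal (Sg t v) * E a t v) \<partial>lborel) + E a c v \<le> 1"
  using exp_rate_le(1)[OF Sg_section[OF v] Sg_nn Sg_int assms(2)] unfolding E_def by simp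

lemma E_rate_backward:
  assumes v: "v \<in> space N" and "a \<le> c"
  shows "(\<integral>\<^sup>+t. indicator {a..c} t * (ennreal (Sg t v) * E t c v) \<partial>lborel) + E a c v \<le> 1"
  using exp_rate_le(2)[OF Sg_section[OF v] Sg_nn Sg_int assms(2)] unfolding E_def by simp

text \<open>
  A particle killed at rate \<open>l + \<Sigma>\<close> dies at most once; letting the endpoint of the interval in
  \<open>exp_rate_le\<close> tend to infinity.
\<close>

lemma E_rate_discounted:
  assumes v: "v \<in> space N" and l: "0 \<le> l"
  shows "(\<integral>\<^sup>+t. indicator {a..} t * (ennreal (l + Sg t v) * (ennreal (exp (- l * (t - a))) * E a t v)) \<partial>lborel) \<le> 1"
proof -
  let ?g = "\<lambda>t. indicator {a..} t * (ennreal (l + Sg t v) * (ennreal (exp (- l * (t - a))) * E a t v))"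
  note [measurable] = Sg_section[OF v]
  have [measurable]: "(\<lambda>t. E a t v) \<in> borel_measurable borel" using v by measurable
  have *: "(\<integral>\<^sup>+t. indicator {a..c} t * ?g t \<partial>lborel) \<le> 1" if "a \<le> c" for c
  proof -
    have c: "set_integrable lborel {a..t} (\<lambda>_. l)" for t by (rule borel_integrable_atLeastAtMost') simp
    note i = set_integral_add(1)[OF c Sg_int]
    have e: "(LBINT \<tau>:{a..t}. l + Sg \<tau> v) = l * (t - a) + (LBINT \<tau>:{a..t}. Sg \<tau> v)" if "a \<le> t" for t
    proof -
      have "(LBINT \<tau>:{a..t}. l + Sg \<tau> v) = (LBINT \<tau>:{a..t}. l) + (LBINT \<tau>:{a..t}. Sg \<tau> v)"
        using c Sg_int by (rule set_integral_add(2))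
      thus ?thesis using that by (simp add: set_integral_const mult.commute)
    qed
    have "(\<integral>\<^sup>+t. indicator {a..c} t * ?g t \<partial>lborel) =
        (\<integral>\<^sup>+t. indicator {a..c} t * (ennreal (l + Sg t v) *
           ennreal (exp (- (LBINT \<tau>:{a..t}. l + Sg \<tau> v)))) \<partial>lborel)"
    proof (rule nn_integral_cong)
      fix t
      have "ennreal (exp (- l * (t - a))) * E a t v = ennreal (exp (- (LBINT \<tau>:{a..t}. l + Sg \<tau> v)))" if "a \<le> t"
        unfolding e[OF that] E_def by (simp add: ennreal_mult'[symmetric] exp_add[symmetric])
      thus "indicator {a..c} t * ?g t = indicator {a..c} t * (ennreal (l + Sg t v) *
           ennreal (exp (- (LBINT \<tau>:{a..t}. l + Sg \<tau> v))))" by (auto simp: indicator_def)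
    qed
    also have "\<dots> \<le> 1"
    proof (rule order_trans)
      have m: "(\<lambda>t. l + Sg t v) \<in> borel_measurable borel" by measurable
      have "0 \<le> l + Sg t v" for t using l Sg_nn[of t v] by simp
      from exp_rate_le(1)[OF m this i that]
      show "(\<integral>\<^sup>+t. indicator {a..c} t * (ennreal (l + Sg t v) *
           ennreal (exp (- (LBINT \<tau>:{a..t}. l + Sg \<tau> v)))) \<partial>lborel)
        + ennreal (exp (- (LBINT \<tau>:{a..c}. l + Sg \<tau> v))) \<le> 1" .
    qed (simp add: add_increasing2)
    finally show ?thesis .
  qed
  have "(\<integral>\<^sup>+t. ?g t \<partial>lborel) = (\<integral>\<^sup>+t. (SUP n. indicator {a..a + real n} t * ?g t) \<partial>lborel)"
  proof (rule nn_integral_cong)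
    fix t :: real
    obtain m :: nat where m: "t - a \<le> real m" using real_arch_simple by blast
    show "?g t = (SUP n. indicator {a..a + real n} t * ?g t)"
    proof (rule antisym)
      show "?g t \<le> (SUP n. indicator {a..a + real n} t * ?g t)"
        by (rule SUP_upper2[of m]) (use m in \<open>auto simp: indicator_def\<close>)
    qed (auto intro!: SUP_least simp: indicator_def)
  qed
  also have "\<dots> = (SUP n. \<integral>\<^sup>+t. indicator {a..a + real n} t * ?g t \<partial>lborel)"
    by (rule nn_integral_monotone_convergence_SUP) (auto simp: incseq_def le_fun_def indicator_def)
  also have "\<dots> \<le> 1" by (rule SUP_least) (rule *, simp)
  finally show ?thesis .
qed

text \<open>
  \<open>K n t s v w\<close> is the density of particles that start at time \<open>s\<close> with velocity \<open>w\<close>, are scattered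
  \<open>n + 1\<close> times and have velocity \<open>v\<close> at time \<open>t\<close>.  Kernels, rather than operators, are iterated
  because their joint measurability follows by a plain induction.
\<close>

primrec K :: "nat \<Rightarrow> real \<Rightarrow> real \<Rightarrow> 'a \<Rightarrow> 'a \<Rightarrow> ennreal" where
  "K 0 = (\<lambda>t s v w. \<integral>\<^sup>+r. indicator {s..t} r * (E r t v * (b r v w * E s r w)) \<partial>lborel)"
| "K (Suc n) = (\<lambda>t s v w. \<integral>\<^sup>+r. indicator {s..t} r *
     ((\<integral>\<^sup>+w'. K n t r v w' * b r w' w \<partial>N) * E s r w) \<partial>lborel)"

lemma K_measurable[measurable (raw)]:
  assumes [measurable]: "T \<in> borel_measurable Q" "S \<in> borel_measurable Q"
    "V \<in> measurable Q N" "W \<in> measurable Q N"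
  shows "(\<lambda>q. K n (T q) (S q) (V q) (W q)) \<in> borel_measurable Q"
proof -
  have "(\<lambda>(t, s, v, w). K n t s v w) \<in> borel_measurable (borel \<Otimes>\<^sub>M borel \<Otimes>\<^sub>M N \<Otimes>\<^sub>M N)"
  proof (induction n)
    case 0
    show ?case by (simp, measurable)
  next
    case (Suc n)
    have [measurable (raw)]: "(\<lambda>q. K n (T q) (S q) (V q) (W q)) \<in> borel_measurable Q"
      if [measurable]: "T \<in> borel_measurable Q" "S \<in> borel_measurable Q"
        "V \<in> measurable Q N" "W \<in> measurable Q N" for T S V W and Q :: "'z measure"
      using measurable_compose[OF _ Suc, of "\<lambda>q. (T q, S q, V q, W q)" Q] by simp
    show ?case by (simp, measurable)
  qed
  from measurable_compose[OF _ this, of "\<lambda>q. (T q, S q, V q, W q)" Q] show ?thesis by simp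
qed

definition B :: "real \<Rightarrow> ('a \<Rightarrow> ennreal) \<Rightarrow> 'a \<Rightarrow> ennreal" where
  "B r \<phi> v = (\<integral>\<^sup>+w. b r v w * \<phi> w \<partial>N)"

lemma B_measurable[measurable (raw)]:
  assumes [measurable]: "T \<in> borel_measurable Q" "V \<in> measurable Q N"
    "case_prod \<Phi> \<in> borel_measurable (Q \<Otimes>\<^sub>M N)"
  shows "(\<lambda>q. B (T q) (\<Phi> q) (V q)) \<in> borel_measurable Q"
  unfolding B_def by measurable

text \<open>
  The \<open>n\<close>-th Dyson--Phillips term on nonnegative functions.  The term of order \<open>0\<close> is a multiplication and has
  no kernel, hence the case distinction.
\<close>

definition vE :: "nat \<Rightarrow> real \<Rightarrow> real \<Rightarrow> ('a \<Rightarrow> ennreal) \<Rightarrow> 'a \<Rightarrow> ennreal" where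
  "vE n t s \<phi> v = (case n of 0 \<Rightarrow> E s t v * \<phi> v | Suc m \<Rightarrow> \<integral>\<^sup>+w. K m t s v w * \<phi> w \<partial>N)"

lemma vE_0: "vE 0 t s \<phi> v = E s t v * \<phi> v" by (simp add: vE_def)

lemma vE_measurable[measurable (raw)]:
  assumes [measurable]: "T \<in> borel_measurable Q" "S \<in> borel_measurable Q" "V \<in> measurable Q N"
    "case_prod \<Phi> \<in> borel_measurable (Q \<Otimes>\<^sub>M N)"
  shows "(\<lambda>q. vE n (T q) (S q) (\<Phi> q) (V q)) \<in> borel_measurable Q"
  by (cases n) (simp_all add: vE_def)

text \<open>
  The recursion by which the Dyson--Phillips terms are defined, splitting off the first scattering;
  the kernels split it off in the same way, and Tonelli's theorem moves the integral over \<open>w\<close> inside.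
\<close>

lemma vE_Suc:
  assumes [measurable]: "\<phi> \<in> borel_measurable N" and v[measurable]: "v \<in> space N"
  shows "vE (Suc n) t s \<phi> v = (\<integral>\<^sup>+r. indicator {s..t} r * vE n t r (B r (vE 0 r s \<phi>)) v \<partial>lborel)"
proof (cases n)
  case 0
  have "vE (Suc n) t s \<phi> v = (\<integral>\<^sup>+w. \<integral>\<^sup>+r. indicator {s..t} r * (E r t v * (b r v w * (E s r w * \<phi> w))) \<partial>lborel \<partial>N)"
    unfolding vE_def 0
    by (simp, rule nn_integral_cong, subst nn_integral_multc[symmetric]) (auto simp: mult.assoc)
  also have "\<dots> = (\<integral>\<^sup>+r. \<integral>\<^sup>+w. indicator {s..t} r * (E r t v * (b r v w * (E s r w * \<phi> w))) \<partial>N \<partial>lborel)"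
    by (rule tonelli) (unfold_locales, measurable)
  finally show ?thesis unfolding 0 vE_0 B_def by (simp add: nn_integral_cmult)
next
  case (Suc m)
  define X where "X r w = (\<integral>\<^sup>+w'. K m t r v w' * b r w' w \<partial>N)" for r w
  have [measurable]: "case_prod X \<in> borel_measurable (borel \<Otimes>\<^sub>M N)"
    unfolding X_def by measurable
  have "vE (Suc n) t s \<phi> v = (\<integral>\<^sup>+w. \<integral>\<^sup>+r. indicator {s..t} r * (X r w * (E s r w * \<phi> w)) \<partial>lborel \<partial>N)"
    unfolding vE_def Suc K.simps nat.case X_def[symmetric]
    by (rule nn_integral_cong, subst nn_integral_multc[symmetric]) (auto simp: mult.assoc)
  also have "\<dots> = (\<integral>\<^sup>+r. \<integral>\<^sup>+w. indicator {s..t} r * (X r w * (E s r w * \<phi> w)) \<partial>N \<partial>lborel)"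
    by (rule tonelli) (unfold_locales, measurable)
  also have "\<dots> = (\<integral>\<^sup>+r. indicator {s..t} r * (\<integral>\<^sup>+w. X r w * (E s r w * \<phi> w) \<partial>N) \<partial>lborel)"
    by (simp add: nn_integral_cmult)
  also have "\<dots> = (\<integral>\<^sup>+r. indicator {s..t} r * (\<integral>\<^sup>+w. \<integral>\<^sup>+w'. K m t r v w' * (b r w' w * (E s r w * \<phi> w)) \<partial>N \<partial>N) \<partial>lborel)"
  proof -
    have "X r w * (E s r w * \<phi> w) = (\<integral>\<^sup>+w'. K m t r v w' * (b r w' w * (E s r w * \<phi> w)) \<partial>N)"
      if [measurable]: "w \<in> space N" for r w
      unfolding X_def by (subst nn_integral_multc[symmetric]) (auto simp: mult.assoc)
    thus ?thesis
      by (intro nn_integral_cong arg_cong[where f = "\<lambda>x. indicator _ _ * x"]) auto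
  qed
  also have "\<dots> = (\<integral>\<^sup>+r. indicator {s..t} r * (\<integral>\<^sup>+w'. \<integral>\<^sup>+w. K m t r v w' * (b r w' w * (E s r w * \<phi> w)) \<partial>N \<partial>N) \<partial>lborel)"
    by (subst tonelli[OF sf sf]) auto
  also have "\<dots> = (\<integral>\<^sup>+r. indicator {s..t} r * (\<integral>\<^sup>+w'. K m t r v w' * (\<integral>\<^sup>+w. b r w' w * (E s r w * \<phi> w) \<partial>N) \<partial>N) \<partial>lborel)"
    by (intro nn_integral_cong arg_cong[where f = "\<lambda>x. indicator _ _ * x"] nn_integral_cmult) measurable
  finally show ?thesis unfolding Suc vE_def B_def by simp
qed

end

section \<open>Mass bound and evolution property\<close>

lemma suminf_swap_ennreal:
  fixes x :: "nat \<Rightarrow> nat \<Rightarrow> ennreal"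
  shows "(\<Sum>i. \<Sum>j. x i j) = (\<Sum>j. \<Sum>i. x i j)"
proof -
  have sfc: "sigma_finite_measure (count_space (UNIV :: nat set))"
    by (rule sigma_finite_measure_count_space)
  have "case_prod x \<in> borel_measurable (count_space UNIV \<Otimes>\<^sub>M count_space UNIV)"
    by measurable
  from tonelli[OF sfc sfc this] show ?thesis by (simp add: nn_integral_count_space_nat)
qed

lemma Cauchy_product_ennreal:
  fixes x :: "nat \<Rightarrow> nat \<Rightarrow> ennreal"
  shows "(\<Sum>n. \<Sum>k\<le>n. x k (n - k)) = (\<Sum>k. \<Sum>j. x k j)"
proof -
  have "(\<Sum>n. \<Sum>k\<le>n. x k (n - k)) = (\<Sum>n. \<Sum>k. if k \<le> n then x k (n - k) else 0)"
    by (rule suminf_cong, subst suminf_finite[of "{.._}"]) auto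
  also have "\<dots> = (\<Sum>k. \<Sum>n. if k \<le> n then x k (n - k) else 0)"
    by (rule suminf_swap_ennreal)
  also have "\<dots> = (\<Sum>k. \<Sum>j. x k j)"
  proof (rule suminf_cong)
    fix k
    show "(\<Sum>n. if k \<le> n then x k (n - k) else 0) = (\<Sum>j. x k j)"
      by (subst suminf_offset[of _ k]) auto
  qed
  finally show ?thesis .
qed

context kinetic begin

lemma B_nn_integral:
  assumes "sigma_finite_measure Q" and [measurable]: "case_prod \<Phi> \<in> borel_measurable (Q \<Otimes>\<^sub>M N)" "v \<in> space N"
  shows "B t (\<lambda>w. \<integral>\<^sup>+q. \<Phi> q w \<partial>Q) v = (\<integral>\<^sup>+q. B t (\<Phi> q) v \<partial>Q)"
proof -
  interpret Q: sigma_finite_measure Q by fact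
  have "B t (\<lambda>w. \<integral>\<^sup>+q. \<Phi> q w \<partial>Q) v = (\<integral>\<^sup>+w. \<integral>\<^sup>+q. b t v w * \<Phi> q w \<partial>Q \<partial>N)"
    unfolding B_def by (rule nn_integral_cong) (simp add: nn_integral_cmult)
  also have "\<dots> = (\<integral>\<^sup>+q. B t (\<Phi> q) v \<partial>Q)"
    unfolding B_def by (rule tonelli[OF sf assms(1)]) measurable
  finally show ?thesis .
qed

lemma vE_section:
  assumes [measurable]: "\<phi> \<in> borel_measurable N"
  shows "vE n t s \<phi> \<in> borel_measurable N"
  by measurable

lemma vE_nn_integral:
  assumes "sigma_finite_measure Q" and [measurable]: "case_prod \<Phi> \<in> borel_measurable (Q \<Otimes>\<^sub>M N)" "v \<in> space N"
  shows "vE n t s (\<lambda>w. \<integral>\<^sup>+q. \<Phi> q w \<partial>Q) v = (\<integral>\<^sup>+q. vE n t s (\<Phi> q) v \<partial>Q)"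
proof (cases n)
  case 0
  thus ?thesis by (simp add: vE_0 nn_integral_cmult)
next
  case (Suc m)
  interpret Q: sigma_finite_measure Q by fact
  have "vE n t s (\<lambda>w. \<integral>\<^sup>+q. \<Phi> q w \<partial>Q) v = (\<integral>\<^sup>+w. \<integral>\<^sup>+q. K m t s v w * \<Phi> q w \<partial>Q \<partial>N)"
    unfolding vE_def Suc nat.case by (rule nn_integral_cong) (simp add: nn_integral_cmult)
  also have "\<dots> = (\<integral>\<^sup>+q. vE n t s (\<Phi> q) v \<partial>Q)"
    unfolding vE_def Suc nat.case by (rule tonelli[OF sf assms(1)]) measurable
  finally show ?thesis .
qed

lemma vE_suminf:
  assumes [measurable]: "\<And>i. \<phi> i \<in> borel_measurable N" "v \<in> space N"
  shows "vE n t s (\<lambda>w. \<Sum>i. \<phi> i w) v = (\<Sum>i. vE n t s (\<phi> i) v)"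
  by (cases n) (simp_all add: vE_def nn_integral_suminf[symmetric])

lemma B_add:
  assumes [measurable]: "\<phi> \<in> borel_measurable N" "\<psi> \<in> borel_measurable N" "v \<in> space N"
  shows "B t (\<lambda>w. \<phi> w + \<psi> w) v = B t \<phi> v + B t \<psi> v"
  unfolding B_def by (simp add: nn_integral_add[symmetric] distrib_left)

lemma vE_add:
  assumes [measurable]: "\<phi> \<in> borel_measurable N" "\<psi> \<in> borel_measurable N" "v \<in> space N"
  shows "vE n t s (\<lambda>w. \<phi> w + \<psi> w) v = vE n t s \<phi> v + vE n t s \<psi> v"
  by (cases n) (simp_all add: vE_def nn_integral_add[symmetric] distrib_left)

lemma B_cmult:
  assumes [measurable]: "\<phi> \<in> borel_measurable N" "v \<in> space N"
  shows "B t (\<lambda>w. c * \<phi> w) v = c * B t \<phi> v"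
  unfolding B_def by (simp add: nn_integral_cmult[symmetric] mult.left_commute)

lemma vE_cmult:
  assumes [measurable]: "\<phi> \<in> borel_measurable N" "v \<in> space N"
  shows "vE n t s (\<lambda>w. c * \<phi> w) v = c * vE n t s \<phi> v"
  by (cases n) (simp_all add: vE_def nn_integral_cmult[symmetric] mult.left_commute)

lemma vE_zero[simp]: "vE n t s (\<lambda>w. 0) v = 0"
  by (cases n) (simp_all add: vE_def)

lemma B_mono: "(\<And>w. w \<in> space N \<Longrightarrow> \<phi> w \<le> \<psi> w) \<Longrightarrow> B t \<phi> v \<le> B t \<psi> v"
  unfolding B_def by (rule nn_integral_mono) (auto intro: mult_left_mono)

lemma vE_mono: "(\<And>w. w \<in> space N \<Longrightarrow> \<phi> w \<le> \<psi> w) \<Longrightarrow> v \<in> space N \<Longrightarrow> vE n t s \<phi> v \<le> vE n t s \<psi> v"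
  by (cases n) (auto simp: vE_def intro!: nn_integral_mono mult_left_mono)

lemma vE_cong_AE: "(AE w in N. \<phi> w = \<psi> w) \<Longrightarrow> n = 0 \<longrightarrow> \<phi> v = \<psi> v \<Longrightarrow> vE n t s \<phi> v = vE n t s \<psi> v"
  by (cases n) (auto simp: vE_def intro!: nn_integral_cong_AE)

lemma vE_cong: "(\<And>w. w \<in> space N \<Longrightarrow> \<phi> w = \<psi> w) \<Longrightarrow> v \<in> space N \<Longrightarrow> vE n t s \<phi> v = vE n t s \<psi> v"
  by (rule vE_cong_AE) auto

text \<open>
  The times outside the null set on which scattering might create mass.
\<close>

definition loss_time :: "real \<Rightarrow> bool" where
  "loss_time t \<longleftrightarrow> (AE w in N. (\<integral>\<^sup>+ v. b t v w \<partial>N) \<le> ennreal (Sg t w))"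

lemma AE_loss_time: "AE t in lborel. loss_time t" unfolding loss_time_def by (rule loss)

lemma B_mass_eq:
  assumes [measurable]: "\<phi> \<in> borel_measurable N"
  shows "(\<integral>\<^sup>+v. B t \<phi> v \<partial>N) = (\<integral>\<^sup>+w. (\<integral>\<^sup>+ v. b t v w \<partial>N) * \<phi> w \<partial>N)"
  unfolding B_def by (subst tonelli[OF sf sf]) (auto intro!: nn_integral_cong nn_integral_multc)

lemma B_mass_le:
  assumes [measurable]: "\<phi> \<in> borel_measurable N" and "loss_time t"
  shows "(\<integral>\<^sup>+v. B t \<phi> v \<partial>N) \<le> (\<integral>\<^sup>+w. ennreal (Sg t w) * \<phi> w \<partial>N)"
  unfolding B_mass_eq[OF assms(1)]
proof (rule nn_integral_mono_AE)
  show "AE w in N. (\<integral>\<^sup>+ v. b t v w \<partial>N) * \<phi> w \<le> ennreal (Sg t w) * \<phi> w"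
    using assms(2) unfolding loss_time_def by eventually_elim (rule mult_right_mono, auto)
qed

text \<open>
  Particles survive until \<open>t\<close>, are scattered a first time before \<open>t\<close>, or are absorbed.
\<close>

lemma gain_mass_le:
  assumes [measurable]: "\<phi> \<in> borel_measurable N" and "s \<le> t"
  shows "(\<integral>\<^sup>+v. vE 0 t s \<phi> v \<partial>N) + (\<integral>\<^sup>+r. indicator {s..t} r * (\<integral>\<^sup>+v. B r (vE 0 r s \<phi>) v \<partial>N) \<partial>lborel)
     \<le> (\<integral>\<^sup>+v. \<phi> v \<partial>N)"
proof -
  have "(\<integral>\<^sup>+r. indicator {s..t} r * (\<integral>\<^sup>+v. B r (vE 0 r s \<phi>) v \<partial>N) \<partial>lborel) \<le>
     (\<integral>\<^sup>+r. indicator {s..t} r * (\<integral>\<^sup>+w. ennreal (Sg r w) * (E s r w * \<phi> w) \<partial>N) \<partial>lborel)"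
  proof (rule nn_integral_mono_AE, use AE_loss_time in eventually_elim)
    fix r assume r: "loss_time r"
    show "indicator {s..t} r * (\<integral>\<^sup>+v. B r (vE 0 r s \<phi>) v \<partial>N) \<le>
       indicator {s..t} r * (\<integral>\<^sup>+w. ennreal (Sg r w) * (E s r w * \<phi> w) \<partial>N)"
      using B_mass_le[OF vE_section[OF assms(1), of 0 r s] r] by (auto simp: vE_0 intro: mult_left_mono)
  qed
  also have "\<dots> = (\<integral>\<^sup>+r. \<integral>\<^sup>+w. indicator {s..t} r * (ennreal (Sg r w) * (E s r w * \<phi> w)) \<partial>N \<partial>lborel)"
    by (simp add: nn_integral_cmult)
  also have "\<dots> = (\<integral>\<^sup>+w. \<integral>\<^sup>+r. indicator {s..t} r * (ennreal (Sg r w) * (E s r w * \<phi> w)) \<partial>lborel \<partial>N)"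
    by (rule tonelli) (unfold_locales, measurable)
  also have "\<dots> = (\<integral>\<^sup>+w. (\<integral>\<^sup>+r. indicator {s..t} r * (ennreal (Sg r w) * E s r w) \<partial>lborel) * \<phi> w \<partial>N)"
    by (intro nn_integral_cong, subst nn_integral_multc[symmetric]) (auto simp: mult.assoc)
  finally have "(\<integral>\<^sup>+v. vE 0 t s \<phi> v \<partial>N) + (\<integral>\<^sup>+r. indicator {s..t} r * (\<integral>\<^sup>+v. B r (vE 0 r s \<phi>) v \<partial>N) \<partial>lborel)
    \<le> (\<integral>\<^sup>+v. E s t v * \<phi> v \<partial>N) + (\<integral>\<^sup>+w. (\<integral>\<^sup>+r. indicator {s..t} r * (ennreal (Sg r w) * E s r w) \<partial>lborel) * \<phi> w \<partial>N)"
    by (auto simp: vE_0 intro: add_left_mono)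
  also have "\<dots> = (\<integral>\<^sup>+v. ((\<integral>\<^sup>+r. indicator {s..t} r * (ennreal (Sg r v) * E s r v) \<partial>lborel) + E s t v) * \<phi> v \<partial>N)"
    by (subst nn_integral_add[symmetric]) (auto simp: distrib_right add.commute)
  also have "\<dots> \<le> (\<integral>\<^sup>+v. 1 * \<phi> v \<partial>N)"
    by (intro nn_integral_mono mult_right_mono E_rate_forward) (use assms in auto)
  finally show ?thesis by simp
qed

text \<open>
  Induction on the number of scatterings: after the first scattering at time \<open>r\<close> the induction
  hypothesis applies to the scattered particles \<open>G r\<close>, and \<open>gain_mass_le\<close> accounts for the first scattering.
\<close>

lemma vE_partial_mass_le:
  assumes "\<phi> \<in> borel_measurable N" and "s \<le> t"
  shows "(\<Sum>n\<le>k. \<integral>\<^sup>+v. vE n t s \<phi> v \<partial>N) \<le> (\<integral>\<^sup>+v. \<phi> v \<partial>N)"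
  using assms
proof (induction k arbitrary: s \<phi>)
  case 0
  note [measurable] = 0(1)
  have "(\<integral>\<^sup>+v. vE 0 t s \<phi> v \<partial>N) \<le> (\<integral>\<^sup>+v. 1 * \<phi> v \<partial>N)"
    unfolding vE_0 by (intro nn_integral_mono mult_right_mono E_le_1) auto
  thus ?case by simp
next
  case (Suc k)
  note [measurable] = Suc.prems(1)
  define G where "G r = B r (vE 0 r s \<phi>)" for r
  have [measurable]: "case_prod G \<in> borel_measurable (borel \<Otimes>\<^sub>M N)" unfolding G_def by measurable
  have Gr[measurable]: "G r \<in> borel_measurable N" for r by measurable
  have e: "(\<integral>\<^sup>+v. vE (Suc n) t s \<phi> v \<partial>N) = (\<integral>\<^sup>+r. indicator {s..t} r * (\<integral>\<^sup>+v. vE n t r (G r) v \<partial>N) \<partial>lborel)" for n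
  proof -
    have "(\<integral>\<^sup>+v. vE (Suc n) t s \<phi> v \<partial>N) = (\<integral>\<^sup>+v. \<integral>\<^sup>+r. indicator {s..t} r * vE n t r (G r) v \<partial>lborel \<partial>N)"
      by (rule nn_integral_cong) (simp add: vE_Suc G_def)
    also have "\<dots> = (\<integral>\<^sup>+r. \<integral>\<^sup>+v. indicator {s..t} r * vE n t r (G r) v \<partial>N \<partial>lborel)"
      by (rule tonelli) (unfold_locales, measurable)
    finally show ?thesis by (simp add: nn_integral_cmult)
  qed
  have "(\<Sum>n\<le>Suc k. \<integral>\<^sup>+v. vE n t s \<phi> v \<partial>N) = (\<integral>\<^sup>+v. vE 0 t s \<phi> v \<partial>N) +
      (\<Sum>n\<le>k. \<integral>\<^sup>+v. vE (Suc n) t s \<phi> v \<partial>N)"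
    by (subst sum.atMost_Suc_shift) simp
  also have "(\<Sum>n\<le>k. \<integral>\<^sup>+v. vE (Suc n) t s \<phi> v \<partial>N) =
     (\<integral>\<^sup>+r. indicator {s..t} r * (\<Sum>n\<le>k. \<integral>\<^sup>+v. vE n t r (G r) v \<partial>N) \<partial>lborel)"
    unfolding e by (subst nn_integral_sum[symmetric]) (auto simp: sum_distrib_left)
  also have "\<dots> \<le> (\<integral>\<^sup>+r. indicator {s..t} r * (\<integral>\<^sup>+v. G r v \<partial>N) \<partial>lborel)"
  proof (intro nn_integral_mono)
    fix r
    show "indicator {s..t} r * (\<Sum>n\<le>k. \<integral>\<^sup>+v. vE n t r (G r) v \<partial>N) \<le> indicator {s..t} r * (\<integral>\<^sup>+v. G r v \<partial>N)"
      using Suc.IH[of "G r" r] by (auto simp: indicator_def)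
  qed
  finally show ?case
    using gain_mass_le[OF Suc.prems] unfolding G_def by (meson add_left_mono order_trans)
qed

definition vI :: "real \<Rightarrow> real \<Rightarrow> ('a \<Rightarrow> ennreal) \<Rightarrow> 'a \<Rightarrow> ennreal" where
  "vI t s \<phi> v = (\<Sum>n. vE n t s \<phi> v)"

lemma vI_measurable[measurable (raw)]:
  assumes [measurable]: "T \<in> borel_measurable Q" "S \<in> borel_measurable Q" "V \<in> measurable Q N"
    "case_prod \<Phi> \<in> borel_measurable (Q \<Otimes>\<^sub>M N)"
  shows "(\<lambda>q. vI (T q) (S q) (\<Phi> q) (V q)) \<in> borel_measurable Q"
  unfolding vI_def by measurable

lemma vI_mass_le:
  assumes [measurable]: "\<phi> \<in> borel_measurable N" and "s \<le> t"
  shows "(\<integral>\<^sup>+v. vI t s \<phi> v \<partial>N) \<le> (\<integral>\<^sup>+v. \<phi> v \<partial>N)"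
proof -
  have "(\<integral>\<^sup>+v. vI t s \<phi> v \<partial>N) = (\<Sum>n. \<integral>\<^sup>+v. vE n t s \<phi> v \<partial>N)"
    unfolding vI_def by (rule nn_integral_suminf) measurable
  also have "\<dots> \<le> (\<integral>\<^sup>+v. \<phi> v \<partial>N)"
  proof (rule suminf_le_const)
    fix n
    have "(\<Sum>n<n. \<integral>\<^sup>+v. vE n t s \<phi> v \<partial>N) \<le> (\<Sum>n\<le>n. \<integral>\<^sup>+v. vE n t s \<phi> v \<partial>N)"
      by (rule sum_mono2) auto
    thus "(\<Sum>n<n. \<integral>\<^sup>+v. vE n t s \<phi> v \<partial>N) \<le> (\<integral>\<^sup>+v. \<phi> v \<partial>N)"
      using vE_partial_mass_le[OF assms] order_trans by blast
  qed simp
  finally show ?thesis .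
qed

text \<open>
  \<open>n\<close> scatterings in \<open>[s, t]\<close> are distributed over \<open>[s, r]\<close> and \<open>[r, t]\<close>.  The induction splits off the first
  scattering, which lies before or after \<open>r\<close>.
\<close>

lemma vE_split:
  assumes "\<phi> \<in> borel_measurable N" and "s \<le> r" "r \<le> t" and v[measurable]: "v \<in> space N"
  shows "vE n t s \<phi> v = (\<Sum>k\<le>n. vE k t r (vE (n - k) r s \<phi>) v)"
  using assms(1,2)
proof (induction n arbitrary: s \<phi>)
  case 0
  show ?case using E_mult[OF 0(2) assms(3), of v] by (simp add: vE_0 mult_ac)
next
  case (Suc n)
  note [measurable] = Suc.prems(1)
  define G where "G q = B q (vE 0 q s \<phi>)" for q
  have [measurable]: "case_prod G \<in> borel_measurable (borel \<Otimes>\<^sub>M N)" unfolding G_def by measurable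
  have Gr[measurable]: "G r \<in> borel_measurable N" for r by measurable
  have "vE (Suc n) t s \<phi> v = (\<integral>\<^sup>+q. indicator {s..t} q * vE n t q (G q) v \<partial>lborel)"
    unfolding G_def by (rule vE_Suc) measurable
  also have "\<dots> = (\<integral>\<^sup>+q. indicator {s..r} q * vE n t q (G q) v + indicator {r..t} q * vE n t q (G q) v \<partial>lborel)"
    by (rule nn_integral_cong_AE, use AE_lborel_singleton[of r] in eventually_elim)
       (use Suc.prems(2) assms(3) in \<open>auto simp: indicator_def\<close>)
  also have "\<dots> = (\<integral>\<^sup>+q. indicator {s..r} q * vE n t q (G q) v \<partial>lborel) + (\<integral>\<^sup>+q. indicator {r..t} q * vE n t q (G q) v \<partial>lborel)"
    by (rule nn_integral_add) measurable
  also have "(\<integral>\<^sup>+q. indicator {r..t} q * vE n t q (G q) v \<partial>lborel) = vE (Suc n) t r (vE 0 r s \<phi>) v"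
  proof -
    have "vE n t q (G q) v = vE n t q (B q (vE 0 q r (vE 0 r s \<phi>))) v" if "r \<le> q" for q
      unfolding G_def vE_0 E_mult[OF Suc.prems(2) that, symmetric] by (simp add: mult_ac)
    thus ?thesis
      by (subst vE_Suc[OF vE_section[OF Suc.prems(1)] v]) (auto intro!: nn_integral_cong simp: indicator_def)
  qed
  also have "(\<integral>\<^sup>+q. indicator {s..r} q * vE n t q (G q) v \<partial>lborel) = (\<Sum>k\<le>n. vE k t r (vE (Suc n - k) r s \<phi>) v)"
  proof -
    have "(\<integral>\<^sup>+q. indicator {s..r} q * vE n t q (G q) v \<partial>lborel) =
       (\<integral>\<^sup>+q. (\<Sum>k\<le>n. vE k t r (\<lambda>w. indicator {s..r} q * vE (n - k) r q (G q) w) v) \<partial>lborel)"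
    proof (rule nn_integral_cong)
      fix q
      show "indicator {s..r} q * vE n t q (G q) v = (\<Sum>k\<le>n. vE k t r (\<lambda>w. indicator {s..r} q * vE (n - k) r q (G q) w) v)"
        using Suc.IH[of "G q" q] by (cases "q \<in> {s..r}") (auto simp: vE_cmult indicator_def)
    qed
    also have "\<dots> = (\<Sum>k\<le>n. \<integral>\<^sup>+q. vE k t r (\<lambda>w. indicator {s..r} q * vE (n - k) r q (G q) w) v \<partial>lborel)"
      by (rule nn_integral_sum) measurable
    also have "\<dots> = (\<Sum>k\<le>n. vE k t r (vE (Suc n - k) r s \<phi>) v)"
    proof (rule sum.cong[OF refl])
      fix k assume "k \<in> {..n}"
      hence Sk: "Suc n - k = Suc (n - k)" by auto
      have "(\<integral>\<^sup>+q. vE k t r (\<lambda>w. indicator {s..r} q * vE (n - k) r q (G q) w) v \<partial>lborel) =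
        vE k t r (\<lambda>w. \<integral>\<^sup>+q. indicator {s..r} q * vE (n - k) r q (G q) w \<partial>lborel) v"
        by (rule vE_nn_integral[symmetric]) (unfold_locales, measurable)
      also have "\<dots> = vE k t r (vE (Suc n - k) r s \<phi>) v"
        unfolding Sk by (rule vE_cong) (use v in \<open>auto simp: vE_Suc G_def\<close>)
      finally show "(\<integral>\<^sup>+q. vE k t r (\<lambda>w. indicator {s..r} q * vE (n - k) r q (G q) w) v \<partial>lborel) =
         vE k t r (vE (Suc n - k) r s \<phi>) v" .
    qed
    finally show ?thesis .
  qed
  finally show ?case by simp
qed

text \<open>
  The evolution property: the sum of the Dyson--Phillips terms is the Cauchy product of its parts.
\<close>

lemma vI_split:
  assumes [measurable]: "\<phi> \<in> borel_measurable N" and "s \<le> r" "r \<le> t" and [measurable]: "v \<in> space N"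
  shows "vI t s \<phi> v = vI t r (vI r s \<phi>) v"
proof -
  have "vI t s \<phi> v = (\<Sum>n. \<Sum>k\<le>n. vE k t r (vE (n - k) r s \<phi>) v)"
    unfolding vI_def using assms by (simp add: vE_split[of \<phi> s r t])
  also have "\<dots> = (\<Sum>k. \<Sum>j. vE k t r (vE j r s \<phi>) v)" by (rule Cauchy_product_ennreal)
  finally show ?thesis unfolding vI_def[abs_def] vE_suminf[OF vE_section[OF assms(1)] assms(4)] .
qed

end

section \<open>Laplace transforms of windows\<close>

lemma nn_integral_shift:
  fixes f :: "real \<Rightarrow> ennreal"
  assumes "f \<in> borel_measurable borel"
  shows "(\<integral>\<^sup>+r. f r \<partial>lborel) = (\<integral>\<^sup>+q. f (q + c) \<partial>lborel)"
  using nn_integral_real_affine[OF assms, of 1 c] by (simp add: add.commute)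

text \<open>
  The elementary form of \<open>(l - Z) \<integral>\<^sub>0\<^sup>w e\<^sup>a\<^sup>Z da = 1 - e\<^sup>w\<^sup>Z + l \<integral>\<^sub>0\<^sup>w e\<^sup>a\<^sup>Z da\<close> after applying the resolvent,
  rearranged so that no subtraction occurs.
\<close>

lemma laplace_window:
  fixes k :: "real \<Rightarrow> ennreal"
  assumes [measurable]: "k \<in> borel_measurable borel" and w: "0 \<le> w" and l: "0 < l"
  shows "ennreal l * (\<integral>\<^sup>+p. indicator {0..} p * (ennreal (exp (- l * p)) *
             (\<integral>\<^sup>+a. indicator {0..w} a * k (p + a) \<partial>lborel)) \<partial>lborel)
           + (\<integral>\<^sup>+p. indicator {0..} p * (ennreal (exp (- l * p)) * k p) \<partial>lborel)
       = (\<integral>\<^sup>+a. indicator {0..w} a * k a \<partial>lborel)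
           + (\<integral>\<^sup>+p. indicator {0..} p * (ennreal (exp (- l * p)) * k (p + w)) \<partial>lborel)"
    (is "ennreal l * ?A + ?B = ?C + ?D")
proof -
  have [measurable]: "Measurable.pred (borel \<Otimes>\<^sub>M borel) (\<lambda>x :: real \<times> real. fst x \<le> snd x)" by measurable
  \<comment> \<open>The weight which the double integral on the left gives to \<open>k m\<close>, where \<open>m = p + a\<close>.\<close>
  define c where "c m = (\<integral>\<^sup>+a. indicator {0..w} a * (if a \<le> m then ennreal l * ennreal (exp (- l * (m - a))) else 0) \<partial>lborel)" for m :: real
  have [measurable]: "c \<in> borel_measurable borel" unfolding c_def by measurable
  have c: "c m = ennreal (exp (- l * (m - min m w)) - exp (- l * m))" if "0 \<le> m" for m
  proof -
    have "c m = (\<integral>\<^sup>+a. ennreal (l * exp (- l * (m - a))) * indicator {0..min m w} a \<partial>lborel)"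
      unfolding c_def using l by (intro nn_integral_cong) (auto simp: indicator_def ennreal_mult')
    also have "\<dots> = ennreal (exp (- l * (m - min m w)) - exp (- l * (m - 0)))"
      by (rule nn_integral_FTC_Icc) (use l that w in \<open>auto intro!: derivative_eq_intros\<close>)
    finally show ?thesis by simp
  qed
  have "ennreal l * ?A = (\<integral>\<^sup>+p. \<integral>\<^sup>+a. indicator {0..} p * (ennreal l * ennreal (exp (- l * p)) *
             (indicator {0..w} a * k (p + a))) \<partial>lborel \<partial>lborel)"
  proof (subst nn_integral_cmult[symmetric], measurable, rule nn_integral_cong)
    fix p :: real
    have "(\<integral>\<^sup>+a. indicator {0..} p * (ennreal l * ennreal (exp (- l * p)) * (indicator {0..w} a * k (p + a))) \<partial>lborel)
       = indicator {0..} p * (ennreal l * ennreal (exp (- l * p)) * (\<integral>\<^sup>+a. indicator {0..w} a * k (p + a) \<partial>lborel))"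
      by (simp add: nn_integral_cmult)
    thus "ennreal l * (indicator {0..} p * (ennreal (exp (- l * p)) * (\<integral>\<^sup>+a. indicator {0..w} a * k (p + a) \<partial>lborel))) =
       (\<integral>\<^sup>+a. indicator {0..} p * (ennreal l * ennreal (exp (- l * p)) * (indicator {0..w} a * k (p + a))) \<partial>lborel)"
      by (simp only: mult.assoc mult.left_commute mult.commute)
  qed
  also have "\<dots> = (\<integral>\<^sup>+a. \<integral>\<^sup>+p. indicator {0..} p * (ennreal l * ennreal (exp (- l * p)) *
             (indicator {0..w} a * k (p + a))) \<partial>lborel \<partial>lborel)"
    by (rule tonelli) (unfold_locales, measurable)
  also have "\<dots> = (\<integral>\<^sup>+a. \<integral>\<^sup>+m. indicator {0..} m * (indicator {0..w} a * (if a \<le> m then ennreal l * ennreal (exp (- l * (m - a))) else 0) * k m) \<partial>lborel \<partial>lborel)"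
  proof (rule nn_integral_cong)
    fix a :: real
    show "(\<integral>\<^sup>+p. indicator {0..} p * (ennreal l * ennreal (exp (- l * p)) * (indicator {0..w} a * k (p + a))) \<partial>lborel) =
       (\<integral>\<^sup>+m. indicator {0..} m * (indicator {0..w} a * (if a \<le> m then ennreal l * ennreal (exp (- l * (m - a))) else 0) * k m) \<partial>lborel)"
      by (rule trans[OF _ nn_integral_shift[symmetric, of _ a]])
         (auto intro!: nn_integral_cong simp: indicator_def mult_ac)
  qed
  also have "\<dots> = (\<integral>\<^sup>+m. \<integral>\<^sup>+a. indicator {0..} m * (indicator {0..w} a * (if a \<le> m then ennreal l * ennreal (exp (- l * (m - a))) else 0) * k m) \<partial>lborel \<partial>lborel)"
    by (rule tonelli) (unfold_locales, measurable)
  also have "\<dots> = (\<integral>\<^sup>+m. indicator {0..} m * (c m * k m) \<partial>lborel)"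
    unfolding c_def by (simp add: nn_integral_cmult nn_integral_multc)
  finally have "ennreal l * ?A + ?B = (\<integral>\<^sup>+m. indicator {0..} m * (c m * k m) + indicator {0..} m * (ennreal (exp (- l * m)) * k m) \<partial>lborel)"
    by (simp add: nn_integral_add)
  also have "\<dots> = (\<integral>\<^sup>+m. indicator {0..w} m * k m + indicator {w..} m * (ennreal (exp (- l * (m - w))) * k m) \<partial>lborel)"
  proof (rule nn_integral_cong_AE, use AE_lborel_singleton[of w] in eventually_elim)
    fix m assume m: "m \<noteq> w"
    have "c m + ennreal (exp (- l * m)) = ennreal (exp (- l * (m - min m w)))" if "0 \<le> m"
      unfolding c[OF that] using l w that by (subst ennreal_plus[symmetric]) (auto simp: min_def)
    thus "indicator {0..} m * (c m * k m) + indicator {0..} m * (ennreal (exp (- l * m)) * k m) =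
       indicator {0..w} m * k m + indicator {w..} m * (ennreal (exp (- l * (m - w))) * k m)"
      using m w by (auto simp: indicator_def distrib_right[symmetric])
  qed
  also have "\<dots> = ?C + (\<integral>\<^sup>+m. indicator {w..} m * (ennreal (exp (- l * (m - w))) * k m) \<partial>lborel)"
    by (simp add: nn_integral_add)
  also have "(\<integral>\<^sup>+m. indicator {w..} m * (ennreal (exp (- l * (m - w))) * k m) \<partial>lborel) = ?D"
    by (rule trans[OF nn_integral_shift[of _ w]]) (auto intro!: nn_integral_cong simp: indicator_def)
  finally show ?thesis .
qed

text \<open>
  The substitution \<open>\<tau> \<mapsto> \<tau> - q\<close> on the triangle \<open>0 \<le> q \<le> \<tau> \<le> u\<close>; with \<open>nn_integral_quadrant\<close> it
  turns convolutions in time into iterated integrals.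
\<close>

lemma nn_integral_triangle:
  fixes f :: "real \<Rightarrow> real \<Rightarrow> ennreal"
  assumes [measurable]: "case_prod f \<in> borel_measurable (borel \<Otimes>\<^sub>M borel)"
  shows "(\<integral>\<^sup>+\<tau>. indicator {0..u} \<tau> * (\<integral>\<^sup>+q. indicator {0..\<tau>} q * f q (\<tau> - q) \<partial>lborel) \<partial>lborel) =
     (\<integral>\<^sup>+q. indicator {0..u} q * (\<integral>\<^sup>+\<tau>. indicator {0..u - q} \<tau> * f q \<tau> \<partial>lborel) \<partial>lborel)"
proof -
  have "(\<integral>\<^sup>+\<tau>. indicator {0..u} \<tau> * (\<integral>\<^sup>+q. indicator {0..\<tau>} q * f q (\<tau> - q) \<partial>lborel) \<partial>lborel) =
     (\<integral>\<^sup>+\<tau>. \<integral>\<^sup>+q. indicator {0..u} \<tau> * (indicator {0..\<tau>} q * f q (\<tau> - q)) \<partial>lborel \<partial>lborel)"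
    by (simp add: nn_integral_cmult)
  also have "\<dots> = (\<integral>\<^sup>+q. \<integral>\<^sup>+\<tau>. indicator {0..u} \<tau> * (indicator {0..\<tau>} q * f q (\<tau> - q)) \<partial>lborel \<partial>lborel)"
    by (rule tonelli) (unfold_locales, measurable)
  also have "\<dots> = (\<integral>\<^sup>+q. \<integral>\<^sup>+\<tau>. indicator {0..u} q * (indicator {0..u - q} \<tau> * f q \<tau>) \<partial>lborel \<partial>lborel)"
  proof (rule nn_integral_cong)
    fix q :: real
    show "(\<integral>\<^sup>+\<tau>. indicator {0..u} \<tau> * (indicator {0..\<tau>} q * f q (\<tau> - q)) \<partial>lborel) =
      (\<integral>\<^sup>+\<tau>. indicator {0..u} q * (indicator {0..u - q} \<tau> * f q \<tau>) \<partial>lborel)"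
      by (rule trans[OF nn_integral_shift[of _ q]]) (measurable, intro nn_integral_cong, auto simp: indicator_def)
  qed
  finally show ?thesis by (simp add: nn_integral_cmult)
qed

lemma nn_integral_quadrant:
  fixes f :: "real \<Rightarrow> real \<Rightarrow> ennreal"
  assumes [measurable]: "case_prod f \<in> borel_measurable (borel \<Otimes>\<^sub>M borel)"
  shows "(\<integral>\<^sup>+\<tau>. indicator {0..} \<tau> * (\<integral>\<^sup>+q. indicator {0..\<tau>} q * f q (\<tau> - q) \<partial>lborel) \<partial>lborel) =
     (\<integral>\<^sup>+q. indicator {0..} q * (\<integral>\<^sup>+\<tau>. indicator {0..} \<tau> * f q \<tau> \<partial>lborel) \<partial>lborel)"
proof -
  have "(\<integral>\<^sup>+\<tau>. indicator {0..} \<tau> * (\<integral>\<^sup>+q. indicator {0..\<tau>} q * f q (\<tau> - q) \<partial>lborel) \<partial>lborel) =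
     (\<integral>\<^sup>+\<tau>. \<integral>\<^sup>+q. indicator {0..} \<tau> * (indicator {0..\<tau>} q * f q (\<tau> - q)) \<partial>lborel \<partial>lborel)"
    by (simp add: nn_integral_cmult)
  also have "\<dots> = (\<integral>\<^sup>+q. \<integral>\<^sup>+\<tau>. indicator {0..} \<tau> * (indicator {0..\<tau>} q * f q (\<tau> - q)) \<partial>lborel \<partial>lborel)"
    by (rule tonelli) (unfold_locales, measurable)
  also have "\<dots> = (\<integral>\<^sup>+q. \<integral>\<^sup>+\<tau>. indicator {0..} q * (indicator {0..} \<tau> * f q \<tau>) \<partial>lborel \<partial>lborel)"
  proof (rule nn_integral_cong)
    fix q :: real
    show "(\<integral>\<^sup>+\<tau>. indicator {0..} \<tau> * (indicator {0..\<tau>} q * f q (\<tau> - q)) \<partial>lborel) =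
      (\<integral>\<^sup>+\<tau>. indicator {0..} q * (indicator {0..} \<tau> * f q \<tau>) \<partial>lborel)"
      by (rule trans[OF nn_integral_shift[of _ q]]) (measurable, intro nn_integral_cong, auto simp: indicator_def)
  qed
  finally show ?thesis by (simp add: nn_integral_cmult)
qed

section \<open>The lifted semigroup\<close>

context kinetic begin

abbreviation meas :: "(real \<Rightarrow> 'a \<Rightarrow> ennreal) \<Rightarrow> bool" where
  "meas F \<equiv> case_prod F \<in> borel_measurable (borel \<Otimes>\<^sub>M N)"

definition mass :: "(real \<Rightarrow> 'a \<Rightarrow> ennreal) \<Rightarrow> ennreal" where
  "mass F = (\<integral>\<^sup>+s. \<integral>\<^sup>+v. F s v \<partial>N \<partial>lborel)"

text \<open>
  \<open>S n\<close> and \<open>T\<close> are the lifts of the Dyson--Phillips terms and of their sum to functions of time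
  and velocity; \<open>Bk\<close> is scattering at each time, and \<open>Lap n l\<close> is the Laplace transform of \<open>S n\<close>, so that
  \<open>Lap 0 l\<close> is the resolvent at \<open>l\<close> of the transport without scattering.
\<close>

definition S :: "nat \<Rightarrow> real \<Rightarrow> (real \<Rightarrow> 'a \<Rightarrow> ennreal) \<Rightarrow> real \<Rightarrow> 'a \<Rightarrow> ennreal" where
  "S n \<tau> F s v = vE n s (s - \<tau>) (F (s - \<tau>)) v"

definition T :: "real \<Rightarrow> (real \<Rightarrow> 'a \<Rightarrow> ennreal) \<Rightarrow> real \<Rightarrow> 'a \<Rightarrow> ennreal" where
  "T \<tau> F s v = vI s (s - \<tau>) (F (s - \<tau>)) v"

definition Bk :: "(real \<Rightarrow> 'a \<Rightarrow> ennreal) \<Rightarrow> real \<Rightarrow> 'a \<Rightarrow> ennreal" where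
  "Bk F s v = B s (F s) v"

definition J :: "nat \<Rightarrow> real \<Rightarrow> (real \<Rightarrow> 'a \<Rightarrow> ennreal) \<Rightarrow> real \<Rightarrow> 'a \<Rightarrow> ennreal" where
  "J n u F s v = (\<integral>\<^sup>+\<tau>. indicator {0..u} \<tau> * S n \<tau> F s v \<partial>lborel)"

definition Lap :: "nat \<Rightarrow> real \<Rightarrow> (real \<Rightarrow> 'a \<Rightarrow> ennreal) \<Rightarrow> real \<Rightarrow> 'a \<Rightarrow> ennreal" where
  "Lap n l F s v = (\<integral>\<^sup>+p. indicator {0..} p * (ennreal (exp (- l * p)) * S n p F s v) \<partial>lborel)"

abbreviation R where "R \<equiv> Lap 0"

abbreviation fmeas where
  "fmeas Q F \<equiv> (\<lambda>x. F (fst x) (fst (snd x)) (snd (snd x))) \<in> borel_measurable (Q \<Otimes>\<^sub>M borel \<Otimes>\<^sub>M N)"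

lemma fmeasD:
  assumes "fmeas Q F" and [measurable]: "P \<in> measurable X Q" "A \<in> borel_measurable X" "V \<in> measurable X N"
  shows "(\<lambda>x. F (P x) (A x) (V x)) \<in> borel_measurable X"
  using measurable_compose[OF _ assms(1), of "\<lambda>x. (P x, A x, V x)" X] by simp

lemma S_measurable[measurable (raw)]:
  assumes [measurable]: "A \<in> borel_measurable Q" "U \<in> borel_measurable Q" "V \<in> measurable Q N"
    and F: "fmeas Q F"
  shows "(\<lambda>q. S n (U q) (F q) (A q) (V q)) \<in> borel_measurable Q"
proof -
  note [measurable (raw)] = fmeasD[OF F]
  show ?thesis unfolding S_def by measurable
qed

lemma T_measurable[measurable (raw)]:
  assumes [measurable]: "A \<in> borel_measurable Q" "U \<in> borel_measurable Q" "V \<in> measurable Q N"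
    and F: "fmeas Q F"
  shows "(\<lambda>q. T (U q) (F q) (A q) (V q)) \<in> borel_measurable Q"
proof -
  note [measurable (raw)] = fmeasD[OF F]
  show ?thesis unfolding T_def by measurable
qed

lemma Bk_measurable[measurable (raw)]:
  assumes [measurable]: "A \<in> borel_measurable Q" "V \<in> measurable Q N"
    and F: "fmeas Q F"
  shows "(\<lambda>q. Bk (F q) (A q) (V q)) \<in> borel_measurable Q"
proof -
  note [measurable (raw)] = fmeasD[OF F]
  show ?thesis unfolding Bk_def by measurable
qed

lemma J_measurable[measurable (raw)]:
  assumes [measurable]: "A \<in> borel_measurable Q" "U \<in> borel_measurable Q" "V \<in> measurable Q N"
    and F: "fmeas Q F"
  shows "(\<lambda>q. J n (U q) (F q) (A q) (V q)) \<in> borel_measurable Q"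
proof -
  note [measurable (raw)] = fmeasD[OF F]
  show ?thesis unfolding J_def by measurable
qed

lemma Lap_measurable[measurable (raw)]:
  assumes [measurable]: "A \<in> borel_measurable Q" "V \<in> measurable Q N"
    and F: "fmeas Q F"
  shows "(\<lambda>q. Lap n l (F q) (A q) (V q)) \<in> borel_measurable Q"
proof -
  note [measurable (raw)] = fmeasD[OF F]
  show ?thesis unfolding Lap_def by measurable
qed

end

context kinetic begin

lemma mass_mono: "(\<And>s v. v \<in> space N \<Longrightarrow> F s v \<le> G s v) \<Longrightarrow> mass F \<le> mass G"
  unfolding mass_def by (intro nn_integral_mono) auto

lemma mass_cong: "(\<And>s v. v \<in> space N \<Longrightarrow> F s v = G s v) \<Longrightarrow> mass F = mass G"
  unfolding mass_def by (intro nn_integral_cong) auto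

lemma mass_add:
  assumes [measurable]: "meas F" "meas G"
  shows "mass (\<lambda>s v. F s v + G s v) = mass F + mass G"
  unfolding mass_def by (simp add: nn_integral_add)

lemma mass_cmult:
  assumes [measurable]: "meas F"
  shows "mass (\<lambda>s v. c * F s v) = c * mass F"
  unfolding mass_def by (simp add: nn_integral_cmult)

lemma mass_nn_integral:
  assumes Q: "sigma_finite_measure Q" and [measurable]: "(\<lambda>x. F (fst x) (fst (snd x)) (snd (snd x))) \<in> borel_measurable (Q \<Otimes>\<^sub>M borel \<Otimes>\<^sub>M N)"
  shows "mass (\<lambda>s v. \<integral>\<^sup>+q. F q s v \<partial>Q) = (\<integral>\<^sup>+q. mass (F q) \<partial>Q)"
proof -
  interpret Q: sigma_finite_measure Q by fact
  note [measurable (raw)] = fmeasD[OF assms(2)]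
  have "mass (\<lambda>s v. \<integral>\<^sup>+q. F q s v \<partial>Q) = (\<integral>\<^sup>+s. \<integral>\<^sup>+q. \<integral>\<^sup>+v. F q s v \<partial>N \<partial>Q \<partial>lborel)"
    unfolding mass_def by (intro nn_integral_cong tonelli[OF sf Q]) measurable
  also have "\<dots> = (\<integral>\<^sup>+q. mass (F q) \<partial>Q)"
    unfolding mass_def by (rule tonelli[OF _ Q]) (unfold_locales, measurable)
  finally show ?thesis .
qed

lemma mass_measurable:
  assumes "fmeas Q F"
  shows "(\<lambda>q. mass (F q)) \<in> borel_measurable Q"
proof -
  note [measurable (raw)] = fmeasD[OF assms]
  show ?thesis unfolding mass_def by measurable
qed

lemma mass_suminf:
  assumes [measurable]: "\<And>i. meas (F i)"
  shows "mass (\<lambda>s v. \<Sum>i. F i s v) = (\<Sum>i. mass (F i))"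
  unfolding mass_def by (simp add: nn_integral_suminf)

subsection \<open>Linearity of the lifted operators\<close>

lemma S_nn_integral:
  assumes "sigma_finite_measure Q" and F: "fmeas Q F" and [measurable]: "v \<in> space N"
  shows "S n \<tau> (\<lambda>s v. \<integral>\<^sup>+q. F q s v \<partial>Q) s v = (\<integral>\<^sup>+q. S n \<tau> (F q) s v \<partial>Q)"
proof -
  note [measurable (raw)] = fmeasD[OF F]
  show ?thesis unfolding S_def by (rule vE_nn_integral[OF assms(1)]) measurable
qed

lemma Bk_nn_integral:
  assumes "sigma_finite_measure Q" and F: "fmeas Q F" and [measurable]: "v \<in> space N"
  shows "Bk (\<lambda>s v. \<integral>\<^sup>+q. F q s v \<partial>Q) s v = (\<integral>\<^sup>+q. Bk (F q) s v \<partial>Q)"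
proof -
  note [measurable (raw)] = fmeasD[OF F]
  show ?thesis unfolding Bk_def by (rule B_nn_integral[OF assms(1)]) measurable
qed

lemma Lap_nn_integral:
  assumes Q: "sigma_finite_measure Q" and F: "fmeas Q F" and [measurable]: "v \<in> space N"
  shows "Lap n l (\<lambda>s v. \<integral>\<^sup>+q. F q s v \<partial>Q) s v = (\<integral>\<^sup>+q. Lap n l (F q) s v \<partial>Q)"
proof -
  interpret Q: sigma_finite_measure Q by fact
  note [measurable (raw)] = fmeasD[OF F]
  have "Lap n l (\<lambda>s v. \<integral>\<^sup>+q. F q s v \<partial>Q) s v =
     (\<integral>\<^sup>+p. \<integral>\<^sup>+q. indicator {0..} p * (ennreal (exp (- l * p)) * S n p (F q) s v) \<partial>Q \<partial>lborel)"
    unfolding Lap_def by (simp add: S_nn_integral[OF Q F assms(3)] nn_integral_cmult)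
  also have "\<dots> = (\<integral>\<^sup>+q. Lap n l (F q) s v \<partial>Q)"
    unfolding Lap_def by (rule tonelli[OF _ Q]) (unfold_locales, measurable)
  finally show ?thesis .
qed

lemma S_add:
  assumes [measurable]: "meas F" "meas G" "v \<in> space N"
  shows "S n \<tau> (\<lambda>s v. F s v + G s v) s v = S n \<tau> F s v + S n \<tau> G s v"
  unfolding S_def by (rule vE_add) measurable

lemma S_cmult:
  assumes [measurable]: "meas F" "v \<in> space N"
  shows "S n \<tau> (\<lambda>s v. c * F s v) s v = c * S n \<tau> F s v"
  unfolding S_def by (rule vE_cmult) measurable

lemma Bk_add:
  assumes [measurable]: "meas F" "meas G" "v \<in> space N"
  shows "Bk (\<lambda>s v. F s v + G s v) s v = Bk F s v + Bk G s v"
  unfolding Bk_def by (rule B_add) measurable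

lemma Bk_cmult:
  assumes [measurable]: "meas F" "v \<in> space N"
  shows "Bk (\<lambda>s v. c * F s v) s v = c * Bk F s v"
  unfolding Bk_def by (rule B_cmult) measurable

lemma Lap_add:
  assumes [measurable]: "meas F" "meas G" "v \<in> space N"
  shows "Lap n l (\<lambda>s v. F s v + G s v) s v = Lap n l F s v + Lap n l G s v"
  unfolding Lap_def by (simp add: S_add[OF assms] distrib_left nn_integral_add)

lemma Lap_cmult:
  assumes [measurable]: "meas F" "v \<in> space N"
  shows "Lap n l (\<lambda>s v. c * F s v) s v = c * Lap n l F s v"
  unfolding Lap_def by (simp add: S_cmult[OF assms] nn_integral_cmult[symmetric] mult.left_commute)

lemma S_mono: "(\<And>s v. v \<in> space N \<Longrightarrow> F s v \<le> G s v) \<Longrightarrow> v \<in> space N \<Longrightarrow> S n \<tau> F s v \<le> S n \<tau> G s v"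
  unfolding S_def by (rule vE_mono) auto

lemma Bk_mono: "(\<And>s v. v \<in> space N \<Longrightarrow> F s v \<le> G s v) \<Longrightarrow> Bk F s v \<le> Bk G s v"
  unfolding Bk_def by (rule B_mono) auto

lemma Lap_mono: "(\<And>s v. v \<in> space N \<Longrightarrow> F s v \<le> G s v) \<Longrightarrow> v \<in> space N \<Longrightarrow> Lap n l F s v \<le> Lap n l G s v"
  unfolding Lap_def by (intro nn_integral_mono mult_left_mono S_mono) auto

lemma Bk_cong: "(\<And>s v. v \<in> space N \<Longrightarrow> F s v = G s v) \<Longrightarrow> Bk F s v = Bk G s v"
  by (rule antisym) (auto intro: Bk_mono)

lemma Lap_cong: "(\<And>s v. v \<in> space N \<Longrightarrow> F s v = G s v) \<Longrightarrow> v \<in> space N \<Longrightarrow> Lap n l F s v = Lap n l G s v"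
  by (rule antisym) (auto intro: Lap_mono)

subsection \<open>Duhamel expansion\<close>

lemma S_Suc:
  assumes [measurable]: "meas F" "v \<in> space N"
  shows "S (Suc n) \<tau> F s v = (\<integral>\<^sup>+q. indicator {0..\<tau>} q * S n (\<tau> - q) (Bk (S 0 q F)) s v \<partial>lborel)"
proof -
  have "S (Suc n) \<tau> F s v = (\<integral>\<^sup>+r. indicator {s - \<tau>..s} r * vE n s r (B r (vE 0 r (s - \<tau>) (F (s - \<tau>)))) v \<partial>lborel)"
    unfolding S_def by (rule vE_Suc) measurable
  also have "\<dots> = (\<integral>\<^sup>+q. indicator {0..\<tau>} q * S n (\<tau> - q) (Bk (S 0 q F)) s v \<partial>lborel)"
    unfolding S_def Bk_def
    by (rule trans[OF nn_integral_shift[of _ "s - \<tau>"]], measurable, intro nn_integral_cong)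
       (auto simp: indicator_def algebra_simps S_def[abs_def])
  finally show ?thesis .
qed

lemma T_eq_suminf: "T \<tau> F s v = (\<Sum>n. S n \<tau> F s v)"
  unfolding T_def S_def vI_def ..

text \<open>
  Splitting off the first scattering, summed over all orders.
\<close>

lemma T_Duhamel:
  assumes [measurable]: "meas F" "v \<in> space N"
  shows "T \<tau> F s v = S 0 \<tau> F s v + (\<integral>\<^sup>+q. indicator {0..\<tau>} q * T (\<tau> - q) (Bk (S 0 q F)) s v \<partial>lborel)"
proof -
  have "T \<tau> F s v = (\<Sum>n. S (Suc n) \<tau> F s v) + S 0 \<tau> F s v"
    unfolding T_eq_suminf by (subst suminf_offset[of _ 1]) auto
  also have "(\<Sum>n. S (Suc n) \<tau> F s v) = (\<integral>\<^sup>+q. indicator {0..\<tau>} q * T (\<tau> - q) (Bk (S 0 q F)) s v \<partial>lborel)"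
    unfolding T_eq_suminf by (simp add: S_Suc[OF assms] nn_integral_suminf[symmetric])
  finally show ?thesis by (simp add: add.commute)
qed

lemma T_nn_integral:
  assumes Q: "sigma_finite_measure Q" and F: "fmeas Q F" and [measurable]: "v \<in> space N"
  shows "T \<tau> (\<lambda>s v. \<integral>\<^sup>+q. F q s v \<partial>Q) s v = (\<integral>\<^sup>+q. T \<tau> (F q) s v \<partial>Q)"
proof -
  interpret Q: sigma_finite_measure Q by fact
  note [measurable (raw)] = fmeasD[OF F]
  show ?thesis unfolding T_eq_suminf
    by (simp add: S_nn_integral[OF Q F assms(3)] nn_integral_suminf)
qed

lemma T_add:
  assumes [measurable]: "meas F" "meas G" "v \<in> space N"
  shows "T \<tau> (\<lambda>s v. F s v + G s v) s v = T \<tau> F s v + T \<tau> G s v"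
  unfolding T_eq_suminf by (simp add: S_add[OF assms] suminf_add)

lemma T_cmult:
  assumes [measurable]: "meas F" "v \<in> space N"
  shows "T \<tau> (\<lambda>s v. c * F s v) s v = c * T \<tau> F s v"
  unfolding T_eq_suminf by (simp add: S_cmult[OF assms])

lemma T_mono: "(\<And>s v. v \<in> space N \<Longrightarrow> F s v \<le> G s v) \<Longrightarrow> v \<in> space N \<Longrightarrow> T \<tau> F s v \<le> T \<tau> G s v"
  unfolding T_eq_suminf by (intro suminf_le S_mono) auto

lemma T_cong: "(\<And>s v. v \<in> space N \<Longrightarrow> F s v = G s v) \<Longrightarrow> v \<in> space N \<Longrightarrow> T \<tau> F s v = T \<tau> G s v"
  by (rule antisym) (auto intro: T_mono)

lemma T_T:
  assumes [measurable]: "meas F" "v \<in> space N" and "0 \<le> a" "0 \<le> c"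
  shows "T a (T c F) s v = T (a + c) F s v"
proof -
  have "T (a + c) F s v = vI s (s - (a + c)) (F (s - (a + c))) v" unfolding T_def ..
  also have "\<dots> = vI s (s - a) (vI (s - a) (s - (a + c)) (F (s - (a + c)))) v"
    by (rule vI_split) (use assms in auto)
  also have "\<dots> = T a (T c F) s v"
    unfolding T_def[abs_def] by (simp add: diff_diff_eq)
  finally show ?thesis ..
qed

lemma S0_S0:
  assumes "0 \<le> a" "0 \<le> c"
  shows "S 0 a (S 0 c F) s v = S 0 (a + c) F s v"
proof -
  have "E (s - (a + c)) s v = E (s - a) s v * E (s - (a + c)) (s - a) v"
    using E_mult[of "s - (a + c)" "s - a" s v] assms by (simp add: mult.commute)
  thus ?thesis by (simp add: S_def vE_0 mult.assoc diff_diff_eq)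
qed

subsection \<open>Mass bounds\<close>

lemma T_mass_le:
  assumes [measurable]: "meas F" and "0 \<le> \<tau>"
  shows "mass (T \<tau> F) \<le> mass F"
proof -
  have "mass (T \<tau> F) = (\<integral>\<^sup>+s. \<integral>\<^sup>+v. vI (s + \<tau>) s (F s) v \<partial>N \<partial>lborel)"
  proof -
    have "(\<lambda>s. \<integral>\<^sup>+v. vI s (s - \<tau>) (F (s - \<tau>)) v \<partial>N) \<in> borel_measurable borel" by measurable
    from nn_integral_shift[OF this, of \<tau>] show ?thesis by (simp add: mass_def T_def)
  qed
  also have "\<dots> \<le> mass F"
    unfolding mass_def by (intro nn_integral_mono vI_mass_le) (use assms(2) in \<open>measurable, auto\<close>)
  finally show ?thesis .
qed

lemma S_le_T: "S n \<tau> F s v \<le> T \<tau> F s v"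
proof -
  have "(\<Sum>n\<in>{n}. S n \<tau> F s v) \<le> (\<Sum>n. S n \<tau> F s v)" by (rule sum_le_suminf) auto
  thus ?thesis by (simp add: T_eq_suminf)
qed

lemma S_mass_le:
  assumes [measurable]: "meas F" and "0 \<le> \<tau>"
  shows "mass (S n \<tau> F) \<le> mass F"
  by (rule order_trans[OF mass_mono[OF S_le_T] T_mass_le[OF assms]])

lemma J_mass_le:
  assumes [measurable]: "meas F" and "0 \<le> u"
  shows "mass (J n u F) \<le> ennreal u * mass F"
proof -
  have "mass (J n u F) = (\<integral>\<^sup>+\<tau>. mass (\<lambda>s v. indicator {0..u} \<tau> * S n \<tau> F s v) \<partial>lborel)"
    unfolding J_def by (rule mass_nn_integral) (unfold_locales, measurable)
  also have "\<dots> = (\<integral>\<^sup>+\<tau>. indicator {0..u} \<tau> * mass (S n \<tau> F) \<partial>lborel)"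
    by (intro nn_integral_cong mass_cmult) measurable
  also have "\<dots> \<le> (\<integral>\<^sup>+\<tau>. mass F * indicator {0..u} \<tau> \<partial>lborel)"
    by (intro nn_integral_mono) (auto simp: indicator_def S_mass_le)
  also have "\<dots> = ennreal u * mass F" using assms(2) by (simp add: nn_integral_cmult mult.commute)
  finally show ?thesis .
qed

lemma Bk_mass_le:
  assumes [measurable]: "meas F"
  shows "mass (Bk F) \<le> mass (\<lambda>s v. ennreal (Sg s v) * F s v)"
  unfolding mass_def Bk_def
  by (rule nn_integral_mono_AE, use AE_loss_time in eventually_elim, rule B_mass_le) auto

text \<open>
  Every particle is removed at most once, at rate \<open>l + \<Sigma>\<close>; the balance bounds \<open>B R\<close> and \<open>l R\<close> alike and sums
  the masses of \<open>(R B)\<^sup>n M\<close>.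
\<close>

lemma R_mass_le:
  assumes [measurable]: "meas g" and l: "0 \<le> l"
  shows "mass (\<lambda>s v. ennreal (l + Sg s v) * R l g s v) \<le> mass g"
proof -
  let ?h = "\<lambda>p a v. indicator {0..} p * (ennreal (l + Sg (a + p) v) * (ennreal (exp (- l * p)) * (E a (a + p) v * g a v)))"
  have "mass (\<lambda>s v. ennreal (l + Sg s v) * R l g s v) =
    mass (\<lambda>s v. \<integral>\<^sup>+p. ?h p (s - p) v \<partial>lborel)"
    unfolding Lap_def S_def vE_0
    by (rule mass_cong, subst nn_integral_cmult[symmetric], measurable) (simp add: mult.left_commute)
  also have "\<dots> = (\<integral>\<^sup>+p. mass (\<lambda>s v. ?h p (s - p) v) \<partial>lborel)"
    by (rule mass_nn_integral) (unfold_locales, measurable)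
  also have "\<dots> = (\<integral>\<^sup>+p. mass (\<lambda>s v. ?h p s v) \<partial>lborel)"
  proof (rule nn_integral_cong)
    fix p :: real
    have "(\<lambda>s. \<integral>\<^sup>+v. ?h p (s - p) v \<partial>N) \<in> borel_measurable borel" by measurable
    from nn_integral_shift[OF this, of p] show "mass (\<lambda>s v. ?h p (s - p) v) = mass (?h p)"
      by (simp add: mass_def)
  qed
  also have "\<dots> = mass (\<lambda>s v. \<integral>\<^sup>+p. ?h p s v \<partial>lborel)"
    by (rule mass_nn_integral[symmetric]) (unfold_locales, measurable)
  also have "\<dots> \<le> mass g"
  proof (rule mass_mono)
    fix s v assume v[measurable]: "v \<in> space N"
    have "(\<integral>\<^sup>+p. ?h p s v \<partial>lborel) = (\<integral>\<^sup>+p. indicator {0..} p * (ennreal (l + Sg (s + p) v) * (ennreal (exp (- l * p)) * E s (s + p) v)) * g s v \<partial>lborel)"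
      by (simp add: mult.assoc)
    also have "\<dots> = (\<integral>\<^sup>+p. indicator {0..} p * (ennreal (l + Sg (s + p) v) * (ennreal (exp (- l * p)) * E s (s + p) v)) \<partial>lborel) * g s v"
      by (rule nn_integral_multc) measurable
    also have "(\<integral>\<^sup>+p. indicator {0..} p * (ennreal (l + Sg (s + p) v) * (ennreal (exp (- l * p)) * E s (s + p) v)) \<partial>lborel)
       = (\<integral>\<^sup>+t. indicator {s..} t * (ennreal (l + Sg t v) * (ennreal (exp (- l * (t - s))) * E s t v)) \<partial>lborel)"
      by (rule trans[OF _ nn_integral_shift[of _ s, symmetric]]) (auto intro!: nn_integral_cong simp: indicator_def add.commute)
    also have "\<dots> * g s v \<le> 1 * g s v"
      by (intro mult_right_mono E_rate_discounted v l) auto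
    finally show "(\<integral>\<^sup>+p. ?h p s v \<partial>lborel) \<le> g s v" by simp
  qed
  finally show ?thesis .
qed

lemma BR_mass_le:
  assumes [measurable]: "meas g" and l: "0 \<le> l"
  shows "mass (Bk (R l g)) \<le> mass g"
proof -
  have "mass (Bk (R l g)) \<le> mass (\<lambda>s v. ennreal (Sg s v) * R l g s v)" by (rule Bk_mass_le) measurable
  also have "\<dots> \<le> mass (\<lambda>s v. ennreal (l + Sg s v) * R l g s v)"
    by (intro mass_mono mult_right_mono ennreal_leI) (use l in auto)
  finally show ?thesis using R_mass_le[OF assms] by simp
qed

lemma R_mass_le':
  assumes [measurable]: "meas g" and l: "0 \<le> l"
  shows "ennreal l * mass (R l g) \<le> mass g"
proof -
  have "ennreal l * mass (R l g) = mass (\<lambda>s v. ennreal l * R l g s v)" by (simp add: mass_cmult)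
  also have "\<dots> \<le> mass (\<lambda>s v. ennreal (l + Sg s v) * R l g s v)"
    by (intro mass_mono mult_right_mono ennreal_leI) (use Sg_nn in auto)
  finally show ?thesis using R_mass_le[OF assms] by simp
qed

subsection \<open>Laplace transforms of the Dyson--Phillips terms\<close>

text \<open>
  The Laplace transform turns the convolution in \<open>S_Suc\<close> into a product, so that
  \<open>Lap n l = R (B R)\<^sup>n\<close>.
\<close>

lemma Lap_Suc:
  assumes [measurable]: "meas F" "v \<in> space N"
  shows "Lap (Suc n) l F s v = Lap n l (Bk (R l F)) s v"
proof -
  have "Lap (Suc n) l F s v = (\<integral>\<^sup>+p. indicator {0..} p * (\<integral>\<^sup>+q. indicator {0..p} q *
      (ennreal (exp (- l * q)) * (ennreal (exp (- l * (p - q))) * S n (p - q) (Bk (S 0 q F)) s v)) \<partial>lborel) \<partial>lborel)"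
  proof -
    have "ennreal (exp (- l * p)) * S (Suc n) p F s v = (\<integral>\<^sup>+q. indicator {0..p} q *
      (ennreal (exp (- l * q)) * (ennreal (exp (- l * (p - q))) * S n (p - q) (Bk (S 0 q F)) s v)) \<partial>lborel)" for p
    proof (subst S_Suc[OF assms], subst nn_integral_cmult[symmetric], measurable, rule nn_integral_cong)
      fix q
      have "ennreal (exp (- l * p)) = ennreal (exp (- l * q)) * ennreal (exp (- l * (p - q)))"
        by (simp add: ennreal_mult'[symmetric] exp_add[symmetric] algebra_simps)
      thus "ennreal (exp (- l * p)) * (indicator {0..p} q * S n (p - q) (Bk (S 0 q F)) s v) =
        indicator {0..p} q * (ennreal (exp (- l * q)) * (ennreal (exp (- l * (p - q))) * S n (p - q) (Bk (S 0 q F)) s v))"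
        by (simp add: mult_ac)
    qed
    thus ?thesis unfolding Lap_def by simp
  qed
  also have "\<dots> = (\<integral>\<^sup>+q. indicator {0..} q * (\<integral>\<^sup>+\<tau>. indicator {0..} \<tau> *
       (ennreal (exp (- l * q)) * (ennreal (exp (- l * \<tau>)) * S n \<tau> (Bk (S 0 q F)) s v)) \<partial>lborel) \<partial>lborel)"
    by (rule nn_integral_quadrant) measurable
  also have "\<dots> = (\<integral>\<^sup>+q. Lap n l (\<lambda>s v. indicator {0..} q * (ennreal (exp (- l * q)) * Bk (S 0 q F) s v)) s v \<partial>lborel)"
  proof (rule nn_integral_cong)
    fix q :: real
    have "Lap n l (\<lambda>s v. indicator {0..} q * (ennreal (exp (- l * q)) * Bk (S 0 q F) s v)) s v =
       Lap n l (\<lambda>s v. (indicator {0..} q * ennreal (exp (- l * q))) * Bk (S 0 q F) s v) s v"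
      by (simp add: mult.assoc)
    also have "\<dots> = (indicator {0..} q * ennreal (exp (- l * q))) * Lap n l (Bk (S 0 q F)) s v"
      by (rule Lap_cmult) measurable
    also have "\<dots> = indicator {0..} q * (\<integral>\<^sup>+\<tau>. ennreal (exp (- l * q)) * (indicator {0..} \<tau> *
       (ennreal (exp (- l * \<tau>)) * S n \<tau> (Bk (S 0 q F)) s v)) \<partial>lborel)"
      unfolding Lap_def by (subst nn_integral_cmult) (measurable, simp only: mult.assoc)
    finally show "indicator {0..} q * (\<integral>\<^sup>+\<tau>. indicator {0..} \<tau> *
       (ennreal (exp (- l * q)) * (ennreal (exp (- l * \<tau>)) * S n \<tau> (Bk (S 0 q F)) s v)) \<partial>lborel) =
      Lap n l (\<lambda>s v. indicator {0..} q * (ennreal (exp (- l * q)) * Bk (S 0 q F) s v)) s v"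
      by (simp only: mult.left_commute)
  qed
  also have "\<dots> = Lap n l (\<lambda>s v. \<integral>\<^sup>+q. indicator {0..} q * (ennreal (exp (- l * q)) * Bk (S 0 q F) s v) \<partial>lborel) s v"
    by (rule Lap_nn_integral[symmetric]) (unfold_locales, measurable)
  also have "\<dots> = Lap n l (Bk (R l F)) s v"
  proof (rule Lap_cong)
    fix s v assume [measurable]: "v \<in> space N"
    have "Bk (R l F) s v = (\<integral>\<^sup>+q. Bk (\<lambda>s v. (indicator {0..} q * ennreal (exp (- l * q))) * S 0 q F s v) s v \<partial>lborel)"
      unfolding Lap_def mult.assoc[symmetric] by (rule Bk_nn_integral) (unfold_locales, measurable)
    also have "\<dots> = (\<integral>\<^sup>+q. (indicator {0..} q * ennreal (exp (- l * q))) * Bk (S 0 q F) s v \<partial>lborel)"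
      by (intro nn_integral_cong Bk_cmult) measurable
    finally show "(\<integral>\<^sup>+q. indicator {0..} q * (ennreal (exp (- l * q)) * Bk (S 0 q F) s v) \<partial>lborel) = Bk (R l F) s v"
      by (simp add: mult.assoc)
  qed fact
  finally show ?thesis .
qed

text \<open>
  On \<open>[0, u]\<close> the discount factor \<open>exp (- l p)\<close> is at least \<open>exp (- l u)\<close>.
\<close>

lemma J_le_Lap:
  assumes [measurable]: "meas F" "v \<in> space N" and l: "0 \<le> l"
  shows "J n u F s v \<le> ennreal (exp (l * u)) * Lap n l F s v"
proof -
  have "J n u F s v \<le> (\<integral>\<^sup>+p. ennreal (exp (l * u)) * (indicator {0..} p * (ennreal (exp (- l * p)) * S n p F s v)) \<partial>lborel)"
    unfolding J_def
  proof (rule nn_integral_mono)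
    fix p :: real
    have "1 * S n p F s v \<le> ennreal (exp (l * u)) * (ennreal (exp (- l * p)) * S n p F s v)" if "p \<le> u"
      unfolding mult.assoc[symmetric]
      by (rule mult_right_mono) (use l that in \<open>auto simp: ennreal_mult'[symmetric] exp_add[symmetric] mult_left_mono\<close>)
    thus "indicator {0..u} p * S n p F s v \<le> ennreal (exp (l * u)) * (indicator {0..} p * (ennreal (exp (- l * p)) * S n p F s v))"
      by (auto simp: indicator_def)
  qed
  also have "\<dots> = ennreal (exp (l * u)) * Lap n l F s v"
    unfolding Lap_def by (rule nn_integral_cmult) measurable
  finally show ?thesis .
qed

end

section \<open>Resolvents of time windows\<close>

context kinetic begin

abbreviation rmeas :: "(real \<Rightarrow> real \<Rightarrow> 'a \<Rightarrow> ennreal) \<Rightarrow> bool" where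
  "rmeas H \<equiv> fmeas borel H"

lemma interval_family:
  assumes "rmeas H"
  shows "fmeas lborel (\<lambda>q s v. indicator {0..u} q * H q s v)"
proof -
  note [measurable (raw)] = fmeasD[OF assms]
  show ?thesis by measurable
qed

lemma Bk_interval:
  assumes H: "rmeas H" and v[measurable]: "v \<in> space N"
  shows "Bk (\<lambda>s v. \<integral>\<^sup>+q. indicator {0..u} q * H q s v \<partial>lborel) s v = (\<integral>\<^sup>+q. indicator {0..u} q * Bk (H q) s v \<partial>lborel)"
proof -
  note [measurable (raw)] = fmeasD[OF H]
  have "Bk (\<lambda>s v. \<integral>\<^sup>+q. indicator {0..u} q * H q s v \<partial>lborel) s v = (\<integral>\<^sup>+q. Bk (\<lambda>s v. indicator {0..u} q * H q s v) s v \<partial>lborel)"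
    by (rule Bk_nn_integral[OF _ interval_family[OF H] v]) unfold_locales
  thus ?thesis by (simp add: Bk_cmult[OF _ v])
qed

lemma S_interval:
  assumes H: "rmeas H" and v[measurable]: "v \<in> space N"
  shows "S n \<tau> (\<lambda>s v. \<integral>\<^sup>+q. indicator {0..u} q * H q s v \<partial>lborel) s v = (\<integral>\<^sup>+q. indicator {0..u} q * S n \<tau> (H q) s v \<partial>lborel)"
proof -
  note [measurable (raw)] = fmeasD[OF H]
  have "S n \<tau> (\<lambda>s v. \<integral>\<^sup>+q. indicator {0..u} q * H q s v \<partial>lborel) s v = (\<integral>\<^sup>+q. S n \<tau> (\<lambda>s v. indicator {0..u} q * H q s v) s v \<partial>lborel)"
    by (rule S_nn_integral[OF _ interval_family[OF H] v]) unfold_locales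
  thus ?thesis by (simp add: S_cmult[OF _ v])
qed

lemma T_interval:
  assumes H: "rmeas H" and v[measurable]: "v \<in> space N"
  shows "T \<tau> (\<lambda>s v. \<integral>\<^sup>+q. indicator {0..u} q * H q s v \<partial>lborel) s v = (\<integral>\<^sup>+q. indicator {0..u} q * T \<tau> (H q) s v \<partial>lborel)"
proof -
  note [measurable (raw)] = fmeasD[OF H]
  have "T \<tau> (\<lambda>s v. \<integral>\<^sup>+q. indicator {0..u} q * H q s v \<partial>lborel) s v = (\<integral>\<^sup>+q. T \<tau> (\<lambda>s v. indicator {0..u} q * H q s v) s v \<partial>lborel)"
    by (rule T_nn_integral[OF _ interval_family[OF H] v]) unfold_locales
  thus ?thesis by (simp add: T_cmult[OF _ v])
qed

lemma Lap_interval: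
  assumes H: "rmeas H" and v[measurable]: "v \<in> space N"
  shows "Lap n l (\<lambda>s v. \<integral>\<^sup>+q. indicator {0..u} q * H q s v \<partial>lborel) s v = (\<integral>\<^sup>+q. indicator {0..u} q * Lap n l (H q) s v \<partial>lborel)"
proof -
  note [measurable (raw)] = fmeasD[OF H]
  have "Lap n l (\<lambda>s v. \<integral>\<^sup>+q. indicator {0..u} q * H q s v \<partial>lborel) s v = (\<integral>\<^sup>+q. Lap n l (\<lambda>s v. indicator {0..u} q * H q s v) s v \<partial>lborel)"
    by (rule Lap_nn_integral[OF _ interval_family[OF H] v]) unfold_locales
  thus ?thesis by (simp add: Lap_cmult[OF _ v])
qed

lemma mass_interval:
  assumes H: "rmeas H"
  shows "mass (\<lambda>s v. \<integral>\<^sup>+q. indicator {0..u} q * H q s v \<partial>lborel) = (\<integral>\<^sup>+q. indicator {0..u} q * mass (H q) \<partial>lborel)"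
proof -
  note [measurable (raw)] = fmeasD[OF H]
  have "mass (\<lambda>s v. \<integral>\<^sup>+q. indicator {0..u} q * H q s v \<partial>lborel) = (\<integral>\<^sup>+q. mass (\<lambda>s v. indicator {0..u} q * H q s v) \<partial>lborel)"
    by (rule mass_nn_integral[OF _ interval_family[OF H]]) unfold_locales
  thus ?thesis by (simp add: mass_cmult)
qed

lemma resolvent_window_base:
  assumes G[measurable]: "meas G" and v[measurable]: "v \<in> space N" and w: "0 \<le> w" and l: "0 < l"
  shows "ennreal l * R l (J 0 w G) s v + R l G s v = J 0 w G s v + R l (S 0 w G) s v"
proof -
  have [measurable]: "(\<lambda>m. S 0 m G s v) \<in> borel_measurable borel" by measurable
  have f: "fmeas borel (\<lambda>q. S 0 q G)" by measurable
  have "indicator {0..} p * (ennreal (exp (- l * p)) * S 0 p (J 0 w G) s v) =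
     indicator {0..} p * (ennreal (exp (- l * p)) * (\<integral>\<^sup>+a. indicator {0..w} a * S 0 (p + a) G s v \<partial>lborel))" for p
  proof (cases "0 \<le> p")
    case True
    have "S 0 p (J 0 w G) s v = (\<integral>\<^sup>+a. indicator {0..w} a * S 0 p (S 0 a G) s v \<partial>lborel)"
      unfolding J_def[abs_def] by (rule S_interval[OF f v])
    also have "\<dots> = (\<integral>\<^sup>+a. indicator {0..w} a * S 0 (p + a) G s v \<partial>lborel)"
      by (intro nn_integral_cong) (auto simp: indicator_def S0_S0 True)
    finally show ?thesis by simp
  qed simp
  moreover have "indicator {0..} p * (ennreal (exp (- l * p)) * S 0 p (S 0 w G) s v) =
     indicator {0..} p * (ennreal (exp (- l * p)) * S 0 (p + w) G s v)" for p
    using w by (auto simp: indicator_def S0_S0)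
  ultimately show ?thesis
    using laplace_window[of "\<lambda>m. S 0 m G s v", OF _ w l] unfolding Lap_def J_def[of 0 w G s v] by simp
qed

text \<open>
  The particles with exactly \<open>n\<close> scatterings that appear during \<open>[0, u]\<close>, when \<open>F\<close> is the initial state.
\<close>

definition source :: "nat \<Rightarrow> real \<Rightarrow> (real \<Rightarrow> 'a \<Rightarrow> ennreal) \<Rightarrow> real \<Rightarrow> 'a \<Rightarrow> ennreal" where
  "source n u F = (case n of 0 \<Rightarrow> F | Suc m \<Rightarrow> Bk (J m u F))"

lemma source_measurable[measurable (raw)]:
  assumes [measurable]: "A \<in> borel_measurable Q" "U \<in> borel_measurable Q" "V \<in> measurable Q N"
    and F: "fmeas Q F"
  shows "(\<lambda>q. source n (U q) (F q) (A q) (V q)) \<in> borel_measurable Q"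
proof -
  note [measurable (raw)] = fmeasD[OF F]
  show ?thesis by (cases n) (simp_all add: source_def)
qed

lemma J_Suc:
  assumes [measurable]: "meas F" "v \<in> space N"
  shows "J (Suc n) u F s v = (\<integral>\<^sup>+q. indicator {0..u} q * J n (u - q) (Bk (S 0 q F)) s v \<partial>lborel)"
  unfolding J_def S_Suc[OF assms] by (rule nn_integral_triangle) measurable

lemma source_Suc:
  assumes F[measurable]: "meas F" and v[measurable]: "v \<in> space N"
  shows "source (Suc n) u F s v = (\<integral>\<^sup>+q. indicator {0..u} q * source n (u - q) (Bk (S 0 q F)) s v \<partial>lborel)"
proof (cases n)
  case 0
  have f: "fmeas borel (\<lambda>q. S 0 q F)" by measurable
  show ?thesis unfolding 0 source_def J_def[abs_def] by (simp add: Bk_interval[OF f v])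
next
  case (Suc m)
  have f: "fmeas borel (\<lambda>q. J m (u - q) (Bk (S 0 q F)))" by measurable
  have "Bk (J (Suc m) u F) s v = Bk (\<lambda>s v. \<integral>\<^sup>+q. indicator {0..u} q * J m (u - q) (Bk (S 0 q F)) s v \<partial>lborel) s v"
    by (rule Bk_cong) (rule J_Suc[OF F])
  thus ?thesis unfolding Suc source_def by (simp add: Bk_interval[OF f v])
qed

text \<open>
  In terms of the generator \<open>Z\<close> of \<open>S 0\<close> this is \<open>Z (J n u F) = S n u F - source n u F\<close>, multiplied by
  the resolvent.  It exhibits \<open>J n u F\<close> as the difference of the resolvents of \<open>l J n u F + source n u F\<close> and
  \<open>S n u F\<close>.  Both sides obey the same Duhamel recursion, so only \<open>n = 0\<close> needs a
  computation.
\<close>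

lemma resolvent_window:
  assumes "meas F" and v[measurable]: "v \<in> space N" and "0 \<le> u" and l: "0 < l"
  shows "ennreal l * R l (J n u F) s v + R l (source n u F) s v = J n u F s v + R l (S n u F) s v"
  using assms(1,3)
proof (induction n arbitrary: F u)
  case 0
  thus ?case unfolding source_def using resolvent_window_base[OF 0(1) v 0(2) l] by simp
next
  case (Suc n)
  note F[measurable] = Suc.prems(1)
  let ?G = "\<lambda>q. Bk (S 0 q F)"
  have f1: "fmeas borel (\<lambda>q. J n (u - q) (?G q))" by measurable
  have f2: "fmeas borel (\<lambda>q. source n (u - q) (?G q))" by measurable
  have f3: "fmeas borel (\<lambda>q. S n (u - q) (?G q))" by measurable
  have "R l (J (Suc n) u F) s v = (\<integral>\<^sup>+q. indicator {0..u} q * R l (J n (u - q) (?G q)) s v \<partial>lborel)"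
    by (subst Lap_interval[OF f1 v, symmetric]) (rule Lap_cong[OF J_Suc[OF F] v])
  moreover have "R l (source (Suc n) u F) s v = (\<integral>\<^sup>+q. indicator {0..u} q * R l (source n (u - q) (?G q)) s v \<partial>lborel)"
    by (subst Lap_interval[OF f2 v, symmetric]) (rule Lap_cong[OF source_Suc[OF F] v])
  moreover have "R l (S (Suc n) u F) s v = (\<integral>\<^sup>+q. indicator {0..u} q * R l (S n (u - q) (?G q)) s v \<partial>lborel)"
    by (subst Lap_interval[OF f3 v, symmetric]) (rule Lap_cong[OF S_Suc[OF F] v])
  moreover have "J (Suc n) u F s v = (\<integral>\<^sup>+q. indicator {0..u} q * J n (u - q) (?G q) s v \<partial>lborel)"
    by (rule J_Suc[OF F v])
  moreover have "ennreal l * (\<integral>\<^sup>+q. indicator {0..u} q * R l (J n (u - q) (?G q)) s v \<partial>lborel) +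
      (\<integral>\<^sup>+q. indicator {0..u} q * R l (source n (u - q) (?G q)) s v \<partial>lborel) =
     (\<integral>\<^sup>+q. indicator {0..u} q * (ennreal l * R l (J n (u - q) (?G q)) s v + R l (source n (u - q) (?G q)) s v) \<partial>lborel)"
    by (subst nn_integral_cmult[symmetric], measurable, subst nn_integral_add[symmetric], measurable)
       (simp only: distrib_left mult.left_commute)
  moreover have "\<dots> = (\<integral>\<^sup>+q. indicator {0..u} q * (J n (u - q) (?G q) s v + R l (S n (u - q) (?G q)) s v) \<partial>lborel)"
  proof (rule nn_integral_cong)
    fix q
    have "meas (?G q)" by measurable
    from Suc.IH[OF this, of "u - q"]
    show "indicator {0..u} q * (ennreal l * R l (J n (u - q) (?G q)) s v + R l (source n (u - q) (?G q)) s v) =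
      indicator {0..u} q * (J n (u - q) (?G q) s v + R l (S n (u - q) (?G q)) s v)"
      by (auto simp: indicator_def)
  qed
  moreover have "\<dots> = (\<integral>\<^sup>+q. indicator {0..u} q * J n (u - q) (?G q) s v \<partial>lborel) +
      (\<integral>\<^sup>+q. indicator {0..u} q * R l (S n (u - q) (?G q)) s v \<partial>lborel)"
    by (subst nn_integral_add[symmetric], measurable) (simp only: distrib_left)
  ultimately show ?case by simp
qed

end

section \<open>Supersolutions\<close>

lemma ennreal_squeeze_0:
  fixes f h :: "'i \<Rightarrow> ennreal"
  assumes "(h \<longlongrightarrow> 0) A" "\<And>i. f i \<le> h i"
  shows "(f \<longlongrightarrow> 0) A"
  by (rule tendsto_sandwich[OF _ _ tendsto_const assms(1)]) (auto intro: always_eventually assms(2))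

lemma ennreal_half_less:
  fixes a :: ennreal
  assumes "0 < a"
  shows "\<exists>e>0. e + e < a"
proof (cases a)
  case (real x)
  with assms have "0 < x" by simp
  thus ?thesis using real by (intro exI[of _ "ennreal (x / 3)"]) (simp add: ennreal_plus[symmetric] ennreal_less_iff del: ennreal_plus)
next
  case top
  thus ?thesis by (intro exI[of _ 1]) simp
qed

context kinetic begin

lemma mass_eq_pair:
  assumes [measurable]: "meas F"
  shows "mass F = (\<integral>\<^sup>+x. F (fst x) (snd x) \<partial>(lborel \<Otimes>\<^sub>M N))"
proof -
  have "case_prod F \<in> borel_measurable (lborel \<Otimes>\<^sub>M N)" by measurable
  from nn_integral_fst[OF this] show ?thesis by (simp add: mass_def case_prod_beta')
qed

lemma AE_pair_iff:
  assumes [measurable]: "Measurable.pred (borel \<Otimes>\<^sub>M N) (\<lambda>x. P (fst x) (snd x))"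
  shows "(AE x in lborel \<Otimes>\<^sub>M N. P (fst x) (snd x)) \<longleftrightarrow> (AE s in lborel. AE v in N. P s v)"
    and "(AE x in lborel \<Otimes>\<^sub>M N. P (fst x) (snd x)) \<longleftrightarrow> (AE v in N. AE s in lborel. P s v)"
proof -
  interpret pair_sigma_finite lborel N by unfold_locales
  have P: "{x \<in> space (lborel \<Otimes>\<^sub>M N). P (fst x) (snd x)} \<in> sets (lborel \<Otimes>\<^sub>M N)" by measurable
  show 1: "(AE x in lborel \<Otimes>\<^sub>M N. P (fst x) (snd x)) \<longleftrightarrow> (AE s in lborel. AE v in N. P s v)"
    using AE_pair_iff[of "\<lambda>s v. P s v"] P by simp
  have "(AE s in lborel. AE v in N. P s v) \<longleftrightarrow> (AE v in N. AE s in lborel. P s v)"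
    by (rule AE_commute) (use P in \<open>simp add: case_prod_beta'\<close>)
  thus "(AE x in lborel \<Otimes>\<^sub>M N. P (fst x) (snd x)) \<longleftrightarrow> (AE v in N. AE s in lborel. P s v)"
    using 1 by simp
qed

lemma mass_finite_AE:
  assumes [measurable]: "meas F" and "mass F \<noteq> top"
  shows "AE x in lborel \<Otimes>\<^sub>M N. F (fst x) (snd x) \<noteq> top"
proof -
  have "(\<integral>\<^sup>+x. F (fst x) (snd x) \<partial>(lborel \<Otimes>\<^sub>M N)) \<noteq> \<infinity>" using assms by (simp add: mass_eq_pair)
  from nn_integral_PInf_AE[OF _ this] show ?thesis by simp
qed

lemma mass_dominated_convergence:
  assumes [measurable]: "\<And>i. meas (f i)" "meas w" and w: "mass w \<noteq> top"
    and bound: "\<And>i. AE x in lborel \<Otimes>\<^sub>M N. f i (fst x) (snd x) \<le> w (fst x) (snd x)"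
    and lim: "AE x in lborel \<Otimes>\<^sub>M N. (\<lambda>i. f i (fst x) (snd x)) \<longlonglongrightarrow> 0"
  shows "(\<lambda>i. mass (f i)) \<longlonglongrightarrow> 0"
proof -
  have "(\<lambda>i. \<integral>\<^sup>+x. f i (fst x) (snd x) \<partial>(lborel \<Otimes>\<^sub>M N)) \<longlonglongrightarrow> (\<integral>\<^sup>+(x :: real \<times> 'a). 0 \<partial>(lborel \<Otimes>\<^sub>M N))"
    apply (rule nn_integral_dominated_convergence[where w = "\<lambda>x. w (fst x) (snd x)"])
    subgoal by measurable
    subgoal by measurable
    subgoal by measurable
    subgoal using bound by simp
    subgoal using w by (simp add: mass_eq_pair less_top)
    subgoal using lim by simp
    done
  thus ?thesis by (simp add: mass_eq_pair)
qed

lemma Bk_mono_AE: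
  assumes "AE v in N. \<forall>s. F s v \<le> G s v"
  shows "Bk F s v \<le> Bk G s v"
  unfolding Bk_def B_def
  by (rule nn_integral_mono_AE, use assms in eventually_elim) (auto intro: mult_left_mono)

lemma R_mono_AE:
  assumes "AE v in N. \<forall>s. F s v \<le> G s v"
  shows "AE v in N. \<forall>s. R l F s v \<le> R l G s v"
  using assms by eventually_elim
    (auto simp: Lap_def S_def vE_0 intro!: nn_integral_mono mult_left_mono)

definition RB :: "real \<Rightarrow> (real \<Rightarrow> 'a \<Rightarrow> ennreal) \<Rightarrow> real \<Rightarrow> 'a \<Rightarrow> ennreal" where
  "RB l F = R l (Bk F)"

lemma RB_meas: "meas F \<Longrightarrow> meas (RB l F)"
proof -
  assume [measurable]: "meas F"
  show "meas (RB l F)" unfolding RB_def by measurable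
qed

lemma RB_pow_meas: "meas F \<Longrightarrow> meas ((RB l ^^ n) F)"
  by (induction n) (auto intro: RB_meas)

text \<open>
  \<open>Lap n l g = (R B)\<^sup>n R g\<close>, and \<open>R B\<close> is monotone.
\<close>

lemma Lap_le_RB_pow:
  assumes "meas g" and "AE v in N. \<forall>s. R l g s v \<le> h s v"
  shows "AE v in N. \<forall>s. Lap n l g s v \<le> (RB l ^^ n) h s v"
  using assms
proof (induction n arbitrary: g h)
  case 0
  thus ?case by simp
next
  case (Suc n)
  note [measurable] = Suc.prems(1)
  have g': "meas (Bk (R l g))" by measurable
  have "AE v in N. \<forall>s. R l (Bk (R l g)) s v \<le> RB l h s v"
    unfolding RB_def by (rule R_mono_AE) (use Bk_mono_AE[OF Suc.prems(2)] in auto)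
  from Suc.IH[OF g' this] AE_space show ?case
  proof eventually_elim
    fix v assume "\<forall>s. Lap n l (Bk (R l g)) s v \<le> (RB l ^^ n) (RB l h) s v" "v \<in> space N"
    thus "\<forall>s. Lap (Suc n) l g s v \<le> (RB l ^^ Suc n) h s v"
      by (simp add: Lap_Suc[OF Suc.prems(1)] funpow_swap1)
  qed
qed

text \<open>
  \<open>B Lap n l = (B R)\<^sup>n\<^sup>+\<^sup>1\<close>, and \<open>B R\<close> does not increase mass.
\<close>

lemma Bk_Lap_mass_le:
  assumes "meas g" and l: "0 \<le> l"
  shows "mass (Bk (Lap n l g)) \<le> mass g"
  using assms(1)
proof (induction n arbitrary: g)
  case 0
  thus ?case using BR_mass_le[OF 0 l] by simp
next
  case (Suc n)
  note [measurable] = Suc.prems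
  have m: "meas (Bk (R l g))" by measurable
  have "mass (Bk (Lap (Suc n) l g)) = mass (Bk (Lap n l (Bk (R l g))))"
    by (intro mass_cong Bk_cong Lap_Suc[OF Suc.prems])
  also have "\<dots> \<le> mass g"
    using Suc.IH[OF m] BR_mass_le[OF Suc.prems l] by simp
  finally show ?case .
qed

lemma E_rate_past:
  assumes v[measurable]: "v \<in> space N"
  shows "(\<integral>\<^sup>+p. indicator {0..} p * (ennreal (Sg (s - p) v) * E (s - p) s v) \<partial>lborel) \<le> 1"
proof -
  let ?g = "\<lambda>p. indicator {0..} p * (ennreal (Sg (s - p) v) * E (s - p) s v)"
  have *: "(\<integral>\<^sup>+p. indicator {0..real n} p * ?g p \<partial>lborel) \<le> 1" for n
  proof -
    have "(\<integral>\<^sup>+p. indicator {0..real n} p * ?g p \<partial>lborel) =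
       (\<integral>\<^sup>+t. indicator {s - real n..s} t * (ennreal (Sg t v) * E t s v) \<partial>lborel)"
      by (subst (2) nn_integral_real_affine[where c = "-1" and t = s])
         (measurable, auto intro!: nn_integral_cong simp: indicator_def)
    also have "\<dots> \<le> 1"
      using E_rate_backward[OF v, of "s - real n" s] by (auto intro: order_trans[OF _ E_rate_backward[OF v, of "s - real n" s]] simp: add_increasing2)
    finally show ?thesis .
  qed
  have "(\<integral>\<^sup>+t. ?g t \<partial>lborel) = (\<integral>\<^sup>+t. (SUP n. indicator {0..real n} t * ?g t) \<partial>lborel)"
  proof (rule nn_integral_cong)
    fix t :: real
    obtain m :: nat where m: "t \<le> real m" using real_arch_simple by blast
    show "?g t = (SUP n. indicator {0..real n} t * ?g t)"
    proof (rule antisym)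
      show "?g t \<le> (SUP n. indicator {0..real n} t * ?g t)"
        by (rule SUP_upper2[of m]) (use m in \<open>auto simp: indicator_def\<close>)
    qed (auto intro!: SUP_least simp: indicator_def)
  qed
  also have "\<dots> = (SUP n. \<integral>\<^sup>+t. indicator {0..real n} t * ?g t \<partial>lborel)"
    by (rule nn_integral_monotone_convergence_SUP) (auto simp: incseq_def le_fun_def indicator_def)
  also have "\<dots> \<le> 1" by (rule SUP_least) (rule *)
  finally show ?thesis .
qed

lemma exp_minus_integral: "(\<integral>\<^sup>+p. indicator {0..} p * ennreal (exp (- p)) \<partial>lborel) = 1"
  using exp_minus_tail[of 0] by simp

text \<open>
  Going back by time \<open>p\<close> costs at most the factor \<open>exp (l p)\<close> in \<open>M\<close>, which the discount at \<open>l + 1\<close>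
  absorbs.  What remains is the probability \<open>E_rate_past\<close> of having been removed in the past, at most \<open>1\<close>.
\<close>

lemma supersolution_RB_le:
  assumes M[measurable]: "meas M" and l: "0 \<le> l"
    and mono: "\<And>s t v. s \<le> t \<Longrightarrow> v \<in> space N \<Longrightarrow> ennreal (exp (l * s)) * M s v \<le> ennreal (exp (l * t)) * M t v"
    and db: "AE t in lborel. AE v in N. Bk M t v \<le> ennreal (Sg t v) * M t v"
  shows "AE v in N. \<forall>s. RB (l + 1) M s v \<le> M s v"
proof -
  have "AE v in N. AE t in lborel. Bk M t v \<le> ennreal (Sg t v) * M t v"
    using db by (subst AE_pair_iff(2)[symmetric], measurable, subst AE_pair_iff(1)) measurable
  thus ?thesis using AE_space
  proof eventually_elim
    fix v assume db: "AE t in lborel. Bk M t v \<le> ennreal (Sg t v) * M t v" and v[measurable]: "v \<in> space N"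
    show "\<forall>s. RB (l + 1) M s v \<le> M s v"
    proof
      fix s
      have db': "AE p in lborel. Bk M (s - p) v \<le> ennreal (Sg (s - p) v) * M (s - p) v"
        using AE_borel_affine[of "-1" "\<lambda>t. Bk M t v \<le> ennreal (Sg t v) * M t v" s] db by simp
      have "RB (l + 1) M s v = (\<integral>\<^sup>+p. indicator {0..} p * (ennreal (exp (- (l + 1) * p)) * (E (s - p) s v * Bk M (s - p) v)) \<partial>lborel)"
        unfolding RB_def Lap_def S_def vE_0 ..
      also have "\<dots> \<le> (\<integral>\<^sup>+p. indicator {0..} p * (ennreal (Sg (s - p) v) * E (s - p) s v) * M s v \<partial>lborel)"
      proof (rule nn_integral_mono_AE, use db' in eventually_elim)
        fix p assume d: "Bk M (s - p) v \<le> ennreal (Sg (s - p) v) * M (s - p) v"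
        have "ennreal (exp (- (l + 1) * p)) * (E (s - p) s v * Bk M (s - p) v) \<le> (ennreal (Sg (s - p) v) * E (s - p) s v) * M s v"
          if p: "0 \<le> p"
        proof -
          have "ennreal (exp (- (l + 1) * p)) * M (s - p) v \<le> ennreal (exp (- l * s)) * (ennreal (exp (l * (s - p))) * M (s - p) v)"
            unfolding mult.assoc[symmetric]
            by (rule mult_right_mono) (use p in \<open>auto simp: ennreal_mult'[symmetric] exp_add[symmetric] algebra_simps\<close>)
          also have "\<dots> \<le> ennreal (exp (- l * s)) * (ennreal (exp (l * s)) * M s v)"
            by (intro mult_left_mono mono v) (use p in auto)
          also have "\<dots> = M s v" unfolding mult.assoc[symmetric] by (simp add: ennreal_mult'[symmetric] exp_add[symmetric])
          finally have 1: "ennreal (exp (- (l + 1) * p)) * M (s - p) v \<le> M s v" .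
          have "ennreal (exp (- (l + 1) * p)) * (E (s - p) s v * Bk M (s - p) v) \<le>
             ennreal (exp (- (l + 1) * p)) * (E (s - p) s v * (ennreal (Sg (s - p) v) * M (s - p) v))"
            by (intro mult_left_mono d) auto
          also have "\<dots> = (ennreal (Sg (s - p) v) * E (s - p) s v) * (ennreal (exp (- (l + 1) * p)) * M (s - p) v)"
            by (simp only: mult_ac)
          also have "\<dots> \<le> (ennreal (Sg (s - p) v) * E (s - p) s v) * M s v"
            by (intro mult_left_mono 1) auto
          finally show ?thesis .
        qed
        thus "indicator {0..} p * (ennreal (exp (- (l + 1) * p)) * (E (s - p) s v * Bk M (s - p) v)) \<le>
          indicator {0..} p * (ennreal (Sg (s - p) v) * E (s - p) s v) * M s v"
          by (auto simp: indicator_def)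
      qed
      also have "\<dots> = (\<integral>\<^sup>+p. indicator {0..} p * (ennreal (Sg (s - p) v) * E (s - p) s v) \<partial>lborel) * M s v"
        by (rule nn_integral_multc) measurable
      also have "\<dots> \<le> 1 * M s v" by (intro mult_right_mono E_rate_past v) auto
      finally show "RB (l + 1) M s v \<le> M s v" by simp
    qed
  qed
qed

text \<open>
  Here the part \<open>exp (- p)\<close> of the discount at \<open>l + 1\<close> that \<open>M\<close> does not consume is integrated; this is
  where \<open>l + 1\<close> rather than \<open>l\<close> is needed.
\<close>

lemma supersolution_R_le:
  assumes [measurable]: "meas M" "meas g" and l: "0 \<le> l"
    and mono: "\<And>s t v. s \<le> t \<Longrightarrow> v \<in> space N \<Longrightarrow> ennreal (exp (l * s)) * M s v \<le> ennreal (exp (l * t)) * M t v"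
    and g: "\<And>s v. v \<in> space N \<Longrightarrow> g s v \<le> k * M s v" and v[measurable]: "v \<in> space N"
  shows "R (l + 1) g s v \<le> k * M s v"
proof -
  have "R (l + 1) g s v \<le> (\<integral>\<^sup>+p. indicator {0..} p * ennreal (exp (- p)) * (k * M s v) \<partial>lborel)"
    unfolding Lap_def S_def vE_0
  proof (rule nn_integral_mono)
    fix p :: real
    have "ennreal (exp (- (l + 1) * p)) * (E (s - p) s v * g (s - p) v) \<le> ennreal (exp (- p)) * (k * M s v)" if "0 \<le> p"
    proof -
      have "ennreal (exp (- (l + 1) * p)) * (E (s - p) s v * g (s - p) v) \<le> ennreal (exp (- (l + 1) * p)) * (1 * (k * M (s - p) v))"
        by (intro mult_left_mono mult_mono E_le_1 g v) auto
      also have "\<dots> = ennreal (exp (- p)) * (k * (ennreal (exp (- l * s)) * (ennreal (exp (l * (s - p))) * M (s - p) v)))"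
      proof -
        have "ennreal (exp (- (l + 1) * p)) = ennreal (exp (- p)) * (ennreal (exp (- l * s)) * ennreal (exp (l * (s - p))))"
          by (simp add: ennreal_mult'[symmetric] exp_add[symmetric] algebra_simps)
        thus ?thesis by (simp add: mult_ac)
      qed
      also have "\<dots> \<le> ennreal (exp (- p)) * (k * (ennreal (exp (- l * s)) * (ennreal (exp (l * s)) * M s v)))"
        by (intro mult_left_mono mono v) (use that in auto)
      also have "ennreal (exp (- l * s)) * (ennreal (exp (l * s)) * M s v) = M s v"
        unfolding mult.assoc[symmetric] by (simp add: ennreal_mult'[symmetric] exp_add[symmetric])
      finally show ?thesis .
    qed
    thus "indicator {0..} p * (ennreal (exp (- (l + 1) * p)) * (E (s - p) s v * g (s - p) v)) \<le>
      indicator {0..} p * ennreal (exp (- p)) * (k * M s v)"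
      by (auto simp: indicator_def)
  qed
  also have "\<dots> = k * M s v" by (simp add: nn_integral_multc exp_minus_integral)
  finally show ?thesis .
qed

lemma RB_pow_cmult:
  assumes "meas h" "v \<in> space N"
  shows "(RB l ^^ n) (\<lambda>s v. c * h s v) s v = c * (RB l ^^ n) h s v"
  using assms(2)
proof (induction n arbitrary: s v)
  case (Suc n)
  have "meas ((RB l ^^ n) h)" by (rule RB_pow_meas) fact
  note [measurable] = this
  have "(RB l ^^ Suc n) (\<lambda>s v. c * h s v) s v = RB l (\<lambda>s v. c * (RB l ^^ n) h s v) s v"
    unfolding funpow.simps(2) o_apply RB_def[of _ "(RB l ^^ n) _"] RB_def[of _ "\<lambda>s v. c * _ s v"]
    by (intro Lap_cong Bk_cong Suc.IH Suc.prems)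
  also have "\<dots> = R l (\<lambda>s v. c * Bk ((RB l ^^ n) h) s v) s v"
    unfolding RB_def[of _ "\<lambda>s v. c * _ s v"] by (intro Lap_cong Bk_cmult Suc.prems) measurable
  also have "\<dots> = c * (RB l ^^ Suc n) h s v"
    by (subst Lap_cmult) (use Suc.prems in \<open>measurable, simp add: RB_def[of _ "(RB l ^^ n) h"]\<close>)
  finally show ?case .
qed simp

text \<open>
  With \<open>f\<^sub>n = (R B)\<^sup>n M\<close>, the mass of \<open>\<Sigma> f\<^sub>n\<close> decreases in each step by at least \<open>l\<close> times the mass of \<open>f\<^sub>n\<^sub>+\<^sub>1\<close>.
  So the masses of \<open>f\<^sub>n\<close> are summable, \<open>f\<^sub>n\<close> tends to \<open>0\<close> almost everywhere, and \<open>\<Sigma> M\<close> dominates.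
\<close>

lemma supersolution_gain_vanishes:
  assumes M[measurable]: "meas M" and Mfin: "mass M \<noteq> top" and SM: "mass (\<lambda>s v. ennreal (Sg s v) * M s v) \<noteq> top"
    and l: "0 < l" and le: "AE v in N. \<forall>s. RB l M s v \<le> M s v"
  shows "(\<lambda>n. mass (Bk ((RB l ^^ n) M))) \<longlonglongrightarrow> 0"
proof -
  define f where "f n = (RB l ^^ n) M" for n
  have f[measurable]: "meas (f n)" for n unfolding f_def by (rule RB_pow_meas[OF M])
  have f_Suc: "f (Suc n) = R l (Bk (f n))" for n by (simp add: f_def RB_def)
  have fM: "AE v in N. \<forall>s. f n s v \<le> M s v" for n
  proof (induction n)
    case (Suc n)
    have "AE v in N. \<forall>s. f (Suc n) s v \<le> RB l M s v"
      unfolding f_Suc RB_def by (rule R_mono_AE) (use Bk_mono_AE[OF Suc] in auto)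
    with le show ?case by eventually_elim (blast intro: order_trans)
  qed (simp add: f_def)
  let ?C = "mass (\<lambda>s v. ennreal (Sg s v) * M s v)"
  have step: "ennreal l * mass (f (Suc n)) + mass (\<lambda>s v. ennreal (Sg s v) * f (Suc n) s v) \<le>
     mass (\<lambda>s v. ennreal (Sg s v) * f n s v)" for n
  proof -
    have "ennreal l * mass (f (Suc n)) + mass (\<lambda>s v. ennreal (Sg s v) * f (Suc n) s v)
      = mass (\<lambda>s v. ennreal (l + Sg s v) * f (Suc n) s v)"
      by (subst mass_cmult[symmetric], measurable, subst mass_add[symmetric], measurable)
         (use l Sg_nn in \<open>simp add: distrib_right[symmetric]\<close>)
    also have "\<dots> \<le> mass (Bk (f n))"
      unfolding f_Suc by (rule R_mass_le) (use l in \<open>measurable, auto\<close>)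
    also have "\<dots> \<le> mass (\<lambda>s v. ennreal (Sg s v) * f n s v)"
      by (rule Bk_mass_le) measurable
    finally show ?thesis .
  qed
  have partial: "ennreal l * (\<Sum>i<n. mass (f (Suc i))) + mass (\<lambda>s v. ennreal (Sg s v) * f n s v) \<le> ?C" for n
  proof (induction n)
    case (Suc n)
    have "ennreal l * (\<Sum>i<Suc n. mass (f (Suc i))) + mass (\<lambda>s v. ennreal (Sg s v) * f (Suc n) s v)
       = ennreal l * (\<Sum>i<n. mass (f (Suc i))) + (ennreal l * mass (f (Suc n)) + mass (\<lambda>s v. ennreal (Sg s v) * f (Suc n) s v))"
      by (simp add: distrib_left add.assoc)
    also have "\<dots> \<le> ?C" by (rule order_trans[OF add_left_mono[OF step] Suc.IH])
    finally show ?case .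
  qed (simp add: f_def)
  have "ennreal l * (\<Sum>i. mass (f (Suc i))) \<le> ?C"
  proof -
    have "(\<Sum>i. ennreal l * mass (f (Suc i))) \<le> ?C"
      by (rule suminf_le_const) (auto simp: sum_distrib_left[symmetric] intro!: order_trans[OF _ partial] add_increasing2)
    thus ?thesis by simp
  qed
  hence "(\<Sum>i. mass (f (Suc i))) \<noteq> top"
    using SM l by (auto simp: ennreal_mult_top top_unique ennreal_mult_eq_top_iff)
  hence "mass (\<lambda>s v. \<Sum>i. f (Suc i) s v) \<noteq> top" by (subst mass_suminf) auto
  hence "AE x in lborel \<Otimes>\<^sub>M N. (\<Sum>i. f (Suc i) (fst x) (snd x)) \<noteq> top"
    by (intro mass_finite_AE[where F = "\<lambda>s v. \<Sum>i. f (Suc i) s v"]) measurable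
  hence lim: "AE x in lborel \<Otimes>\<^sub>M N. (\<lambda>n. f n (fst x) (snd x)) \<longlonglongrightarrow> 0"
  proof eventually_elim
    fix x assume a: "(\<Sum>i. f (Suc i) (fst x) (snd x)) \<noteq> top"
    have fin: "f (Suc i) (fst x) (snd x) < top" for i
      by (rule ennreal_suminf_lessD) (use a in \<open>simp add: less_top\<close>)
    have "summable (\<lambda>i. enn2real (f (Suc i) (fst x) (snd x)))"
    proof (rule summable_suminf_not_top)
      show "(\<Sum>i. ennreal (enn2real (f (Suc i) (fst x) (snd x)))) \<noteq> top" using a fin by simp
    qed simp
    hence "(\<lambda>i. ennreal (enn2real (f (Suc i) (fst x) (snd x)))) \<longlonglongrightarrow> ennreal 0"
      by (intro tendsto_ennrealI summable_LIMSEQ_zero)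
    hence "(\<lambda>i. f (Suc i) (fst x) (snd x)) \<longlonglongrightarrow> 0" using fin by simp
    thus "(\<lambda>n. f n (fst x) (snd x)) \<longlonglongrightarrow> 0" by (rule LIMSEQ_imp_Suc)
  qed
  have "(\<lambda>n. mass (\<lambda>s v. ennreal (Sg s v) * f n s v)) \<longlonglongrightarrow> 0"
  proof (rule mass_dominated_convergence[OF _ _ SM])
    fix n
    show "AE x in lborel \<Otimes>\<^sub>M N. ennreal (Sg (fst x) (snd x)) * f n (fst x) (snd x) \<le> ennreal (Sg (fst x) (snd x)) * M (fst x) (snd x)"
    proof (subst AE_pair_iff(2)[of "\<lambda>s v. ennreal (Sg s v) * f n s v \<le> ennreal (Sg s v) * M s v"])
      show "AE v in N. AE s in lborel. ennreal (Sg s v) * f n s v \<le> ennreal (Sg s v) * M s v"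
        using fM[of n] by eventually_elim (intro AE_I2, auto intro: mult_left_mono)
    qed measurable
  next
    show "AE x in lborel \<Otimes>\<^sub>M N. (\<lambda>n. ennreal (Sg (fst x) (snd x)) * f n (fst x) (snd x)) \<longlonglongrightarrow> 0"
      using lim
    proof eventually_elim
      fix x assume "(\<lambda>n. f n (fst x) (snd x)) \<longlonglongrightarrow> 0"
      hence "(\<lambda>n. ennreal (Sg (fst x) (snd x)) * f n (fst x) (snd x)) \<longlonglongrightarrow> ennreal (Sg (fst x) (snd x)) * 0"
        by (rule ennreal_tendsto_cmult[rotated]) simp
      thus "(\<lambda>n. ennreal (Sg (fst x) (snd x)) * f n (fst x) (snd x)) \<longlonglongrightarrow> 0" by simp
    qed
  qed measurable
  hence "(\<lambda>n. mass (Bk (f n))) \<longlonglongrightarrow> 0"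
    by (rule ennreal_squeeze_0) (rule Bk_mass_le, measurable)
  thus ?thesis by (simp add: f_def)
qed

text \<open>
  Cut \<open>F\<close> at \<open>k M\<close>.  The part below is controlled by \<open>supersolution_gain_vanishes\<close>, the part above
  has small mass by positivity of \<open>M\<close>, uniformly in \<open>n\<close> after applying \<open>Bk_Lap_mass_le\<close>.
\<close>

lemma gain_vanishes:
  assumes M[measurable]: "meas M" and Mfin: "mass M \<noteq> top" and SM: "mass (\<lambda>s v. ennreal (Sg s v) * M s v) \<noteq> top"
    and l: "0 \<le> l"
    and mono: "\<And>s t v. s \<le> t \<Longrightarrow> v \<in> space N \<Longrightarrow> ennreal (exp (l * s)) * M s v \<le> ennreal (exp (l * t)) * M t v"
    and db: "AE t in lborel. AE v in N. Bk M t v \<le> ennreal (Sg t v) * M t v"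
    and pos: "AE x in lborel \<Otimes>\<^sub>M N. 0 \<le> fst x \<longrightarrow> 0 < M (fst x) (snd x)"
    and F[measurable]: "meas F" and Ffin: "mass F \<noteq> top" and F0: "\<And>s v. s < 0 \<Longrightarrow> F s v = 0"
  shows "(\<lambda>n. mass (Bk (J n u F))) \<longlonglongrightarrow> 0"
proof -
  let ?l = "l + 1"
  have l': "0 < ?l" "0 \<le> ?l" using l by auto
  \<comment> \<open>\<open>g k\<close> is the part of \<open>F\<close> below \<open>k M\<close>, \<open>r k\<close> the excess.\<close>
  define g where "g k s v = min (F s v) (of_nat k * M s v)" for k s v
  define r where "r k s v = F s v - g k s v" for k s v
  have [measurable]: "meas (g k)" "meas (r k)" for k unfolding g_def r_def by measurable
  have split: "F s v = g k s v + r k s v" for k s v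
  proof -
    have "g k s v \<le> F s v" by (simp add: g_def)
    from add_diff_inverse_ennreal[OF this] show ?thesis unfolding r_def by (rule sym)
  qed
  have r_le: "r k s v \<le> F s v" for k s v unfolding r_def by (rule diff_le_self_ennreal)
  have g_lim: "(\<lambda>n. mass (Bk (Lap n ?l (g k)))) \<longlonglongrightarrow> 0" for k
  proof -
    have "AE v in N. \<forall>s. Lap n ?l (g k) s v \<le> (RB ?l ^^ n) (\<lambda>s v. of_nat k * M s v) s v" for n
    proof (rule Lap_le_RB_pow)
      show "AE v in N. \<forall>s. R ?l (g k) s v \<le> of_nat k * M s v"
      proof (rule AE_I2, rule allI)
        fix v s assume v: "v \<in> space N"
        show "R ?l (g k) s v \<le> of_nat k * M s v"
          by (rule supersolution_R_le[OF M _ l mono _ v]) (auto simp: g_def)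
      qed
    qed measurable
    hence le: "mass (Bk (Lap n ?l (g k))) \<le> mass (Bk (\<lambda>s v. of_nat k * (RB ?l ^^ n) M s v))" for n
    proof (intro mass_mono)
      fix s v assume "v \<in> space N"
      have "Bk (Lap n ?l (g k)) s v \<le> Bk ((RB ?l ^^ n) (\<lambda>s v. of_nat k * M s v)) s v"
        by (rule Bk_mono_AE) fact
      also have "\<dots> = Bk (\<lambda>s v. of_nat k * (RB ?l ^^ n) M s v) s v"
        by (intro Bk_cong RB_pow_cmult M)
      finally show "Bk (Lap n ?l (g k)) s v \<le> Bk (\<lambda>s v. of_nat k * (RB ?l ^^ n) M s v) s v" .
    qed
    have e: "mass (Bk (\<lambda>s v. of_nat k * (RB ?l ^^ n) M s v)) = of_nat k * mass (Bk ((RB ?l ^^ n) M))" for n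
    proof -
      note [measurable] = RB_pow_meas[OF M]
      have "mass (Bk (\<lambda>s v. of_nat k * (RB ?l ^^ n) M s v)) = mass (\<lambda>s v. of_nat k * Bk ((RB ?l ^^ n) M) s v)"
        by (intro mass_cong Bk_cmult) measurable
      thus ?thesis by (subst (asm) mass_cmult) measurable
    qed
    have "(\<lambda>n. of_nat k * mass (Bk ((RB ?l ^^ n) M))) \<longlonglongrightarrow> of_nat k * 0"
      by (rule ennreal_tendsto_cmult[OF of_nat_less_top],
          rule supersolution_gain_vanishes[OF M Mfin SM l'(1)], rule supersolution_RB_le[OF M l mono db])
    hence "(\<lambda>n. of_nat k * mass (Bk ((RB ?l ^^ n) M))) \<longlonglongrightarrow> 0" by simp
    thus ?thesis
      by (rule ennreal_squeeze_0) (use le e in auto)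
  qed
  have r_lim: "(\<lambda>k. mass (r k)) \<longlonglongrightarrow> 0"
  proof (rule mass_dominated_convergence[OF _ F Ffin])
    show "AE x in lborel \<Otimes>\<^sub>M N. (\<lambda>k. r k (fst x) (snd x)) \<longlonglongrightarrow> 0"
      using pos mass_finite_AE[OF F Ffin]
    proof eventually_elim
      fix x assume pos: "0 \<le> fst x \<longrightarrow> 0 < M (fst x) (snd x)" and fin: "F (fst x) (snd x) \<noteq> top"
      have "\<exists>K. \<forall>k\<ge>K. r k (fst x) (snd x) = 0"
      proof (cases "0 \<le> fst x")
        case True
        with pos have p: "0 < M (fst x) (snd x)" by simp
        obtain K :: nat where K: "F (fst x) (snd x) \<le> of_nat K * M (fst x) (snd x)"
        proof (cases "M (fst x) (snd x) = top")
          case True thus thesis using that[of 1] by simp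
        next
          case False
          obtain m where m: "M (fst x) (snd x) = ennreal m" "0 < m"
            using False p by (cases "M (fst x) (snd x)") auto
          obtain a where a: "F (fst x) (snd x) = ennreal a" "0 \<le> a" using fin by (cases "F (fst x) (snd x)") auto
          obtain K :: nat where "a / m \<le> real K" using real_arch_simple by blast
          hence "a \<le> real K * m" using m by (simp add: field_simps)
          thus thesis using that[of K] m a by (simp add: ennreal_of_nat_eq_real_of_nat ennreal_mult'[symmetric] ennreal_leI)
        qed
        have "r k (fst x) (snd x) = 0" if "K \<le> k" for k
        proof -
          have "of_nat K * M (fst x) (snd x) \<le> of_nat k * M (fst x) (snd x)"
            by (rule mult_right_mono) (use that in auto)
          with K have "F (fst x) (snd x) \<le> of_nat k * M (fst x) (snd x)" by (rule order_trans)
          thus ?thesis using fin by (simp add: r_def g_def min_absorb1 diff_eq_0_iff_ennreal)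
        qed
        thus ?thesis by blast
      next
        case False
        thus ?thesis using F0[of "fst x" "snd x"] by (auto simp: r_def g_def)
      qed
      then obtain K where "\<forall>k\<ge>K. r k (fst x) (snd x) = 0" ..
      thus "(\<lambda>k. r k (fst x) (snd x)) \<longlonglongrightarrow> 0"
        by (intro tendsto_eventually) (auto simp: eventually_sequentially)
    qed
  qed (auto simp: r_le)
  have Lap_lim: "(\<lambda>n. mass (Bk (Lap n ?l F))) \<longlonglongrightarrow> 0"
  proof (rule order_tendstoI)
    fix a :: ennreal assume a: "0 < a"
    obtain e where e: "0 < e" "e + e < a" using ennreal_half_less[OF a] by blast
    from order_tendstoD(2)[OF r_lim e(1)] obtain k where k: "mass (r k) < e"
      using eventually_happens'[OF sequentially_bot] by blast
    have le: "mass (Bk (Lap n ?l F)) \<le> mass (Bk (Lap n ?l (g k))) + mass (r k)" for n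
    proof -
      have "mass (Bk (Lap n ?l F)) = mass (\<lambda>s v. Bk (Lap n ?l (g k)) s v + Bk (Lap n ?l (r k)) s v)"
      proof (rule mass_cong)
        fix s v assume v[measurable]: "v \<in> space N"
        have "Lap n ?l F s v = Lap n ?l (g k) s v + Lap n ?l (r k) s v" if w[measurable]: "v \<in> space N" for s v
        proof -
          have "Lap n ?l F s v = Lap n ?l (\<lambda>s v. g k s v + r k s v) s v"
            by (rule Lap_cong[OF split w])
          also have "\<dots> = Lap n ?l (g k) s v + Lap n ?l (r k) s v" by (rule Lap_add) measurable
          finally show ?thesis .
        qed
        hence "Bk (Lap n ?l F) s v = Bk (\<lambda>s v. Lap n ?l (g k) s v + Lap n ?l (r k) s v) s v"
          by (rule Bk_cong)
        also have "\<dots> = Bk (Lap n ?l (g k)) s v + Bk (Lap n ?l (r k)) s v"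
          by (rule Bk_add) measurable
        finally show "Bk (Lap n ?l F) s v = Bk (Lap n ?l (g k)) s v + Bk (Lap n ?l (r k)) s v" .
      qed
      also have "\<dots> = mass (Bk (Lap n ?l (g k))) + mass (Bk (Lap n ?l (r k)))"
        by (rule mass_add) measurable
      also have "\<dots> \<le> mass (Bk (Lap n ?l (g k))) + mass (r k)"
        by (intro add_left_mono Bk_Lap_mass_le l') measurable
      finally show ?thesis .
    qed
    show "\<forall>\<^sub>F n in sequentially. mass (Bk (Lap n ?l F)) < a"
      using order_tendstoD(2)[OF g_lim[of k] e(1)]
    proof eventually_elim
      fix n assume "mass (Bk (Lap n ?l (g k))) < e"
      hence "mass (Bk (Lap n ?l (g k))) + mass (r k) < a"
        using k by (intro order_le_less_trans[OF add_mono e(2)]) auto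
      with le[of n] show "mass (Bk (Lap n ?l F)) < a" by (rule order_le_less_trans)
    qed
  qed simp
  have le: "mass (Bk (J n u F)) \<le> ennreal (exp (?l * u)) * mass (Bk (Lap n ?l F))" for n
  proof -
    have "mass (Bk (J n u F)) \<le> mass (Bk (\<lambda>s v. ennreal (exp (?l * u)) * Lap n ?l F s v))"
      by (intro mass_mono Bk_mono J_le_Lap F l')
    also have "\<dots> = mass (\<lambda>s v. ennreal (exp (?l * u)) * Bk (Lap n ?l F) s v)"
      by (intro mass_cong Bk_cmult) measurable
    also have "\<dots> = ennreal (exp (?l * u)) * mass (Bk (Lap n ?l F))" by (rule mass_cmult) measurable
    finally show ?thesis .
  qed
  have "(\<lambda>n. ennreal (exp (?l * u)) * mass (Bk (Lap n ?l F))) \<longlonglongrightarrow> 0"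
    using ennreal_tendsto_cmult[OF ennreal_less_top Lap_lim, of "exp (?l * u)"] by simp
  from ennreal_squeeze_0[OF this le] show ?thesis .
qed

end

section \<open>Distance of extended nonnegative numbers\<close>

text \<open>
  \<open>\<bar>x - y\<bar>\<close> for extended numbers.  The first case makes the distance of \<open>\<infinity>\<close> to itself \<open>0\<close>, as
  \<open>\<infinity> - \<infinity> = \<infinity>\<close> for \<^typ>\<open>ennreal\<close>.
\<close>

definition absdiff :: "ennreal \<Rightarrow> ennreal \<Rightarrow> ennreal" where
  "absdiff x y = (if x = y then 0 else (x - y) + (y - x))"

lemma absdiff_le_iff: "absdiff x y \<le> c \<longleftrightarrow> x \<le> y + c \<and> y \<le> x + c"
proof -
  have *: "(a - b) + (b - a) = b - a" "a \<le> b + c" "b - a \<le> c \<longleftrightarrow> b \<le> a + c" if "a < b" for a b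
  proof -
    have "a < top" "a \<le> b" using that less_le_trans[OF that top_greatest] by auto
    thus "(a - b) + (b - a) = b - a" by (simp add: diff_eq_0_iff_ennreal)
    show "a \<le> b + c" using that by (simp add: add_increasing2)
    show "b - a \<le> c \<longleftrightarrow> b \<le> a + c" using \<open>a < top\<close> by (subst ennreal_minus_le_iff) auto
  qed
  show ?thesis
  proof (cases x y rule: linorder_cases)
    case less
    hence "x \<noteq> y" by auto
    hence "absdiff x y = y - x" unfolding absdiff_def by (simp only: if_False \<open>x \<noteq> y\<close> *(1)[OF less])
    thus ?thesis using *(2,3)[OF less] by simp
  next
    case equal thus ?thesis by (simp add: absdiff_def)
  next
    case greater
    hence "x \<noteq> y" by auto
    hence "absdiff x y = x - y" unfolding absdiff_def
      by (simp only: if_False \<open>x \<noteq> y\<close> add.commute[of "x - y"] *(1)[OF greater])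
    thus ?thesis using *(2,3)[OF greater] by simp
  qed
qed

lemma absdiff_measurable[measurable (raw)]:
  assumes [measurable]: "f \<in> borel_measurable Q" "g \<in> borel_measurable Q"
  shows "(\<lambda>x. absdiff (f x) (g x)) \<in> borel_measurable Q"
  unfolding absdiff_def by measurable

lemma absdiff_self[simp]: "absdiff x x = 0" by (simp add: absdiff_def)
lemma absdiff_commute: "absdiff x y = absdiff y x" by (simp add: absdiff_def add.commute)

lemma absdiff_upper: "x \<le> y + absdiff x y" "y \<le> x + absdiff x y"
  using absdiff_le_iff[of x y "absdiff x y"] by auto

lemma absdiff_triangle: "absdiff x z \<le> absdiff x y + absdiff y z"
  unfolding absdiff_le_iff
proof
  have "x \<le> y + absdiff x y" by (rule absdiff_upper)
  also have "\<dots> \<le> (z + absdiff y z) + absdiff x y" by (intro add_right_mono absdiff_upper)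
  finally show "x \<le> z + (absdiff x y + absdiff y z)" by (simp add: ac_simps)
  have "z \<le> y + absdiff y z" by (rule absdiff_upper)
  also have "\<dots> \<le> (x + absdiff x y) + absdiff y z" by (intro add_right_mono absdiff_upper)
  finally show "z \<le> x + (absdiff x y + absdiff y z)" by (simp add: ac_simps)
qed

lemma absdiff_add: "absdiff (a + b) (c + d) \<le> absdiff a c + absdiff b d"
  unfolding absdiff_le_iff
proof
  have "a + b \<le> (c + absdiff a c) + (d + absdiff b d)" by (intro add_mono absdiff_upper)
  thus "a + b \<le> c + d + (absdiff a c + absdiff b d)" by (simp add: ac_simps)
  have "c + d \<le> (a + absdiff a c) + (b + absdiff b d)" by (intro add_mono absdiff_upper)
  thus "c + d \<le> a + b + (absdiff a c + absdiff b d)" by (simp add: ac_simps)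
qed

lemma absdiff_mult: "absdiff (k * a) (k * c) \<le> k * absdiff a c"
  unfolding absdiff_le_iff distrib_left[symmetric] by (intro conjI mult_left_mono absdiff_upper) auto

lemma absdiff_cancel:
  assumes "z < top" shows "absdiff x y \<le> absdiff (x + z) (y + z)"
proof -
  have "x + z \<le> y + z + absdiff (x + z) (y + z)" "y + z \<le> x + z + absdiff (x + z) (y + z)" by (rule absdiff_upper)+
  hence "z + x \<le> z + (y + absdiff (x + z) (y + z))" "z + y \<le> z + (x + absdiff (x + z) (y + z))"
    by (simp_all add: ac_simps)
  thus ?thesis unfolding absdiff_le_iff using assms by (auto simp: ennreal_add_left_cancel_le)
qed

lemma absdiff_le_add: "absdiff x y \<le> x + y"
  unfolding absdiff_le_iff by (auto simp: add_increasing2 add_increasing add.commute)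

lemma absdiff_add_left: "absdiff (x + y) x \<le> y"
  unfolding absdiff_le_iff by (auto simp: add_increasing2 add.assoc)

lemma absdiff_ennreal: "0 \<le> a \<Longrightarrow> 0 \<le> c \<Longrightarrow> absdiff (ennreal a) (ennreal c) = ennreal \<bar>a - c\<bar>"
  by (cases a c rule: linorder_cases) (auto simp: absdiff_def ennreal_minus ennreal_neg)

lemma absdiff_nn_integral:
  assumes [measurable]: "f \<in> borel_measurable Q" "g \<in> borel_measurable Q"
  shows "absdiff (\<integral>\<^sup>+x. f x \<partial>Q) (\<integral>\<^sup>+x. g x \<partial>Q) \<le> (\<integral>\<^sup>+x. absdiff (f x) (g x) \<partial>Q)"
  unfolding absdiff_le_iff
  by (auto simp: nn_integral_add[symmetric] intro!: nn_integral_mono absdiff_upper)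

lemma tendsto_at_right_0_seqI:
  fixes f :: "real \<Rightarrow> ennreal"
  assumes "\<And>X :: nat \<Rightarrow> real. (\<And>i. 0 < X i) \<Longrightarrow> X \<longlonglongrightarrow> 0 \<Longrightarrow> (\<lambda>i. f (X i)) \<longlonglongrightarrow> 0"
  shows "(f \<longlongrightarrow> 0) (at_right 0)"
  unfolding tendsto_at_iff_sequentially o_def using assms by auto

section \<open>Continuity of translation in the mean\<close>

definition shift_modulus :: "(real \<Rightarrow> ennreal) \<Rightarrow> real \<Rightarrow> ennreal" where
  "shift_modulus f \<tau> = (\<integral>\<^sup>+s. absdiff (f (s - \<tau>)) (f s) \<partial>lborel)"

lemma nn_integral_shift_minus:
  fixes f :: "real \<Rightarrow> ennreal"
  assumes [measurable]: "f \<in> borel_measurable borel"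
  shows "(\<integral>\<^sup>+s. f (s - \<tau>) \<partial>lborel) = (\<integral>\<^sup>+s. f s \<partial>lborel)"
  using nn_integral_shift[of f "- \<tau>"] by simp

lemma shift_modulus_le:
  assumes [measurable]: "f \<in> borel_measurable borel"
  shows "shift_modulus f \<tau> \<le> 2 * (\<integral>\<^sup>+s. f s \<partial>lborel)"
proof -
  have "shift_modulus f \<tau> \<le> (\<integral>\<^sup>+s. f (s - \<tau>) + f s \<partial>lborel)"
    unfolding shift_modulus_def by (intro nn_integral_mono absdiff_le_add)
  also have "\<dots> = 2 * (\<integral>\<^sup>+s. f s \<partial>lborel)"
    by (subst nn_integral_add) (simp_all add: nn_integral_shift_minus mult_2)
  finally show ?thesis .
qed

lemma shift_modulus_approx:
  assumes [measurable]: "f \<in> borel_measurable borel"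
    and ap: "\<And>e. 0 < e \<Longrightarrow> \<exists>g \<in> borel_measurable borel. (\<integral>\<^sup>+s. absdiff (f s) (g s) \<partial>lborel) \<le> e \<and> (shift_modulus g \<longlongrightarrow> 0) (at_right 0)"
  shows "(shift_modulus f \<longlongrightarrow> 0) (at_right 0)"
proof (rule order_tendstoI)
  fix a :: ennreal assume "0 < a"
  then obtain a' where a': "0 < a'" "a' + a' < a" using ennreal_half_less by blast
  obtain e where e: "0 < e" "e + e < a'" using ennreal_half_less[OF a'(1)] by blast
  from ap[OF e(1)] obtain g where g[measurable]: "g \<in> borel_measurable borel"
    and ge: "(\<integral>\<^sup>+s. absdiff (f s) (g s) \<partial>lborel) \<le> e" and lim: "(shift_modulus g \<longlongrightarrow> 0) (at_right 0)" by blast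
  from order_tendstoD(2)[OF lim a'(1)] show "\<forall>\<^sub>F \<tau> in at_right 0. shift_modulus f \<tau> < a"
  proof eventually_elim
    fix \<tau> assume s: "shift_modulus g \<tau> < a'"
    have "shift_modulus f \<tau> \<le> (\<integral>\<^sup>+s. absdiff (f (s - \<tau>)) (g (s - \<tau>)) + (absdiff (g (s - \<tau>)) (g s) + absdiff (f s) (g s)) \<partial>lborel)"
      unfolding shift_modulus_def
    proof (rule nn_integral_mono)
      fix s
      have "absdiff (f (s - \<tau>)) (f s) \<le> absdiff (f (s - \<tau>)) (g (s - \<tau>)) + absdiff (g (s - \<tau>)) (f s)" by (rule absdiff_triangle)
      also have "\<dots> \<le> absdiff (f (s - \<tau>)) (g (s - \<tau>)) + (absdiff (g (s - \<tau>)) (g s) + absdiff (g s) (f s))"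
        by (intro add_left_mono absdiff_triangle)
      finally show "absdiff (f (s - \<tau>)) (f s) \<le> absdiff (f (s - \<tau>)) (g (s - \<tau>)) + (absdiff (g (s - \<tau>)) (g s) + absdiff (f s) (g s))"
        by (simp add: absdiff_commute[of "g s"])
    qed
    also have "\<dots> = (\<integral>\<^sup>+s. absdiff (f s) (g s) \<partial>lborel) + (shift_modulus g \<tau> + (\<integral>\<^sup>+s. absdiff (f s) (g s) \<partial>lborel))"
      using nn_integral_shift_minus[of "\<lambda>s. absdiff (f s) (g s)" \<tau>]
      by (simp add: nn_integral_add shift_modulus_def)
    also have "\<dots> \<le> e + (a' + e)" using s by (intro add_mono ge) auto
    also have "\<dots> = (e + e) + a'" by (simp add: ac_simps)
    also have "\<dots> \<le> a' + a'" using e(2) by (intro add_right_mono) auto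
    also have "\<dots> < a" by fact
    finally show "shift_modulus f \<tau> < a" .
  qed
qed simp

text \<open>
  The two parts of the symmetric difference of \<open>U\<close> and its translate have equal measure, and the
  part \<open>U - (U + \<tau>)\<close> vanishes pointwise as \<open>\<tau> \<rightarrow> 0\<close> because \<open>U\<close> is open.
\<close>

lemma shift_modulus_open:
  fixes U :: "real set"
  assumes U: "open U" and fin: "emeasure lborel U < top"
  shows "(shift_modulus (indicator U) \<longlongrightarrow> 0) (at_right 0)"
proof (rule tendsto_at_right_0_seqI)
  fix X :: "nat \<Rightarrow> real" assume X: "X \<longlonglongrightarrow> 0"
  have [measurable]: "U \<in> sets borel" using U by simp
  define a where "a \<tau> = (\<integral>\<^sup>+s. indicator U s * indicator (- U) (s - \<tau>) \<partial>lborel)" for \<tau> :: real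
  define c where "c \<tau> = (\<integral>\<^sup>+s. indicator (- U) s * indicator U (s - \<tau>) \<partial>lborel)" for \<tau> :: real
  define p where "p \<tau> = (\<integral>\<^sup>+s. indicator U s * indicator U (s - \<tau>) \<partial>lborel)" for \<tau> :: real
  have ap: "a \<tau> + p \<tau> = emeasure lborel U" for \<tau>
    unfolding a_def p_def by (subst nn_integral_add[symmetric]) (auto simp: indicator_def intro!: nn_integral_cong simp flip: nn_integral_indicator)
  have cp: "c \<tau> + p \<tau> = emeasure lborel U" for \<tau>
  proof -
    have "c \<tau> + p \<tau> = (\<integral>\<^sup>+s. indicator U (s - \<tau>) \<partial>lborel)"
      unfolding c_def p_def by (subst nn_integral_add[symmetric]) (auto simp: indicator_def intro!: nn_integral_cong)
    thus ?thesis by (simp add: nn_integral_shift_minus)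
  qed
  have pfin: "p \<tau> < top" for \<tau>
  proof -
    have "p \<tau> \<le> a \<tau> + p \<tau>" by (simp add: add_increasing)
    thus ?thesis unfolding ap using fin by (rule order_le_less_trans)
  qed
  have ac: "a \<tau> = c \<tau>" for \<tau>
    using ap[of \<tau>] cp[of \<tau>] pfin[of \<tau>] by (metis add.commute ennreal_add_left_cancel less_irrefl infinity_ennreal_def)
  have "shift_modulus (indicator U) \<tau> = c \<tau> + a \<tau>" for \<tau>
    unfolding shift_modulus_def a_def c_def
    by (subst nn_integral_add[symmetric]) (auto simp: indicator_def absdiff_def intro!: nn_integral_cong)
  hence sm: "shift_modulus (indicator U) \<tau> = 2 * a \<tau>" for \<tau> by (simp add: ac mult_2)
  have "(\<lambda>i. a (X i)) \<longlonglongrightarrow> (\<integral>\<^sup>+(s::real). 0 \<partial>lborel)"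
    unfolding a_def
  proof (rule nn_integral_dominated_convergence[where w = "indicator U"])
    show "AE s in lborel. (\<lambda>i. indicator U s * indicator (- U) (s - X i) :: ennreal) \<longlonglongrightarrow> 0"
    proof (rule AE_I2)
      fix s
      show "(\<lambda>i. indicator U s * indicator (- U) (s - X i) :: ennreal) \<longlonglongrightarrow> 0"
      proof (cases "s \<in> U")
        case True
        have "(\<lambda>i. s - X i) \<longlonglongrightarrow> s - 0" by (intro tendsto_diff tendsto_const X)
        hence "\<forall>\<^sub>F i in sequentially. s - X i \<in> U" using True U by (auto simp: tendsto_def)
        hence "\<forall>\<^sub>F i in sequentially. (indicator U s * indicator (- U) (s - X i) :: ennreal) = 0"
          by eventually_elim simp
        thus ?thesis by (rule tendsto_eventually)
      qed simp
    qed
  qed (use fin in \<open>auto split: split_indicator\<close>)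
  hence "(\<lambda>i. a (X i)) \<longlonglongrightarrow> 0" by simp
  from ennreal_tendsto_cmult[OF _ this, of 2] show "(\<lambda>i. shift_modulus (indicator U) (X i)) \<longlonglongrightarrow> 0"
    unfolding sm by simp
qed

text \<open>
  Approximation in the mean: from open sets to Borel sets by outer regularity, then to
  nonnegative functions by monotone limits.
\<close>

lemma shift_modulus_tendsto_0:
  assumes f: "f \<in> borel_measurable borel" and "(\<integral>\<^sup>+s. f s \<partial>lborel) < top"
  shows "(shift_modulus f \<longlongrightarrow> 0) (at_right 0)"
  using assms
proof (induction rule: borel_measurable_induct)
  case (cong f g)
  have "f = g" using cong(3) by auto
  thus ?case using cong by simp
next
  case (set A)
  have [measurable]: "A \<in> sets borel" using set by simp
  show ?case
  proof (rule shift_modulus_approx)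
    fix e :: ennreal assume e: "0 < e"
    obtain e' :: real where e': "0 < e'" "ennreal e' \<le> e"
    proof (cases e)
      case (real r) thus thesis using e that[of r] by auto
    next
      case top thus thesis using that[of 1] by auto
    qed
    from outer_regular_lborel[OF \<open>A \<in> sets borel\<close> e'(1)] obtain U where
      U: "open U" "A \<subseteq> U" "emeasure lborel (U - A) < ennreal e'" by auto
    have [measurable]: "U \<in> sets borel" using U by simp
    have "emeasure lborel U \<le> emeasure lborel A + emeasure lborel (U - A)"
      using U(2) by (subst plus_emeasure) (auto simp: Un_absorb1 intro: emeasure_mono)
    also have "\<dots> < top" using set(2) U(3) by (auto simp: less_top[symmetric])
    finally have fin: "emeasure lborel U < top" .
    have "(\<integral>\<^sup>+s. absdiff (indicator A s) (indicator U s) \<partial>lborel) = (\<integral>\<^sup>+s. indicator (U - A) s \<partial>lborel)"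
      using U(2) by (intro nn_integral_cong) (auto simp: indicator_def absdiff_def)
    also have "\<dots> = emeasure lborel (U - A)" by (rule nn_integral_indicator) auto
    also have "\<dots> \<le> e" using U(3) e'(2) by simp
    finally show "\<exists>g\<in>borel_measurable borel. (\<integral>\<^sup>+s. absdiff (indicator A s) (g s) \<partial>lborel) \<le> e \<and> (shift_modulus g \<longlongrightarrow> 0) (at_right 0)"
      using shift_modulus_open[OF U(1) fin] by (intro bexI[of _ "indicator U"]) auto
  qed simp
next
  case (mult u c)
  show ?case
  proof (cases "c = 0")
    case True
    thus ?thesis by (simp add: shift_modulus_def[abs_def])
  next
    case False
    note [measurable] = mult.hyps(2)
    have "(\<integral>\<^sup>+s. u s \<partial>lborel) < top"
      using mult.prems False by (auto simp: nn_integral_cmult ennreal_mult_less_top)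
    from mult.IH[OF this] have "((\<lambda>\<tau>. c * shift_modulus u \<tau>) \<longlongrightarrow> c * 0) (at_right 0)"
      by (intro ennreal_tendsto_cmult mult.hyps)
    hence lim: "((\<lambda>\<tau>. c * shift_modulus u \<tau>) \<longlongrightarrow> 0) (at_right 0)" by simp
    have "shift_modulus (\<lambda>x. c * u x) \<tau> \<le> c * shift_modulus u \<tau>" for \<tau>
      unfolding shift_modulus_def by (subst nn_integral_cmult[symmetric]) (auto intro!: nn_integral_mono absdiff_mult)
    from ennreal_squeeze_0[OF lim this] show ?thesis .
  qed
next
  case (add u v)
  note [measurable] = add.hyps(1) add.hyps(3)
  have "(\<integral>\<^sup>+s. u s \<partial>lborel) < top" "(\<integral>\<^sup>+s. v s \<partial>lborel) < top"
    using add.prems by (auto simp: nn_integral_add)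
  hence lim: "((\<lambda>\<tau>. shift_modulus v \<tau> + shift_modulus u \<tau>) \<longlongrightarrow> 0 + 0) (at_right 0)"
    by (intro tendsto_add add.IH)
  hence lim: "((\<lambda>\<tau>. shift_modulus v \<tau> + shift_modulus u \<tau>) \<longlongrightarrow> 0) (at_right 0)" by simp
  have "shift_modulus (\<lambda>x. v x + u x) \<tau> \<le> shift_modulus v \<tau> + shift_modulus u \<tau>" for \<tau>
    unfolding shift_modulus_def by (subst nn_integral_add[symmetric]) (auto intro!: nn_integral_mono absdiff_add)
  from ennreal_squeeze_0[OF lim this] show ?case .
next
  case (seq U)
  note [measurable] = seq.hyps(1)
  have fm[measurable]: "f \<in> borel_measurable borel" by (rule assms(1))
  have le: "U i s \<le> f s" for i s unfolding seq.hyps(4) by (auto intro: SUP_upper)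
  show ?case
    unfolding seq.hyps(4)[symmetric]
  proof (rule shift_modulus_approx[OF fm])
    fix e :: ennreal assume e: "0 < e"
    have "(\<lambda>i. \<integral>\<^sup>+s. absdiff (f s) (U i s) \<partial>lborel) \<longlonglongrightarrow> (\<integral>\<^sup>+(s::real). 0 \<partial>lborel)"
    proof (rule nn_integral_dominated_convergence[where w = "f"])
      have "AE s in lborel. f s \<noteq> \<infinity>"
        by (rule nn_integral_PInf_AE) (use seq.prems in \<open>auto simp: seq.hyps(4)[symmetric] SUP_apply\<close>)
      thus "AE s in lborel. (\<lambda>i. absdiff (f s) (U i s)) \<longlonglongrightarrow> 0"
      proof eventually_elim
        fix s assume fs: "f s \<noteq> \<infinity>"
        have "incseq (\<lambda>i. U i s)" using seq.hyps(3) by (auto simp: incseq_def le_fun_def)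
        from LIMSEQ_SUP[OF this] have "(\<lambda>i. U i s) \<longlonglongrightarrow> f s" unfolding seq.hyps(4) by (simp add: image_image)
        hence "(\<lambda>i. f s - U i s) \<longlonglongrightarrow> f s - f s" using fs by (intro tendsto_diff_ennreal tendsto_const) auto
        hence "(\<lambda>i. f s - U i s) \<longlonglongrightarrow> 0" using fs by (simp add: less_top)
        thus "(\<lambda>i. absdiff (f s) (U i s)) \<longlonglongrightarrow> 0"
          by (rule ennreal_squeeze_0) (use le fs in \<open>auto simp: absdiff_le_iff add_increasing2 add_diff_inverse_ennreal\<close>)
      qed
      show "AE s in lborel. absdiff (f s) (U i s) \<le> f s" for i
        using le by (auto simp: absdiff_le_iff add_increasing2 add_increasing)
      show "(\<integral>\<^sup>+s. f s \<partial>lborel) < \<infinity>" using seq.prems by (simp add: seq.hyps(4)[symmetric])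
    qed measurable
    hence "(\<lambda>i. \<integral>\<^sup>+s. absdiff (f s) (U i s) \<partial>lborel) \<longlonglongrightarrow> 0" by simp
    from order_tendstoD(2)[OF this e] obtain i where i: "(\<integral>\<^sup>+s. absdiff (f s) (U i s) \<partial>lborel) < e"
      using eventually_happens'[OF sequentially_bot] by blast
    have "(\<integral>\<^sup>+s. U i s \<partial>lborel) \<le> (\<integral>\<^sup>+s. f s \<partial>lborel)" by (intro nn_integral_mono le)
    also have "\<dots> < top" using seq.prems by (simp add: seq.hyps(4)[symmetric])
    finally have "(shift_modulus (U i) \<longlongrightarrow> 0) (at_right 0)" by (rule seq.IH)
    thus "\<exists>g\<in>borel_measurable borel. (\<integral>\<^sup>+s. absdiff (f s) (g s) \<partial>lborel) \<le> e \<and> (shift_modulus g \<longlongrightarrow> 0) (at_right 0)"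
      using i by (intro bexI[of _ "U i"]) auto
  qed
qed

lemma absdiff_factor_tendsto_0:
  assumes c: "(\<lambda>i::nat. ennreal (c i)) \<longlonglongrightarrow> 1" and nn: "\<And>i. 0 \<le> c i" and x: "x \<noteq> top"
  shows "(\<lambda>i. absdiff (ennreal (c i) * x) x) \<longlonglongrightarrow> 0"
proof -
  obtain r where r: "x = ennreal r" "0 \<le> r" using x by (cases x) auto
  have "c \<longlonglongrightarrow> 1"
    using tendsto_enn2real[OF c[folded ennreal_1]] nn by simp
  hence "(\<lambda>i. ennreal \<bar>c i * r - r\<bar>) \<longlonglongrightarrow> ennreal \<bar>1 * r - r\<bar>"
    by (intro tendsto_intros)
  moreover have "absdiff (ennreal (c i) * x) x = ennreal \<bar>c i * r - r\<bar>" for i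
    using r nn by (simp add: ennreal_mult'[symmetric] absdiff_ennreal)
  ultimately show ?thesis by simp
qed

section \<open>Strong continuity\<close>

context kinetic begin

definition edist :: "(real \<Rightarrow> 'a \<Rightarrow> ennreal) \<Rightarrow> (real \<Rightarrow> 'a \<Rightarrow> ennreal) \<Rightarrow> ennreal" where
  "edist F G = mass (\<lambda>s v. absdiff (F s v) (G s v))"

lemma edist_triangle:
  assumes [measurable]: "meas F" "meas G" "meas H"
  shows "edist F H \<le> edist F G + edist G H"
  unfolding edist_def by (subst mass_add[symmetric]) (auto intro: mass_mono absdiff_triangle)

lemma mass_le_edist:
  assumes [measurable]: "meas F" "meas G"
  shows "mass F \<le> mass G + edist F G"
  unfolding edist_def by (subst mass_add[symmetric]) (auto intro: mass_mono absdiff_upper)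

lemma edist_mass_diff:
  assumes [measurable]: "meas F" "meas G" "meas D" and FG: "\<And>s v. v \<in> space N \<Longrightarrow> F s v = G s v + D s v"
  shows "edist F G \<le> mass D"
  unfolding edist_def by (rule mass_mono) (simp add: FG absdiff_add_left)

lemma edist_T_le:
  assumes [measurable]: "meas F" "meas G" and t: "0 \<le> \<tau>"
  shows "edist (T \<tau> F) (T \<tau> G) \<le> edist F G"
proof -
  let ?D = "\<lambda>s v. absdiff (F s v) (G s v)"
  have "edist (T \<tau> F) (T \<tau> G) \<le> mass (T \<tau> ?D)"
    unfolding edist_def
  proof (rule mass_mono)
    fix s v assume v[measurable]: "v \<in> space N"
    have "T \<tau> F s v \<le> T \<tau> (\<lambda>s v. G s v + ?D s v) s v" by (rule T_mono[OF absdiff_upper(1) v])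
    moreover have "T \<tau> G s v \<le> T \<tau> (\<lambda>s v. F s v + ?D s v) s v" by (rule T_mono[OF absdiff_upper(2) v])
    moreover have "T \<tau> (\<lambda>s v. G s v + ?D s v) s v = T \<tau> G s v + T \<tau> ?D s v"
      "T \<tau> (\<lambda>s v. F s v + ?D s v) s v = T \<tau> F s v + T \<tau> ?D s v"
      by (rule T_add; measurable)+
    ultimately show "absdiff (T \<tau> F s v) (T \<tau> G s v) \<le> T \<tau> ?D s v" by (simp add: absdiff_le_iff)
  qed
  also have "\<dots> \<le> edist F G" unfolding edist_def by (rule T_mass_le[OF _ t]) measurable
  finally show ?thesis .
qed

lemma shift_tendsto_0:
  assumes F[measurable]: "meas F" and fin: "mass F \<noteq> top"
  shows "((\<lambda>\<tau>. edist (\<lambda>s v. F (s - \<tau>) v) F) \<longlongrightarrow> 0) (at_right 0)"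
proof (rule tendsto_at_right_0_seqI)
  fix X :: "nat \<Rightarrow> real" assume Xp: "\<And>i. 0 < X i" and X: "X \<longlonglongrightarrow> 0"
  have Xr: "filterlim X (at_right 0) sequentially"
    using X Xp Xp[THEN less_imp_neq, THEN not_sym] by (auto simp: filterlim_at)
  have e: "edist (\<lambda>s v. F (s - \<tau>) v) F = (\<integral>\<^sup>+v. shift_modulus (\<lambda>s. F s v) \<tau> \<partial>N)" for \<tau>
    unfolding edist_def mass_def shift_modulus_def by (rule tonelli) (unfold_locales, measurable)
  have m: "mass F = (\<integral>\<^sup>+v. \<integral>\<^sup>+s. F s v \<partial>lborel \<partial>N)"
    unfolding mass_def by (rule tonelli) (unfold_locales, measurable)
  have [measurable]: "v \<in> space N \<Longrightarrow> (\<lambda>s. F s v) \<in> borel_measurable borel" for v by measurable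
  have "(\<lambda>i. \<integral>\<^sup>+v. shift_modulus (\<lambda>s. F s v) (X i) \<partial>N) \<longlonglongrightarrow> (\<integral>\<^sup>+v. 0 \<partial>N)"
  proof (rule nn_integral_dominated_convergence[where w = "\<lambda>v. 2 * (\<integral>\<^sup>+s. F s v \<partial>lborel)"])
    show "(\<lambda>v. shift_modulus (\<lambda>s. F s v) (X i)) \<in> borel_measurable N" for i
      unfolding shift_modulus_def by measurable
    show "AE v in N. shift_modulus (\<lambda>s. F s v) (X i) \<le> 2 * (\<integral>\<^sup>+s. F s v \<partial>lborel)" for i
      by (rule AE_I2, rule shift_modulus_le) measurable
    show "(\<integral>\<^sup>+v. 2 * (\<integral>\<^sup>+s. F s v \<partial>lborel) \<partial>N) < \<infinity>"
      using fin by (subst nn_integral_cmult) (auto simp: m[symmetric] ennreal_mult_less_top less_top)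
    have "AE v in N. (\<integral>\<^sup>+s. F s v \<partial>lborel) \<noteq> \<infinity>"
      by (rule nn_integral_PInf_AE) (use fin in \<open>auto simp: m[symmetric]\<close>)
    thus "AE v in N. (\<lambda>i. shift_modulus (\<lambda>s. F s v) (X i)) \<longlonglongrightarrow> 0"
      using AE_space
    proof eventually_elim
      fix v assume f: "(\<integral>\<^sup>+s. F s v \<partial>lborel) \<noteq> \<infinity>" and [measurable]: "v \<in> space N"
      have "(shift_modulus (\<lambda>s. F s v) \<longlongrightarrow> 0) (at_right 0)"
        by (rule shift_modulus_tendsto_0) (use f in \<open>auto simp: less_top\<close>)
      from filterlim_compose[OF this Xr] show "(\<lambda>i. shift_modulus (\<lambda>s. F s v) (X i)) \<longlonglongrightarrow> 0" .
    qed
  qed measurable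
  thus "(\<lambda>i. edist (\<lambda>s v. F (s - X i) v) F) \<longlonglongrightarrow> 0" unfolding e by simp
qed

lemma E_tendsto_1:
  assumes Xp: "\<And>i. 0 < X i" and X: "X \<longlonglongrightarrow> (0::real)"
  shows "(\<lambda>i::nat. E s (s + X i) v) \<longlonglongrightarrow> 1"
proof -
  let ?h = "\<lambda>t. integral {s..t} (\<lambda>\<tau>. Sg \<tau> v)"
  have HK: "(LBINT \<tau>:{s..t}. Sg \<tau> v) = ?h t" for t
    by (rule set_borel_integral_eq_integral(2)) (rule Sg_int)
  have "(\<lambda>\<tau>. Sg \<tau> v) integrable_on {s..s+1}" by (rule set_borel_integral_eq_integral(1)) (rule Sg_int)
  from indefinite_integral_continuous_1[OF this] have "continuous_on {s..s+1} ?h" .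
  hence "(?h \<longlongrightarrow> ?h s) (at s within {s..s+1})" unfolding continuous_on_def by (rule bspec) simp
  moreover have "filterlim (\<lambda>i. s + X i) (at s within {s..s+1}) sequentially"
  proof -
    have "(\<lambda>i. s + X i) \<longlonglongrightarrow> s + 0" by (intro tendsto_intros X)
    moreover have "\<forall>\<^sub>F i in sequentially. s + X i \<in> {s..s+1} \<and> s + X i \<noteq> s"
      using order_tendstoD(2)[OF X zero_less_one] by eventually_elim (use Xp in \<open>auto simp: less_imp_le\<close>, use Xp less_irrefl in metis)
    ultimately show ?thesis by (simp add: filterlim_at)
  qed
  ultimately have "(\<lambda>i. ?h (s + X i)) \<longlonglongrightarrow> ?h s" by (rule filterlim_compose)
  hence "(\<lambda>i. ?h (s + X i)) \<longlonglongrightarrow> 0" by simp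
  hence "(\<lambda>i. ennreal (exp (- ?h (s + X i)))) \<longlonglongrightarrow> ennreal (exp (- 0))"
    by (intro tendsto_intros)
  thus ?thesis unfolding E_def HK by simp
qed

lemma S0_tendsto:
  assumes F[measurable]: "meas F" and fin: "mass F \<noteq> top"
  shows "((\<lambda>\<tau>. edist (S 0 \<tau> F) F) \<longlongrightarrow> 0) (at_right 0)"
proof -
  let ?A = "\<lambda>\<tau>. mass (\<lambda>s v. absdiff (E s (s + \<tau>) v * F s v) (F s v))"
  have le: "edist (S 0 \<tau> F) F \<le> ?A \<tau> + edist (\<lambda>s v. F (s - \<tau>) v) F" for \<tau>
  proof -
    have "edist (S 0 \<tau> F) F \<le> edist (S 0 \<tau> F) (\<lambda>s v. F (s - \<tau>) v) + edist (\<lambda>s v. F (s - \<tau>) v) F"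
      by (rule edist_triangle) measurable
    also have "edist (S 0 \<tau> F) (\<lambda>s v. F (s - \<tau>) v) = ?A \<tau>"
    proof -
      have "(\<lambda>s. \<integral>\<^sup>+v. absdiff (E (s - \<tau>) s v * F (s - \<tau>) v) (F (s - \<tau>) v) \<partial>N) \<in> borel_measurable borel" by measurable
      from nn_integral_shift[OF this, of \<tau>] show ?thesis
        by (simp add: edist_def mass_def S_def vE_0)
    qed
    finally show ?thesis .
  qed
  have "(?A \<longlongrightarrow> 0) (at_right 0)"
  proof (rule tendsto_at_right_0_seqI)
    fix X :: "nat \<Rightarrow> real" assume Xp: "\<And>i. 0 < X i" and X: "X \<longlonglongrightarrow> 0"
    show "(\<lambda>i. ?A (X i)) \<longlonglongrightarrow> 0"
    proof (rule mass_dominated_convergence[OF _ F fin])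
      show "AE x in lborel \<Otimes>\<^sub>M N. absdiff (E (fst x) (fst x + X i) (snd x) * F (fst x) (snd x)) (F (fst x) (snd x)) \<le> F (fst x) (snd x)" for i
        by (rule AE_I2) (auto simp: absdiff_le_iff add_increasing add_increasing2 mult_left_le_one_le intro!: order_trans[OF mult_right_mono[OF E_le_1]])
      show "AE x in lborel \<Otimes>\<^sub>M N. (\<lambda>i. absdiff (E (fst x) (fst x + X i) (snd x) * F (fst x) (snd x)) (F (fst x) (snd x))) \<longlonglongrightarrow> 0"
        using mass_finite_AE[OF F fin]
      proof eventually_elim
        fix x assume f: "F (fst x) (snd x) \<noteq> top"
        show "(\<lambda>i. absdiff (E (fst x) (fst x + X i) (snd x) * F (fst x) (snd x)) (F (fst x) (snd x))) \<longlonglongrightarrow> 0"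
          unfolding E_def by (rule absdiff_factor_tendsto_0[OF E_tendsto_1[OF Xp X, unfolded E_def] _ f]) simp
      qed
    qed measurable
  qed
  hence "((\<lambda>\<tau>. ?A \<tau> + edist (\<lambda>s v. F (s - \<tau>) v) F) \<longlongrightarrow> 0 + 0) (at_right 0)"
    by (intro tendsto_add shift_tendsto_0[OF F fin])
  hence "((\<lambda>\<tau>. ?A \<tau> + edist (\<lambda>s v. F (s - \<tau>) v) F) \<longlongrightarrow> 0) (at_right 0)" by simp
  from ennreal_squeeze_0[OF this le] show ?thesis .
qed

text \<open>
  What has been scattered is no more than what is missing from \<open>S 0 \<tau> F\<close>, because \<open>T\<close> does not increase
  mass; thus continuity of \<open>T\<close> follows from that of \<open>S 0\<close>.
\<close>

lemma edist_T_S0: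
  assumes F[measurable]: "meas F" and fin: "mass F \<noteq> top" and t: "0 \<le> \<tau>"
  shows "edist (T \<tau> F) F \<le> 2 * edist (S 0 \<tau> F) F"
proof -
  let ?D = "\<lambda>s v. \<integral>\<^sup>+q. indicator {0..\<tau>} q * T (\<tau> - q) (Bk (S 0 q F)) s v \<partial>lborel"
  have [measurable]: "meas ?D" by measurable
  have "mass (T \<tau> F) = mass (\<lambda>s v. S 0 \<tau> F s v + ?D s v)" by (rule mass_cong) (rule T_Duhamel[OF F])
  also have "\<dots> = mass (S 0 \<tau> F) + mass ?D" by (rule mass_add) measurable
  finally have "mass (S 0 \<tau> F) + mass ?D \<le> mass F" using T_mass_le[OF F t] by simp
  also have "\<dots> \<le> mass (S 0 \<tau> F) + edist (S 0 \<tau> F) F"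
    using mass_le_edist[OF F, of "S 0 \<tau> F"] by (simp add: edist_def absdiff_commute)
  finally have "mass ?D \<le> edist (S 0 \<tau> F) F"
    using S_mass_le[OF F t, of 0] fin by (auto simp: ennreal_add_left_cancel_le top_unique)
  moreover have "edist (T \<tau> F) (S 0 \<tau> F) \<le> mass ?D"
    by (rule edist_mass_diff[OF _ _ _ T_Duhamel[OF F]]) measurable
  ultimately have "edist (T \<tau> F) (S 0 \<tau> F) + edist (S 0 \<tau> F) F \<le> edist (S 0 \<tau> F) F + edist (S 0 \<tau> F) F"
    by (intro add_right_mono) auto
  moreover have "edist (T \<tau> F) F \<le> edist (T \<tau> F) (S 0 \<tau> F) + edist (S 0 \<tau> F) F"
    by (rule edist_triangle) measurable
  ultimately show ?thesis unfolding mult_2 by (rule order_trans[rotated])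
qed

text \<open>
  Averages over \<open>[0, \<tau>]\<close> of functions that are uniformly close to \<open>h\<close> are close to \<open>h\<close>.  The family may
  depend on \<open>\<tau>\<close>, as it does in Duhamel's formula.
\<close>

lemma averages_tendsto:
  assumes h[measurable]: "meas h" and Y: "\<And>\<tau>. rmeas (Y \<tau>)"
    and lim: "\<And>e. 0 < e \<Longrightarrow> \<exists>\<delta>>0. \<forall>\<tau> q. 0 < q \<longrightarrow> q < \<tau> \<longrightarrow> \<tau> < \<delta> \<longrightarrow> edist (Y \<tau> q) h \<le> e"
  shows "((\<lambda>\<tau>. edist (\<lambda>s v. ennreal (1 / \<tau>) * (\<integral>\<^sup>+q. indicator {0..\<tau>} q * Y \<tau> q s v \<partial>lborel)) h) \<longlongrightarrow> 0) (at_right 0)"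
proof (rule order_tendstoI)
  fix a :: ennreal assume "0 < a"
  then obtain e where e: "0 < e" "e + e < a" using ennreal_half_less by blast
  from lim[OF e(1)] obtain \<delta> where d: "\<delta> > 0" "\<And>\<tau> q. 0 < q \<Longrightarrow> q < \<tau> \<Longrightarrow> \<tau> < \<delta> \<Longrightarrow> edist (Y \<tau> q) h \<le> e" by blast
  have "\<forall>\<^sub>F \<tau> in at_right 0. 0 < \<tau> \<and> \<tau> < \<delta>"
    using d(1) by (auto simp: eventually_at_right_field)
  thus "\<forall>\<^sub>F \<tau> in at_right 0. edist (\<lambda>s v. ennreal (1 / \<tau>) * (\<integral>\<^sup>+q. indicator {0..\<tau>} q * Y \<tau> q s v \<partial>lborel)) h < a"
  proof eventually_elim
    fix \<tau> assume t: "0 < \<tau> \<and> \<tau> < \<delta>"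
    note [measurable (raw)] = fmeasD[OF Y[of \<tau>]]
    have D: "rmeas (\<lambda>q s v. absdiff (Y \<tau> q s v) (h s v))" by measurable
    have one: "ennreal (1 / \<tau>) * ennreal \<tau> = 1" using t by (simp add: ennreal_mult'[symmetric])
    have "edist (\<lambda>s v. ennreal (1 / \<tau>) * (\<integral>\<^sup>+q. indicator {0..\<tau>} q * Y \<tau> q s v \<partial>lborel)) h \<le>
       mass (\<lambda>s v. ennreal (1 / \<tau>) * (\<integral>\<^sup>+q. indicator {0..\<tau>} q * absdiff (Y \<tau> q s v) (h s v) \<partial>lborel))"
      unfolding edist_def
    proof (rule mass_mono)
      fix s v assume [measurable]: "v \<in> space N"
      have hq: "h s v = ennreal (1 / \<tau>) * (\<integral>\<^sup>+q. indicator {0..\<tau>} q * h s v \<partial>lborel)"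
        using t one by (simp add: nn_integral_multc mult.assoc[symmetric])
      have "absdiff (ennreal (1 / \<tau>) * (\<integral>\<^sup>+q. indicator {0..\<tau>} q * Y \<tau> q s v \<partial>lborel)) (h s v) \<le>
        ennreal (1 / \<tau>) * absdiff (\<integral>\<^sup>+q. indicator {0..\<tau>} q * Y \<tau> q s v \<partial>lborel) (\<integral>\<^sup>+q. indicator {0..\<tau>} q * h s v \<partial>lborel)"
        by (subst hq) (rule absdiff_mult)
      also have "\<dots> \<le> ennreal (1 / \<tau>) * (\<integral>\<^sup>+q. absdiff (indicator {0..\<tau>} q * Y \<tau> q s v) (indicator {0..\<tau>} q * h s v) \<partial>lborel)"
        by (intro mult_left_mono absdiff_nn_integral) measurable
      also have "\<dots> \<le> ennreal (1 / \<tau>) * (\<integral>\<^sup>+q. indicator {0..\<tau>} q * absdiff (Y \<tau> q s v) (h s v) \<partial>lborel)"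
        by (intro mult_left_mono nn_integral_mono absdiff_mult) auto
      finally show "absdiff (ennreal (1 / \<tau>) * (\<integral>\<^sup>+q. indicator {0..\<tau>} q * Y \<tau> q s v \<partial>lborel)) (h s v) \<le> \<dots>" .
    qed
    also have "\<dots> = ennreal (1 / \<tau>) * mass (\<lambda>s v. \<integral>\<^sup>+q. indicator {0..\<tau>} q * absdiff (Y \<tau> q s v) (h s v) \<partial>lborel)"
      by (rule mass_cmult) measurable
    also have "mass (\<lambda>s v. \<integral>\<^sup>+q. indicator {0..\<tau>} q * absdiff (Y \<tau> q s v) (h s v) \<partial>lborel) = (\<integral>\<^sup>+q. indicator {0..\<tau>} q * edist (Y \<tau> q) h \<partial>lborel)"
      unfolding edist_def by (rule mass_interval[OF D])
    also have "\<dots> \<le> (\<integral>\<^sup>+q. e * indicator {0..\<tau>} q \<partial>lborel)"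
    proof (rule nn_integral_mono_AE, use AE_lborel_singleton[of 0] AE_lborel_singleton[of \<tau>] in eventually_elim)
      fix q assume "q \<noteq> 0" "q \<noteq> \<tau>"
      thus "indicator {0..\<tau>} q * edist (Y \<tau> q) h \<le> e * indicator {0..\<tau>} q"
        using d(2)[of q \<tau>] t by (auto simp: indicator_def)
    qed
    also have "\<dots> = e * ennreal \<tau>" using t by (simp add: nn_integral_cmult)
    also have "ennreal (1 / \<tau>) * (e * ennreal \<tau>) = e" using one by (simp add: mult.left_commute)
    also have "e < a" using e by (meson add_increasing2 order_le_less_trans order_refl zero_le)
    finally show "edist (\<lambda>s v. ennreal (1 / \<tau>) * (\<integral>\<^sup>+q. indicator {0..\<tau>} q * Y \<tau> q s v \<partial>lborel)) h < a"
      by (simp add: mult_left_mono)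
  qed
qed simp

end

section \<open>The generator on the range of the resolvent\<close>

context kinetic begin

text \<open>
  The part of the resolvent integral over \<open>[0, \<tau>]\<close>.
\<close>

definition early :: "real \<Rightarrow> real \<Rightarrow> (real \<Rightarrow> 'a \<Rightarrow> ennreal) \<Rightarrow> real \<Rightarrow> 'a \<Rightarrow> ennreal" where
  "early l \<tau> g s v = (\<integral>\<^sup>+q. indicator {0..\<tau>} q * (ennreal (exp (- l * q)) * S 0 q g s v) \<partial>lborel)"

lemma early_measurable[measurable (raw)]:
  assumes [measurable]: "U \<in> borel_measurable Q" "A \<in> borel_measurable Q" "V \<in> measurable Q N" and F: "fmeas Q F"
  shows "(\<lambda>q. early l (U q) (F q) (A q) (V q)) \<in> borel_measurable Q"
proof -
  note [measurable (raw)] = fmeasD[OF F]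
  show ?thesis unfolding early_def by measurable
qed

lemma S0_R:
  assumes g[measurable]: "meas g" and v[measurable]: "v \<in> space N" and t: "0 \<le> \<tau>"
  shows "S 0 \<tau> (R l g) s v + ennreal (exp (l * \<tau>)) * early l \<tau> g s v = ennreal (exp (l * \<tau>)) * R l g s v"
proof -
  have [measurable]: "(\<lambda>p. S 0 p g s v) \<in> borel_measurable borel" by measurable
  let ?L = "\<integral>\<^sup>+p. indicator {\<tau>..} p * (ennreal (exp (- l * p)) * S 0 p g s v) \<partial>lborel"
  have "R l g s v = (\<integral>\<^sup>+p. indicator {0..\<tau>} p * (ennreal (exp (- l * p)) * S 0 p g s v) + indicator {\<tau>..} p * (ennreal (exp (- l * p)) * S 0 p g s v) \<partial>lborel)"
    unfolding Lap_def
    by (rule nn_integral_cong_AE, use AE_lborel_singleton[of \<tau>] in eventually_elim) (use t in \<open>auto simp: indicator_def\<close>)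
  also have "\<dots> = early l \<tau> g s v + ?L" unfolding early_def by (rule nn_integral_add) measurable
  finally have 1: "R l g s v = early l \<tau> g s v + ?L" .
  have "S 0 \<tau> (R l g) s v = (\<integral>\<^sup>+p. S 0 \<tau> (\<lambda>s v. (indicator {0..} p * ennreal (exp (- l * p))) * S 0 p g s v) s v \<partial>lborel)"
    unfolding Lap_def[abs_def] mult.assoc[symmetric] by (rule S_nn_integral) (unfold_locales, measurable)
  also have "\<dots> = (\<integral>\<^sup>+p. (indicator {0..} p * ennreal (exp (- l * p))) * S 0 \<tau> (S 0 p g) s v \<partial>lborel)"
    by (intro nn_integral_cong S_cmult) measurable
  also have "\<dots> = (\<integral>\<^sup>+p. (indicator {0..} p * ennreal (exp (- l * p))) * S 0 (p + \<tau>) g s v \<partial>lborel)"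
    using t by (intro nn_integral_cong) (auto simp: indicator_def S0_S0 add.commute)
  also have "\<dots> = (\<integral>\<^sup>+p. ennreal (exp (l * \<tau>)) * (indicator {\<tau>..} (p + \<tau>) * (ennreal (exp (- l * (p + \<tau>))) * S 0 (p + \<tau>) g s v)) \<partial>lborel)"
  proof (rule nn_integral_cong)
    fix p
    have "ennreal (exp (- l * p)) = ennreal (exp (l * \<tau>)) * ennreal (exp (- l * (p + \<tau>)))"
      by (simp add: ennreal_mult'[symmetric] exp_add[symmetric] algebra_simps)
    thus "(indicator {0..} p * ennreal (exp (- l * p))) * S 0 (p + \<tau>) g s v =
      ennreal (exp (l * \<tau>)) * (indicator {\<tau>..} (p + \<tau>) * (ennreal (exp (- l * (p + \<tau>))) * S 0 (p + \<tau>) g s v))"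
      by (simp add: mult.assoc indicator_def)
  qed
  also have "\<dots> = (\<integral>\<^sup>+p. ennreal (exp (l * \<tau>)) * (indicator {\<tau>..} p * (ennreal (exp (- l * p)) * S 0 p g s v)) \<partial>lborel)"
    by (rule nn_integral_shift[symmetric]) measurable
  also have "\<dots> = ennreal (exp (l * \<tau>)) * ?L" by (rule nn_integral_cmult) measurable
  finally show ?thesis unfolding 1 by (simp add: distrib_left add.commute)
qed

lemma Bk_early_tendsto_0:
  assumes g[measurable]: "meas g" and fin: "mass g \<noteq> top" and l: "0 < l"
  shows "((\<lambda>\<tau>. mass (Bk (early l \<tau> g))) \<longlongrightarrow> 0) (at_right 0)"
proof (rule tendsto_at_right_0_seqI)
  fix X :: "nat \<Rightarrow> real" assume Xp: "\<And>i. 0 < X i" and X: "X \<longlonglongrightarrow> 0"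
  define m where "m q = ennreal (exp (- l * q)) * mass (Bk (S 0 q g))" for q
  have f: "rmeas (\<lambda>q s v. ennreal (exp (- l * q)) * S 0 q g s v)" by measurable
  have f': "rmeas (\<lambda>q s v. ennreal (exp (- l * q)) * Bk (S 0 q g) s v)" by measurable
  have f'': "rmeas (\<lambda>q. Bk (S 0 q g))" by measurable
  have [measurable]: "m \<in> borel_measurable borel" unfolding m_def using mass_measurable[OF f''] by measurable
  have e: "mass (Bk (early l \<tau> g)) = (\<integral>\<^sup>+q. indicator {0..\<tau>} q * m q \<partial>lborel)" for \<tau>
  proof -
    have "mass (Bk (early l \<tau> g)) = mass (\<lambda>s v. \<integral>\<^sup>+q. indicator {0..\<tau>} q * (ennreal (exp (- l * q)) * Bk (S 0 q g) s v) \<partial>lborel)"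
    proof (rule mass_cong)
      fix s v assume [measurable]: "v \<in> space N"
      have "Bk (early l \<tau> g) s v = (\<integral>\<^sup>+q. indicator {0..\<tau>} q * Bk (\<lambda>s v. ennreal (exp (- l * q)) * S 0 q g s v) s v \<partial>lborel)"
        unfolding early_def[abs_def] by (rule Bk_interval[OF f]) fact
      also have "\<dots> = (\<integral>\<^sup>+q. indicator {0..\<tau>} q * (ennreal (exp (- l * q)) * Bk (S 0 q g) s v) \<partial>lborel)"
        by (intro nn_integral_cong arg_cong[where f = "\<lambda>x. indicator _ _ * x"] Bk_cmult) measurable
      finally show "Bk (early l \<tau> g) s v = \<dots>" .
    qed
    also have "\<dots> = (\<integral>\<^sup>+q. indicator {0..\<tau>} q * mass (\<lambda>s v. ennreal (exp (- l * q)) * Bk (S 0 q g) s v) \<partial>lborel)"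
      by (rule mass_interval[OF f'])
    also have "\<dots> = (\<integral>\<^sup>+q. indicator {0..\<tau>} q * m q \<partial>lborel)"
      unfolding m_def by (intro nn_integral_cong arg_cong[where f = "\<lambda>x. indicator _ _ * x"] mass_cmult) measurable
    finally show ?thesis .
  qed
  have total: "(\<integral>\<^sup>+q. indicator {0..1} q * m q \<partial>lborel) < \<infinity>"
  proof -
    have "mass (Bk (early l 1 g)) \<le> mass (Bk (R l g))"
      unfolding early_def Lap_def
      by (intro mass_mono Bk_mono nn_integral_mono) (auto simp: indicator_def)
    also have "\<dots> \<le> mass g" by (rule BR_mass_le[OF g]) (use l in simp)
    also have "\<dots> < \<infinity>" using fin by (simp add: less_top)
    finally show ?thesis unfolding e .
  qed
  have "(\<lambda>i. \<integral>\<^sup>+q. indicator {0..X i} q * (indicator {0..1} q * m q) \<partial>lborel) \<longlonglongrightarrow> (\<integral>\<^sup>+(q::real). 0 \<partial>lborel)"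
  proof (rule nn_integral_dominated_convergence[OF _ _ _ _ total])
    show "AE q in lborel. (\<lambda>i. indicator {0..X i} q * (indicator {0..1} q * m q)) \<longlonglongrightarrow> 0"
      using AE_lborel_singleton[of 0]
    proof eventually_elim
      fix q :: real assume q: "q \<noteq> 0"
      have "\<forall>\<^sub>F i in sequentially. indicator {0..X i} q * (indicator {0..1} q * m q) = 0"
      proof (cases "0 < q")
        case True
        from order_tendstoD(2)[OF X this] show ?thesis by eventually_elim simp
      next
        case False with q show ?thesis by (simp add: indicator_def)
      qed
      thus "(\<lambda>i. indicator {0..X i} q * (indicator {0..1} q * m q)) \<longlonglongrightarrow> 0" by (rule tendsto_eventually)
    qed
  qed (measurable, auto simp: indicator_def)
  hence lim: "(\<lambda>i. \<integral>\<^sup>+q. indicator {0..X i} q * (indicator {0..1} q * m q) \<partial>lborel) \<longlonglongrightarrow> 0" by simp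
  have "\<forall>\<^sub>F i in sequentially. (\<integral>\<^sup>+q. indicator {0..X i} q * (indicator {0..1} q * m q) \<partial>lborel) = mass (Bk (early l (X i) g))"
    using order_tendstoD(2)[OF X zero_less_one]
  proof eventually_elim
    fix i assume "X i < 1"
    thus "(\<integral>\<^sup>+q. indicator {0..X i} q * (indicator {0..1} q * m q) \<partial>lborel) = mass (Bk (early l (X i) g))"
      unfolding e by (intro nn_integral_cong) (auto simp: indicator_def)
  qed
  from Lim_transform_eventually[OF lim this] show "(\<lambda>i. mass (Bk (early l (X i) g))) \<longlonglongrightarrow> 0" .
qed

lemma exp_minus_1_tendsto_0: "((\<lambda>q. ennreal (exp (l * q) - 1)) \<longlongrightarrow> 0) (at_right (0::real))"
proof -
  have "((\<lambda>q. ennreal (exp (l * q) - 1)) \<longlongrightarrow> ennreal (exp (l * 0) - 1)) (at_right 0)"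
    by (intro tendsto_intros)
  thus ?thesis by simp
qed

text \<open>
  \<open>B\<close> is unbounded, so strong continuity of \<open>S 0\<close> is not enough.  On the range of the
  resolvent \<open>S0_R\<close> expresses \<open>S 0 q f\<close> through \<open>f\<close> and a truncated resolvent integral, both of which
  \<open>B\<close> maps to functions of finite mass.
\<close>

lemma BS0_tendsto:
  assumes g[measurable]: "meas g" and fin: "mass g \<noteq> top" and l: "0 < l"
  shows "((\<lambda>q. edist (Bk (S 0 q (R l g))) (Bk (R l g))) \<longlongrightarrow> 0) (at_right 0)"
proof -
  let ?f = "R l g"
  let ?c = "\<lambda>q. ennreal (exp (l * q))"
  have Bf: "mass (Bk ?f) < top"
    using BR_mass_le[OF g, of l] l fin by (simp add: less_top order_le_less_trans)
  have le: "edist (Bk (S 0 q ?f)) (Bk ?f) \<le> ennreal (exp (l * q) - 1) * mass (Bk ?f) + ?c q * mass (Bk (early l q g))"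
    if q: "0 < q" for q
  proof -
    have c1: "?c q = 1 + ennreal (exp (l * q) - 1)" using q l by (simp add: ennreal_1[symmetric] ennreal_plus[symmetric] del: ennreal_1 ennreal_plus)
    have "edist (Bk (S 0 q ?f)) (Bk ?f) \<le> mass (\<lambda>s v. ennreal (exp (l * q) - 1) * Bk ?f s v + ?c q * Bk (early l q g) s v)"
      unfolding edist_def
    proof (rule mass_mono)
      fix s v assume v[measurable]: "v \<in> space N"
      have "?c q * Bk ?f s v = Bk (\<lambda>s v. ?c q * ?f s v) s v" by (rule Bk_cmult[symmetric]) measurable
      also have "\<dots> = Bk (\<lambda>s v. S 0 q ?f s v + ?c q * early l q g s v) s v"
        by (rule Bk_cong) (use S0_R[OF g, of _ q l] q in simp)
      also have "\<dots> = Bk (S 0 q ?f) s v + Bk (\<lambda>s v. ?c q * early l q g s v) s v"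
        by (rule Bk_add) measurable
      also have "Bk (\<lambda>s v. ?c q * early l q g s v) s v = ?c q * Bk (early l q g) s v"
        by (rule Bk_cmult) measurable
      finally have eq: "?c q * Bk ?f s v = Bk (S 0 q ?f) s v + ?c q * Bk (early l q g) s v" .
      have "Bk (S 0 q ?f) s v \<le> Bk (S 0 q ?f) s v + ?c q * Bk (early l q g) s v" by simp
      also have "\<dots> = ?c q * Bk ?f s v" by (rule eq[symmetric])
      also have "\<dots> = Bk ?f s v + ennreal (exp (l * q) - 1) * Bk ?f s v"
        unfolding c1 by (simp add: distrib_right)
      finally have 1: "Bk (S 0 q ?f) s v \<le> Bk ?f s v + ennreal (exp (l * q) - 1) * Bk ?f s v" .
      have 2: "Bk ?f s v \<le> Bk (S 0 q ?f) s v + ?c q * Bk (early l q g) s v"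
      proof -
        have "Bk ?f s v \<le> ?c q * Bk ?f s v" unfolding c1 by (simp add: distrib_right)
        thus ?thesis unfolding eq .
      qed
      show "absdiff (Bk (S 0 q ?f) s v) (Bk ?f s v) \<le> ennreal (exp (l * q) - 1) * Bk ?f s v + ?c q * Bk (early l q g) s v"
        unfolding absdiff_le_iff
        by (intro conjI order_trans[OF 1] order_trans[OF 2] add_left_mono) (auto simp: add_increasing add_increasing2)
    qed
    also have "\<dots> = mass (\<lambda>s v. ennreal (exp (l * q) - 1) * Bk ?f s v) + mass (\<lambda>s v. ?c q * Bk (early l q g) s v)"
      by (rule mass_add) measurable
    also have "\<dots> = ennreal (exp (l * q) - 1) * mass (Bk ?f) + ?c q * mass (Bk (early l q g))"
      by (intro arg_cong2[where f = "(+)"] mass_cmult) measurable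
    finally show ?thesis .
  qed
  have "((\<lambda>q. mass (Bk ?f) * ennreal (exp (l * q) - 1)) \<longlongrightarrow> mass (Bk ?f) * 0) (at_right 0)"
    by (intro ennreal_tendsto_cmult Bf exp_minus_1_tendsto_0)
  hence t1: "((\<lambda>q. ennreal (exp (l * q) - 1) * mass (Bk ?f)) \<longlongrightarrow> 0) (at_right 0)" by (simp add: mult.commute)
  have "((\<lambda>q. ennreal (exp l) * mass (Bk (early l q g))) \<longlongrightarrow> ennreal (exp l) * 0) (at_right 0)"
    by (intro ennreal_tendsto_cmult Bk_early_tendsto_0[OF g fin l]) simp
  with t1 have "((\<lambda>q. ennreal (exp (l * q) - 1) * mass (Bk ?f) + ennreal (exp l) * mass (Bk (early l q g))) \<longlongrightarrow> 0 + 0) (at_right 0)"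
    by (intro tendsto_add) simp_all
  hence lim: "((\<lambda>q. ennreal (exp (l * q) - 1) * mass (Bk ?f) + ennreal (exp l) * mass (Bk (early l q g))) \<longlongrightarrow> 0) (at_right 0)"
    by simp
  have "\<forall>\<^sub>F q in at_right 0. 0 < q \<and> q < (1::real)" by (auto simp: eventually_at_right_field intro: exI[of _ 1])
  hence "\<forall>\<^sub>F q in at_right 0. edist (Bk (S 0 q ?f)) (Bk ?f) \<le> ennreal (exp (l * q) - 1) * mass (Bk ?f) + ennreal (exp l) * mass (Bk (early l q g))"
  proof eventually_elim
    fix q :: real assume q: "0 < q \<and> q < 1"
    have "?c q * mass (Bk (early l q g)) \<le> ennreal (exp l) * mass (Bk (early l q g))"
      using q l by (intro mult_right_mono ennreal_leI) auto
    with le[of q] q show "edist (Bk (S 0 q ?f)) (Bk ?f) \<le> ennreal (exp (l * q) - 1) * mass (Bk ?f) + ennreal (exp l) * mass (Bk (early l q g))"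
      by (meson add_left_mono order_trans)
  qed
  from tendsto_sandwich[OF _ this tendsto_const lim] show ?thesis by simp
qed

lemma T_tendsto:
  assumes F: "meas F" and fin: "mass F \<noteq> top"
  shows "((\<lambda>\<tau>. edist (T \<tau> F) F) \<longlongrightarrow> 0) (at_right 0)"
proof -
  have "((\<lambda>\<tau>. 2 * edist (S 0 \<tau> F) F) \<longlongrightarrow> 2 * 0) (at_right 0)"
    by (intro ennreal_tendsto_cmult S0_tendsto[OF F fin]) simp
  hence lim: "((\<lambda>\<tau>. 2 * edist (S 0 \<tau> F) F) \<longlongrightarrow> 0) (at_right 0)" by simp
  have "\<forall>\<^sub>F \<tau> in at_right 0. edist (T \<tau> F) F \<le> 2 * edist (S 0 \<tau> F) F"
    using eventually_at_right_less[of "0::real"] by eventually_elim (rule edist_T_S0[OF F fin], simp)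
  from tendsto_sandwich[OF _ this tendsto_const lim] show ?thesis by simp
qed

lemma tendsto_0_at_right_delta:
  fixes f :: "real \<Rightarrow> ennreal"
  assumes "(f \<longlongrightarrow> 0) (at_right 0)" "0 < e"
  shows "\<exists>\<delta>>0. \<forall>q. 0 < q \<longrightarrow> q < \<delta> \<longrightarrow> f q < e"
  using order_tendstoD(2)[OF assms] by (auto simp: eventually_at_right_field)

lemma gain_average_tendsto:
  assumes g[measurable]: "meas g" and fin: "mass g \<noteq> top" and l: "0 < l"
  shows "((\<lambda>\<tau>. edist (\<lambda>s v. ennreal (1 / \<tau>) * (\<integral>\<^sup>+q. indicator {0..\<tau>} q * T (\<tau> - q) (Bk (S 0 q (R l g))) s v \<partial>lborel)) (Bk (R l g))) \<longlongrightarrow> 0) (at_right 0)"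
proof (rule averages_tendsto)
  let ?f = "R l g"
  have Bf: "mass (Bk ?f) \<noteq> top"
    using BR_mass_le[OF g, of l] l fin by (auto simp: top_unique)
  have [measurable]: "meas (Bk ?f)" by measurable
  show "meas (Bk ?f)" by measurable
  show "rmeas (\<lambda>q. T (\<tau> - q) (Bk (S 0 q ?f)))" for \<tau> by measurable
  fix e :: ennreal assume "0 < e"
  then obtain e' where e': "0 < e'" "e' + e' < e" using ennreal_half_less by blast
  from tendsto_0_at_right_delta[OF BS0_tendsto[OF g fin l] e'(1)] obtain d1 where
    d1: "d1 > 0" "\<And>q. 0 < q \<Longrightarrow> q < d1 \<Longrightarrow> edist (Bk (S 0 q ?f)) (Bk ?f) < e'" by blast
  from tendsto_0_at_right_delta[OF T_tendsto[OF \<open>meas (Bk ?f)\<close> Bf] e'(1)] obtain d2 where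
    d2: "d2 > 0" "\<And>q. 0 < q \<Longrightarrow> q < d2 \<Longrightarrow> edist (T q (Bk ?f)) (Bk ?f) < e'" by blast
  show "\<exists>\<delta>>0. \<forall>\<tau> q. 0 < q \<longrightarrow> q < \<tau> \<longrightarrow> \<tau> < \<delta> \<longrightarrow> edist (T (\<tau> - q) (Bk (S 0 q ?f))) (Bk ?f) \<le> e"
  proof (intro exI[of _ "min d1 d2"] conjI allI impI)
    fix \<tau> q :: real assume q: "0 < q" "q < \<tau>" "\<tau> < min d1 d2"
    have "edist (T (\<tau> - q) (Bk (S 0 q ?f))) (Bk ?f) \<le> edist (T (\<tau> - q) (Bk (S 0 q ?f))) (T (\<tau> - q) (Bk ?f)) + edist (T (\<tau> - q) (Bk ?f)) (Bk ?f)"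
      by (rule edist_triangle) measurable
    also have "\<dots> \<le> e' + e'"
    proof (rule add_mono)
      have "edist (T (\<tau> - q) (Bk (S 0 q ?f))) (T (\<tau> - q) (Bk ?f)) \<le> edist (Bk (S 0 q ?f)) (Bk ?f)"
        by (rule edist_T_le) (use q in \<open>measurable, auto\<close>)
      also have "\<dots> \<le> e'" using d1(2)[of q] q by auto
      finally show "edist (T (\<tau> - q) (Bk (S 0 q ?f))) (T (\<tau> - q) (Bk ?f)) \<le> e'" .
      show "edist (T (\<tau> - q) (Bk ?f)) (Bk ?f) \<le> e'" using d2(2)[of "\<tau> - q"] q by auto
    qed
    finally show "edist (T (\<tau> - q) (Bk (S 0 q ?f))) (Bk ?f) \<le> e" using e' by auto
  qed (use d1 d2 in auto)
qed

lemma early_average_tendsto: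
  assumes g[measurable]: "meas g" and fin: "mass g \<noteq> top" and l: "0 < l"
  shows "((\<lambda>\<tau>. edist (\<lambda>s v. ennreal (1 / \<tau>) * (ennreal (exp (l * \<tau>)) * early l \<tau> g s v)) g) \<longlongrightarrow> 0) (at_right 0)"
proof -
  have "ennreal (exp (l * \<tau>)) * early l \<tau> g s v = (\<integral>\<^sup>+q. indicator {0..\<tau>} q * (ennreal (exp (l * (\<tau> - q))) * S 0 q g s v) \<partial>lborel)"
    if [measurable]: "v \<in> space N" for \<tau> s v
    unfolding early_def
  proof (subst nn_integral_cmult[symmetric], measurable, rule nn_integral_cong)
    fix q
    have "ennreal (exp (l * (\<tau> - q))) = ennreal (exp (l * \<tau>)) * ennreal (exp (- l * q))"
      by (simp add: ennreal_mult'[symmetric] exp_add[symmetric] algebra_simps)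
    thus "ennreal (exp (l * \<tau>)) * (indicator {0..\<tau>} q * (ennreal (exp (- l * q)) * S 0 q g s v)) =
       indicator {0..\<tau>} q * (ennreal (exp (l * (\<tau> - q))) * S 0 q g s v)" by (simp add: mult_ac)
  qed
  hence "edist (\<lambda>s v. ennreal (1 / \<tau>) * (ennreal (exp (l * \<tau>)) * early l \<tau> g s v)) g =
     edist (\<lambda>s v. ennreal (1 / \<tau>) * (\<integral>\<^sup>+q. indicator {0..\<tau>} q * (ennreal (exp (l * (\<tau> - q))) * S 0 q g s v) \<partial>lborel)) g" for \<tau>
    unfolding edist_def by (intro mass_cong) simp
  moreover have "((\<lambda>\<tau>. edist (\<lambda>s v. ennreal (1 / \<tau>) * (\<integral>\<^sup>+q. indicator {0..\<tau>} q * (ennreal (exp (l * (\<tau> - q))) * S 0 q g s v) \<partial>lborel)) g) \<longlongrightarrow> 0) (at_right 0)"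
  proof (rule averages_tendsto[OF g])
    show "rmeas (\<lambda>q s v. ennreal (exp (l * (\<tau> - q))) * S 0 q g s v)" for \<tau> by measurable
    fix e :: ennreal assume "0 < e"
    then obtain e' where e': "0 < e'" "e' + e' < e" using ennreal_half_less by blast
    from tendsto_0_at_right_delta[OF S0_tendsto[OF g fin] e'(1)] obtain d1 where
      d1: "d1 > 0" "\<And>q. 0 < q \<Longrightarrow> q < d1 \<Longrightarrow> edist (S 0 q g) g < e'" by blast
    have "((\<lambda>q. mass g * ennreal (exp (l * q) - 1)) \<longlongrightarrow> mass g * 0) (at_right 0)"
      using fin by (intro ennreal_tendsto_cmult exp_minus_1_tendsto_0) (simp add: less_top)
    hence "((\<lambda>q. mass g * ennreal (exp (l * q) - 1)) \<longlongrightarrow> 0) (at_right 0)" by simp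
    from tendsto_0_at_right_delta[OF this e'(1)] obtain d2 where
      d2: "d2 > 0" "\<And>q. 0 < q \<Longrightarrow> q < d2 \<Longrightarrow> mass g * ennreal (exp (l * q) - 1) < e'" by blast
    show "\<exists>\<delta>>0. \<forall>\<tau> q. 0 < q \<longrightarrow> q < \<tau> \<longrightarrow> \<tau> < \<delta> \<longrightarrow> edist (\<lambda>s v. ennreal (exp (l * (\<tau> - q))) * S 0 q g s v) g \<le> e"
    proof (intro exI[of _ "min d1 d2"] conjI allI impI)
      fix \<tau> q :: real assume q: "0 < q" "q < \<tau>" "\<tau> < min d1 d2"
      have c1: "ennreal (exp (l * (\<tau> - q))) = 1 + ennreal (exp (l * (\<tau> - q)) - 1)"
        using q l by (simp add: ennreal_1[symmetric] ennreal_plus[symmetric] del: ennreal_1 ennreal_plus)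
      have "edist (\<lambda>s v. ennreal (exp (l * (\<tau> - q))) * S 0 q g s v) g \<le>
         edist (\<lambda>s v. ennreal (exp (l * (\<tau> - q))) * S 0 q g s v) (S 0 q g) + edist (S 0 q g) g"
        by (rule edist_triangle) measurable
      also have "\<dots> \<le> e' + e'"
      proof (rule add_mono)
        have "edist (\<lambda>s v. ennreal (exp (l * (\<tau> - q))) * S 0 q g s v) (S 0 q g) \<le> mass (\<lambda>s v. ennreal (exp (l * (\<tau> - q)) - 1) * S 0 q g s v)"
          by (rule edist_mass_diff) (measurable, simp add: c1 distrib_right)
        also have "\<dots> = ennreal (exp (l * (\<tau> - q)) - 1) * mass (S 0 q g)" by (rule mass_cmult) measurable
        also have "\<dots> \<le> ennreal (exp (l * (\<tau> - q)) - 1) * mass g"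
          by (intro mult_left_mono S_mass_le g) (use q in auto)
        also have "\<dots> \<le> e'" using d2(2)[of "\<tau> - q"] q by (simp add: mult.commute less_imp_le)
        finally show "edist (\<lambda>s v. ennreal (exp (l * (\<tau> - q))) * S 0 q g s v) (S 0 q g) \<le> e'" .
        show "edist (S 0 q g) g \<le> e'" using d1(2)[of q] q by auto
      qed
      finally show "edist (\<lambda>s v. ennreal (exp (l * (\<tau> - q))) * S 0 q g s v) g \<le> e" using e' by auto
    qed (use d1 d2 in auto)
  qed
  ultimately show ?thesis by simp
qed

lemma R_finite_mass:
  assumes g: "meas g" and fin: "mass g \<noteq> top" and l: "0 < l"
  shows "mass (R l g) \<noteq> top"
proof
  assume "mass (R l g) = top"
  with R_mass_le'[OF g, of l] l have "top \<le> mass g" by (simp add: ennreal_mult_top)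
  with fin show False by (simp add: top_unique)
qed

text \<open>
  The generator of \<open>T\<close> maps \<open>f = R g\<close> to \<open>l f + B f - g\<close>; the terms are distributed over the two
  arguments of the distance so that no subtraction occurs.  By Duhamel's formula the difference quotient
  of \<open>T\<close> consists of that of \<open>S 0\<close>, which \<open>S0_R\<close> evaluates, and of an average of scattered particles,
  which tends to \<open>B f\<close>.
\<close>

theorem resolvent_generator_limit:
  assumes g[measurable]: "meas g" and fin: "mass g \<noteq> top" and l: "0 < l"
  defines "f \<equiv> R l g"
  shows "((\<lambda>\<tau>. mass (\<lambda>s v. absdiff (ennreal (1 / \<tau>) * T \<tau> f s v + g s v)
      (ennreal (1 / \<tau>) * f s v + (ennreal l * f s v + Bk f s v)))) \<longlongrightarrow> 0) (at_right 0)"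
proof -
  have f[measurable]: "meas f" unfolding f_def by measurable
  have ffin: "mass f \<noteq> top" unfolding f_def by (rule R_finite_mass[OF g fin l])
  let ?D = "\<lambda>\<tau> s v. \<integral>\<^sup>+q. indicator {0..\<tau>} q * T (\<tau> - q) (Bk (S 0 q f)) s v \<partial>lborel"
  let ?Z = "\<lambda>\<tau> s v. ennreal (1 / \<tau>) * (ennreal (exp (l * \<tau>)) * early l \<tau> g s v)"
  let ?k = "\<lambda>\<tau>. ennreal \<bar>exp (l * \<tau>) / \<tau> - (1 / \<tau> + l)\<bar>"
  let ?e = "\<lambda>\<tau>. mass (\<lambda>s v. absdiff (ennreal (1 / \<tau>) * T \<tau> f s v + g s v)
      (ennreal (1 / \<tau>) * f s v + (ennreal l * f s v + Bk f s v)))"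
  let ?r = "\<lambda>\<tau>. mass f * ?k \<tau> + (edist (\<lambda>s v. ennreal (1 / \<tau>) * ?D \<tau> s v) (Bk f) + edist (?Z \<tau>) g)"
  have le: "?e \<tau> \<le> ?r \<tau>" if t: "0 < \<tau>" for \<tau>
  proof -
    have "?e \<tau> \<le> mass (\<lambda>s v. ?k \<tau> * f s v + (absdiff (ennreal (1 / \<tau>) * ?D \<tau> s v) (Bk f s v) + absdiff (?Z \<tau> s v) (g s v)))"
      unfolding mass_def
    proof (rule nn_integral_mono_AE)
      have "AE s in lborel. AE v in N. f s v \<noteq> top"
        using mass_finite_AE[OF f ffin] by (subst (asm) AE_pair_iff(1)) measurable
      thus "AE s in lborel. (\<integral>\<^sup>+v. absdiff (ennreal (1 / \<tau>) * T \<tau> f s v + g s v) (ennreal (1 / \<tau>) * f s v + (ennreal l * f s v + Bk f s v)) \<partial>N) \<le>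
        (\<integral>\<^sup>+v. ?k \<tau> * f s v + (absdiff (ennreal (1 / \<tau>) * ?D \<tau> s v) (Bk f s v) + absdiff (?Z \<tau> s v) (g s v)) \<partial>N)"
      proof eventually_elim
        fix s assume "AE v in N. f s v \<noteq> top"
        hence "AE v in N. absdiff (ennreal (1 / \<tau>) * T \<tau> f s v + g s v) (ennreal (1 / \<tau>) * f s v + (ennreal l * f s v + Bk f s v)) \<le>
          ?k \<tau> * f s v + (absdiff (ennreal (1 / \<tau>) * ?D \<tau> s v) (Bk f s v) + absdiff (?Z \<tau> s v) (g s v))"
          using AE_space
        proof eventually_elim
          fix v assume fv: "f s v \<noteq> top" and v: "v \<in> space N"
          have sr: "S 0 \<tau> f s v + ennreal (exp (l * \<tau>)) * early l \<tau> g s v = ennreal (exp (l * \<tau>)) * f s v"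
            unfolding f_def by (rule S0_R[OF g v]) (use t in simp)
          have "ennreal (exp (l * \<tau>)) * early l \<tau> g s v \<le> ennreal (exp (l * \<tau>)) * f s v"
            unfolding sr[symmetric] by simp
          also have "\<dots> < top" using fv by (simp add: ennreal_mult_less_top less_top)
          finally have Zfin: "?Z \<tau> s v < top" by (simp add: ennreal_mult_less_top)
          have X: "ennreal (1 / \<tau>) * T \<tau> f s v + g s v + ?Z \<tau> s v =
            ennreal (exp (l * \<tau>) / \<tau>) * f s v + (ennreal (1 / \<tau>) * ?D \<tau> s v + g s v)"
          proof -
            have "ennreal (1 / \<tau>) * T \<tau> f s v + g s v + ?Z \<tau> s v =
              ennreal (1 / \<tau>) * (S 0 \<tau> f s v + ennreal (exp (l * \<tau>)) * early l \<tau> g s v) + (ennreal (1 / \<tau>) * ?D \<tau> s v + g s v)"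
              unfolding T_Duhamel[OF f v, of \<tau> s] by (simp add: distrib_left ac_simps)
            also have "ennreal (1 / \<tau>) * (S 0 \<tau> f s v + ennreal (exp (l * \<tau>)) * early l \<tau> g s v) = ennreal (exp (l * \<tau>) / \<tau>) * f s v"
              unfolding sr mult.assoc[symmetric] using t by (simp add: ennreal_mult'[symmetric])
            finally show ?thesis .
          qed
          have Y: "ennreal (1 / \<tau>) * f s v + (ennreal l * f s v + Bk f s v) + ?Z \<tau> s v =
            ennreal (1 / \<tau> + l) * f s v + (Bk f s v + ?Z \<tau> s v)"
          proof -
            have "ennreal (1 / \<tau> + l) = ennreal (1 / \<tau>) + ennreal l"
              by (rule ennreal_plus) (use t l in auto)
            thus ?thesis by (simp add: distrib_right add.assoc)
          qed
          have "absdiff (ennreal (1 / \<tau>) * T \<tau> f s v + g s v) (ennreal (1 / \<tau>) * f s v + (ennreal l * f s v + Bk f s v)) \<le>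
             absdiff (ennreal (exp (l * \<tau>) / \<tau>) * f s v + (ennreal (1 / \<tau>) * ?D \<tau> s v + g s v)) (ennreal (1 / \<tau> + l) * f s v + (Bk f s v + ?Z \<tau> s v))"
            using absdiff_cancel[OF Zfin] unfolding X[symmetric] Y[symmetric] .
          also have "\<dots> \<le> absdiff (ennreal (exp (l * \<tau>) / \<tau>) * f s v) (ennreal (1 / \<tau> + l) * f s v) +
              (absdiff (ennreal (1 / \<tau>) * ?D \<tau> s v) (Bk f s v) + absdiff (g s v) (?Z \<tau> s v))"
            by (rule order_trans[OF absdiff_add add_left_mono[OF absdiff_add]])
          also have "absdiff (ennreal (exp (l * \<tau>) / \<tau>) * f s v) (ennreal (1 / \<tau> + l) * f s v) \<le> ?k \<tau> * f s v"
          proof -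
            have "absdiff (ennreal (exp (l * \<tau>) / \<tau>) * f s v) (ennreal (1 / \<tau> + l) * f s v) \<le> f s v * absdiff (ennreal (exp (l * \<tau>) / \<tau>)) (ennreal (1 / \<tau> + l))"
              unfolding mult.commute[of _ "f s v"] by (rule absdiff_mult)
            also have "absdiff (ennreal (exp (l * \<tau>) / \<tau>)) (ennreal (1 / \<tau> + l)) = ?k \<tau>"
              by (rule absdiff_ennreal) (use t l in auto)
            finally show ?thesis by (simp add: mult.commute)
          qed
          finally show "absdiff (ennreal (1 / \<tau>) * T \<tau> f s v + g s v) (ennreal (1 / \<tau>) * f s v + (ennreal l * f s v + Bk f s v)) \<le>
            ?k \<tau> * f s v + (absdiff (ennreal (1 / \<tau>) * ?D \<tau> s v) (Bk f s v) + absdiff (?Z \<tau> s v) (g s v))"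
            by (simp add: add_right_mono absdiff_commute[of "g s v"])
        qed
        thus "(\<integral>\<^sup>+v. absdiff (ennreal (1 / \<tau>) * T \<tau> f s v + g s v) (ennreal (1 / \<tau>) * f s v + (ennreal l * f s v + Bk f s v)) \<partial>N) \<le>
          (\<integral>\<^sup>+v. ?k \<tau> * f s v + (absdiff (ennreal (1 / \<tau>) * ?D \<tau> s v) (Bk f s v) + absdiff (?Z \<tau> s v) (g s v)) \<partial>N)"
          by (rule nn_integral_mono_AE)
      qed
    qed
    also have "\<dots> = mass (\<lambda>s v. ?k \<tau> * f s v) + mass (\<lambda>s v. absdiff (ennreal (1 / \<tau>) * ?D \<tau> s v) (Bk f s v) + absdiff (?Z \<tau> s v) (g s v))"
      by (rule mass_add) measurable
    also have "\<dots> = ?r \<tau>"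
      unfolding edist_def by (subst mass_cmult, measurable, subst mass_add) (measurable, simp add: mult.commute)
    finally show ?thesis .
  qed
  have "((\<lambda>\<tau>. exp (l * \<tau>) / \<tau> - (1 / \<tau> + l)) \<longlongrightarrow> 0) (at_right 0)"
  proof -
    have "((\<lambda>x. exp (l * x)) has_real_derivative l) (at 0)"
      by (auto intro!: derivative_eq_intros)
    hence "((\<lambda>h. (exp (l * (0 + h)) - exp (l * 0)) / h) \<longlongrightarrow> l) (at 0)" unfolding DERIV_def .
    hence "((\<lambda>h. (exp (l * h) - 1) / h - l) \<longlongrightarrow> l - l) (at 0)" by (intro tendsto_diff tendsto_const) simp
    hence "((\<lambda>h. (exp (l * h) - 1) / h - l) \<longlongrightarrow> 0) (at_right 0)" by (simp add: filterlim_at_split)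
    thus ?thesis by (simp add: diff_divide_distrib algebra_simps)
  qed
  hence "(?k \<longlongrightarrow> ennreal \<bar>0\<bar>) (at_right 0)" by (intro tendsto_intros)
  hence "((\<lambda>\<tau>. mass f * ?k \<tau>) \<longlongrightarrow> mass f * ennreal \<bar>0\<bar>) (at_right 0)"
    using ffin by (intro ennreal_tendsto_cmult) (auto simp: less_top)
  hence k: "((\<lambda>\<tau>. mass f * ?k \<tau>) \<longlongrightarrow> 0) (at_right 0)" by simp
  have "(?r \<longlongrightarrow> 0 + (0 + 0)) (at_right 0)"
    by (intro tendsto_add k) (use gain_average_tendsto[OF g fin l] early_average_tendsto[OF g fin l] in \<open>simp_all add: f_def\<close>)
  hence r: "(?r \<longlongrightarrow> 0) (at_right 0)" by simp
  have "\<forall>\<^sub>F \<tau> in at_right 0. ?e \<tau> \<le> ?r \<tau>"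
    using eventually_at_right_less[of "0::real"] by eventually_elim (rule le)
  from tendsto_sandwich[OF _ this tendsto_const r] show ?thesis by simp
qed

end

section \<open>Extension of the data to the whole line\<close>

text \<open>
  The data of the theorem, for an arbitrary topological space of velocities.
\<close>

locale kinetic_data =
  fixes \<mu> :: "'a :: topological_space measure"
    and Sig :: "real \<times> 'a \<Rightarrow> real" and b :: "real \<times> 'a \<times> 'a \<Rightarrow> real"
  assumes borel: "sets \<mu> = sets borel"
    and sigma_finite: "sigma_finite_measure \<mu>"
    and Sig_measurable: "Sig \<in> borel_measurable (tvmeas \<mu>)"
    and Sig_nonneg: "\<And>t v. t \<ge> 0 \<Longrightarrow> v \<in> supp \<mu> \<Longrightarrow> Sig (t, v) \<ge> 0"
    and Sig_locally_integrable:
      "AE v in vmeas \<mu>. \<forall>T\<ge>0. set_integrable lborel {0..T} (\<lambda>t. Sig (t, v))"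
    and b_measurable: "b \<in> borel_measurable (tmeas \<Otimes>\<^sub>M (vmeas \<mu> \<Otimes>\<^sub>M vmeas \<mu>))"
    and b_nonneg:
      "\<And>t v v'. t \<ge> 0 \<Longrightarrow> v \<in> supp \<mu> \<Longrightarrow> v' \<in> supp \<mu> \<Longrightarrow> b (t, v, v') \<ge> 0"
    and b_le_Sig:
      "AE (t, v') in tvmeas \<mu>.
        (\<integral>\<^sup>+ v. ennreal (b (t, v, v')) \<partial>vmeas \<mu>) \<le> ennreal (Sig (t, v'))"
begin

abbreviation "N \<equiv> vmeas \<mu>"

lemma supp_measurable: "supp \<mu> \<in> sets \<mu>"
proof -
  have "- supp \<mu> = \<Union>{U. open U \<and> emeasure \<mu> U = 0}" unfolding supp_def by auto
  hence "open (- supp \<mu>)" by auto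
  hence "supp \<mu> \<in> sets borel" by (intro borel_closed) (simp add: closed_def)
  thus ?thesis using borel by simp
qed

lemma space_N: "space N = supp \<mu>"
  unfolding vmeas_def space_restrict_space using sets.sets_into_space[OF supp_measurable] by auto

lemma sigma_finite_N: "sigma_finite_measure N"
  unfolding vmeas_def by (rule sigma_finite_measure_restrict_space[OF sigma_finite supp_measurable])

lemma space_tmeas: "space tmeas = {0..}" by (simp add: tmeas_def space_restrict_space)

lemma sigma_finite_tmeas: "sigma_finite_measure tmeas"
  unfolding tmeas_def by (rule sigma_finite_measure_restrict_space) (auto intro: sigma_finite_lborel)

lemma clip_time_measurable:
  "(\<lambda>x. max 0 (fst x)) \<in> measurable (borel \<Otimes>\<^sub>M Q) tmeas"
  unfolding tmeas_def by (rule measurable_restrict_space2) auto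

text \<open>
  Functions on the half line extended by a constant to negative times; clipping the time at \<open>0\<close>
  keeps the original function away from times where it is not measurable.
\<close>

lemma extend_measurable:
  assumes h: "h \<in> borel_measurable (tmeas \<Otimes>\<^sub>M Q)" and c: "c \<in> space borel"
  shows "(\<lambda>x. if 0 \<le> fst x then h x else c) \<in> borel_measurable (borel \<Otimes>\<^sub>M Q)"
proof -
  note [measurable] = clip_time_measurable[of Q]
  have [measurable]: "(\<lambda>x. h (max 0 (fst x), snd x)) \<in> borel_measurable (borel \<Otimes>\<^sub>M Q)"
    by (rule measurable_compose[OF _ h]) measurable
  have "(\<lambda>x. if 0 \<le> fst x then h (max 0 (fst x), snd x) else c) \<in> borel_measurable (borel \<Otimes>\<^sub>M Q)"
    by measurable
  also have "(\<lambda>x. if 0 \<le> fst x then h (max 0 (fst x), snd x) else c) = (\<lambda>x. if 0 \<le> fst x then h x else c)"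
    by (auto simp: max_def fun_eq_iff)
  finally show ?thesis .
qed

lemma nn_integral_tvmeas:
  assumes [measurable]: "h \<in> borel_measurable (tvmeas \<mu>)"
  shows "(\<integral>\<^sup>+x. h x \<partial>tvmeas \<mu>) = (\<integral>\<^sup>+s. \<integral>\<^sup>+v. (if 0 \<le> s then h (s, v) else 0) \<partial>N \<partial>lborel)"
proof -
  interpret N: sigma_finite_measure N by (rule sigma_finite_N)
  have "(\<integral>\<^sup>+x. h x \<partial>tvmeas \<mu>) = (\<integral>\<^sup>+s. \<integral>\<^sup>+v. h (s, v) \<partial>N \<partial>tmeas)"
    using N.nn_integral_fst[of h tmeas] assms unfolding tvmeas_def by simp
  also have "\<dots> = (\<integral>\<^sup>+s. (\<integral>\<^sup>+v. h (s, v) \<partial>N) * indicator {0..} s \<partial>lborel)"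
    unfolding tmeas_def by (rule nn_integral_restrict_space) simp
  also have "\<dots> = (\<integral>\<^sup>+s. \<integral>\<^sup>+v. (if 0 \<le> s then h (s, v) else 0) \<partial>N \<partial>lborel)"
    by (intro nn_integral_cong) (auto simp: indicator_def)
  finally show ?thesis .
qed

lemma AE_tvmeasD:
  assumes "AE x in tvmeas \<mu>. P x"
  shows "AE s in lborel. 0 \<le> s \<longrightarrow> (AE v in N. P (s, v))"
proof -
  interpret N: sigma_finite_measure N by (rule sigma_finite_N)
  interpret t: sigma_finite_measure tmeas by (rule sigma_finite_tmeas)
  interpret pair_sigma_finite tmeas N ..
  have "AE s in tmeas. AE v in N. P (s, v)"
    using AE_pair[of P] assms unfolding tvmeas_def by simp
  thus ?thesis unfolding tmeas_def by (subst (asm) AE_restrict_space_iff) auto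
qed

lemma AE_tvmeasI:
  assumes "{x \<in> space (tvmeas \<mu>). P x} \<in> sets (tvmeas \<mu>)"
    and "AE s in lborel. 0 \<le> s \<longrightarrow> (AE v in N. P (s, v))"
  shows "AE x in tvmeas \<mu>. P x"
proof -
  interpret N: sigma_finite_measure N by (rule sigma_finite_N)
  interpret t: sigma_finite_measure tmeas by (rule sigma_finite_tmeas)
  interpret pair_sigma_finite tmeas N ..
  have "AE s in tmeas. AE v in N. P (s, v)"
    using assms(2) unfolding tmeas_def by (subst AE_restrict_space_iff) auto
  thus ?thesis using AE_pair_measure[of P] assms(1) unfolding tvmeas_def by simp
qed

definition Sig0 :: "real \<times> 'a \<Rightarrow> real" where
  "Sig0 x = (if 0 \<le> fst x then Sig x else 0)"

definition b0 :: "real \<times> 'a \<times> 'a \<Rightarrow> real" where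
  "b0 x = (if 0 \<le> fst x then b x else 0)"

lemma Sig0_measurable[measurable]: "Sig0 \<in> borel_measurable (borel \<Otimes>\<^sub>M N)"
  using extend_measurable[of Sig N 0] Sig_measurable unfolding tvmeas_def Sig0_def[abs_def] by simp

lemma b0_measurable[measurable]: "b0 \<in> borel_measurable (borel \<Otimes>\<^sub>M N \<Otimes>\<^sub>M N)"
  using extend_measurable[of b "N \<Otimes>\<^sub>M N" 0] b_measurable unfolding b0_def[abs_def] by simp

lemma b0_eq: "0 \<le> r \<Longrightarrow> b0 (r, v, w) = b (r, v, w)" by (simp add: b0_def)

lemma B_h_b0: assumes "0 \<le> r" shows "B_h \<mu> b r = B_h \<mu> b0 r"
  unfolding B_h_def[abs_def] dom_B_h_def sigma_h_def[abs_def] b0_eq[OF assms] ..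

lemma U_h_Sig0: assumes "0 \<le> s" shows "U_h Sig t s = U_h Sig0 t s"
proof -
  have "(LBINT \<tau>:{s..t}. Sig (\<tau>, v)) = (LBINT \<tau>:{s..t}. Sig0 (\<tau>, v))" for v
    by (rule set_lebesgue_integral_cong) (use assms in \<open>auto simp: Sig0_def\<close>)
  thus ?thesis unfolding U_h_def[abs_def] by simp
qed

lemma Vn_h_0: "0 \<le> s \<Longrightarrow> Vn_h \<mu> Sig b n t s \<phi> v = Vn_h \<mu> Sig0 b0 n t s \<phi> v"
proof (induction n arbitrary: s \<phi>)
  case 0 thus ?case by (simp add: U_h_Sig0)
next
  case (Suc n)
  have "(LBINT r:{s..t}. Vn_h \<mu> Sig b n t r (B_h \<mu> b r (U_h Sig r s \<phi>)) v) =
     (LBINT r:{s..t}. Vn_h \<mu> Sig0 b0 n t r (B_h \<mu> b0 r (U_h Sig0 r s \<phi>)) v)"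
    by (rule set_lebesgue_integral_cong) (use Suc in \<open>auto simp: B_h_b0 U_h_Sig0\<close>)
  thus ?case by simp
qed

lemma U_h_measurable[measurable (raw)]:
  assumes [measurable]: "T \<in> borel_measurable Q" "S \<in> borel_measurable Q" "V \<in> measurable Q N"
    "case_prod \<Phi> \<in> borel_measurable (Q \<Otimes>\<^sub>M N)"
  shows "(\<lambda>q. U_h Sig0 (T q) (S q) (\<Phi> q) (V q)) \<in> borel_measurable Q"
  unfolding U_h_def set_lebesgue_integral_def by measurable

lemma sigma_h_measurable[measurable (raw)]:
  assumes [measurable]: "T \<in> borel_measurable Q" "V \<in> measurable Q N"
  shows "(\<lambda>q. sigma_h \<mu> b0 (T q) (V q)) \<in> borel_measurable Q"
proof -
  interpret N: sigma_finite_measure N by (rule sigma_finite_N)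
  show ?thesis unfolding sigma_h_def by measurable
qed

lemma dom_B_h_iff:
  assumes [measurable]: "\<phi> \<in> borel_measurable N"
  shows "\<phi> \<in> dom_B_h \<mu> b0 r \<longleftrightarrow> (\<integral>\<^sup>+v. ennreal \<bar>\<phi> v\<bar> \<partial>N) < \<infinity> \<and> (\<integral>\<^sup>+v. sigma_h \<mu> b0 r v * ennreal \<bar>\<phi> v\<bar> \<partial>N) < \<infinity>"
  unfolding dom_B_h_def mem_Collect_eq integrable_iff_bounded
  by (subst nn_integral_density) auto

lemma B_h_measurable[measurable (raw)]:
  assumes [measurable]: "T \<in> borel_measurable Q" "V \<in> measurable Q N"
    "case_prod \<Phi> \<in> borel_measurable (Q \<Otimes>\<^sub>M N)"
  shows "(\<lambda>q. B_h \<mu> b0 (T q) (\<Phi> q) (V q)) \<in> borel_measurable Q"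
proof -
  interpret N: sigma_finite_measure N by (rule sigma_finite_N)
  let ?P = "\<lambda>q. (\<integral>\<^sup>+v. ennreal \<bar>\<Phi> q v\<bar> \<partial>N) < \<infinity> \<and> (\<integral>\<^sup>+v. sigma_h \<mu> b0 (T q) v * ennreal \<bar>\<Phi> q v\<bar> \<partial>N) < \<infinity>"
  have [measurable]: "Measurable.pred Q ?P" by measurable
  have "(\<lambda>q. if ?P q then (\<integral>v'. b0 (T q, V q, v') * \<Phi> q v' \<partial>N) else 0) \<in> borel_measurable Q"
    by measurable
  also have "?this \<longleftrightarrow> (\<lambda>q. B_h \<mu> b0 (T q) (\<Phi> q) (V q)) \<in> borel_measurable Q"
  proof (rule measurable_cong)
    fix q assume [measurable]: "q \<in> space Q"
    have "\<Phi> q \<in> borel_measurable N" by measurable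
    from dom_B_h_iff[OF this] show "(if ?P q then (\<integral>v'. b0 (T q, V q, v') * \<Phi> q v' \<partial>N) else 0) = B_h \<mu> b0 (T q) (\<Phi> q) (V q)"
      unfolding B_h_def by simp
  qed
  finally show ?thesis .
qed

section \<open>Measurability of the Dyson--Phillips terms\<close>

text \<open>
  The Dyson--Phillips terms are recursive in their initial state, which in turn depends on further
  time parameters.  To make the induction on \<open>n\<close> close, the state depends on a sequence of reals: each
  step stores the two times of the new state in the first two entries and shifts the others.
\<close>

abbreviation "PM \<equiv> (\<Pi>\<^sub>M i\<in>(UNIV :: nat set). (borel :: real measure))"

lemma Vn_h_measurable_PM:
  assumes "case_prod \<psi> \<in> borel_measurable (PM \<Otimes>\<^sub>M N)"
  shows "(\<lambda>(x, t, s, v). Vn_h \<mu> Sig0 b0 n t s (\<psi> x) v) \<in> borel_measurable (PM \<Otimes>\<^sub>M borel \<Otimes>\<^sub>M borel \<Otimes>\<^sub>M N)"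
  using assms
proof (induction n arbitrary: \<psi>)
  case 0
  note [measurable] = 0
  show ?case by (simp, measurable)
next
  case (Suc n)
  note [measurable] = Suc.prems
  define sh where "sh y = (\<lambda>i. y (i + 2))" for y :: "nat \<Rightarrow> real"
  define \<psi>' where "\<psi>' y w = B_h \<mu> b0 (y 0) (U_h Sig0 (y 0) (y 1) (\<psi> (sh y))) w" for y :: "nat \<Rightarrow> real" and w
  have [measurable]: "sh \<in> measurable PM PM"
    unfolding sh_def[abs_def] by (rule measurable_PiM_single') auto
  have "case_prod \<psi>' \<in> borel_measurable (PM \<Otimes>\<^sub>M N)"
    unfolding \<psi>'_def by measurable
  from Suc.IH[OF this] have IH: "(\<lambda>(x, t, s, v). Vn_h \<mu> Sig0 b0 n t s (\<psi>' x) v) \<in> borel_measurable (PM \<Otimes>\<^sub>M borel \<Otimes>\<^sub>M borel \<Otimes>\<^sub>M N)" .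
  let ?X = "(PM \<Otimes>\<^sub>M borel \<Otimes>\<^sub>M borel \<Otimes>\<^sub>M N) \<Otimes>\<^sub>M (borel :: real measure)"
  have c: "(\<lambda>p. case_nat (snd p) (case_nat (fst (snd (snd (fst p)))) (fst (fst p)))) \<in> measurable ?X PM"
  proof (rule measurable_PiM_single')
    fix i :: nat
    show "(\<lambda>p. case_nat (snd p) (case_nat (fst (snd (snd (fst p)))) (fst (fst p))) i) \<in> borel_measurable ?X"
    proof (cases i)
      case 0 thus ?thesis by simp
    next
      case (Suc j)
      thus ?thesis by (cases j) simp_all
    qed
  qed auto
  have "(\<lambda>p. (case_nat (snd p) (case_nat (fst (snd (snd (fst p)))) (fst (fst p))), fst (snd (fst p)), snd p, snd (snd (snd (fst p)))))
    \<in> measurable ?X (PM \<Otimes>\<^sub>M borel \<Otimes>\<^sub>M borel \<Otimes>\<^sub>M N)"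
    by (intro measurable_Pair c) measurable
  from measurable_compose[OF this IH]
  have m[measurable]: "(\<lambda>p. Vn_h \<mu> Sig0 b0 n (fst (snd (fst p))) (snd p) (\<psi>' (case_nat (snd p) (case_nat (fst (snd (snd (fst p)))) (fst (fst p))))) (snd (snd (snd (fst p)))))
     \<in> borel_measurable ?X" by simp
  have e: "\<psi>' (case_nat r (case_nat s x)) = B_h \<mu> b0 r (U_h Sig0 r s (\<psi> x))" for r s x
  proof -
    have "sh (case_nat r (case_nat s x)) = x" by (simp add: sh_def fun_eq_iff numeral_2_eq_2)
    thus ?thesis by (intro ext) (simp add: \<psi>'_def)
  qed
  have m'[measurable]: "(\<lambda>p. Vn_h \<mu> Sig0 b0 n (fst (snd (fst p))) (snd p) (B_h \<mu> b0 (snd p) (U_h Sig0 (snd p) (fst (snd (snd (fst p)))) (\<psi> (fst (fst p))))) (snd (snd (snd (fst p)))))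
     \<in> borel_measurable ?X" using m unfolding e .
  have "(\<lambda>y. \<integral>r. indicator {fst (snd (snd y))..fst (snd y)} r *\<^sub>R Vn_h \<mu> Sig0 b0 n (fst (snd y)) r (B_h \<mu> b0 r (U_h Sig0 r (fst (snd (snd y))) (\<psi> (fst y)))) (snd (snd (snd y))) \<partial>lborel)
    \<in> borel_measurable (PM \<Otimes>\<^sub>M borel \<Otimes>\<^sub>M borel \<Otimes>\<^sub>M N)"
  proof (rule lborel.borel_measurable_lebesgue_integral)
    show "(\<lambda>(y, r). indicator {fst (snd (snd y))..fst (snd y)} r *\<^sub>R Vn_h \<mu> Sig0 b0 n (fst (snd y)) r (B_h \<mu> b0 r (U_h Sig0 r (fst (snd (snd y))) (\<psi> (fst y)))) (snd (snd (snd y))))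
       \<in> borel_measurable ((PM \<Otimes>\<^sub>M borel \<Otimes>\<^sub>M borel \<Otimes>\<^sub>M N) \<Otimes>\<^sub>M lborel)"
      unfolding case_prod_beta' measurable_lborel1
      by (subst measurable_cong_sets[OF sets_pair_measure_cong[OF refl sets_lborel] refl],
          intro borel_measurable_scaleR m') measurable
  qed
  thus ?case by (simp add: case_prod_beta' set_lebesgue_integral_def)
qed

lemma Vn_h_measurable:
  assumes \<psi>: "case_prod \<psi> \<in> borel_measurable (borel \<Otimes>\<^sub>M N)"
    and [measurable]: "P \<in> borel_measurable X" "T \<in> borel_measurable X" "S \<in> borel_measurable X" "V \<in> measurable X N"
  shows "(\<lambda>x. Vn_h \<mu> Sig0 b0 n (T x) (S x) (\<psi> (P x :: real)) (V x)) \<in> borel_measurable X"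
proof -
  note [measurable] = \<psi>
  have "case_prod (\<lambda>y. \<psi> (y (0::nat))) \<in> borel_measurable (PM \<Otimes>\<^sub>M N)" by measurable
  from Vn_h_measurable_PM[OF this, of n]
  have 1: "(\<lambda>(x, t, s, v). Vn_h \<mu> Sig0 b0 n t s (\<psi> (x 0)) v) \<in> borel_measurable (PM \<Otimes>\<^sub>M borel \<Otimes>\<^sub>M borel \<Otimes>\<^sub>M N)" .
  have "(\<lambda>x i. P x) \<in> measurable X PM" by (rule measurable_PiM_single') auto
  hence "(\<lambda>x. (\<lambda>i. P x, T x, S x, V x)) \<in> measurable X (PM \<Otimes>\<^sub>M borel \<Otimes>\<^sub>M borel \<Otimes>\<^sub>M N)"
    by measurable
  from measurable_compose[OF this 1] show ?thesis by simp
qed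

end

section \<open>Nonnegative functions and their representatives\<close>

lemma AE_lborel_shift:
  assumes "AE s in lborel. P (s::real)"
  shows "AE s in lborel. P (s - c)"
proof -
  obtain Z where Z: "{s \<in> space lborel. \<not> P s} \<subseteq> Z" "emeasure lborel Z = 0" "Z \<in> sets lborel"
    by (rule AE_E[OF assms])
  have [measurable]: "Z \<in> sets borel" using Z(3) by simp
  have "AE s in lborel. s \<notin> Z" by (rule AE_not_in) (use Z in \<open>simp add: null_sets_def\<close>)
  from AE_borel_affine[OF _ _ this, of 1 "- c"] have "AE s in lborel. - c + 1 * s \<notin> Z" by simp
  thus ?thesis by eventually_elim (use Z(1) in auto)
qed

context kinetic_data begin

text \<open>
  Outside this set of velocities, of full measure, the removal rate is replaced by \<open>0\<close>, since \<open>kinetic\<close>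
  asks for local integrability at every velocity.
\<close>

definition good :: "'a set" where
  "good = (SOME G. G \<in> sets N \<and> (AE v in N. v \<in> G) \<and>
     (\<forall>v\<in>G. \<forall>T\<ge>0. set_integrable lborel {0..T} (\<lambda>t. Sig (t, v))))"

lemma good: "good \<in> sets N" "AE v in N. v \<in> good"
  "v \<in> good \<Longrightarrow> T \<ge> 0 \<Longrightarrow> set_integrable lborel {0..T} (\<lambda>t. Sig (t, v))"
proof -
  obtain Z where Z: "{v \<in> space N. \<not> (\<forall>T\<ge>0. set_integrable lborel {0..T} (\<lambda>t. Sig (t, v)))} \<subseteq> Z"
    "emeasure N Z = 0" "Z \<in> sets N"
    by (rule AE_E[OF Sig_locally_integrable])
  have "\<exists>G. G \<in> sets N \<and> (AE v in N. v \<in> G) \<and> (\<forall>v\<in>G. \<forall>T\<ge>0. set_integrable lborel {0..T} (\<lambda>t. Sig (t, v)))"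
  proof (intro exI[of _ "space N - Z"] conjI ballI)
    have "Z \<in> null_sets N" using Z by (simp add: null_sets_def)
    from AE_not_in[OF this] AE_space show "AE v in N. v \<in> space N - Z" by eventually_elim simp
  qed (use Z in auto)
  from someI_ex[OF this, folded good_def]
  show "good \<in> sets N" "AE v in N. v \<in> good"
    "v \<in> good \<Longrightarrow> T \<ge> 0 \<Longrightarrow> set_integrable lborel {0..T} (\<lambda>t. Sig (t, v))" by auto
qed

lemma good_space: "v \<in> good \<Longrightarrow> v \<in> space N"
  using sets.sets_into_space[OF good(1)] by auto

definition Sg :: "real \<Rightarrow> 'a \<Rightarrow> real" where
  "Sg t v = (if v \<in> good then Sig0 (t, v) else 0)"

definition bb :: "real \<Rightarrow> 'a \<Rightarrow> 'a \<Rightarrow> ennreal" where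
  "bb t v w = ennreal (b0 (t, v, w))"

lemma Sig0_nonneg: "v \<in> space N \<Longrightarrow> 0 \<le> Sig0 (t, v)"
  using Sig_nonneg by (simp add: Sig0_def space_N)

lemma b0_nonneg: "v \<in> space N \<Longrightarrow> w \<in> space N \<Longrightarrow> 0 \<le> b0 (t, v, w)"
  using b_nonneg by (simp add: b0_def space_N)

lemma Sg_integrable: "set_integrable lborel {s..t} (\<lambda>\<tau>. Sg \<tau> v)"
proof (cases "v \<in> good")
  case True
  let ?T = "max t 0"
  have "set_integrable lborel ({s..t} \<inter> {0..?T}) (\<lambda>\<tau>. Sig (\<tau>, v))"
    by (rule set_integrable_subset[OF good(3)[OF True, of ?T]]) auto
  moreover have "indicator {s..t} \<tau> *\<^sub>R Sg \<tau> v = indicator ({s..t} \<inter> {0..?T}) \<tau> *\<^sub>R Sig (\<tau>, v)" for \<tau>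
    using True by (auto simp: Sg_def Sig0_def indicator_def)
  ultimately show ?thesis by (simp add: set_integrable_def)
qed (simp add: Sg_def set_integrable_def)

lemma AE_b_le_Sig: "AE t in lborel. 0 \<le> t \<longrightarrow> (AE w in N. (\<integral>\<^sup>+ v. ennreal (b (t, v, w)) \<partial>N) \<le> ennreal (Sig (t, w)))"
  using AE_tvmeasD[OF b_le_Sig] by simp

sublocale kin?: kinetic N Sg bb
proof -
  interpret sigma_finite_measure N by (rule sigma_finite_N)
  note [measurable] = good(1)
  show "kinetic N Sg bb"
  proof
    show "case_prod Sg \<in> borel_measurable (borel \<Otimes>\<^sub>M N)" unfolding Sg_def by measurable
    show "0 \<le> Sg t v" for t v using Sig0_nonneg[OF good_space] by (simp add: Sg_def)
    show "set_integrable lborel {s..t} (\<lambda>\<tau>. Sg \<tau> v)" for s t v by (rule Sg_integrable)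
    show "(\<lambda>(t, v, w). bb t v w) \<in> borel_measurable (borel \<Otimes>\<^sub>M N \<Otimes>\<^sub>M N)" unfolding bb_def by measurable
    show "AE t in lborel. AE w in N. (\<integral>\<^sup>+ v. bb t v w \<partial>N) \<le> ennreal (Sg t w)"
      using AE_b_le_Sig
    proof eventually_elim
      fix t assume t: "0 \<le> t \<longrightarrow> (AE w in N. (\<integral>\<^sup>+ v. ennreal (b (t, v, w)) \<partial>N) \<le> ennreal (Sig (t, w)))"
      show "AE w in N. (\<integral>\<^sup>+ v. bb t v w \<partial>N) \<le> ennreal (Sg t w)"
      proof (cases "0 \<le> t")
        case True
        with t have "AE w in N. (\<integral>\<^sup>+ v. ennreal (b (t, v, w)) \<partial>N) \<le> ennreal (Sig (t, w))" by simp
        with good(2) show ?thesis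
          by eventually_elim (simp add: Sg_def Sig0_def bb_def b0_def True)
      next
        case False
        thus ?thesis by (simp add: bb_def b0_def)
      qed
    qed
  qed
qed

lemma U_h_eq: "v \<in> good \<Longrightarrow> U_h Sig0 t s \<phi> v = enn2real (E s t v) * \<phi> v"
  unfolding U_h_def E_def Sg_def by simp

definition rep :: "('a \<Rightarrow> real) \<Rightarrow> ('a \<Rightarrow> ennreal) \<Rightarrow> bool" where
  "rep \<phi> \<Phi> \<longleftrightarrow> \<phi> \<in> borel_measurable N \<and> \<Phi> \<in> borel_measurable N \<and>
     (AE v in N. \<Phi> v = ennreal (\<phi> v) \<and> 0 \<le> \<phi> v) \<and> (\<integral>\<^sup>+v. \<Phi> v \<partial>N) < top"

lemma rep_U_h:
  assumes "rep \<phi> \<Phi>" and "s \<le> t"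
  shows "rep (U_h Sig0 t s \<phi>) (vE 0 t s \<Phi>)"
proof -
  have [measurable]: "\<phi> \<in> borel_measurable N" "\<Phi> \<in> borel_measurable N"
    and ae: "AE v in N. \<Phi> v = ennreal (\<phi> v) \<and> 0 \<le> \<phi> v" and fin: "(\<integral>\<^sup>+v. \<Phi> v \<partial>N) < top"
    using assms(1) by (auto simp: rep_def)
  have "AE v in N. vE 0 t s \<Phi> v = ennreal (U_h Sig0 t s \<phi> v) \<and> 0 \<le> U_h Sig0 t s \<phi> v"
    using ae good(2) by eventually_elim (simp add: U_h_eq vE_0 ennreal_mult')
  moreover have "(\<integral>\<^sup>+v. vE 0 t s \<Phi> v \<partial>N) \<le> (\<integral>\<^sup>+v. \<Phi> v \<partial>N)"
  proof -
    have "(\<integral>\<^sup>+v. vE 0 t s \<Phi> v \<partial>N) \<le> (\<integral>\<^sup>+v. 1 * \<Phi> v \<partial>N)"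
      unfolding vE_0 by (intro nn_integral_mono mult_right_mono E_le_1) auto
    thus ?thesis by simp
  qed
  moreover have "U_h Sig0 t s \<phi> \<in> borel_measurable N" "vE 0 t s \<Phi> \<in> borel_measurable N" by measurable
  ultimately show ?thesis using fin by (auto simp: rep_def intro: order_le_less_trans)
qed

text \<open>
  Finite mass of \<open>B r \<Phi>\<close> is membership of \<open>\<phi>\<close> in the domain of the scattering operator, since
  \<open>\<integral> B r \<Phi> d\<mu> = \<integral> \<sigma> \<Phi> d\<mu>\<close>.
\<close>

lemma B_h_rep:
  assumes "rep \<phi> \<Phi>" and Bfin: "(\<integral>\<^sup>+v. B r \<Phi> v \<partial>N) < top"
  shows "\<And>v. v \<in> space N \<Longrightarrow> B_h \<mu> b0 r \<phi> v = enn2real (B r \<Phi> v)" and "rep (B_h \<mu> b0 r \<phi>) (B r \<Phi>)"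
proof -
  have [measurable]: "\<phi> \<in> borel_measurable N" "\<Phi> \<in> borel_measurable N"
    and ae: "AE v in N. \<Phi> v = ennreal (\<phi> v) \<and> 0 \<le> \<phi> v" and fin: "(\<integral>\<^sup>+v. \<Phi> v \<partial>N) < top"
    using assms(1) by (auto simp: rep_def)
  have "(\<integral>\<^sup>+v. ennreal \<bar>\<phi> v\<bar> \<partial>N) = (\<integral>\<^sup>+v. \<Phi> v \<partial>N)"
    by (rule nn_integral_cong_AE, use ae in eventually_elim) simp
  moreover have "(\<integral>\<^sup>+v. sigma_h \<mu> b0 r v * ennreal \<bar>\<phi> v\<bar> \<partial>N) = (\<integral>\<^sup>+v. B r \<Phi> v \<partial>N)"
    unfolding B_mass_eq[OF \<open>\<Phi> \<in> borel_measurable N\<close>] sigma_h_def bb_def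
    by (rule nn_integral_cong_AE, use ae in eventually_elim) simp
  ultimately have dom: "\<phi> \<in> dom_B_h \<mu> b0 r"
    using fin Bfin by (subst dom_B_h_iff) auto
  show eq: "B_h \<mu> b0 r \<phi> v = enn2real (B r \<Phi> v)" if v[measurable]: "v \<in> space N" for v
  proof -
    have "B_h \<mu> b0 r \<phi> v = (\<integral>v'. b0 (r, v, v') * \<phi> v' \<partial>N)" using dom by (simp add: B_h_def)
    also have "\<dots> = enn2real (\<integral>\<^sup>+v'. ennreal (b0 (r, v, v') * \<phi> v') \<partial>N)"
    proof (rule integral_eq_nn_integral)
      show "(\<lambda>v'. b0 (r, v, v') * \<phi> v') \<in> borel_measurable N" by measurable
      show "AE v' in N. 0 \<le> b0 (r, v, v') * \<phi> v'"
        using ae AE_space by eventually_elim (simp add: b0_nonneg v)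
    qed
    also have "(\<integral>\<^sup>+v'. ennreal (b0 (r, v, v') * \<phi> v') \<partial>N) = B r \<Phi> v"
      unfolding B_def bb_def
      by (rule nn_integral_cong_AE, use ae AE_space in eventually_elim) (simp add: b0_nonneg v ennreal_mult')
    finally show ?thesis .
  qed
  have "AE v in N. B r \<Phi> v \<noteq> \<infinity>" by (rule nn_integral_PInf_AE) (use Bfin in auto)
  hence "AE v in N. B r \<Phi> v = ennreal (B_h \<mu> b0 r \<phi> v) \<and> 0 \<le> B_h \<mu> b0 r \<phi> v"
    using AE_space by eventually_elim (simp add: eq less_top)
  moreover have "B_h \<mu> b0 r \<phi> \<in> borel_measurable N" "B r \<Phi> \<in> borel_measurable N" by measurable
  ultimately show "rep (B_h \<mu> b0 r \<phi>) (B r \<Phi>)" using Bfin by (simp add: rep_def)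
qed

text \<open>
  The identity is pointwise in \<open>v\<close>, not only almost everywhere, because in the recursion the time of
  the first scattering is integrated at fixed \<open>v\<close>.  For almost every such time the scattered state has finite mass and a
  finite term of order \<open>n\<close> at \<open>v\<close>, so the induction hypothesis applies.
\<close>

lemma Vn_h_eq_vE:
  assumes "rep \<phi> \<Phi>" and "s \<le> t" and v: "v \<in> good" and eq: "\<phi> v = enn2real (\<Phi> v)"
    and fin: "vE n t s \<Phi> v < top"
  shows "Vn_h \<mu> Sig0 b0 n t s \<phi> v = enn2real (vE n t s \<Phi> v)"
  using assms(1,2) eq fin
proof (induction n arbitrary: s \<phi> \<Phi>)
  case 0
  thus ?case by (simp add: U_h_eq[OF v] vE_0 enn2real_mult)
next
  case (Suc n)
  have vN[measurable]: "v \<in> space N" by (rule good_space[OF v])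
  have [measurable]: "\<phi> \<in> borel_measurable N" "\<Phi> \<in> borel_measurable N" and Pfin: "(\<integral>\<^sup>+v. \<Phi> v \<partial>N) < top"
    using Suc.prems(1) by (auto simp: rep_def)
  define G where "G r = B r (vE 0 r s \<Phi>)" for r
  have [measurable]: "case_prod G \<in> borel_measurable (borel \<Otimes>\<^sub>M N)" unfolding G_def by measurable
  define g where "g r = B_h \<mu> b0 r (U_h Sig0 r s \<phi>)" for r
  have gm: "case_prod g \<in> borel_measurable (borel \<Otimes>\<^sub>M N)" unfolding g_def by measurable
  have [measurable]: "(\<lambda>r. Vn_h \<mu> Sig0 b0 n t r (g r) v) \<in> borel_measurable borel"
    by (rule Vn_h_measurable[OF gm]) measurable
  have [measurable]: "(\<lambda>r. vE n t r (G r) v) \<in> borel_measurable borel" by measurable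
  have vS: "vE (Suc n) t s \<Phi> v = (\<integral>\<^sup>+r. indicator {s..t} r * vE n t r (G r) v \<partial>lborel)"
    unfolding G_def by (rule vE_Suc) measurable
  have "(\<integral>\<^sup>+r. indicator {s..t} r * (\<integral>\<^sup>+v. G r v \<partial>N) \<partial>lborel) \<le> (\<integral>\<^sup>+v. \<Phi> v \<partial>N)"
    unfolding G_def using gain_mass_le[of \<Phi> s t] Suc.prems(2) by (auto intro: order_trans[OF add_increasing])
  hence 1: "AE r in lborel. indicator {s..t} r * (\<integral>\<^sup>+v. G r v \<partial>N) \<noteq> \<infinity>"
    using Pfin by (intro nn_integral_PInf_AE) (auto simp: top_unique)
  have 2: "AE r in lborel. indicator {s..t} r * vE n t r (G r) v \<noteq> \<infinity>"
    using Suc.prems(4) vS by (intro nn_integral_PInf_AE) auto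
  have ae: "AE r in lborel. indicator {s..t} r * vE n t r (G r) v = ennreal (indicator {s..t} r *\<^sub>R Vn_h \<mu> Sig0 b0 n t r (g r) v)
      \<and> 0 \<le> indicator {s..t} r *\<^sub>R Vn_h \<mu> Sig0 b0 n t r (g r) v"
    using 1 2
  proof eventually_elim
    fix r assume a: "indicator {s..t} r * (\<integral>\<^sup>+v. G r v \<partial>N) \<noteq> \<infinity>" "indicator {s..t} r * vE n t r (G r) v \<noteq> \<infinity>"
    show "indicator {s..t} r * vE n t r (G r) v = ennreal (indicator {s..t} r *\<^sub>R Vn_h \<mu> Sig0 b0 n t r (g r) v)
      \<and> 0 \<le> indicator {s..t} r *\<^sub>R Vn_h \<mu> Sig0 b0 n t r (g r) v"
    proof (cases "r \<in> {s..t}")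
      case True
      with a have f: "(\<integral>\<^sup>+v. G r v \<partial>N) < top" "vE n t r (G r) v < top" by (auto simp: less_top)
      have "rep (U_h Sig0 r s \<phi>) (vE 0 r s \<Phi>)" by (rule rep_U_h) (use Suc.prems True in auto)
      from B_h_rep[OF this f(1)[unfolded G_def]] vN
      have "g r v = enn2real (G r v)" "rep (g r) (G r)" by (auto simp: g_def G_def)
      with Suc.IH[of "g r" "G r" r] f(2) True
      have "Vn_h \<mu> Sig0 b0 n t r (g r) v = enn2real (vE n t r (G r) v)" by simp
      with f(2) True show ?thesis by simp
    qed simp
  qed
  have "Vn_h \<mu> Sig0 b0 (Suc n) t s \<phi> v = (\<integral>r. indicator {s..t} r *\<^sub>R Vn_h \<mu> Sig0 b0 n t r (g r) v \<partial>lborel)"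
    by (simp add: g_def set_lebesgue_integral_def)
  also have "\<dots> = enn2real (\<integral>\<^sup>+r. ennreal (indicator {s..t} r *\<^sub>R Vn_h \<mu> Sig0 b0 n t r (g r) v) \<partial>lborel)"
    by (rule integral_eq_nn_integral, measurable) (use ae in auto)
  also have "(\<integral>\<^sup>+r. ennreal (indicator {s..t} r *\<^sub>R Vn_h \<mu> Sig0 b0 n t r (g r) v) \<partial>lborel) = vE (Suc n) t s \<Phi> v"
    unfolding vS by (rule nn_integral_cong_AE) (use ae in auto)
  finally show ?case .
qed

subsection \<open>Functions of time and velocity\<close>

lemma fst_tv[measurable]: "fst \<in> borel_measurable (tvmeas \<mu>)"
proof -
  have "fst \<in> measurable (tvmeas \<mu>) tmeas" unfolding tvmeas_def by measurable
  moreover have "(\<lambda>x. x) \<in> borel_measurable tmeas" unfolding tmeas_def by (rule measurable_restrict_space1) simp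
  ultimately show ?thesis using measurable_compose by blast
qed

lemma snd_tv[measurable]: "snd \<in> measurable (tvmeas \<mu>) N"
  unfolding tvmeas_def by measurable

lemma sigma_finite_tv: "sigma_finite_measure (tvmeas \<mu>)"
proof -
  interpret N: sigma_finite_measure N by (rule sigma_finite_N)
  interpret t: sigma_finite_measure tmeas by (rule sigma_finite_tmeas)
  interpret pair_sigma_finite tmeas N ..
  show ?thesis unfolding tvmeas_def ..
qed

lemma space_tv: "x \<in> space (tvmeas \<mu>) \<longleftrightarrow> 0 \<le> fst x \<and> snd x \<in> space N"
  by (auto simp: tvmeas_def space_pair_measure space_tmeas mem_Times_iff)

text \<open>
  The element \<open>f\<close> of the positive cone is represented by \<open>F\<close>, which vanishes at negative times
  and may be infinite on a null set.
\<close>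

definition Rep :: "(real \<times> 'a \<Rightarrow> real) \<Rightarrow> (real \<Rightarrow> 'a \<Rightarrow> ennreal) \<Rightarrow> bool" where
  "Rep f F \<longleftrightarrow> f \<in> borel_measurable (tvmeas \<mu>) \<and> meas F \<and> (\<forall>s v. s < 0 \<longrightarrow> F s v = 0) \<and> mass F \<noteq> top \<and>
     (AE x in tvmeas \<mu>. F (fst x) (snd x) = ennreal (f x) \<and> 0 \<le> f x)"

lemma RepD:
  assumes "Rep f F"
  shows "f \<in> borel_measurable (tvmeas \<mu>)" "meas F" "\<And>s v. s < 0 \<Longrightarrow> F s v = 0" "mass F \<noteq> top"
    "AE x in tvmeas \<mu>. F (fst x) (snd x) = ennreal (f x) \<and> 0 \<le> f x"
  using assms by (auto simp: Rep_def)

lemma meas_tv: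
  assumes [measurable]: "meas F"
  shows "(\<lambda>x. F (fst x) (snd x)) \<in> borel_measurable (tvmeas \<mu>)"
  by measurable

lemma nn_integral_tv_mass:
  assumes [measurable]: "meas F" and 0: "\<And>s v. s < 0 \<Longrightarrow> F s v = 0"
  shows "(\<integral>\<^sup>+x. F (fst x) (snd x) \<partial>tvmeas \<mu>) = mass F"
  unfolding mass_def by (subst nn_integral_tvmeas) (use 0 in \<open>auto intro!: nn_integral_cong\<close>)

lemma nn_integral_tv_le_mass:
  assumes [measurable]: "meas F"
  shows "(\<integral>\<^sup>+x. F (fst x) (snd x) \<partial>tvmeas \<mu>) \<le> mass F"
  unfolding mass_def by (subst nn_integral_tvmeas) (auto intro!: nn_integral_mono)

lemma Rep_integral:
  assumes "Rep f F"
  shows "integrable (tvmeas \<mu>) f" "(\<integral>x. f x \<partial>tvmeas \<mu>) = enn2real (mass F)" "L1_norm (tvmeas \<mu>) f = enn2real (mass F)"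
proof -
  note R = RepD[OF assms]
  note [measurable] = R(1)
  have e: "(\<integral>\<^sup>+x. ennreal (f x) \<partial>tvmeas \<mu>) = mass F"
  proof -
    have "(\<integral>\<^sup>+x. ennreal (f x) \<partial>tvmeas \<mu>) = (\<integral>\<^sup>+x. F (fst x) (snd x) \<partial>tvmeas \<mu>)"
      by (rule nn_integral_cong_AE) (use R(5) in auto)
    also have "\<dots> = mass F" by (rule nn_integral_tv_mass[OF R(2,3)])
    finally show ?thesis .
  qed
  show "integrable (tvmeas \<mu>) f"
    by (rule integrableI_nonneg) (use R(4,5) e in \<open>auto simp: less_top\<close>)
  show i: "(\<integral>x. f x \<partial>tvmeas \<mu>) = enn2real (mass F)"
    unfolding e[symmetric] by (rule integral_eq_nn_integral) (use R(5) in auto)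
  have "L1_norm (tvmeas \<mu>) f = (\<integral>x. f x \<partial>tvmeas \<mu>)"
    unfolding L1_norm_def by (rule integral_cong_AE) (use R(5) in auto)
  thus "L1_norm (tvmeas \<mu>) f = enn2real (mass F)" using i by simp
qed

lemma RepI:
  assumes "f \<in> borel_measurable (tvmeas \<mu>)" "meas F" "\<And>s v. s < 0 \<Longrightarrow> F s v = 0" "mass F \<noteq> top"
    and "AE x in tvmeas \<mu>. f x = enn2real (F (fst x) (snd x))"
  shows "Rep f F"
proof -
  have "(\<integral>\<^sup>+x. F (fst x) (snd x) \<partial>tvmeas \<mu>) \<noteq> \<infinity>"
    using assms(4) nn_integral_tv_mass[OF assms(2,3)] by simp
  from nn_integral_PInf_AE[OF meas_tv[OF assms(2)] this] assms(5)
  have "AE x in tvmeas \<mu>. F (fst x) (snd x) = ennreal (f x) \<and> 0 \<le> f x"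
    by eventually_elim (simp add: less_top)
  thus ?thesis using assms by (simp add: Rep_def)
qed

lemma Tn_h_eq:
  assumes "0 \<le> fst x"
  shows "Tn_h \<mu> Sig b n \<tau> f x = (if \<tau> \<le> fst x then Vn_h \<mu> Sig0 b0 n (fst x) (fst x - \<tau>)
     (\<lambda>w. if 0 \<le> fst x - \<tau> then f (fst x - \<tau>, w) else 0) (snd x) else 0)"
  by (cases x) (simp add: Tn_h_def lift_evol_def Vn_h_0)

lemma T_h_eq: "T_h \<mu> Sig b \<tau> f x = (\<Sum>n. Tn_h \<mu> Sig b n \<tau> f x)"
  by (cases x) (simp add: T_h_def Tn_h_def lift_evol_def V_h_def)

lemma Tn_h_measurable:
  assumes f: "f \<in> borel_measurable (tvmeas \<mu>)" and [measurable]: "P \<in> borel_measurable X" "Y \<in> measurable X (tvmeas \<mu>)"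
  shows "(\<lambda>y. Tn_h \<mu> Sig b n (P y) f (Y y)) \<in> borel_measurable X"
proof -
  have "(\<lambda>x. if 0 \<le> fst x then f x else 0) \<in> borel_measurable (borel \<Otimes>\<^sub>M N)"
    by (rule extend_measurable) (use f in \<open>auto simp: tvmeas_def\<close>)
  also have "(\<lambda>x. if 0 \<le> fst x then f x else 0) = case_prod (\<lambda>s w. if 0 \<le> s then f (s, w) else 0)" by auto
  finally have \<psi>: "case_prod (\<lambda>s w. if 0 \<le> s then f (s, w) else 0) \<in> borel_measurable (borel \<Otimes>\<^sub>M N)" .
  have [measurable]: "(\<lambda>y. fst (Y y)) \<in> borel_measurable X" by (rule measurable_compose[OF _ fst_tv]) measurable
  have [measurable]: "(\<lambda>y. snd (Y y)) \<in> measurable X N" by (rule measurable_compose[OF _ snd_tv]) measurable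
  note [measurable] = Vn_h_measurable[OF \<psi>]
  have "(\<lambda>y. if P y \<le> fst (Y y) then Vn_h \<mu> Sig0 b0 n (fst (Y y)) (fst (Y y) - P y)
     (\<lambda>w. if 0 \<le> fst (Y y) - P y then f (fst (Y y) - P y, w) else 0) (snd (Y y)) else 0) \<in> borel_measurable X"
    by (intro measurable_If Vn_h_measurable[OF \<psi>]) measurable
  also have "?this \<longleftrightarrow> (\<lambda>y. Tn_h \<mu> Sig b n (P y) f (Y y)) \<in> borel_measurable X"
  proof (rule measurable_cong)
    fix y assume "y \<in> space X"
    hence "Y y \<in> space (tvmeas \<mu>)" by (rule measurable_space[OF assms(3)])
    hence "0 \<le> fst (Y y)" by (simp add: space_tv)
    thus "(if P y \<le> fst (Y y) then Vn_h \<mu> Sig0 b0 n (fst (Y y)) (fst (Y y) - P y)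
     (\<lambda>w. if 0 \<le> fst (Y y) - P y then f (fst (Y y) - P y, w) else 0) (snd (Y y)) else 0) = Tn_h \<mu> Sig b n (P y) f (Y y)"
      by (rule Tn_h_eq[symmetric])
  qed
  finally show ?thesis .
qed

lemma T_h_measurable:
  assumes f: "f \<in> borel_measurable (tvmeas \<mu>)" and [measurable]: "P \<in> borel_measurable X" "Y \<in> measurable X (tvmeas \<mu>)"
  shows "(\<lambda>y. T_h \<mu> Sig b (P y) f (Y y)) \<in> borel_measurable X"
  unfolding T_h_eq by (intro borel_measurable_suminf Tn_h_measurable[OF f]) measurable

lemma Rep_Tn_h:
  assumes "Rep f F" and t: "0 \<le> \<tau>"
  shows "Rep (Tn_h \<mu> Sig b n \<tau> f) (S n \<tau> F)"
proof (rule RepI)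
  note R = RepD[OF assms(1)]
  note F[measurable] = R(2)
  show m[measurable]: "Tn_h \<mu> Sig b n \<tau> f \<in> borel_measurable (tvmeas \<mu>)"
    by (rule Tn_h_measurable[OF R(1)]) measurable
  show S[measurable]: "meas (S n \<tau> F)" by measurable
  show "S n \<tau> F s v = 0" if "s < 0" for s v
  proof -
    have "F (s - \<tau>) = (\<lambda>_. 0)" using R(3)[of "s - \<tau>"] that t by auto
    thus ?thesis by (simp add: S_def)
  qed
  show "mass (S n \<tau> F) \<noteq> top"
    using S_mass_le[OF F t, of n] R(4) by (auto simp: top_unique)
  define \<psi> where "\<psi> s w = (if 0 \<le> s then f (s, w) else 0)" for s w
  have "(\<lambda>x. if 0 \<le> fst x then f x else 0) \<in> borel_measurable (borel \<Otimes>\<^sub>M N)"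
    by (rule extend_measurable) (use R(1) in \<open>auto simp: tvmeas_def\<close>)
  also have "(\<lambda>x. if 0 \<le> fst x then f x else 0) = case_prod \<psi>" by (auto simp: \<psi>_def)
  finally have [measurable]: "case_prod \<psi> \<in> borel_measurable (borel \<Otimes>\<^sub>M N)" .
  have "AE s in lborel. (\<integral>\<^sup>+v. F s v \<partial>N) \<noteq> \<infinity>"
    by (rule nn_integral_PInf_AE) (use R(4) in \<open>auto simp: mass_def\<close>)
  with AE_tvmeasD[OF R(5)] have ae: "AE s in lborel. 0 \<le> s \<longrightarrow> rep (\<psi> s) (F s)"
  proof eventually_elim
    fix s assume a: "0 \<le> s \<longrightarrow> (AE v in N. F (fst (s, v)) (snd (s, v)) = ennreal (f (s, v)) \<and> 0 \<le> f (s, v))"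
      "(\<integral>\<^sup>+v. F s v \<partial>N) \<noteq> \<infinity>"
    show "0 \<le> s \<longrightarrow> rep (\<psi> s) (F s)"
    proof
      assume s: "0 \<le> s"
      have "\<psi> s \<in> borel_measurable N" "F s \<in> borel_measurable N" by measurable
      thus "rep (\<psi> s) (F s)" using a s by (simp add: rep_def \<psi>_def less_top)
    qed
  qed
  from AE_lborel_shift[OF this]
  have ae': "AE s in lborel. 0 \<le> s - \<tau> \<longrightarrow> rep (\<psi> (s - \<tau>)) (F (s - \<tau>))" .
  show "AE x in tvmeas \<mu>. Tn_h \<mu> Sig b n \<tau> f x = enn2real (S n \<tau> F (fst x) (snd x))"
  proof (rule AE_tvmeasI)
    have [measurable]: "(\<lambda>x. S n \<tau> F (fst x) (snd x)) \<in> borel_measurable (tvmeas \<mu>)" by (rule meas_tv[OF S])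
    show "{x \<in> space (tvmeas \<mu>). Tn_h \<mu> Sig b n \<tau> f x = enn2real (S n \<tau> F (fst x) (snd x))} \<in> sets (tvmeas \<mu>)"
      by measurable
    show "AE s in lborel. 0 \<le> s \<longrightarrow> (AE v in N. Tn_h \<mu> Sig b n \<tau> f (s, v) = enn2real (S n \<tau> F (fst (s, v)) (snd (s, v))))"
      using ae'
    proof eventually_elim
      fix s assume r: "0 \<le> s - \<tau> \<longrightarrow> rep (\<psi> (s - \<tau>)) (F (s - \<tau>))"
      show "0 \<le> s \<longrightarrow> (AE v in N. Tn_h \<mu> Sig b n \<tau> f (s, v) = enn2real (S n \<tau> F (fst (s, v)) (snd (s, v))))"
      proof
        assume s: "0 \<le> s"
        show "AE v in N. Tn_h \<mu> Sig b n \<tau> f (s, v) = enn2real (S n \<tau> F (fst (s, v)) (snd (s, v)))"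
        proof (cases "\<tau> \<le> s")
          case False
          hence "F (s - \<tau>) = (\<lambda>_. 0)" using R(3)[of "s - \<tau>"] by auto
          hence "S n \<tau> F s v = 0" for v by (simp add: S_def)
          thus ?thesis using False s by (simp add: Tn_h_eq)
        next
          case True
          hence rp: "rep (\<psi> (s - \<tau>)) (F (s - \<tau>))" using r by simp
          have Fm[measurable]: "F (s - \<tau>) \<in> borel_measurable N" by measurable
          have "(\<integral>\<^sup>+v. vE n s (s - \<tau>) (F (s - \<tau>)) v \<partial>N) \<le> (\<Sum>k\<le>n. \<integral>\<^sup>+v. vE k s (s - \<tau>) (F (s - \<tau>)) v \<partial>N)"
            by (rule member_le_sum) auto
          also have "\<dots> \<le> (\<integral>\<^sup>+v. F (s - \<tau>) v \<partial>N)" by (rule vE_partial_mass_le[OF Fm]) (use t in simp)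
          also have "\<dots> < top" using rp by (simp add: rep_def)
          finally have "AE v in N. vE n s (s - \<tau>) (F (s - \<tau>)) v \<noteq> \<infinity>"
            by (intro nn_integral_PInf_AE) auto
          moreover have "AE v in N. F (s - \<tau>) v = ennreal (\<psi> (s - \<tau>) v) \<and> 0 \<le> \<psi> (s - \<tau>) v"
            using rp by (simp add: rep_def)
          ultimately show ?thesis using good(2)
          proof eventually_elim
            fix v assume a: "vE n s (s - \<tau>) (F (s - \<tau>)) v \<noteq> \<infinity>" "F (s - \<tau>) v = ennreal (\<psi> (s - \<tau>) v) \<and> 0 \<le> \<psi> (s - \<tau>) v" "v \<in> good"
            have "Vn_h \<mu> Sig0 b0 n s (s - \<tau>) (\<psi> (s - \<tau>)) v = enn2real (vE n s (s - \<tau>) (F (s - \<tau>)) v)"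
              by (rule Vn_h_eq_vE[OF rp]) (use a t in \<open>auto simp: less_top\<close>)
            thus "Tn_h \<mu> Sig b n \<tau> f (s, v) = enn2real (S n \<tau> F (fst (s, v)) (snd (s, v)))"
              using s True by (simp add: Tn_h_eq S_def \<psi>_def[abs_def])
          qed
        qed
      qed
    qed
  qed
qed

lemma Rep_T_h:
  assumes "Rep f F" and t: "0 \<le> \<tau>"
  shows "Rep (T_h \<mu> Sig b \<tau> f) (T \<tau> F)"
proof (rule RepI)
  note R = RepD[OF assms(1)]
  note F[measurable] = R(2)
  show "T_h \<mu> Sig b \<tau> f \<in> borel_measurable (tvmeas \<mu>)"
    by (rule T_h_measurable[OF R(1)]) measurable
  show TF: "meas (T \<tau> F)" by measurable
  show T0: "T \<tau> F s v = 0" if "s < 0" for s v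
  proof -
    have "F (s - \<tau>) = (\<lambda>_. 0)" using R(3)[of "s - \<tau>"] that t by auto
    thus ?thesis by (simp add: T_eq_suminf S_def)
  qed
  show fin: "mass (T \<tau> F) \<noteq> top"
    using T_mass_le[OF F t] R(4) by (auto simp: top_unique)
  have "AE x in tvmeas \<mu>. T \<tau> F (fst x) (snd x) \<noteq> \<infinity>"
    by (rule nn_integral_PInf_AE[OF meas_tv[OF TF]]) (use nn_integral_tv_mass[OF TF T0] fin in auto)
  moreover have "AE x in tvmeas \<mu>. \<forall>n. S n \<tau> F (fst x) (snd x) = ennreal (Tn_h \<mu> Sig b n \<tau> f x) \<and> 0 \<le> Tn_h \<mu> Sig b n \<tau> f x"
    using RepD(5)[OF Rep_Tn_h[OF assms]] by (simp add: AE_all_countable)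
  ultimately show "AE x in tvmeas \<mu>. T_h \<mu> Sig b \<tau> f x = enn2real (T \<tau> F (fst x) (snd x))"
  proof eventually_elim
    fix x assume a: "T \<tau> F (fst x) (snd x) \<noteq> \<infinity>" "\<forall>n. S n \<tau> F (fst x) (snd x) = ennreal (Tn_h \<mu> Sig b n \<tau> f x) \<and> 0 \<le> Tn_h \<mu> Sig b n \<tau> f x"
    have T: "T \<tau> F (fst x) (snd x) = (\<Sum>n. ennreal (Tn_h \<mu> Sig b n \<tau> f x))" using a(2) by (simp add: T_eq_suminf)
    have "summable (\<lambda>n. Tn_h \<mu> Sig b n \<tau> f x)"
      by (rule summable_suminf_not_top) (use a T in auto)
    hence "T \<tau> F (fst x) (snd x) = ennreal (\<Sum>n. Tn_h \<mu> Sig b n \<tau> f x)"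
      unfolding T using a(2) by (intro suminf_ennreal_eq summable_sums) auto
    thus "T_h \<mu> Sig b \<tau> f x = enn2real (T \<tau> F (fst x) (snd x))"
      using a(2) \<open>summable _\<close> by (simp add: T_h_eq suminf_nonneg)
  qed
qed

text \<open>
  A time integral of the real functions is the pointwise integral of the representatives; Tonelli's
  theorem exchanges "for every time, almost every \<open>x\<close>" with "for almost every \<open>x\<close>, almost every time".
\<close>

lemma Rep_time_integral:
  assumes H[measurable]: "(\<lambda>p. H (fst p) (snd p)) \<in> borel_measurable (borel \<Otimes>\<^sub>M tvmeas \<mu>)" and G: "rmeas G"
    and R: "\<And>\<tau>. 0 \<le> \<tau> \<Longrightarrow> \<tau> \<le> u \<Longrightarrow> Rep (H \<tau>) (G \<tau>)"
    and fin: "mass (\<lambda>s v. \<integral>\<^sup>+\<tau>. indicator {0..u} \<tau> * G \<tau> s v \<partial>lborel) \<noteq> top"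
  shows "Rep (\<lambda>x. LBINT \<tau>:{0..u}. H \<tau> x) (\<lambda>s v. \<integral>\<^sup>+\<tau>. indicator {0..u} \<tau> * G \<tau> s v \<partial>lborel)"
proof (rule RepI)
  note [measurable (raw)] = fmeasD[OF G]
  interpret tv: sigma_finite_measure "tvmeas \<mu>" by (rule sigma_finite_tv)
  interpret P: pair_sigma_finite lborel "tvmeas \<mu>" by unfold_locales
  have [measurable]: "(\<lambda>p. H (snd p) (fst p)) \<in> borel_measurable (tvmeas \<mu> \<Otimes>\<^sub>M borel)"
    using measurable_compose[OF _ H, of "\<lambda>p. (snd p, fst p)"] by simp
  show "(\<lambda>x. LBINT \<tau>:{0..u}. H \<tau> x) \<in> borel_measurable (tvmeas \<mu>)"
    unfolding set_lebesgue_integral_def by measurable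
  show "meas (\<lambda>s v. \<integral>\<^sup>+\<tau>. indicator {0..u} \<tau> * G \<tau> s v \<partial>lborel)" by measurable
  show "(\<integral>\<^sup>+\<tau>. indicator {0..u} \<tau> * G \<tau> s v \<partial>lborel) = 0" if "s < 0" for s v
  proof -
    have "indicator {0..u} \<tau> * G \<tau> s v = 0" for \<tau> using RepD(3)[OF R[of \<tau>] that] by (auto simp: indicator_def)
    hence "(\<integral>\<^sup>+\<tau>. indicator {0..u} \<tau> * G \<tau> s v \<partial>lborel) = (\<integral>\<^sup>+(\<tau>::real). 0 \<partial>lborel)"
      by (rule nn_integral_cong)
    thus ?thesis by simp
  qed
  show "mass (\<lambda>s v. \<integral>\<^sup>+\<tau>. indicator {0..u} \<tau> * G \<tau> s v \<partial>lborel) \<noteq> top" by fact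
  let ?Q = "\<lambda>\<tau> x. indicator {0..u} \<tau> * G \<tau> (fst x) (snd x) = ennreal (indicator {0..u} \<tau> *\<^sub>R H \<tau> x) \<and> 0 \<le> indicator {0..u} \<tau> *\<^sub>R H \<tau> x"
  have "AE \<tau> in lborel. AE x in tvmeas \<mu>. ?Q \<tau> x"
  proof (rule AE_I2)
    fix \<tau> :: real
    show "AE x in tvmeas \<mu>. ?Q \<tau> x"
    proof (cases "\<tau> \<in> {0..u}")
      case True
      with RepD(5)[OF R[of \<tau>]] show ?thesis by auto
    qed simp
  qed
  moreover have "{p \<in> space (lborel \<Otimes>\<^sub>M tvmeas \<mu>). ?Q (fst p) (snd p)} \<in> sets (lborel \<Otimes>\<^sub>M tvmeas \<mu>)"
    by measurable
  ultimately have "AE x in tvmeas \<mu>. AE \<tau> in lborel. ?Q \<tau> x" using P.AE_commute[of ?Q] by blast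
  thus "AE x in tvmeas \<mu>. (LBINT \<tau>:{0..u}. H \<tau> x) = enn2real (\<integral>\<^sup>+\<tau>. indicator {0..u} \<tau> * G \<tau> (fst x) (snd x) \<partial>lborel)"
    using AE_space
  proof eventually_elim
    fix x assume ae: "AE \<tau> in lborel. ?Q \<tau> x" and [measurable]: "x \<in> space (tvmeas \<mu>)"
    have "(LBINT \<tau>:{0..u}. H \<tau> x) = enn2real (\<integral>\<^sup>+\<tau>. ennreal (indicator {0..u} \<tau> *\<^sub>R H \<tau> x) \<partial>lborel)"
      unfolding set_lebesgue_integral_def
    proof (rule integral_eq_nn_integral)
      have "(\<lambda>\<tau>. H \<tau> x) \<in> borel_measurable borel"
        using measurable_compose[OF _ H, of "\<lambda>\<tau>. (\<tau>, x)" borel] by simp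
      thus "(\<lambda>\<tau>. indicator {0..u} \<tau> *\<^sub>R H \<tau> x) \<in> borel_measurable lborel" by simp
    qed (use ae in auto)
    also have "(\<integral>\<^sup>+\<tau>. ennreal (indicator {0..u} \<tau> *\<^sub>R H \<tau> x) \<partial>lborel) = (\<integral>\<^sup>+\<tau>. indicator {0..u} \<tau> * G \<tau> (fst x) (snd x) \<partial>lborel)"
      by (rule nn_integral_cong_AE) (use ae in auto)
    finally show "(LBINT \<tau>:{0..u}. H \<tau> x) = enn2real (\<integral>\<^sup>+\<tau>. indicator {0..u} \<tau> * G \<tau> (fst x) (snd x) \<partial>lborel)" .
  qed
qed

lemma Rep_J:
  assumes "Rep f F" and u: "0 \<le> u"
  shows "Rep (\<lambda>x. LBINT s:{0..u}. Tn_h \<mu> Sig b n s f x) (J n u F)"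
proof -
  note R = RepD[OF assms(1)]
  note F[measurable] = R(2)
  have r: "rmeas (\<lambda>\<tau>. S n \<tau> F)" by measurable
  have "mass (J n u F) \<noteq> top"
    using J_mass_le[OF F u, of n] R(4) by (auto simp: top_unique ennreal_mult_eq_top_iff)
  thus ?thesis unfolding J_def[abs_def]
    by (intro Rep_time_integral[OF _ r Rep_Tn_h[OF assms(1)]] Tn_h_measurable[OF R(1)]) auto
qed

lemma Rep_T_integral:
  assumes "Rep f F" and u: "0 \<le> u"
  shows "Rep (\<lambda>x. LBINT s:{0..u}. T_h \<mu> Sig b s f x) (\<lambda>s v. \<integral>\<^sup>+\<tau>. indicator {0..u} \<tau> * T \<tau> F s v \<partial>lborel)"
proof -
  note R = RepD[OF assms(1)]
  note F[measurable] = R(2)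
  have r: "rmeas (\<lambda>\<tau>. T \<tau> F)" by measurable
  have "mass (\<lambda>s v. \<integral>\<^sup>+\<tau>. indicator {0..u} \<tau> * T \<tau> F s v \<partial>lborel) = (\<integral>\<^sup>+\<tau>. indicator {0..u} \<tau> * mass (T \<tau> F) \<partial>lborel)"
    by (rule mass_interval[OF r])
  also have "\<dots> \<le> (\<integral>\<^sup>+\<tau>. mass F * indicator {0..u} \<tau> \<partial>lborel)"
    by (intro nn_integral_mono) (auto simp: indicator_def T_mass_le)
  also have "\<dots> < top" using R(4) u by (simp add: nn_integral_cmult ennreal_mult_less_top less_top)
  finally have "mass (\<lambda>s v. \<integral>\<^sup>+\<tau>. indicator {0..u} \<tau> * T \<tau> F s v \<partial>lborel) \<noteq> top" by simp
  thus ?thesis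
    by (intro Rep_time_integral[OF _ r Rep_T_h[OF assms(1)]] T_h_measurable[OF R(1)]) auto
qed

end

section \<open>Mass balance and honesty\<close>

text \<open>
  The generator is a choice among almost everywhere equal functions, so any function with the
  defining limit property has the same integral.
\<close>

lemma generates_to_integral_unique:
  assumes int: "\<And>\<tau>. 0 < \<tau> \<Longrightarrow> integrable N (T \<tau> f)"
    and g: "generates_to N T f g" and h: "generates_to N T f h"
  shows "(\<integral>x. g x \<partial>N) = (\<integral>x. h x \<partial>N)"
proof -
  let ?q = "\<lambda>\<tau> x. (T \<tau> f x - f x) / \<tau>"
  have ints: "integrable N f" "integrable N g" "integrable N h" using g h by (auto simp: generates_to_def)
  have "((\<lambda>\<tau>. L1_norm N (\<lambda>x. ?q \<tau> x - g x) + L1_norm N (\<lambda>x. ?q \<tau> x - h x)) \<longlongrightarrow> 0 + 0) (at_right 0)"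
    using g h by (intro tendsto_add) (auto simp: generates_to_def)
  moreover have "\<forall>\<^sub>F \<tau> in at_right (0::real). \<bar>(\<integral>x. g x \<partial>N) - (\<integral>x. h x \<partial>N)\<bar> \<le>
      L1_norm N (\<lambda>x. ?q \<tau> x - g x) + L1_norm N (\<lambda>x. ?q \<tau> x - h x)"
    using eventually_at_right_less[of "0::real"]
  proof eventually_elim
    fix \<tau> :: real assume t: "0 < \<tau>"
    have q: "integrable N (?q \<tau>)" using int[OF t] ints by auto
    have "\<bar>(\<integral>x. g x \<partial>N) - (\<integral>x. h x \<partial>N)\<bar> = \<bar>\<integral>x. g x - h x \<partial>N\<bar>" using ints by simp
    also have "\<dots> \<le> (\<integral>x. \<bar>g x - h x\<bar> \<partial>N)" by (rule integral_abs_bound)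
    also have "\<dots> \<le> (\<integral>x. \<bar>?q \<tau> x - g x\<bar> + \<bar>?q \<tau> x - h x\<bar> \<partial>N)"
      using ints q by (intro integral_mono) auto
    also have "\<dots> = L1_norm N (\<lambda>x. ?q \<tau> x - g x) + L1_norm N (\<lambda>x. ?q \<tau> x - h x)"
      unfolding L1_norm_def using ints q by (intro Bochner_Integration.integral_add) auto
    finally show "\<bar>(\<integral>x. g x \<partial>N) - (\<integral>x. h x \<partial>N)\<bar> \<le> \<dots>" .
  qed
  ultimately have "\<bar>(\<integral>x. g x \<partial>N) - (\<integral>x. h x \<partial>N)\<bar> \<le> 0 + 0"
    by (intro tendsto_lowerbound) auto
  thus ?thesis by simp
qed

context kinetic begin

lemma Bk_J_mass_le:
  assumes [measurable]: "meas F"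
  shows "mass (Bk (J n u F)) \<le> ennreal (exp u) * mass F"
proof -
  have "mass (Bk (J n u F)) \<le> mass (Bk (\<lambda>s v. ennreal (exp (1 * u)) * Lap n 1 F s v))"
    by (intro mass_mono Bk_mono J_le_Lap assms) auto
  also have "\<dots> = mass (\<lambda>s v. ennreal (exp (1 * u)) * Bk (Lap n 1 F) s v)"
    by (intro mass_cong Bk_cmult) measurable
  also have "\<dots> = ennreal (exp (1 * u)) * mass (Bk (Lap n 1 F))" by (rule mass_cmult) measurable
  also have "\<dots> \<le> ennreal (exp (1 * u)) * mass F" by (intro mult_left_mono Bk_Lap_mass_le assms) auto
  finally show ?thesis by simp
qed

lemma source_mass_finite:
  assumes "meas F" "mass F \<noteq> top"
  shows "mass (source n u F) \<noteq> top"
proof (cases n)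
  case (Suc m)
  thus ?thesis using Bk_J_mass_le[OF assms(1), of m u] assms(2)
    by (auto simp: source_def top_unique ennreal_mult_eq_top_iff)
qed (use assms in \<open>simp add: source_def\<close>)

text \<open>
  The generator of \<open>T\<close> maps \<open>J n u \<Phi>\<close> to \<open>S n u \<Phi> + B (J n u \<Phi>) - source n u \<Phi>\<close>.  By \<open>resolvent_window\<close> at
  \<open>l = 1\<close>, \<open>J n u \<Phi>\<close> is a difference of two resolvents, and the limit is known for each of them.
\<close>

lemma J_generator_limit:
  fixes n :: nat
  assumes Ph[measurable]: "meas \<Phi>" and fin: "mass \<Phi> \<noteq> top" and u: "0 \<le> u"
  defines "F \<equiv> J n u \<Phi>"
  shows "((\<lambda>\<tau>. mass (\<lambda>s v. absdiff (ennreal (1 / \<tau>) * T \<tau> F s v + source n u \<Phi> s v)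
      (ennreal (1 / \<tau>) * F s v + (S n u \<Phi> s v + Bk F s v)))) \<longlongrightarrow> 0) (at_right 0)"
proof -
  define q where "q = S n u \<Phi>"
  define r where "r = source n u \<Phi>"
  define p where "p s v = F s v + r s v" for s v
  have [measurable]: "meas F" unfolding F_def by measurable
  have q[measurable]: "meas q" unfolding q_def by measurable
  have [measurable]: "meas r" unfolding r_def by measurable
  have p[measurable]: "meas p" unfolding p_def by measurable
  have Ffin: "mass F \<noteq> top" unfolding F_def
    using J_mass_le[OF Ph u, of n] fin by (auto simp: top_unique ennreal_mult_eq_top_iff)
  have qfin: "mass q \<noteq> top" unfolding q_def using S_mass_le[OF Ph u, of n] fin by (auto simp: top_unique)
  have rfin: "mass r \<noteq> top" unfolding r_def by (rule source_mass_finite[OF Ph fin])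
  have pfin: "mass p \<noteq> top" unfolding p_def using Ffin rfin by (subst mass_add) auto
  let ?P = "R 1 p" and ?Q = "R 1 q"
  have split: "F s v + ?Q s v = ?P s v" if v[measurable]: "v \<in> space N" for s v
  proof -
    have "?P s v = R 1 F s v + R 1 r s v" unfolding p_def by (rule Lap_add) measurable
    with resolvent_window[OF Ph v u, of 1 n s] show ?thesis by (simp add: F_def q_def r_def)
  qed
  let ?e = "\<lambda>g f \<tau> s v. absdiff (ennreal (1 / \<tau>) * T \<tau> f s v + g s v) (ennreal (1 / \<tau>) * f s v + (ennreal 1 * f s v + Bk f s v))"
  have lim: "((\<lambda>\<tau>. mass (?e p ?P \<tau>)) \<longlongrightarrow> 0) (at_right 0)" "((\<lambda>\<tau>. mass (?e q ?Q \<tau>)) \<longlongrightarrow> 0) (at_right 0)"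
    by (rule resolvent_generator_limit[OF p pfin zero_less_one], rule resolvent_generator_limit[OF q qfin zero_less_one])
  let ?d = "\<lambda>\<tau> s v. absdiff (ennreal (1 / \<tau>) * T \<tau> F s v + r s v) (ennreal (1 / \<tau>) * F s v + (q s v + Bk F s v))"
  have Qfin: "mass ?Q \<noteq> top" by (rule R_finite_mass[OF q qfin]) simp
  have BQfin: "mass (Bk ?Q) \<noteq> top" using BR_mass_le[OF q, of 1] qfin by (auto simp: top_unique)
  have le: "mass (?d \<tau>) \<le> mass (?e p ?P \<tau>) + mass (?e q ?Q \<tau>)" if t: "0 < \<tau>" for \<tau>
  proof -
    \<comment> \<open>Adding \<open>Z\<close>, finite almost everywhere, to both sides replaces the difference of resolvents by sums.\<close>
    define Z where "Z s v = ennreal (1 / \<tau>) * T \<tau> ?Q s v + (ennreal (1 / \<tau>) * ?Q s v + (?Q s v + Bk ?Q s v)) + F s v" for s v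
    have Z[measurable]: "meas Z" unfolding Z_def by measurable
    have TQ: "mass (T \<tau> ?Q) \<noteq> top"
    proof -
      have "mass (T \<tau> ?Q) \<le> mass ?Q" by (rule T_mass_le) (use t in \<open>measurable, auto\<close>)
      thus ?thesis using Qfin by (auto simp: top_unique)
    qed
    have "mass Z = ennreal (1 / \<tau>) * mass (T \<tau> ?Q) + (ennreal (1 / \<tau>) * mass ?Q + (mass ?Q + mass (Bk ?Q))) + mass F"
      unfolding Z_def by (simp add: mass_add mass_cmult)
    hence "mass Z \<noteq> top" using TQ Qfin BQfin Ffin by (simp add: ennreal_mult_eq_top_iff)
    from mass_finite_AE[OF Z this]
    have "AE s in lborel. AE v in N. Z s v \<noteq> top" by (subst (asm) AE_pair_iff(1)) measurable
    hence "mass (?d \<tau>) \<le> mass (\<lambda>s v. ?e p ?P \<tau> s v + ?e q ?Q \<tau> s v)"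
      unfolding mass_def
    proof (rule nn_integral_mono_AE[OF AE_mp], intro AE_I2 impI)
      fix s assume "AE v in N. Z s v \<noteq> top"
      hence "AE v in N. ?d \<tau> s v \<le> ?e p ?P \<tau> s v + ?e q ?Q \<tau> s v"
        using AE_space
      proof eventually_elim
        fix v assume Zv: "Z s v \<noteq> top" and v[measurable]: "v \<in> space N"
        have TP: "T \<tau> ?P s v = T \<tau> F s v + T \<tau> ?Q s v"
        proof -
          have "T \<tau> ?P s v = T \<tau> (\<lambda>s v. F s v + ?Q s v) s v" by (rule T_cong[OF split[symmetric] v])
          also have "\<dots> = T \<tau> F s v + T \<tau> ?Q s v" by (rule T_add) measurable
          finally show ?thesis .
        qed
        have BP: "Bk ?P s v = Bk F s v + Bk ?Q s v"
        proof -
          have "Bk ?P s v = Bk (\<lambda>s v. F s v + ?Q s v) s v" by (rule Bk_cong[OF split[symmetric]])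
          also have "\<dots> = Bk F s v + Bk ?Q s v" by (rule Bk_add) measurable
          finally show ?thesis .
        qed
        let ?A = "ennreal (1 / \<tau>) * T \<tau> F s v + r s v" and ?C = "ennreal (1 / \<tau>) * F s v + (q s v + Bk F s v)"
        have 1: "?A + Z s v = (ennreal (1 / \<tau>) * T \<tau> ?P s v + p s v) + (ennreal (1 / \<tau>) * ?Q s v + (ennreal 1 * ?Q s v + Bk ?Q s v))"
          unfolding Z_def TP p_def by (simp add: distrib_left ac_simps)
        have 2: "?C + Z s v = (ennreal (1 / \<tau>) * ?P s v + (ennreal 1 * ?P s v + Bk ?P s v)) + (ennreal (1 / \<tau>) * T \<tau> ?Q s v + q s v)"
          unfolding Z_def BP split[OF v, symmetric] by (simp add: distrib_left ac_simps)
        have "?d \<tau> s v \<le> absdiff (?A + Z s v) (?C + Z s v)" by (rule absdiff_cancel) (use Zv in \<open>simp add: less_top\<close>)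
        also have "\<dots> \<le> ?e p ?P \<tau> s v + absdiff (ennreal (1 / \<tau>) * ?Q s v + (ennreal 1 * ?Q s v + Bk ?Q s v)) (ennreal (1 / \<tau>) * T \<tau> ?Q s v + q s v)"
          unfolding 1 2 by (rule absdiff_add)
        also have "absdiff (ennreal (1 / \<tau>) * ?Q s v + (ennreal 1 * ?Q s v + Bk ?Q s v)) (ennreal (1 / \<tau>) * T \<tau> ?Q s v + q s v) = ?e q ?Q \<tau> s v"
          by (rule absdiff_commute)
        finally show "?d \<tau> s v \<le> ?e p ?P \<tau> s v + ?e q ?Q \<tau> s v" .
      qed
      thus "(\<integral>\<^sup>+v. ?d \<tau> s v \<partial>N) \<le> (\<integral>\<^sup>+v. ?e p ?P \<tau> s v + ?e q ?Q \<tau> s v \<partial>N)"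
        by (rule nn_integral_mono_AE)
    qed
    also have "\<dots> = mass (?e p ?P \<tau>) + mass (?e q ?Q \<tau>)" by (rule mass_add) measurable
    finally show ?thesis .
  qed
  have "((\<lambda>\<tau>. mass (?e p ?P \<tau>) + mass (?e q ?Q \<tau>)) \<longlongrightarrow> 0 + 0) (at_right 0)"
    by (rule tendsto_add[OF lim])
  hence l: "((\<lambda>\<tau>. mass (?e p ?P \<tau>) + mass (?e q ?Q \<tau>)) \<longlongrightarrow> 0) (at_right 0)" by simp
  have "\<forall>\<^sub>F \<tau> in at_right 0. mass (?d \<tau>) \<le> mass (?e p ?P \<tau>) + mass (?e q ?Q \<tau>)"
    using eventually_at_right_less[of "0::real"] by eventually_elim (rule le)
  from tendsto_sandwich[OF _ this tendsto_const l] show ?thesis unfolding q_def r_def by simp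
qed

lemma mass_T_antimono:
  assumes F[measurable]: "meas F" and "0 \<le> a" "a \<le> c"
  shows "mass (T c F) \<le> mass (T a F)"
proof -
  have m: "meas (T a F)" by measurable
  have "mass (T c F) = mass (T (c - a) (T a F))"
    by (rule mass_cong) (use assms in \<open>simp add: T_T\<close>)
  also have "\<dots> \<le> mass (T a F)" by (rule T_mass_le[OF m]) (use assms in simp)
  finally show ?thesis .
qed

definition exposure :: "(real \<Rightarrow> 'a \<Rightarrow> ennreal) \<Rightarrow> real \<Rightarrow> ennreal" where
  "exposure F u = (\<integral>\<^sup>+q. indicator {0..u} q * mass (T q F) \<partial>lborel)"

lemma mass_T_measurable[measurable]:
  assumes [measurable]: "meas F"
  shows "(\<lambda>q. mass (T q F)) \<in> borel_measurable borel"
proof -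
  have "rmeas (\<lambda>q. T q F)" by measurable
  from mass_measurable[OF this] show ?thesis .
qed

text \<open>
  The mass of \<open>T q F\<close> is nonincreasing in \<open>q\<close> and continuous at \<open>0\<close>.
\<close>

lemma exposure_average:
  assumes F[measurable]: "meas F" and fin: "mass F \<noteq> top"
  shows "((\<lambda>u. enn2real (exposure F u) / u) \<longlongrightarrow> enn2real (mass F)) (at_right 0)"
proof -
  let ?m = "\<lambda>q. mass (T q F)"
  have up: "exposure F u \<le> ennreal u * mass F" and lo: "ennreal u * ?m u \<le> exposure F u" if u: "0 < u" for u
  proof -
    have "exposure F u \<le> (\<integral>\<^sup>+q. mass F * indicator {0..u} q \<partial>lborel)"
      unfolding exposure_def by (intro nn_integral_mono) (auto simp: indicator_def T_mass_le)
    thus "exposure F u \<le> ennreal u * mass F" using u by (simp add: nn_integral_cmult mult.commute)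
    have "ennreal u * ?m u = (\<integral>\<^sup>+q. ?m u * indicator {0..u} q \<partial>lborel)"
      by (subst nn_integral_cmult_indicator) (use u in \<open>auto simp: mult.commute\<close>)
    also have "\<dots> \<le> exposure F u"
      unfolding exposure_def by (intro nn_integral_mono) (auto simp: indicator_def mass_T_antimono)
    finally show "ennreal u * ?m u \<le> exposure F u" .
  qed
  have mfin: "?m u < top" if "0 \<le> u" for u
    using T_mass_le[OF F that] fin by (auto simp: less_top[symmetric] top_unique)
  have efin: "exposure F u < top" if "0 < u" for u
    using up[OF that] fin by (auto simp: less_top[symmetric] top_unique ennreal_mult_eq_top_iff)
  have m_lim: "((\<lambda>u. enn2real (?m u)) \<longlongrightarrow> enn2real (mass F)) (at_right 0)"
  proof -
    have e: "((\<lambda>u. enn2real (edist (T u F) F)) \<longlongrightarrow> enn2real 0) (at_right 0)"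
      by (rule tendsto_enn2real) (use T_tendsto[OF F fin] in simp_all)
    have efin': "\<forall>\<^sub>F u in at_right 0. edist (T u F) F < top"
      by (rule order_tendstoD(2)[OF T_tendsto[OF F fin]]) simp
    have l: "((\<lambda>u. enn2real (mass F) - enn2real (edist (T u F) F)) \<longlongrightarrow> enn2real (mass F)) (at_right 0)"
      using tendsto_diff[OF tendsto_const e] by simp
    show ?thesis
    proof (rule tendsto_sandwich[OF _ _ l tendsto_const])
      show "\<forall>\<^sub>F u in at_right 0. enn2real (mass F) - enn2real (edist (T u F) F) \<le> enn2real (?m u)"
        using efin' eventually_at_right_less[of "0::real"]
      proof eventually_elim
        fix u :: real assume ed: "edist (T u F) F < top" and u: "0 < u"
        have "mass F \<le> ?m u + edist F (T u F)" by (rule mass_le_edist) measurable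
        also have "edist F (T u F) = edist (T u F) F" by (simp add: edist_def absdiff_commute)
        finally have "enn2real (mass F) \<le> enn2real (?m u + edist (T u F) F)"
          using mfin[of u] u ed by (intro enn2real_mono) auto
        also have "\<dots> = enn2real (?m u) + enn2real (edist (T u F) F)"
          using mfin[of u] u ed by (intro enn2real_plus) auto
        finally show "enn2real (mass F) - enn2real (edist (T u F) F) \<le> enn2real (?m u)" by simp
      qed
      show "\<forall>\<^sub>F u in at_right 0. enn2real (?m u) \<le> enn2real (mass F)"
        using eventually_at_right_less[of "0::real"]
        by eventually_elim (rule enn2real_mono, use T_mass_le[OF F] fin in \<open>auto simp: less_top\<close>)
    qed
  qed
  show ?thesis
  proof (rule tendsto_sandwich[OF _ _ m_lim tendsto_const])
    show "\<forall>\<^sub>F u in at_right 0. enn2real (?m u) \<le> enn2real (exposure F u) / u"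
      using eventually_at_right_less[of "0::real"]
    proof eventually_elim
      fix u :: real assume u: "0 < u"
      have "enn2real (ennreal u * ?m u) \<le> enn2real (exposure F u)"
        by (rule enn2real_mono[OF lo[OF u] efin[OF u]])
      thus "enn2real (?m u) \<le> enn2real (exposure F u) / u" using u by (simp add: enn2real_mult field_simps)
    qed
    show "\<forall>\<^sub>F u in at_right 0. enn2real (exposure F u) / u \<le> enn2real (mass F)"
      using eventually_at_right_less[of "0::real"]
    proof eventually_elim
      fix u :: real assume u: "0 < u"
      have "enn2real (exposure F u) \<le> enn2real (ennreal u * mass F)"
        by (rule enn2real_mono[OF up[OF u]]) (use fin in \<open>simp add: ennreal_mult_less_top less_top\<close>)
      thus "enn2real (exposure F u) / u \<le> enn2real (mass F)" using u by (simp add: enn2real_mult field_simps)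
    qed
  qed
qed

text \<open>
  With \<open>m q\<close> the mass of \<open>T q F\<close>, the four terms are the integrals of \<open>m\<close> over \<open>[0, t]\<close>, \<open>[t, t + u]\<close>,
  \<open>[0, u]\<close> and \<open>[u, t + u]\<close>.
\<close>

lemma exposure_balance:
  assumes F[measurable]: "meas F" and fin: "mass F \<noteq> top" and t: "0 \<le> t" and u: "0 < u"
  defines "\<Phi> \<equiv> \<lambda>s v. \<integral>\<^sup>+\<tau>. indicator {0..t} \<tau> * T \<tau> F s v \<partial>lborel"
  shows "mass \<Phi> + exposure (T t F) u = exposure F u + mass (T u \<Phi>)"
proof -
  let ?m = "\<lambda>q. mass (T q F)"
  have r: "rmeas (\<lambda>q. T q F)" by measurable
  have r': "rmeas (\<lambda>q. T u (T q F))" by measurable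
  have 1: "mass \<Phi> = (\<integral>\<^sup>+q. indicator {0..t} q * ?m q \<partial>lborel)"
    unfolding \<Phi>_def by (rule mass_interval[OF r])
  have 2: "exposure (T t F) u = (\<integral>\<^sup>+q. indicator {t..t + u} q * ?m q \<partial>lborel)"
  proof -
    have "exposure (T t F) u = (\<integral>\<^sup>+q. indicator {t..t + u} (q + t) * ?m (q + t) \<partial>lborel)"
      unfolding exposure_def
    proof (rule nn_integral_cong)
      fix q :: real
      have "mass (T q (T t F)) = ?m (q + t)" if "0 \<le> q" by (rule mass_cong) (use that t in \<open>simp add: T_T\<close>)
      thus "indicator {0..u} q * mass (T q (T t F)) = indicator {t..t + u} (q + t) * ?m (q + t)" by (auto simp: indicator_def)
    qed
    also have "\<dots> = (\<integral>\<^sup>+q. indicator {t..t + u} q * ?m q \<partial>lborel)" by (rule nn_integral_shift[symmetric]) measurable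
    finally show ?thesis .
  qed
  have 3: "mass (T u \<Phi>) = (\<integral>\<^sup>+q. indicator {u..t + u} q * ?m q \<partial>lborel)"
  proof -
    have "mass (T u \<Phi>) = mass (\<lambda>s v. \<integral>\<^sup>+\<tau>. indicator {0..t} \<tau> * T u (T \<tau> F) s v \<partial>lborel)"
      unfolding \<Phi>_def by (rule mass_cong) (rule T_interval[OF r])
    also have "\<dots> = (\<integral>\<^sup>+q. indicator {0..t} q * mass (T u (T q F)) \<partial>lborel)" by (rule mass_interval[OF r'])
    also have "\<dots> = (\<integral>\<^sup>+q. indicator {u..t + u} (q + u) * ?m (q + u) \<partial>lborel)"
    proof (rule nn_integral_cong)
      fix q :: real
      have "mass (T u (T q F)) = ?m (q + u)" if "0 \<le> q" by (rule mass_cong) (use that u in \<open>simp add: T_T add.commute\<close>)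
      thus "indicator {0..t} q * mass (T u (T q F)) = indicator {u..t + u} (q + u) * ?m (q + u)" by (auto simp: indicator_def)
    qed
    also have "\<dots> = (\<integral>\<^sup>+q. indicator {u..t + u} q * ?m q \<partial>lborel)" by (rule nn_integral_shift[symmetric]) measurable
    finally show ?thesis .
  qed
  have split: "(\<integral>\<^sup>+q. indicator {0..c} q * ?m q \<partial>lborel) + (\<integral>\<^sup>+q. indicator {c..t + u} q * ?m q \<partial>lborel) =
      (\<integral>\<^sup>+q. indicator {0..t + u} q * ?m q \<partial>lborel)" if "0 \<le> c" "c \<le> t + u" for c
  proof (subst nn_integral_add[symmetric], measurable, rule nn_integral_cong_AE, use AE_lborel_singleton[of c] in eventually_elim)
    fix q assume "q \<noteq> c"
    thus "indicator {0..c} q * ?m q + indicator {c..t + u} q * ?m q = indicator {0..t + u} q * ?m q"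
      using that by (auto simp: indicator_def)
  qed
  show ?thesis unfolding 1 2 3 exposure_def[of F] using split[of t] split[of u] t u by simp
qed

end

context kinetic_data begin

lemma Rep_enn2real:
  assumes [measurable]: "meas G" and "\<And>s v. s < 0 \<Longrightarrow> G s v = 0" "mass G \<noteq> top"
  shows "Rep (\<lambda>x. enn2real (G (fst x) (snd x))) G"
proof (rule RepI)
  show "(\<lambda>x. enn2real (G (fst x) (snd x))) \<in> borel_measurable (tvmeas \<mu>)"
    by (rule borel_measurable_enn2real[OF meas_tv[OF assms(1)]])
qed (use assms in simp_all)

lemma Bk_neg_time: "s < 0 \<Longrightarrow> Bk F s v = 0"
  by (simp add: Bk_def B_def bb_def b0_def)

text \<open>
  Convergence in mass of nonnegative difference quotients, written without subtraction, is
  convergence in the norm of the real ones.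
\<close>

lemma Rep_generates:
  assumes j: "Rep j F" and s: "Rep s' X" and bk: "Rep b' Y" and r: "Rep r' W"
    and lim: "((\<lambda>\<tau>. mass (\<lambda>s v. absdiff (ennreal (1 / \<tau>) * T \<tau> F s v + W s v)
      (ennreal (1 / \<tau>) * F s v + (X s v + Y s v)))) \<longlongrightarrow> 0) (at_right 0)"
  shows "generates_to (tvmeas \<mu>) (T_h \<mu> Sig b) j (\<lambda>x. s' x + b' x - r' x)"
    and "(\<integral>x. s' x + b' x - r' x \<partial>tvmeas \<mu>) = enn2real (mass X) + enn2real (mass Y) - enn2real (mass W)"
proof -
  note [measurable] = RepD(1,2)[OF j] RepD(1,2)[OF s] RepD(1,2)[OF bk] RepD(1,2)[OF r]
  note I = Rep_integral(1)[OF j] Rep_integral(1,2)[OF s] Rep_integral(1,2)[OF bk] Rep_integral(1,2)[OF r]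
  have h: "integrable (tvmeas \<mu>) (\<lambda>x. s' x + b' x - r' x)" using I by simp
  show "(\<integral>x. s' x + b' x - r' x \<partial>tvmeas \<mu>) = enn2real (mass X) + enn2real (mass Y) - enn2real (mass W)"
    using I by simp
  define d where "d \<tau> s v = absdiff (ennreal (1 / \<tau>) * T \<tau> F s v + W s v) (ennreal (1 / \<tau>) * F s v + (X s v + Y s v))" for \<tau> s v
  have dm: "meas (d \<tau>)" for \<tau> unfolding d_def by measurable
  let ?X = "\<lambda>\<tau>. \<integral>\<^sup>+x. d \<tau> (fst x) (snd x) \<partial>tvmeas \<mu>"
  have "((\<lambda>\<tau>. mass (d \<tau>)) \<longlongrightarrow> 0) (at_right 0)" using lim unfolding d_def .
  from ennreal_squeeze_0[OF this nn_integral_tv_le_mass[OF dm]]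
  have "((\<lambda>\<tau>. enn2real (?X \<tau>)) \<longlongrightarrow> enn2real 0) (at_right 0)" by (intro tendsto_enn2real) auto
  hence X: "((\<lambda>\<tau>. enn2real (?X \<tau>)) \<longlongrightarrow> 0) (at_right 0)" by simp
  have ev: "\<forall>\<^sub>F \<tau> in at_right 0. enn2real (?X \<tau>) = L1_norm (tvmeas \<mu>) (\<lambda>x. (T_h \<mu> Sig b \<tau> j x - j x) / \<tau> - (s' x + b' x - r' x))"
    using eventually_at_right_less[of "0::real"]
  proof eventually_elim
    fix \<tau> :: real assume t: "0 < \<tau>"
    have Tj: "Rep (T_h \<mu> Sig b \<tau> j) (T \<tau> F)" by (rule Rep_T_h[OF j]) (use t in simp)
    note [measurable] = RepD(1)[OF Tj]
    let ?g = "\<lambda>x. (T_h \<mu> Sig b \<tau> j x - j x) / \<tau> - (s' x + b' x - r' x)"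
    have "L1_norm (tvmeas \<mu>) ?g = enn2real (\<integral>\<^sup>+x. ennreal \<bar>?g x\<bar> \<partial>tvmeas \<mu>)"
      unfolding L1_norm_def by (rule integral_eq_nn_integral) auto
    also have "(\<integral>\<^sup>+x. ennreal \<bar>?g x\<bar> \<partial>tvmeas \<mu>) = ?X \<tau>"
    proof (rule nn_integral_cong_AE)
      show "AE x in tvmeas \<mu>. ennreal \<bar>?g x\<bar> = d \<tau> (fst x) (snd x)"
        using RepD(5)[OF Tj] RepD(5)[OF j] RepD(5)[OF s] RepD(5)[OF bk] RepD(5)[OF r]
      proof eventually_elim
        fix x
        define A where "A = T_h \<mu> Sig b \<tau> j x"
        assume a: "T \<tau> F (fst x) (snd x) = ennreal (T_h \<mu> Sig b \<tau> j x) \<and> 0 \<le> T_h \<mu> Sig b \<tau> j x"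
          "F (fst x) (snd x) = ennreal (j x) \<and> 0 \<le> j x"
          "X (fst x) (snd x) = ennreal (s' x) \<and> 0 \<le> s' x"
          "Y (fst x) (snd x) = ennreal (b' x) \<and> 0 \<le> b' x"
          "W (fst x) (snd x) = ennreal (r' x) \<and> 0 \<le> r' x"
        have nn: "0 \<le> A" "0 \<le> j x" "0 \<le> s' x" "0 \<le> b' x" "0 \<le> r' x"
          and e: "T \<tau> F (fst x) (snd x) = ennreal A" "F (fst x) (snd x) = ennreal (j x)"
            "X (fst x) (snd x) = ennreal (s' x)" "Y (fst x) (snd x) = ennreal (b' x)"
            "W (fst x) (snd x) = ennreal (r' x)"
          using a unfolding A_def by blast+
        have "d \<tau> (fst x) (snd x) = absdiff (ennreal (A / \<tau> + r' x)) (ennreal (j x / \<tau> + (s' x + b' x)))"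
          unfolding d_def e using nn t by (simp add: ennreal_mult'[symmetric])
        also have "\<dots> = ennreal \<bar>(A / \<tau> + r' x) - (j x / \<tau> + (s' x + b' x))\<bar>"
          by (rule absdiff_ennreal) (use nn t in auto)
        also have "(A / \<tau> + r' x) - (j x / \<tau> + (s' x + b' x)) = (A - j x) / \<tau> - (s' x + b' x - r' x)"
          by (simp add: diff_divide_distrib)
        finally show "ennreal \<bar>?g x\<bar> = d \<tau> (fst x) (snd x)"
          unfolding A_def by (rule sym)
      qed
    qed
    finally show "enn2real (?X \<tau>) = L1_norm (tvmeas \<mu>) ?g" by (rule sym)
  qed
  have "((\<lambda>\<tau>. L1_norm (tvmeas \<mu>) (\<lambda>x. (T_h \<mu> Sig b \<tau> j x - j x) / \<tau> - (s' x + b' x - r' x))) \<longlongrightarrow> 0) (at_right 0)"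
    by (rule Lim_transform_eventually[OF X ev])
  thus "generates_to (tvmeas \<mu>) (T_h \<mu> Sig b) j (\<lambda>x. s' x + b' x - r' x)"
    unfolding generates_to_def by (intro conjI I(1) h)
qed

lemma J_generates:
  assumes "Rep f \<Phi>" and u: "0 \<le> u"
  shows "\<exists>g. generates_to (tvmeas \<mu>) (T_h \<mu> Sig b) (\<lambda>x. LBINT s:{0..u}. Tn_h \<mu> Sig b n s f x) g \<and>
    (\<integral>x. g x \<partial>tvmeas \<mu>) = enn2real (mass (S n u \<Phi>)) + enn2real (mass (Bk (J n u \<Phi>))) - enn2real (mass (source n u \<Phi>))"
proof -
  note R = RepD[OF assms(1)]
  note Ph[measurable] = R(2)
  have s: "Rep (\<lambda>x. enn2real (S n u \<Phi> (fst x) (snd x))) (S n u \<Phi>)"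
    by (rule Rep_enn2real[OF RepD(2,3,4)[OF Rep_Tn_h[OF assms]]])
  have bk: "Rep (\<lambda>x. enn2real (Bk (J n u \<Phi>) (fst x) (snd x))) (Bk (J n u \<Phi>))"
  proof (rule Rep_enn2real[OF _ Bk_neg_time])
    show "mass (Bk (J n u \<Phi>)) \<noteq> top"
      using Bk_J_mass_le[OF Ph, of n u] R(4) by (auto simp: top_unique ennreal_mult_eq_top_iff)
  qed measurable
  have r: "Rep (\<lambda>x. enn2real (source n u \<Phi> (fst x) (snd x))) (source n u \<Phi>)"
  proof (rule Rep_enn2real)
    show "mass (source n u \<Phi>) \<noteq> top" by (rule source_mass_finite[OF Ph R(4)])
    show "source n u \<Phi> s v = 0" if "s < 0" for s v
      using R(3)[OF that] Bk_neg_time[OF that] by (cases n) (auto simp: source_def)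
  qed measurable
  note g = Rep_generates[OF Rep_J[OF assms] s bk r J_generator_limit[OF Ph R(4) u]]
  show ?thesis by (rule exI, rule conjI, rule g(1), rule g(2))
qed

lemma a_fun_J:
  assumes "Rep f \<Phi>" and u: "0 \<le> u"
  shows "a_fun \<mu> Sig b (\<lambda>x. LBINT s:{0..u}. Tn_h \<mu> Sig b n s f x) =
    enn2real (mass (source n u \<Phi>)) - enn2real (mass (S n u \<Phi>)) - enn2real (mass (Bk (J n u \<Phi>)))"
proof -
  let ?j = "\<lambda>x. LBINT s:{0..u}. Tn_h \<mu> Sig b n s f x"
  obtain g where g: "generates_to (tvmeas \<mu>) (T_h \<mu> Sig b) ?j g"
    and ig: "(\<integral>x. g x \<partial>tvmeas \<mu>) = enn2real (mass (S n u \<Phi>)) + enn2real (mass (Bk (J n u \<Phi>))) - enn2real (mass (source n u \<Phi>))"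
    using J_generates[OF assms, of n] by blast
  have G: "generates_to (tvmeas \<mu>) (T_h \<mu> Sig b) ?j (G_h \<mu> Sig b ?j)"
    unfolding G_h_def gen_op_def by (rule someI[where P = "generates_to (tvmeas \<mu>) (T_h \<mu> Sig b) ?j", OF g])
  have int: "integrable (tvmeas \<mu>) (T_h \<mu> Sig b \<tau> ?j)" if "0 < \<tau>" for \<tau>
    by (rule Rep_integral(1)[OF Rep_T_h[OF Rep_J[OF assms, of n]]]) (use that in simp)
  have "(\<integral>x. G_h \<mu> Sig b ?j x \<partial>tvmeas \<mu>) = (\<integral>x. g x \<partial>tvmeas \<mu>)"
    by (rule generates_to_integral_unique[of "tvmeas \<mu>" "T_h \<mu> Sig b", OF int G g])
  hence "(\<integral>x. G_h \<mu> Sig b ?j x \<partial>tvmeas \<mu>) =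
     enn2real (mass (S n u \<Phi>)) + enn2real (mass (Bk (J n u \<Phi>))) - enn2real (mass (source n u \<Phi>))"
    unfolding ig .
  thus ?thesis unfolding a_fun_def B_hat_def by simp
qed

text \<open>
  The mass lost to the next scattering is the source of the next term, so the partial sums telescope.
\<close>

lemma a_fun_sums:
  assumes "Rep f \<Phi>" and u: "0 \<le> u" and van: "(\<lambda>n. mass (Bk (J n u \<Phi>))) \<longlonglongrightarrow> 0"
  shows "(\<Sum>n. a_fun \<mu> Sig b (\<lambda>x. LBINT s:{0..u}. Tn_h \<mu> Sig b n s f x)) = enn2real (mass \<Phi>) - enn2real (mass (T u \<Phi>))"
proof (rule sums_unique[symmetric])
  note R = RepD[OF assms(1)]
  note Ph[measurable] = R(2)
  let ?a = "\<lambda>n. a_fun \<mu> Sig b (\<lambda>x. LBINT s:{0..u}. Tn_h \<mu> Sig b n s f x)"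
  let ?g = "\<lambda>n. enn2real (mass (Bk (J n u \<Phi>)))" and ?s = "\<lambda>n. enn2real (mass (S n u \<Phi>))"
  have part: "(\<Sum>n<Suc k. ?a n) = enn2real (mass \<Phi>) - (\<Sum>n<Suc k. ?s n) - ?g k" for k
  proof (induction k)
    case 0 thus ?case using a_fun_J[OF assms(1,2), of 0] by (simp add: source_def)
  next
    case (Suc k)
    have "?a (Suc k) = ?g k - ?s (Suc k) - ?g (Suc k)" using a_fun_J[OF assms(1,2), of "Suc k"] by (simp add: source_def)
    with Suc show ?case by simp
  qed
  have "mass (T u \<Phi>) = (\<Sum>n. mass (S n u \<Phi>))"
    unfolding T_eq_suminf[abs_def] by (rule mass_suminf) measurable
  also have "\<dots> = (\<Sum>n. ennreal (?s n))"
  proof (rule suminf_cong)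
    fix n
    have "mass (S n u \<Phi>) < top" using S_mass_le[OF Ph u, of n] R(4) by (auto simp: less_top top_unique)
    thus "mass (S n u \<Phi>) = ennreal (?s n)" by simp
  qed
  finally have mT: "mass (T u \<Phi>) = (\<Sum>n. ennreal (?s n))" .
  have fin: "mass (T u \<Phi>) \<noteq> top" using T_mass_le[OF Ph u] R(4) by (auto simp: top_unique)
  have sm: "summable ?s" by (rule summable_suminf_not_top) (use mT fin in auto)
  have "mass (T u \<Phi>) = ennreal (\<Sum>n. ?s n)"
    unfolding mT by (intro suminf_ennreal_eq summable_sums sm) auto
  hence "enn2real (mass (T u \<Phi>)) = (\<Sum>n. ?s n)" using sm by (simp add: suminf_nonneg)
  with sm have s: "?s sums enn2real (mass (T u \<Phi>))" by (simp add: summable_sums)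
  have "(\<lambda>n. ?g n) \<longlonglongrightarrow> enn2real 0" by (rule tendsto_enn2real) (use van in auto)
  hence g: "?g \<longlonglongrightarrow> 0" by simp
  have "(\<lambda>k. enn2real (mass \<Phi>) - (\<Sum>n<Suc k. ?s n) - ?g k) \<longlonglongrightarrow> enn2real (mass \<Phi>) - enn2real (mass (T u \<Phi>)) - 0"
    using LIMSEQ_Suc[OF s[unfolded sums_def]] g by (intro tendsto_diff tendsto_const)
  hence "(\<lambda>k. \<Sum>n<Suc k. ?a n) \<longlonglongrightarrow> enn2real (mass \<Phi>) - enn2real (mass (T u \<Phi>))"
    unfolding part by simp
  thus "?a sums (enn2real (mass \<Phi>) - enn2real (mass (T u \<Phi>)))"
    unfolding sums_def by (rule LIMSEQ_imp_Suc)
qed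

text \<open>
  For \<open>\<Phi> = \<integral>\<^sub>0\<^sup>t T \<tau> F d\<tau>\<close> the sum in the definition of \<open>\<aa>\<close>-hat is \<open>mass \<Phi> - mass (T u \<Phi>)\<close>.  By \<open>exposure_balance\<close>
  this is a difference of two integrals over \<open>[0, u]\<close>, and dividing by \<open>u\<close> gives
  \<open>mass F - mass (T t F)\<close> in the limit.
\<close>

theorem honest_if_gain_vanishes:
  assumes van: "\<And>\<Phi> u. meas \<Phi> \<Longrightarrow> mass \<Phi> \<noteq> top \<Longrightarrow> (\<And>s v. s < 0 \<Longrightarrow> \<Phi> s v = 0) \<Longrightarrow> (\<lambda>n. mass (Bk (J n u \<Phi>))) \<longlonglongrightarrow> 0"
  shows "honest_evolution \<mu> Sig b"
  unfolding honest_evolution_def honest_semigroup_def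
proof (intro allI impI)
  fix f :: "real \<times> 'a \<Rightarrow> real" and t :: real
  assume fi: "integrable (tvmeas \<mu>) f" and f0: "AE x in tvmeas \<mu>. 0 \<le> f x" and t: "0 \<le> t"
  define F where "F s v = (if 0 \<le> s then ennreal (f (s, v)) else 0)" for s v
  have [measurable]: "f \<in> borel_measurable (tvmeas \<mu>)" by (rule borel_measurable_integrable[OF fi])
  have F: "Rep f F"
  proof (rule RepI)
    have "(\<lambda>x. if 0 \<le> fst x then ennreal (f x) else 0) \<in> borel_measurable (borel \<Otimes>\<^sub>M N)"
    proof (rule extend_measurable)
      show "(\<lambda>x. ennreal (f x)) \<in> borel_measurable (tmeas \<Otimes>\<^sub>M N)"
        unfolding tvmeas_def[symmetric] by measurable
    qed simp
    also have "(\<lambda>x. if 0 \<le> fst x then ennreal (f x) else 0) = case_prod F" by (auto simp: F_def)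
    finally show Fm: "meas F" .
    show F0: "F s v = 0" if "s < 0" for s v using that by (simp add: F_def)
    have "mass F = (\<integral>\<^sup>+x. F (fst x) (snd x) \<partial>tvmeas \<mu>)" by (rule nn_integral_tv_mass[OF Fm F0, symmetric])
    also have "\<dots> = (\<integral>\<^sup>+x. ennreal (f x) \<partial>tvmeas \<mu>)"
      by (rule nn_integral_cong) (auto simp: F_def space_tv)
    also have "\<dots> \<le> (\<integral>\<^sup>+x. ennreal (norm (f x)) \<partial>tvmeas \<mu>)" by (intro nn_integral_mono ennreal_leI) auto
    also have "\<dots> < top" using fi by (simp add: integrable_iff_bounded)
    finally show "mass F \<noteq> top" by simp
    show "AE x in tvmeas \<mu>. f x = enn2real (F (fst x) (snd x))"
      using f0 AE_space by eventually_elim (simp add: F_def space_tv)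
  qed measurable
  note R = RepD[OF F]
  note Fm[measurable] = R(2)
  define \<Phi> where "\<Phi> = (\<lambda>s v. \<integral>\<^sup>+\<tau>. indicator {0..t} \<tau> * T \<tau> F s v \<partial>lborel)"
  let ?g = "\<lambda>x. LBINT s:{0..t}. T_h \<mu> Sig b s f x"
  have g: "Rep ?g \<Phi>" unfolding \<Phi>_def by (rule Rep_T_integral[OF F t])
  note P = RepD[OF g]
  have Tt: "Rep (T_h \<mu> Sig b t f) (T t F)" by (rule Rep_T_h[OF F t])
  note Ttm = RepD(2,4)[OF Tt]
  have ex: "exposure H u < top" if "meas H" "mass H \<noteq> top" for H and u :: real
  proof -
    note [measurable] = that(1)
    have "exposure H u \<le> (\<integral>\<^sup>+q. mass H * indicator {0..u} q \<partial>lborel)"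
      unfolding exposure_def by (intro nn_integral_mono) (auto simp: indicator_def T_mass_le)
    also have "\<dots> = mass H * emeasure lborel {0..u}" by (rule nn_integral_cmult_indicator) simp
    also have "\<dots> < top"
    proof -
      have "emeasure lborel {0..u} < top" by (simp add: emeasure_lborel_Icc_eq)
      moreover have "mass H < top" using that(2) by (simp add: less_top)
      ultimately show ?thesis by (simp add: ennreal_mult_less_top)
    qed
    finally show ?thesis .
  qed
  let ?q = "\<lambda>u. 1 / u * (\<Sum>n. a_fun \<mu> Sig b (\<lambda>x. LBINT s:{0..u}. Tn_h \<mu> Sig b n s ?g x))"
  have "((\<lambda>u. enn2real (exposure F u) / u - enn2real (exposure (T t F) u) / u) \<longlongrightarrow> enn2real (mass F) - enn2real (mass (T t F))) (at_right 0)"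
    by (intro tendsto_diff exposure_average R(2,4) Ttm)
  moreover have "\<forall>\<^sub>F u in at_right 0. enn2real (exposure F u) / u - enn2real (exposure (T t F) u) / u = ?q u"
    using eventually_at_right_less[of "0::real"]
  proof eventually_elim
    fix u :: real assume u: "0 < u"
    have TP: "mass (T u \<Phi>) < top"
      using T_mass_le[OF P(2), of u] u P(4) by (auto simp: less_top[symmetric] top_unique)
    have "mass \<Phi> + exposure (T t F) u = exposure F u + mass (T u \<Phi>)"
      unfolding \<Phi>_def by (rule exposure_balance[OF R(2,4) t u])
    hence "enn2real (mass \<Phi> + exposure (T t F) u) = enn2real (exposure F u + mass (T u \<Phi>))" by simp
    hence "enn2real (mass \<Phi>) + enn2real (exposure (T t F) u) = enn2real (exposure F u) + enn2real (mass (T u \<Phi>))"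
      using ex[OF R(2,4), of u] ex[OF Ttm, of u] P(4) TP by (simp add: enn2real_plus less_top)
    hence "enn2real (mass \<Phi>) - enn2real (mass (T u \<Phi>)) = enn2real (exposure F u) - enn2real (exposure (T t F) u)" by simp
    thus "enn2real (exposure F u) / u - enn2real (exposure (T t F) u) / u = ?q u"
      using a_fun_sums[OF g _ van[OF P(2,4,3)], of u] u by (simp add: diff_divide_distrib)
  qed
  ultimately have "(?q \<longlongrightarrow> enn2real (mass F) - enn2real (mass (T t F))) (at_right 0)"
    by (rule Lim_transform_eventually)
  hence "a_hat \<mu> Sig b ?g = enn2real (mass F) - enn2real (mass (T t F))"
    unfolding a_hat_def by (intro tendsto_Lim) auto
  thus "L1_norm (tvmeas \<mu>) (T_h \<mu> Sig b t f) = L1_norm (tvmeas \<mu>) f - a_hat \<mu> Sig b ?g"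
    using Rep_integral(3)[OF F] Rep_integral(3)[OF Tt] by simp
qed

end

section \<open>Absolutely continuous functions\<close>

lemma ac_continuous_on:
  assumes "absolutely_continuous_fun_on I f" and I: "\<And>x y. x \<in> I \<Longrightarrow> y \<in> I \<Longrightarrow> {x..y} \<subseteq> I"
  shows "continuous_on I f"
  unfolding continuous_on_iff
proof (intro ballI allI impI)
  fix x and e :: real assume x: "x \<in> I" and e: "0 < e"
  from assms(1) e obtain d where d: "d > 0" and *: "\<And>(n::nat) a b. (\<forall>i<n. a i \<le> b i \<and> {a i..b i} \<subseteq> I) \<Longrightarrow>
      (\<forall>i<n. \<forall>j<n. i \<noteq> j \<longrightarrow> {a i<..<b i} \<inter> {a j<..<b j} = {}) \<Longrightarrow>
      (\<Sum>i<n. b i - a i) < d \<Longrightarrow> (\<Sum>i<n. \<bar>f (b i) - f (a i)\<bar>) < e"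
    unfolding absolutely_continuous_fun_on_def by blast
  show "\<exists>d>0. \<forall>x'\<in>I. dist x' x < d \<longrightarrow> dist (f x') (f x) < e"
  proof (intro exI[of _ d] conjI ballI impI d)
    fix y assume y: "y \<in> I" "dist y x < d"
    show "dist (f y) (f x) < e"
    proof (cases "x \<le> y")
      case True
      with *[of 1 "\<lambda>_. x" "\<lambda>_. y"] I[OF x y(1)] y(2) show ?thesis by (auto simp: dist_real_def)
    next
      case False
      with *[of 1 "\<lambda>_. y" "\<lambda>_. x"] I[OF y(1) x] y(2) show ?thesis
        by (auto simp: dist_real_def abs_minus_commute)
    qed
  qed
qed

text \<open>
  Absolute continuity is stated for indexed families of intervals; here the family is a part of a tagged
  division lying in an open set of small measure.
\<close>

lemma tagged_subset_variation:
  fixes P :: "real \<Rightarrow> real"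
  assumes p: "p tagged_division_of {a..b}" and q: "q \<subseteq> p"
    and U: "open U" "emeasure lborel U < ennreal \<delta>" and qU: "\<And>x k. (x, k) \<in> q \<Longrightarrow> k \<subseteq> U"
    and ac: "\<And>(n::nat) c d. (\<forall>i<n. c i \<le> d i \<and> {c i..d i} \<subseteq> {a..b}) \<Longrightarrow>
      (\<forall>i<n. \<forall>j<n. i \<noteq> j \<longrightarrow> {c i<..<d i} \<inter> {c j<..<d j} = {}) \<Longrightarrow>
      (\<Sum>i<n. d i - c i) < \<delta> \<Longrightarrow> (\<Sum>i<n. \<bar>P (d i) - P (c i)\<bar>) < \<epsilon>"
  shows "(\<Sum>(x, k)\<in>q. \<bar>P (Sup k) - P (Inf k)\<bar>) < \<epsilon>"
proof -
  have fq: "finite q" using p q by (meson finite_subset tagged_division_ofD(1))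
  obtain h where h: "bij_betw h {..<card q} q"
    using ex_bij_betw_nat_finite[OF fq] by (auto simp: atLeast0LessThan)
  define c where "c i = Inf (snd (h i))" for i
  define d where "d i = Sup (snd (h i))" for i
  have hq: "h i \<in> q" if "i < card q" for i using h that by (auto simp: bij_betw_def)
  have form: "snd (h i) = {c i..d i}" "c i \<le> d i" if "i < card q" for i
  proof -
    obtain x k where xk: "h i = (x, k)" by fastforce
    with hq[OF that] q have "(x, k) \<in> p" by auto
    from tagged_division_ofD(4)[OF p this] tagged_division_ofD(2)[OF p this]
    obtain l r where "k = {l..r}" "x \<in> k" by (auto simp: cbox_interval)
    hence "l \<le> r" "k = {l..r}" by auto
    thus "snd (h i) = {c i..d i}" "c i \<le> d i" by (auto simp: c_def d_def xk)
  qed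
  have sub: "{c i..d i} \<subseteq> {a..b}" if "i < card q" for i
  proof -
    have "(fst (h i), snd (h i)) \<in> p" using hq[OF that] q by auto
    from tagged_division_ofD(3)[OF p this] show ?thesis unfolding form(1)[OF that] .
  qed
  have dis: "{c i<..<d i} \<inter> {c j<..<d j} = {}" if "i < card q" "j < card q" "i \<noteq> j" for i j
  proof -
    have "h i \<noteq> h j" using h that by (auto simp: bij_betw_def inj_on_def)
    with tagged_division_ofD(5)[OF p, of "fst (h i)" "snd (h i)" "fst (h j)" "snd (h j)"] hq that q
    have "interior (snd (h i)) \<inter> interior (snd (h j)) = {}" by (auto simp: prod_eq_iff)
    thus ?thesis using form that by simp
  qed
  have len: "(\<Sum>i<card q. d i - c i) < \<delta>"
  proof -
    have "ennreal (\<Sum>i<card q. d i - c i) = (\<Sum>i<card q. emeasure lborel {c i<..<d i})"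
      using form(2) by (subst sum_ennreal[symmetric]) (auto intro!: sum.cong)
    also have "\<dots> = emeasure lborel (\<Union>i\<in>{..<card q}. {c i<..<d i})"
      by (rule sum_emeasure) (use dis in \<open>auto simp: disjoint_family_on_def\<close>)
    also have "\<dots> \<le> emeasure lborel U"
    proof (rule emeasure_mono)
      show "(\<Union>i\<in>{..<card q}. {c i<..<d i}) \<subseteq> U"
      proof (rule UN_least)
        fix i assume i: "i \<in> {..<card q}"
        have "snd (h i) \<subseteq> U" using qU[of "fst (h i)" "snd (h i)"] hq i by simp
        thus "{c i<..<d i} \<subseteq> U" using form(1) i by auto
      qed
    qed (use U(1) in simp)
    also have "\<dots> < ennreal \<delta>" by (rule U(2))
    finally show ?thesis using form(2) by (subst (asm) ennreal_less_iff) (auto intro!: sum_nonneg)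
  qed
  have "(\<Sum>i<card q. \<bar>P (d i) - P (c i)\<bar>) < \<epsilon>"
    by (rule ac) (use form sub dis len in auto)
  also have "(\<Sum>i<card q. \<bar>P (d i) - P (c i)\<bar>) = (\<Sum>i<card q. (\<lambda>(x, k). \<bar>P (Sup k) - P (Inf k)\<bar>) (h i))"
    by (simp add: c_def d_def case_prod_beta)
  also have "\<dots> = (\<Sum>(x, k)\<in>q. \<bar>P (Sup k) - P (Inf k)\<bar>)"
    by (rule sum.reindex_bij_betw[OF h])
  finally show ?thesis .
qed

text \<open>
  A gauge argument.  Points with a nonnegative derivative receive a gauge on which \<open>P\<close> decreases with slope at most
  \<open>\<epsilon>\<close>; the null set of other points is covered by an open set so small that absolute
  continuity bounds the variation of \<open>P\<close> on it.  Both contributions are summed over a fine division.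
\<close>

lemma ac_deriv_nonneg_le:
  fixes P :: "real \<Rightarrow> real"
  assumes ab: "a \<le> b"
    and ac: "\<And>\<epsilon>. 0 < \<epsilon> \<Longrightarrow> \<exists>\<delta>>0. \<forall>(n::nat) c d.
      (\<forall>i<n. c i \<le> d i \<and> {c i..d i} \<subseteq> {a..b}) \<longrightarrow>
      (\<forall>i<n. \<forall>j<n. i \<noteq> j \<longrightarrow> {c i<..<d i} \<inter> {c j<..<d j} = {}) \<longrightarrow>
      (\<Sum>i<n. d i - c i) < \<delta> \<longrightarrow> (\<Sum>i<n. \<bar>P (d i) - P (c i)\<bar>) < \<epsilon>"
    and deriv: "AE t in lborel. t \<in> {a..b} \<longrightarrow> (\<exists>D\<ge>0. (P has_real_derivative D) (at t))"
  shows "P a \<le> P b"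
proof (rule field_le_epsilon)
  fix \<epsilon>' :: real assume e': "0 < \<epsilon>'"
  \<comment> \<open>Decrease at most \<open>\<epsilon> (b - a)\<close> over the division and \<open>\<epsilon>\<close> over the exceptional set.\<close>
  define \<epsilon> where "\<epsilon> = \<epsilon>' / (1 + (b - a))"
  have "\<epsilon> * (1 + (b - a)) = \<epsilon>'" using ab by (simp add: \<epsilon>_def)
  hence e: "0 < \<epsilon>" "\<epsilon> + \<epsilon> * (b - a) = \<epsilon>'"
    using e' ab by (simp_all add: \<epsilon>_def distrib_left)
  from ac[OF e(1)] obtain \<delta> where d: "\<delta> > 0" and ac': "\<And>(n::nat) c d.
      (\<forall>i<n. c i \<le> d i \<and> {c i..d i} \<subseteq> {a..b}) \<Longrightarrow>
      (\<forall>i<n. \<forall>j<n. i \<noteq> j \<longrightarrow> {c i<..<d i} \<inter> {c j<..<d j} = {}) \<Longrightarrow>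
      (\<Sum>i<n. d i - c i) < \<delta> \<Longrightarrow> (\<Sum>i<n. \<bar>P (d i) - P (c i)\<bar>) < \<epsilon>" by blast
  obtain Z where Z: "{t \<in> space lborel. \<not> (t \<in> {a..b} \<longrightarrow> (\<exists>D\<ge>0. (P has_real_derivative D) (at t)))} \<subseteq> Z"
    "emeasure lborel Z = 0" "Z \<in> sets lborel" by (rule AE_E[OF deriv])
  have "Z \<in> sets borel" using Z(3) by simp
  \<comment> \<open>The variation of \<open>P\<close> on intervals inside \<open>U\<close> is below \<open>\<epsilon>\<close>.\<close>
  from outer_regular_lborel[OF this d] obtain U where U: "open U" "Z \<subseteq> U" "emeasure lborel (U - Z) < ennreal \<delta>" by auto
  have Ud: "emeasure lborel U < ennreal \<delta>"
  proof -
    have "emeasure lborel U \<le> emeasure lborel Z + emeasure lborel (U - Z)"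
      using U Z(3) by (subst plus_emeasure) (auto simp: Un_absorb1 intro: emeasure_mono)
    thus ?thesis using U(3) Z(2) by simp
  qed
  have "\<exists>r>0. (t \<in> Z \<longrightarrow> ball t r \<subseteq> U) \<and>
      (t \<in> {a..b} - Z \<longrightarrow> (\<forall>u v. u \<le> t \<longrightarrow> t \<le> v \<longrightarrow> {u..v} \<subseteq> ball t r \<longrightarrow> - (\<epsilon> * (v - u)) \<le> P v - P u))" for t
  proof (cases "t \<in> Z")
    case True
    hence "t \<in> U" using U(2) by auto
    then obtain r where "r > 0" "ball t r \<subseteq> U" using U(1) open_contains_ball by blast
    thus ?thesis using True by blast
  next
    case False
    show ?thesis
    proof (cases "t \<in> {a..b}")
      case True
      with False Z(1) obtain D where D: "D \<ge> 0" "(P has_real_derivative D) (at t)" by auto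
      from D(2) have "(P has_derivative (\<lambda>x. D * x)) (at t)" by (simp add: has_field_derivative_def)
      from has_derivative_at_alt[THEN iffD1, OF this] e(1)
      obtain r where r: "r > 0" "\<And>y. \<bar>y - t\<bar> < r \<Longrightarrow> \<bar>P y - P t - D * (y - t)\<bar> \<le> \<epsilon> * \<bar>y - t\<bar>"
        by (auto simp: real_norm_def)
      show ?thesis
      proof (intro exI[of _ r] conjI impI allI r(1))
        fix u v assume uv: "u \<le> t" "t \<le> v" "{u..v} \<subseteq> ball t r"
        have "u \<in> {u..v}" "v \<in> {u..v}" using uv(1,2) by auto
        hence "u \<in> ball t r" "v \<in> ball t r" using uv(3) by blast+
        hence "\<bar>u - t\<bar> < r" "\<bar>v - t\<bar> < r" by (auto simp: dist_real_def abs_minus_commute)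
        from r(2)[OF this(1)] r(2)[OF this(2)] uv
        have 1: "\<bar>P u - P t - D * (u - t)\<bar> \<le> \<epsilon> * (t - u)" and 2: "\<bar>P v - P t - D * (v - t)\<bar> \<le> \<epsilon> * (v - t)" by auto
        have "P v - P u \<ge> D * (v - t) - \<epsilon> * (v - t) + D * (t - u) - \<epsilon> * (t - u)"
          using 1 2 by (simp add: abs_le_iff algebra_simps)
        moreover have "0 \<le> D * (v - t)" "0 \<le> D * (t - u)" using D(1) uv by auto
        ultimately show "- (\<epsilon> * (v - u)) \<le> P v - P u" by (simp add: algebra_simps)
      qed (use False in auto)
    next
      case False': False
      thus ?thesis using False by (intro exI[of _ 1]) auto
    qed
  qed
  then obtain \<gamma> where g: "\<And>t. \<gamma> t > 0" "\<And>t. t \<in> Z \<Longrightarrow> ball t (\<gamma> t) \<subseteq> U"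
    "\<And>t u v. t \<in> {a..b} - Z \<Longrightarrow> u \<le> t \<Longrightarrow> t \<le> v \<Longrightarrow> {u..v} \<subseteq> ball t (\<gamma> t) \<Longrightarrow> - (\<epsilon> * (v - u)) \<le> P v - P u"
    by metis
  have "gauge (\<lambda>t. ball t (\<gamma> t))" using g(1) by (auto simp: gauge_def)
  then obtain p where p: "p tagged_division_of {a..b}" "(\<lambda>t. ball t (\<gamma> t)) fine p"
    by (rule fine_division_exists_real)
  have fp: "finite p" by (rule tagged_division_ofD(1)[OF p(1)])
  define q where "q = {x \<in> p. fst x \<in> Z}"
  have qp: "q \<subseteq> p" by (auto simp: q_def)
  have qs: "(\<Sum>(x, k)\<in>q. \<bar>P (Sup k) - P (Inf k)\<bar>) < \<epsilon>"
  proof (rule tagged_subset_variation[OF p(1) qp U(1) Ud _ ac'])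
    fix x k assume "(x, k) \<in> q"
    hence xk: "(x, k) \<in> p" "x \<in> Z" by (auto simp: q_def)
    from fineD[OF p(2) xk(1)] g(2)[OF xk(2)] show "k \<subseteq> U" by (rule order_trans)
  qed
  have rest: "- (\<epsilon> * (Sup k - Inf k)) \<le> P (Sup k) - P (Inf k)" if "(x, k) \<in> p - q" for x k
  proof -
    have xk: "(x, k) \<in> p" "x \<notin> Z" using that by (auto simp: q_def)
    from tagged_division_ofD(4)[OF p(1) xk(1)] tagged_division_ofD(2,3)[OF p(1) xk(1)]
    obtain l r where k: "k = {l..r}" "x \<in> k" "k \<subseteq> {a..b}" by (auto simp: cbox_interval)
    hence "l \<le> x" "x \<le> r" by auto
    moreover have "k \<subseteq> ball x (\<gamma> x)" by (rule fineD[OF p(2) xk(1)])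
    ultimately show ?thesis using g(3)[of x l r] k xk(2) by auto
  qed
  have len: "(\<Sum>(x, k)\<in>p. Sup k - Inf k) = b - a"
    using additive_tagged_division_1[OF ab p(1), of "\<lambda>x. x"] by simp
  have nn: "0 \<le> Sup k - Inf k" if "(x, k) \<in> p" for x k
  proof -
    from tagged_division_ofD(4)[OF p(1) that] tagged_division_ofD(2)[OF p(1) that]
    obtain l r where k: "k = {l..r}" "x \<in> k" by (auto simp: cbox_interval)
    thus ?thesis by auto
  qed
  have "P b - P a = (\<Sum>(x, k)\<in>p. P (Sup k) - P (Inf k))"
    using additive_tagged_division_1[OF ab p(1), of P] by simp
  also have "\<dots> = (\<Sum>(x, k)\<in>p - q. P (Sup k) - P (Inf k)) + (\<Sum>(x, k)\<in>q. P (Sup k) - P (Inf k))"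
    by (rule sum.subset_diff[OF qp fp])
  also have "\<dots> \<ge> - (\<epsilon> * (b - a)) + - \<epsilon>"
  proof (rule add_mono)
    have "- (\<epsilon> * (b - a)) = (\<Sum>(x, k)\<in>p. - (\<epsilon> * (Sup k - Inf k)))"
      unfolding len[symmetric] by (simp add: sum_distrib_left sum_negf case_prod_beta)
    also have "\<dots> \<le> (\<Sum>(x, k)\<in>p - q. - (\<epsilon> * (Sup k - Inf k)))"
    proof -
      have "(\<Sum>(x, k)\<in>p - q. \<epsilon> * (Sup k - Inf k)) \<le> (\<Sum>(x, k)\<in>p. \<epsilon> * (Sup k - Inf k))"
        using fp e(1) nn by (intro sum_mono2) auto
      thus ?thesis by (simp add: sum_negf case_prod_beta)
    qed
    also have "\<dots> \<le> (\<Sum>(x, k)\<in>p - q. P (Sup k) - P (Inf k))"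
      using rest by (intro sum_mono) auto
    finally show "- (\<epsilon> * (b - a)) \<le> (\<Sum>(x, k)\<in>p - q. P (Sup k) - P (Inf k))" .
    have "\<bar>\<Sum>(x, k)\<in>q. P (Sup k) - P (Inf k)\<bar> \<le> (\<Sum>(x, k)\<in>q. \<bar>P (Sup k) - P (Inf k)\<bar>)"
      unfolding case_prod_beta by (rule sum_abs)
    thus "- \<epsilon> \<le> (\<Sum>(x, k)\<in>q. P (Sup k) - P (Inf k))" using qs by linarith
  qed
  finally show "P a \<le> P b + \<epsilon>'" using e(2) by simp
qed

text \<open>
  The product of \<open>f\<close> with a Lipschitz function is absolutely continuous on bounded intervals, and its
  derivative is \<open>exp (l t) (l f + f')\<close>.
\<close>

lemma ac_exp_mono:
  fixes f f' :: "real \<Rightarrow> real"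
  assumes ac: "absolutely_continuous_fun_on {0..} f" and l: "0 < l"
    and deriv: "AE t in lborel. 0 \<le> t \<longrightarrow> (f has_real_derivative f' t) (at t)"
    and sub: "AE t in lborel. 0 \<le> t \<longrightarrow> 0 \<le> l * f t + f' t"
    and ab: "0 \<le> a" "a \<le> b"
  shows "exp (l * a) * f a \<le> exp (l * b) * f b"
proof (rule ac_deriv_nonneg_le[OF ab(2)])
  have cont: "continuous_on {a..b} f"
    by (rule continuous_on_subset[OF ac_continuous_on[OF ac]]) (use ab in auto)
  hence "compact (f ` {a..b})" by (rule compact_continuous_image) simp
  then obtain C where C: "\<And>x. x \<in> {a..b} \<Longrightarrow> \<bar>f x\<bar> \<le> C"
    using compact_imp_bounded bounded_iff by (metis (no_types, lifting) imageI real_norm_def)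
  have C0: "0 \<le> C" using C[of a] ab by auto
  define K where "K = exp (l * b)"
  have K: "0 < K" by (simp add: K_def)
  have pt: "\<bar>exp (l * y) * f y - exp (l * x) * f x\<bar> \<le> K * \<bar>f y - f x\<bar> + C * (l * K) * (y - x)"
    if "x \<le> y" "{x..y} \<subseteq> {a..b}" for x y
  proof -
    have xy: "x \<in> {a..b}" "y \<in> {a..b}" using that by auto
    have eq: "exp (l * y) * f y - exp (l * x) * f x = exp (l * y) * (f y - f x) + (exp (l * y) - exp (l * x)) * f x"
      by (simp add: algebra_simps)
    have "exp (l * y) \<le> K" using xy l by (auto simp: K_def)
    hence 1: "\<bar>exp (l * y) * (f y - f x)\<bar> \<le> K * \<bar>f y - f x\<bar>" by (simp add: abs_mult mult_right_mono)
    have "exp (l * y) - exp (l * x) \<le> l * K * (y - x)"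
    proof -
      have "exp (l * y) * (1 + l * (x - y)) \<le> exp (l * y) * exp (l * (x - y))"
        by (intro mult_left_mono exp_ge_add_one_self) auto
      also have "\<dots> = exp (l * x)" by (simp add: exp_add[symmetric] algebra_simps)
      finally have "exp (l * y) - exp (l * x) \<le> exp (l * y) * (l * (y - x))" by (simp add: algebra_simps)
      also have "\<dots> \<le> K * (l * (y - x))" using \<open>exp (l * y) \<le> K\<close> l that by (intro mult_right_mono) auto
      finally show ?thesis by (simp add: mult_ac)
    qed
    moreover have "0 \<le> exp (l * y) - exp (l * x)" using that l by simp
    ultimately have 2: "\<bar>(exp (l * y) - exp (l * x)) * f x\<bar> \<le> (l * K * (y - x)) * C"
      unfolding abs_mult using C[OF xy(1)] l K that by (intro mult_mono) auto
    show ?thesis unfolding eq using abs_triangle_ineq[of "exp (l * y) * (f y - f x)" "(exp (l * y) - exp (l * x)) * f x"] 1 2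
      by (simp add: mult_ac)
  qed
  fix \<epsilon> :: real assume e: "0 < \<epsilon>"
  have "0 < \<epsilon> / (2 * K)" using e K by simp
  with ac obtain \<delta> where d: "\<delta> > 0" and *: "\<And>(n::nat) c d. (\<forall>i<n. c i \<le> d i \<and> {c i..d i} \<subseteq> {0..}) \<Longrightarrow>
      (\<forall>i<n. \<forall>j<n. i \<noteq> j \<longrightarrow> {c i<..<d i} \<inter> {c j<..<d j} = {}) \<Longrightarrow>
      (\<Sum>i<n. d i - c i) < \<delta> \<Longrightarrow> (\<Sum>i<n. \<bar>f (d i) - f (c i)\<bar>) < \<epsilon> / (2 * K)"
    unfolding absolutely_continuous_fun_on_def by blast
  define L where "L = C * (l * K) + 1"
  have L: "0 < L" using C0 l K by (simp add: L_def add_nonneg_pos)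
  show "\<exists>\<delta>>0. \<forall>(n::nat) c d.
      (\<forall>i<n. c i \<le> d i \<and> {c i..d i} \<subseteq> {a..b}) \<longrightarrow>
      (\<forall>i<n. \<forall>j<n. i \<noteq> j \<longrightarrow> {c i<..<d i} \<inter> {c j<..<d j} = {}) \<longrightarrow>
      (\<Sum>i<n. d i - c i) < \<delta> \<longrightarrow> (\<Sum>i<n. \<bar>exp (l * d i) * f (d i) - exp (l * c i) * f (c i)\<bar>) < \<epsilon>"
  proof (intro exI[of _ "min \<delta> (\<epsilon> / (2 * L))"] conjI allI impI)
    show "0 < min \<delta> (\<epsilon> / (2 * L))" using d e L by simp
    fix n :: nat and c d :: "nat \<Rightarrow> real"
    assume A: "\<forall>i<n. c i \<le> d i \<and> {c i..d i} \<subseteq> {a..b}" "\<forall>i<n. \<forall>j<n. i \<noteq> j \<longrightarrow> {c i<..<d i} \<inter> {c j<..<d j} = {}"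
      "(\<Sum>i<n. d i - c i) < min \<delta> (\<epsilon> / (2 * L))"
    have "{a..b} \<subseteq> {0..}" using ab by auto
    hence v: "(\<Sum>i<n. \<bar>f (d i) - f (c i)\<bar>) < \<epsilon> / (2 * K)"
      using A by (intro *) (auto intro: order_trans)
    have s0: "0 \<le> (\<Sum>i<n. d i - c i)" using A(1) by (intro sum_nonneg) auto
    have "(\<Sum>i<n. \<bar>exp (l * d i) * f (d i) - exp (l * c i) * f (c i)\<bar>) \<le> (\<Sum>i<n. K * \<bar>f (d i) - f (c i)\<bar> + C * (l * K) * (d i - c i))"
      using A(1) by (intro sum_mono pt) auto
    also have "\<dots> = K * (\<Sum>i<n. \<bar>f (d i) - f (c i)\<bar>) + C * (l * K) * (\<Sum>i<n. d i - c i)"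
      by (simp add: sum.distrib sum_distrib_left)
    also have "\<dots> \<le> K * (\<Sum>i<n. \<bar>f (d i) - f (c i)\<bar>) + L * (\<Sum>i<n. d i - c i)"
      using s0 by (intro add_left_mono mult_right_mono) (auto simp: L_def)
    also have "\<dots> < K * (\<epsilon> / (2 * K)) + L * (\<epsilon> / (2 * L))"
      using v A(3) K L by (intro add_strict_mono mult_strict_left_mono) auto
    also have "\<dots> = \<epsilon>" using K L by (simp add: field_simps)
    finally show "(\<Sum>i<n. \<bar>exp (l * d i) * f (d i) - exp (l * c i) * f (c i)\<bar>) < \<epsilon>" .
  qed
next
  show "AE t in lborel. t \<in> {a..b} \<longrightarrow> (\<exists>D\<ge>0. ((\<lambda>t. exp (l * t) * f t) has_real_derivative D) (at t))"
    using deriv sub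
  proof eventually_elim
    fix t assume t: "0 \<le> t \<longrightarrow> (f has_real_derivative f' t) (at t)" "0 \<le> t \<longrightarrow> 0 \<le> l * f t + f' t"
    show "t \<in> {a..b} \<longrightarrow> (\<exists>D\<ge>0. ((\<lambda>t. exp (l * t) * f t) has_real_derivative D) (at t))"
    proof
      assume "t \<in> {a..b}"
      with ab t have d: "(f has_real_derivative f' t) (at t)" and nn: "0 \<le> l * f t + f' t" by auto
      have "((\<lambda>t. exp (l * t) * f t) has_real_derivative (exp (l * t) * (l * f t + f' t))) (at t)"
        by (auto intro!: derivative_eq_intros d simp: algebra_simps)
      thus "\<exists>D\<ge>0. ((\<lambda>t. exp (l * t) * f t) has_real_derivative D) (at t)"
        using nn by (intro exI[of _ "exp (l * t) * (l * f t + f' t)"]) auto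
    qed
  qed
qed

section \<open>Integrability of the loss term\<close>

context kinetic begin

lemma mass_liminf:
  assumes [measurable]: "\<And>n. meas (f n)"
  shows "mass (\<lambda>s v. liminf (\<lambda>n. f n s v)) \<le> liminf (\<lambda>n. mass (f n))"
proof -
  have "mass (\<lambda>s v. liminf (\<lambda>n. f n s v)) \<le> (\<integral>\<^sup>+s. liminf (\<lambda>n. \<integral>\<^sup>+v. f n s v \<partial>N) \<partial>lborel)"
    unfolding mass_def by (intro nn_integral_mono nn_integral_liminf) measurable
  also have "\<dots> \<le> liminf (\<lambda>n. mass (f n))"
    unfolding mass_def by (rule nn_integral_liminf) measurable
  finally show ?thesis .
qed

text \<open>
  \<open>x \<le> exp x - 1\<close> for \<open>x = \<integral> min k \<Sigma>\<close>: the fraction removed during time \<open>\<tau>\<close> is, up to the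
  factor \<open>exp (- k \<tau>)\<close>, at least the truncated removal rate integrated over that time.
\<close>

lemma E_truncated:
  assumes v: "v \<in> space N" and t: "0 \<le> \<tau>" and k: "0 \<le> k"
  shows "ennreal (exp (- (k * \<tau>))) * (\<integral>\<^sup>+r. indicator {s..s + \<tau>} r * ennreal (min k (Sg r v)) \<partial>lborel) + E s (s + \<tau>) v \<le> 1"
proof -
  note [measurable] = Sg_section[OF v]
  define x where "x = (LBINT r:{s..s + \<tau>}. min k (Sg r v))"
  have int: "set_integrable lborel {s..s + \<tau>} (\<lambda>r. min k (Sg r v))"
    unfolding set_integrable_def
    by (rule Bochner_Integration.integrable_bound[OF Sg_int[unfolded set_integrable_def, of s "s + \<tau>" v]])
       (use k Sg_nn in \<open>auto simp: indicator_def min_def\<close>)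
  have em: "(\<integral>\<^sup>+r. indicator {s..s + \<tau>} r * ennreal (min k (Sg r v)) \<partial>lborel) = ennreal x"
  proof -
    have "(\<integral>\<^sup>+r. indicator {s..s + \<tau>} r * ennreal (min k (Sg r v)) \<partial>lborel) = (\<integral>\<^sup>+r. ennreal (indicator {s..s + \<tau>} r *\<^sub>R min k (Sg r v)) \<partial>lborel)"
      by (rule nn_integral_cong) (auto simp: indicator_def)
    also have "\<dots> = ennreal x" unfolding x_def set_lebesgue_integral_def
      by (rule nn_integral_eq_integral[OF int[unfolded set_integrable_def]]) (use k Sg_nn in auto)
    finally show ?thesis .
  qed
  have x0: "0 \<le> x" unfolding x_def set_lebesgue_integral_def by (rule integral_nonneg_AE) (use k Sg_nn in auto)
  have xk: "x \<le> k * \<tau>"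
  proof -
    have "x \<le> (LBINT r:{s..s + \<tau>}. k)" unfolding x_def
      by (rule set_integral_mono[OF int]) (auto intro: borel_integrable_atLeastAtMost')
    thus ?thesis using t by (simp add: set_integral_const mult.commute)
  qed
  have xA: "x \<le> (LBINT r:{s..s + \<tau>}. Sg r v)" unfolding x_def
    by (rule set_integral_mono[OF int Sg_int]) auto
  have "exp (- (k * \<tau>)) * x + exp (- (LBINT r:{s..s + \<tau>}. Sg r v)) \<le> exp (- x) * x + exp (- x)"
    using x0 xk xA by (intro add_mono mult_right_mono) auto
  also have "\<dots> = exp (- x) * (1 + x)" by (simp add: algebra_simps)
  also have "\<dots> \<le> exp (- x) * exp x" by (intro mult_left_mono exp_ge_add_one_self) auto
  also have "\<dots> = 1" by (simp add: exp_add[symmetric])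
  finally have "ennreal (exp (- (k * \<tau>)) * x + exp (- (LBINT r:{s..s + \<tau>}. Sg r v))) \<le> ennreal 1" by (rule ennreal_leI)
  thus ?thesis unfolding em E_def using x0 by (simp add: ennreal_mult'[symmetric])
qed

text \<open>
  The loss \<open>mass M - mass (S 0 \<tau> M)\<close> is at most \<open>C \<tau>\<close> and, by \<open>E_truncated\<close>, bounds the mass of
  \<open>\<tau> min k \<Sigma> M\<close> averaged over times at distance at most \<open>\<tau>\<close>.  Taking \<open>\<tau> = 1 / (n + 1)\<close> and \<open>k = n\<close> keeps
  \<open>exp (k \<tau>)\<close> bounded while the truncation disappears; left continuity of \<open>M\<close> in time and Fatou's lemma
  give the bound for \<open>\<Sigma> M\<close> itself.
\<close>

lemma Sg_mass_bound:
  assumes M[measurable]: "meas M" and Mfin: "mass M \<noteq> top"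
    and d: "0 < d" and C: "0 \<le> C"
    and loss: "\<And>\<tau>. 0 < \<tau> \<Longrightarrow> \<tau> < d \<Longrightarrow> mass M \<le> mass (S 0 \<tau> M) + ennreal (C * \<tau>)"
    and cont: "\<And>r v p. v \<in> space N \<Longrightarrow> 0 \<le> p \<Longrightarrow> (\<lambda>n. M (r - p * (1 / real (Suc n))) v) \<longlonglongrightarrow> M r v"
  shows "mass (\<lambda>s v. ennreal (Sg s v) * M s v) \<noteq> top"
proof -
  define \<tau> where "\<tau> n = 1 / real (Suc n)" for n
  have tp: "0 < \<tau> n" for n by (simp add: \<tau>_def)
  \<comment> \<open>The point \<open>r = s + p \<tau>\<close> of the window \<open>[s, s + \<tau>]\<close>, seen from \<open>r\<close>; the average over the window becomes one over \<open>p\<close> in \<open>[0, 1]\<close>.\<close>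
  define G where "G n p r v = ennreal (min (real n) (Sg r v)) * M (r - p * \<tau> n) v" for n p r v
  have Gm: "rmeas (G n)" for n unfolding G_def by measurable
  have bound: "(\<integral>\<^sup>+p. indicator {0..1} p * mass (G n p) \<partial>lborel) \<le> ennreal (C * exp 1)" if n: "\<tau> n < d" for n
  proof -
    let ?k = "real n" and ?t = "\<tau> n"
    let ?x = "\<lambda>s v. \<integral>\<^sup>+r. indicator {s..s + ?t} r * ennreal (min ?k (Sg r v)) \<partial>lborel"
    let ?e = "ennreal (exp (- (?k * ?t)))"
    have S0: "mass (S 0 ?t M) = mass (\<lambda>s v. E s (s + ?t) v * M s v)"
    proof -
      have "(\<lambda>s. \<integral>\<^sup>+v. E (s - ?t) s v * M (s - ?t) v \<partial>N) \<in> borel_measurable borel" by measurable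
      from nn_integral_shift[OF this, of ?t] show ?thesis by (simp add: mass_def S_def vE_0)
    qed
    have "mass (\<lambda>s v. (?e * ?x s v) * M s v) + mass (S 0 ?t M) = mass (\<lambda>s v. (?e * ?x s v + E s (s + ?t) v) * M s v)"
      unfolding S0 by (subst mass_add[symmetric]) (measurable, simp add: distrib_right)
    also have "\<dots> \<le> mass (\<lambda>s v. 1 * M s v)"
      by (intro mass_mono mult_right_mono E_truncated) (use tp[of n] in auto)
    also have "\<dots> = mass M" by simp
    also have "\<dots> \<le> mass (S 0 ?t M) + ennreal (C * ?t)" by (rule loss[OF tp n])
    finally have "mass (S 0 ?t M) + mass (\<lambda>s v. (?e * ?x s v) * M s v) \<le> mass (S 0 ?t M) + ennreal (C * ?t)"
      by (simp add: add.commute)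
    moreover have "mass (S 0 ?t M) < top"
      using S_mass_le[OF M, of ?t 0] tp[of n] Mfin by (auto simp: less_top top_unique)
    ultimately have 1: "mass (\<lambda>s v. (?e * ?x s v) * M s v) \<le> ennreal (C * ?t)"
      by (auto simp: ennreal_add_left_cancel_le)
    have x: "?x s v = ennreal ?t * (\<integral>\<^sup>+p. indicator {0..1} p * ennreal (min ?k (Sg (s + p * ?t) v)) \<partial>lborel)"
      if [measurable]: "v \<in> space N" for s v
    proof -
      have "?x s v = ennreal \<bar>?t\<bar> * (\<integral>\<^sup>+p. indicator {s..s + ?t} (s + ?t * p) * ennreal (min ?k (Sg (s + ?t * p) v)) \<partial>lborel)"
        by (rule nn_integral_real_affine) (use tp[of n] in auto)
      also have "(\<integral>\<^sup>+p. indicator {s..s + ?t} (s + ?t * p) * ennreal (min ?k (Sg (s + ?t * p) v)) \<partial>lborel) =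
         (\<integral>\<^sup>+p. indicator {0..1} p * ennreal (min ?k (Sg (s + p * ?t) v)) \<partial>lborel)"
        by (rule nn_integral_cong) (use tp[of n] in \<open>auto simp: indicator_def mult.commute zero_le_mult_iff mult_le_cancel_left1 mult_le_cancel_right1\<close>)
      finally show ?thesis using tp[of n] by simp
    qed
    have "(\<integral>\<^sup>+p. indicator {0..1} p * mass (G n p) \<partial>lborel) = (\<integral>\<^sup>+p. indicator {0..1} p * mass (\<lambda>s v. ennreal (min ?k (Sg (s + p * ?t) v)) * M s v) \<partial>lborel)"
    proof (rule nn_integral_cong)
      fix p :: real
      have "(\<lambda>r. \<integral>\<^sup>+v. G n p r v \<partial>N) \<in> borel_measurable borel" unfolding G_def by measurable
      from nn_integral_shift[OF this, of "p * ?t"]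
      show "indicator {0..1} p * mass (G n p) = indicator {0..1} p * mass (\<lambda>s v. ennreal (min ?k (Sg (s + p * ?t) v)) * M s v)"
        by (simp add: mass_def G_def)
    qed
    also have "\<dots> = mass (\<lambda>s v. \<integral>\<^sup>+p. indicator {0..1} p * (ennreal (min ?k (Sg (s + p * ?t) v)) * M s v) \<partial>lborel)"
      by (rule mass_interval[symmetric]) measurable
    also have "\<dots> = mass (\<lambda>s v. (\<integral>\<^sup>+p. indicator {0..1} p * ennreal (min ?k (Sg (s + p * ?t) v)) \<partial>lborel) * M s v)"
    proof (rule mass_cong)
      fix s v assume [measurable]: "v \<in> space N"
      show "(\<integral>\<^sup>+p. indicator {0..1} p * (ennreal (min ?k (Sg (s + p * ?t) v)) * M s v) \<partial>lborel) =
        (\<integral>\<^sup>+p. indicator {0..1} p * ennreal (min ?k (Sg (s + p * ?t) v)) \<partial>lborel) * M s v"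
        by (subst nn_integral_multc[symmetric]) (measurable, simp add: mult.assoc)
    qed
    also have "\<dots> = (\<integral>\<^sup>+s. \<integral>\<^sup>+v. ennreal (exp (?k * ?t) / ?t) * ((?e * ?x s v) * M s v) \<partial>N \<partial>lborel)"
      unfolding mass_def
    proof (intro nn_integral_cong)
      fix s v assume v: "v \<in> space N"
      have "ennreal (exp (?k * ?t) / ?t) * (?e * ennreal ?t) = 1"
        using tp[of n] by (simp add: ennreal_mult'[symmetric] exp_minus field_simps)
      hence "ennreal (exp (?k * ?t) / ?t) * ((?e * (ennreal ?t * y)) * z) = y * z" for y z :: ennreal
        by (metis (no_types, lifting) mult.assoc mult.left_neutral)
      thus "(\<integral>\<^sup>+p. indicator {0..1} p * ennreal (min ?k (Sg (s + p * ?t) v)) \<partial>lborel) * M s v =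
         ennreal (exp (?k * ?t) / ?t) * ((?e * ?x s v) * M s v)" unfolding x[OF v] by simp
    qed
    also have "\<dots> = ennreal (exp (?k * ?t) / ?t) * mass (\<lambda>s v. (?e * ?x s v) * M s v)"
      unfolding mass_def[symmetric] by (rule mass_cmult) measurable
    also have "\<dots> \<le> ennreal (exp (?k * ?t) / ?t) * ennreal (C * ?t)" by (intro mult_left_mono 1) simp
    also have "\<dots> = ennreal (C * exp (?k * ?t))"
      using tp[of n] C by (simp add: ennreal_mult'[symmetric] mult.commute)
    also have "\<dots> \<le> ennreal (C * exp 1)"
      using C by (intro ennreal_leI mult_left_mono) (auto simp: \<tau>_def divide_le_eq)
    finally show ?thesis .
  qed
  have le0: "mass (\<lambda>r v. ennreal (Sg r v) * M r v) \<le> mass (\<lambda>r v. liminf (\<lambda>n. G n p r v))" if p: "0 \<le> p" for p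
  proof (rule mass_mono)
    fix r v assume v: "v \<in> space N"
    obtain m :: nat where m: "Sg r v \<le> real m" using real_arch_simple by blast
    have "(\<lambda>n. ennreal (Sg r v) * M (r - p * \<tau> n) v) \<longlonglongrightarrow> ennreal (Sg r v) * M r v"
      unfolding \<tau>_def by (rule ennreal_tendsto_cmult[OF _ cont[OF v p]]) simp
    moreover have "\<forall>\<^sub>F n in sequentially. ennreal (Sg r v) * M (r - p * \<tau> n) v = G n p r v"
      using eventually_ge_at_top[of m] by eventually_elim (use m in \<open>simp add: G_def min_absorb2\<close>)
    ultimately have "(\<lambda>n. G n p r v) \<longlonglongrightarrow> ennreal (Sg r v) * M r v" by (rule Lim_transform_eventually)
    from lim_imp_Liminf[OF _ this] show "ennreal (Sg r v) * M r v \<le> liminf (\<lambda>n. G n p r v)" by simp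
  qed
  have le: "mass (\<lambda>r v. ennreal (Sg r v) * M r v) \<le> liminf (\<lambda>n. mass (G n p))" if p: "0 \<le> p" for p
  proof -
    have "meas (G n p)" for n unfolding G_def by measurable
    from order_trans[OF le0[OF p] mass_liminf[OF this]] show ?thesis .
  qed
  have mm: "(\<lambda>p. mass (G n p)) \<in> borel_measurable borel" for n by (rule mass_measurable[OF Gm])
  note [measurable] = mm
  have "mass (\<lambda>r v. ennreal (Sg r v) * M r v) = (\<integral>\<^sup>+p. mass (\<lambda>r v. ennreal (Sg r v) * M r v) * indicator {0..1::real} p \<partial>lborel)"
    by (subst nn_integral_cmult_indicator) auto
  also have "\<dots> \<le> (\<integral>\<^sup>+p. liminf (\<lambda>n. indicator {0..1} p * mass (G n p)) \<partial>lborel)"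
    by (rule nn_integral_mono) (use le in \<open>auto simp: indicator_def\<close>)
  also have "\<dots> \<le> liminf (\<lambda>n. \<integral>\<^sup>+p. indicator {0..1} p * mass (G n p) \<partial>lborel)"
    by (rule nn_integral_liminf) measurable
  also have "\<dots> \<le> liminf (\<lambda>n. ennreal (C * exp 1))"
  proof (rule Liminf_mono)
    have "\<tau> \<longlonglongrightarrow> 0" unfolding \<tau>_def by (rule LIMSEQ_Suc[OF lim_1_over_n])
    from order_tendstoD(2)[OF this d]
    show "\<forall>\<^sub>F n in sequentially. (\<integral>\<^sup>+p. indicator {0..1} p * mass (G n p) \<partial>lborel) \<le> ennreal (C * exp 1)"
      by eventually_elim (rule bound)
  qed
  also have "\<dots> = ennreal (C * exp 1)" by (simp add: Liminf_const)
  also have "\<dots> < top" by simp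
  finally show ?thesis by simp
qed

end

section \<open>Detailed balance\<close>

context kinetic_data begin

lemma AE_tmeas_iff: "(AE t in tmeas. P t) \<longleftrightarrow> (AE t in lborel. 0 \<le> t \<longrightarrow> P t)"
  unfolding tmeas_def by (subst AE_restrict_space_iff) auto

lemma AE_tvmeas_section:
  assumes P: "{x \<in> space (tvmeas \<mu>). P x} \<in> sets (tvmeas \<mu>)" and ae: "AE x in tvmeas \<mu>. P x"
  shows "AE v in N. AE t in lborel. 0 \<le> t \<longrightarrow> P (t, v)"
proof -
  interpret N: sigma_finite_measure N by (rule sigma_finite_N)
  interpret t: sigma_finite_measure tmeas by (rule sigma_finite_tmeas)
  interpret pair_sigma_finite tmeas N ..
  have "AE t in tmeas. AE v in N. P (t, v)" using AE_pair[of P] ae unfolding tvmeas_def by simp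
  hence "AE v in N. AE t in tmeas. P (t, v)"
    by (subst (asm) AE_commute) (use P in \<open>simp_all add: tvmeas_def\<close>)
  thus ?thesis by (simp add: AE_tmeas_iff)
qed

text \<open>
  Monotonicity of \<open>exp (l t) M(t, v)\<close> propagates positivity: since \<open>M(\<cdot>, v)\<close> is positive almost everywhere, it
  is positive at arbitrarily small times and hence at every positive time.
\<close>

lemma weight_sections:
  assumes M[measurable]: "M \<in> borel_measurable (tvmeas \<mu>)" and l: "0 < l"
    and ac: "AE v in N. absolutely_continuous_fun_on {0..} (\<lambda>t. M (t, v))"
    and pos: "AE x in tvmeas \<mu>. 0 < M x"
    and deriv: "AE v in N. AE t in tmeas. ((\<lambda>t. M (t, v)) has_real_derivative dM (t, v)) (at t)"
    and sub: "AE v in N. AE t in tmeas. 0 \<le> l * M (t, v) + dM (t, v)"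
  shows "AE v in N. continuous_on {0..} (\<lambda>t. M (t, v)) \<and> (\<forall>t>0. 0 < M (t, v)) \<and>
    (\<forall>s t. 0 \<le> s \<longrightarrow> s \<le> t \<longrightarrow> exp (l * s) * M (s, v) \<le> exp (l * t) * M (t, v))"
proof -
  have "AE v in N. AE t in lborel. 0 \<le> t \<longrightarrow> 0 < M (t, v)"
    by (rule AE_tvmeas_section[OF _ pos]) measurable
  thus ?thesis using ac deriv sub unfolding AE_tmeas_iff
  proof eventually_elim
    fix v
    assume p: "AE t in lborel. 0 \<le> t \<longrightarrow> 0 < M (t, v)"
      and ac: "absolutely_continuous_fun_on {0..} (\<lambda>t. M (t, v))"
      and d: "AE t in lborel. 0 \<le> t \<longrightarrow> ((\<lambda>t. M (t, v)) has_real_derivative dM (t, v)) (at t)"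
      and s: "AE t in lborel. 0 \<le> t \<longrightarrow> 0 \<le> l * M (t, v) + dM (t, v)"
    have mono: "exp (l * a) * M (a, v) \<le> exp (l * b) * M (b, v)" if "0 \<le> a" "a \<le> b" for a b
      by (rule ac_exp_mono[OF ac l d s that])
    have "0 < M (t, v)" if t: "0 < t" for t
    proof -
      have "\<exists>r. 0 < r \<and> r < t \<and> 0 < M (r, v)"
      proof (rule ccontr)
        assume no: "\<nexists>r. 0 < r \<and> r < t \<and> 0 < M (r, v)"
        from p have "AE r in lborel. r \<notin> {0<..<t}" by eventually_elim (use no in auto)
        hence "{0<..<t} \<in> null_sets lborel" by (subst AE_iff_null_sets) auto
        thus False using t by (simp add: null_sets_def)
      qed
      then obtain r where r: "0 < r" "r < t" "0 < M (r, v)" by blast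
      hence "0 < exp (l * r) * M (r, v)" by simp
      also have "\<dots> \<le> exp (l * t) * M (t, v)" by (rule mono) (use r in auto)
      finally show ?thesis by (simp add: zero_less_mult_iff)
    qed
    thus "continuous_on {0..} (\<lambda>t. M (t, v)) \<and> (\<forall>t>0. 0 < M (t, v)) \<and>
      (\<forall>s t. 0 \<le> s \<longrightarrow> s \<le> t \<longrightarrow> exp (l * s) * M (s, v) \<le> exp (l * t) * M (t, v))"
      by (intro conjI allI impI ac_continuous_on[OF ac] mono) auto
  qed
qed

text \<open>
  The difference quotients at \<open>f\<close> are eventually within distance \<open>1\<close> of \<open>g\<close>, so their integrals are
  bounded below by \<open>\<integral> g - 1\<close>.
\<close>

lemma generator_domain_loss:
  assumes g: "generates_to (tvmeas \<mu>) (Tn_h \<mu> Sig b 0) f g" and R: "Rep f F"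
  shows "\<exists>d>0. \<exists>C\<ge>0. \<forall>\<tau>. 0 < \<tau> \<longrightarrow> \<tau> < d \<longrightarrow> mass F \<le> mass (S 0 \<tau> F) + ennreal (C * \<tau>)"
proof -
  define h where "h \<tau> x = (Tn_h \<mu> Sig b 0 \<tau> f x - f x) / \<tau> - g x" for \<tau> x
  have gi: "integrable (tvmeas \<mu>) g" and lim: "((\<lambda>\<tau>. L1_norm (tvmeas \<mu>) (h \<tau>)) \<longlongrightarrow> 0) (at_right 0)"
    using g unfolding generates_to_def h_def[abs_def] by auto
  have "\<forall>\<^sub>F \<tau> in at_right 0. L1_norm (tvmeas \<mu>) (h \<tau>) < 1" by (rule order_tendstoD(2)[OF lim]) simp
  then obtain d where d: "d > 0" "\<And>\<tau>. 0 < \<tau> \<Longrightarrow> \<tau> < d \<Longrightarrow> L1_norm (tvmeas \<mu>) (h \<tau>) < 1"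
    unfolding eventually_at_right_field by auto
  define C where "C = 1 + \<bar>\<integral>x. g x \<partial>tvmeas \<mu>\<bar>"
  have "mass F \<le> mass (S 0 \<tau> F) + ennreal (C * \<tau>)" if t: "0 < \<tau>" "\<tau> < d" for \<tau>
  proof -
    have RS: "Rep (Tn_h \<mu> Sig b 0 \<tau> f) (S 0 \<tau> F)" by (rule Rep_Tn_h[OF R]) (use t in simp)
    have "(\<integral>x. h \<tau> x \<partial>tvmeas \<mu>) = ((\<integral>x. Tn_h \<mu> Sig b 0 \<tau> f x \<partial>tvmeas \<mu>) - (\<integral>x. f x \<partial>tvmeas \<mu>)) / \<tau> - (\<integral>x. g x \<partial>tvmeas \<mu>)"
      unfolding h_def using Rep_integral(1)[OF RS] Rep_integral(1)[OF R] gi by simp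
    moreover have "\<bar>\<integral>x. h \<tau> x \<partial>tvmeas \<mu>\<bar> \<le> L1_norm (tvmeas \<mu>) (h \<tau>)"
      unfolding L1_norm_def by (rule integral_abs_bound)
    ultimately have "- C \<le> (enn2real (mass (S 0 \<tau> F)) - enn2real (mass F)) / \<tau>"
      using d(2)[OF t] unfolding Rep_integral(2)[OF RS] Rep_integral(2)[OF R] C_def by linarith
    hence "enn2real (mass F) \<le> enn2real (mass (S 0 \<tau> F)) + C * \<tau>"
      using t(1) by (simp add: pos_le_divide_eq)
    hence "ennreal (enn2real (mass F)) \<le> ennreal (enn2real (mass (S 0 \<tau> F)) + C * \<tau>)" by (rule ennreal_leI)
    also have "\<dots> = ennreal (enn2real (mass (S 0 \<tau> F))) + ennreal (C * \<tau>)"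
      using t(1) by (intro ennreal_plus) (auto simp: C_def)
    finally show ?thesis using RepD(4)[OF R] RepD(4)[OF RS] by (simp add: less_top)
  qed
  moreover have "0 \<le> C" by (simp add: C_def)
  ultimately show ?thesis using d(1) by blast
qed

text \<open>
  The representative \<open>W\<close> of the weight, extended by \<open>0\<close> to times \<open>t \<le> 0\<close>, is shown to satisfy the
  hypotheses of \<open>gain_vanishes\<close>.
\<close>

theorem detailed_balance_honest:
  assumes dom: "M \<in> dom_Z_h \<mu> Sig b" and l: "0 < l"
    and ac: "AE v in N. absolutely_continuous_fun_on {0..} (\<lambda>t. M (t, v))"
    and pos: "AE x in tvmeas \<mu>. 0 < M x"
    and detailed_balance: "\<And>t. t \<ge> 0 \<Longrightarrow> AE (v, v') in N \<Otimes>\<^sub>M N. b (t, v, v') * M (t, v') = b (t, v', v) * M (t, v)"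
    and deriv: "AE v in N. AE t in tmeas. ((\<lambda>t. M (t, v)) has_real_derivative dM (t, v)) (at t)"
    and sub: "AE v in N. AE t in tmeas. 0 \<le> l * M (t, v) + dM (t, v)"
  shows "honest_evolution \<mu> Sig b"
proof -
  interpret N: sigma_finite_measure N by (rule sigma_finite_N)
  interpret NN: pair_sigma_finite N N ..
  obtain g where g: "generates_to (tvmeas \<mu>) (Tn_h \<mu> Sig b 0) M g"
    using dom by (auto simp: dom_Z_h_def gen_dom_def)
  hence Mint: "integrable (tvmeas \<mu>) M" by (simp add: generates_to_def)
  have M[measurable]: "M \<in> borel_measurable (tvmeas \<mu>)" using Mint by (rule borel_measurable_integrable)
  let ?P = "\<lambda>v. continuous_on {0..} (\<lambda>t. M (t, v)) \<and> (\<forall>t>0. 0 < M (t, v)) \<and>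
    (\<forall>s t. 0 \<le> s \<longrightarrow> s \<le> t \<longrightarrow> exp (l * s) * M (s, v) \<le> exp (l * t) * M (t, v))"
  obtain Z where Z: "{v \<in> space N. \<not> ?P v} \<subseteq> Z" "emeasure N Z = 0" "Z \<in> sets N"
    by (rule AE_E[OF weight_sections[OF M l ac pos deriv sub]])
  define G where "G = space N - Z"
  have Gm[measurable]: "G \<in> sets N" unfolding G_def using Z(3) by simp
  have AEG: "AE v in N. v \<in> G"
  proof -
    have "Z \<in> null_sets N" using Z by (simp add: null_sets_def)
    from AE_not_in[OF this] AE_space show ?thesis unfolding G_def by eventually_elim simp
  qed
  have GP: "?P v" if "v \<in> G" for v using that Z(1) by (auto simp: G_def)
  define M0 where "M0 x = (if 0 \<le> fst x then M x else 0)" for x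
  have [measurable]: "M0 \<in> borel_measurable (borel \<Otimes>\<^sub>M N)"
    unfolding M0_def[abs_def] by (rule extend_measurable) (use M in \<open>simp_all add: tvmeas_def\<close>)
  \<comment> \<open>The value \<open>0\<close> at time \<open>0\<close>, a null set, makes \<open>W\<close> left continuous there.\<close>
  define W where "W t v = (if 0 < t \<and> v \<in> G then ennreal (M0 (t, v)) else 0)" for t v
  have W[measurable]: "meas W" unfolding W_def by measurable
  have W_eq: "W t v = ennreal (M (t, v))" "0 < W t v" if "0 < t" "v \<in> G" for t v
    using that GP[of v] by (auto simp: W_def M0_def)
  have W0: "W t v = 0" if "t \<le> 0 \<or> v \<notin> G" for t v using that by (auto simp: W_def)
  have ne0: "AE t in lborel. t \<noteq> (0::real)" by (rule AE_lborel_singleton)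
  have AEx: "AE x in tvmeas \<mu>. fst x \<noteq> 0 \<and> snd x \<in> G"
  proof (rule AE_tvmeasI)
    show "AE s::real in lborel. 0 \<le> s \<longrightarrow> (AE v in N. fst (s, v) \<noteq> 0 \<and> snd (s, v) \<in> G)"
      using ne0 by eventually_elim (use AEG in simp)
  qed measurable
  have WM: "AE x in tvmeas \<mu>. W (fst x) (snd x) = ennreal (M x) \<and> 0 \<le> M x"
    using AEx pos AE_space
  proof eventually_elim
    fix x assume "fst x \<noteq> 0 \<and> snd x \<in> G" "0 < M x" "x \<in> space (tvmeas \<mu>)"
    thus "W (fst x) (snd x) = ennreal (M x) \<and> 0 \<le> M x"
      using W_eq(1)[of "fst x" "snd x"] by (auto simp: space_tv)
  qed
  have Wfin: "mass W \<noteq> top"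
  proof -
    have "mass W = (\<integral>\<^sup>+x. W (fst x) (snd x) \<partial>tvmeas \<mu>)"
      by (rule nn_integral_tv_mass[OF W, symmetric]) (simp add: W0)
    also have "\<dots> = (\<integral>\<^sup>+x. ennreal (norm (M x)) \<partial>tvmeas \<mu>)"
      by (rule nn_integral_cong_AE) (use WM in eventually_elim, simp)
    also have "\<dots> < \<infinity>" using Mint by (simp add: integrable_iff_bounded)
    finally show ?thesis by simp
  qed
  have R: "Rep M W" unfolding Rep_def using M W Wfin WM by (simp add: W0)
  obtain d C where dC: "0 < d" "0 \<le> C"
    and loss: "\<And>\<tau>. 0 < \<tau> \<Longrightarrow> \<tau> < d \<Longrightarrow> mass W \<le> mass (S 0 \<tau> W) + ennreal (C * \<tau>)"
    using generator_domain_loss[OF g R] by blast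
  have cont: "(\<lambda>n. W (r - p * (1 / real (Suc n))) v) \<longlonglongrightarrow> W r v" if p: "0 \<le> p" for r v p
  proof (cases "0 < r \<and> v \<in> G")
    case True
    have "(\<lambda>n. p * (1 / real (Suc n))) \<longlonglongrightarrow> p * 0"
      by (intro tendsto_mult tendsto_const LIMSEQ_Suc[OF lim_1_over_n])
    hence lim: "(\<lambda>n. r - p * (1 / real (Suc n))) \<longlonglongrightarrow> r" by (auto intro: tendsto_eq_intros)
    have "continuous_on {0<..} (\<lambda>t. M (t, v))" using GP[of v] True by (auto elim: continuous_on_subset)
    hence "isCont (\<lambda>t. M (t, v)) r" using True by (simp add: continuous_on_eq_continuous_at)
    from isCont_tendsto_compose[OF this lim]
    have "(\<lambda>n. ennreal (M (r - p * (1 / real (Suc n)), v))) \<longlonglongrightarrow> ennreal (M (r, v))" by (rule tendsto_ennrealI)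
    moreover have "\<forall>\<^sub>F n in sequentially. ennreal (M (r - p * (1 / real (Suc n)), v)) = W (r - p * (1 / real (Suc n))) v"
      using order_tendstoD(1)[OF lim, of 0] True by (auto elim!: eventually_mono simp: W_eq)
    ultimately show ?thesis using True by (auto intro: Lim_transform_eventually simp: W_eq)
  next
    case False
    have "W (r - p * (1 / real (Suc n))) v = 0" for n
    proof (rule W0)
      have "0 \<le> p * (1 / real (Suc n))" using p by simp
      with False show "r - p * (1 / real (Suc n)) \<le> 0 \<or> v \<notin> G" by linarith
    qed
    moreover have "W r v = 0" by (rule W0) (use False in auto)
    ultimately show ?thesis by simp
  qed
  have SgW: "mass (\<lambda>s v. ennreal (Sg s v) * W s v) \<noteq> top"
    by (rule Sg_mass_bound[OF W Wfin dC loss cont])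
  have mono: "ennreal (exp (l * s)) * W s v \<le> ennreal (exp (l * t)) * W t v" if "s \<le> t" "v \<in> space N" for s t v
  proof (cases "0 < s \<and> v \<in> G")
    case True
    with that GP[of v] have "exp (l * s) * M (s, v) \<le> exp (l * t) * M (t, v)" by auto
    thus ?thesis using True that by (simp add: W_eq ennreal_mult'[symmetric] ennreal_leI)
  qed (simp add: W0 not_less)
  have db: "AE t in lborel. AE v in N. Bk W t v \<le> ennreal (Sg t v) * W t v"
    using kin.loss
  proof eventually_elim
    fix t assume ls: "AE v in N. (\<integral>\<^sup>+ w. bb t w v \<partial>N) \<le> ennreal (Sg t v)"
    show "AE v in N. Bk W t v \<le> ennreal (Sg t v) * W t v"
    proof (cases "0 < t")
      case False
      hence "Bk W t v = 0" for v by (simp add: Bk_def B_def W0)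
      thus ?thesis by simp
    next
      case True
      have "AE v in N. AE w in N. b (t, v, w) * M (t, w) = b (t, w, v) * M (t, v)"
        using NN.AE_pair[OF detailed_balance[of t]] True by simp
      with ls AEG AE_space show ?thesis
      proof eventually_elim
        fix v assume ls: "(\<integral>\<^sup>+ w. bb t w v \<partial>N) \<le> ennreal (Sg t v)" and v: "v \<in> G" and [measurable]: "v \<in> space N"
          and db: "AE w in N. b (t, v, w) * M (t, w) = b (t, w, v) * M (t, v)"
        have "Bk W t v = (\<integral>\<^sup>+w. bb t v w * W t w \<partial>N)" by (simp add: Bk_def B_def)
        also have "\<dots> = (\<integral>\<^sup>+w. bb t w v * W t v \<partial>N)"
        proof (rule nn_integral_cong_AE, use db AEG AE_space in eventually_elim)
          fix w assume e: "b (t, v, w) * M (t, w) = b (t, w, v) * M (t, v)" and w: "w \<in> G" "w \<in> space N"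
          have n: "0 \<le> b (t, v, w)" "0 \<le> b (t, w, v)"
            using b_nonneg True w \<open>v \<in> space N\<close> by (simp_all add: space_N)
          have "bb t v w * W t w = ennreal (b (t, v, w) * M (t, w))"
            using True w n by (simp add: bb_def b0_def W_eq ennreal_mult')
          also have "\<dots> = bb t w v * W t v"
            unfolding e using True v n by (simp add: bb_def b0_def W_eq ennreal_mult')
          finally show "bb t v w * W t w = bb t w v * W t v" .
        qed
        also have "\<dots> = (\<integral>\<^sup>+w. bb t w v \<partial>N) * W t v" unfolding bb_def by (rule nn_integral_multc) measurable
        also have "\<dots> \<le> ennreal (Sg t v) * W t v" by (rule mult_right_mono[OF ls]) simp
        finally show "Bk W t v \<le> ennreal (Sg t v) * W t v" .
      qed
    qed
  qed
  have pos': "AE x in lborel \<Otimes>\<^sub>M N. 0 \<le> fst x \<longrightarrow> 0 < W (fst x) (snd x)"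
  proof (subst kin.AE_pair_iff(1)[of "\<lambda>s v. 0 \<le> s \<longrightarrow> 0 < W s v"])
    show "AE s in lborel. AE v in N. 0 \<le> s \<longrightarrow> 0 < W s v"
      using ne0
    proof eventually_elim
      fix s :: real assume "s \<noteq> 0"
      show "AE v in N. 0 \<le> s \<longrightarrow> 0 < W s v" using AEG by eventually_elim (use \<open>s \<noteq> 0\<close> W_eq(2) in simp)
    qed
  qed measurable
  show ?thesis
  proof (rule honest_if_gain_vanishes)
    fix \<Phi> u assume a: "meas \<Phi>" "mass \<Phi> \<noteq> top" "\<And>s v. s < 0 \<Longrightarrow> \<Phi> s v = 0"
    show "(\<lambda>n. mass (Bk (J n u \<Phi>))) \<longlonglongrightarrow> 0"
      by (rule gain_vanishes[OF W Wfin SgW less_imp_le[OF l] mono db pos' a])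
  qed
qed

end

theorem theorem5p9:
  fixes \<mu> :: "(real ^ 'd) measure"
    and Sig :: "real \<times> (real ^ 'd) \<Rightarrow> real"
    and b :: "real \<times> (real ^ 'd) \<times> (real ^ 'd) \<Rightarrow> real"
    and M dM :: "real \<times> (real ^ 'd) \<Rightarrow> real"
    and lam :: real
  assumes borel: "sets \<mu> = sets borel"
    and sigma_finite: "sigma_finite_measure \<mu>"
    and Sig_measurable: "Sig \<in> borel_measurable (tvmeas \<mu>)"
    and Sig_nonneg: "\<And>t v. t \<ge> 0 \<Longrightarrow> v \<in> supp \<mu> \<Longrightarrow> Sig (t, v) \<ge> 0"
    and Sig_locally_integrable:
      "AE v in vmeas \<mu>. \<forall>T\<ge>0. set_integrable lborel {0..T} (\<lambda>t. Sig (t, v))"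
    and b_measurable: "b \<in> borel_measurable (tmeas \<Otimes>\<^sub>M (vmeas \<mu> \<Otimes>\<^sub>M vmeas \<mu>))"
    and b_nonneg:
      "\<And>t v v'. t \<ge> 0 \<Longrightarrow> v \<in> supp \<mu> \<Longrightarrow> v' \<in> supp \<mu> \<Longrightarrow> b (t, v, v') \<ge> 0"
    and b_le_Sig:
      "AE (t, v') in tvmeas \<mu>.
        (\<integral>\<^sup>+ v. ennreal (b (t, v, v')) \<partial>vmeas \<mu>) \<le> ennreal (Sig (t, v'))"
    and M_dom: "M \<in> dom_Z_h \<mu> Sig b"
    \<comment> \<open>\<open>M\<close> is the representative, absolutely continuous in time, of its class\<close>
    and M_ac: "AE v in vmeas \<mu>. absolutely_continuous_fun_on {0..} (\<lambda>t. M (t, v))"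
    and M_pos: "AE (t, v) in tvmeas \<mu>. M (t, v) > 0"
    and detailed_balance:
      "\<And>t. t \<ge> 0 \<Longrightarrow> AE (v, v') in vmeas \<mu> \<Otimes>\<^sub>M vmeas \<mu>.
        b (t, v, v') * M (t, v') = b (t, v', v) * M (t, v)"
    \<comment> \<open>\<open>dM\<close> is the time derivative, which exists for almost every time\<close>
    and dM: "AE v in vmeas \<mu>. AE t in tmeas.
        ((\<lambda>t. M (t, v)) has_real_derivative dM (t, v)) (at t)"
    and lam_pos: "lam > 0"
    and sub: "AE v in vmeas \<mu>. AE t in tmeas. lam * M (t, v) + dM (t, v) \<ge> 0"
  shows "honest_evolution \<mu> Sig b"
proof -
  interpret kinetic_data \<mu> Sig b
    by (rule kinetic_data.intro[OF borel sigma_finite Sig_measurable Sig_nonneg Sig_locally_integrable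
      b_measurable b_nonneg b_le_Sig])
  show ?thesis
    by (rule detailed_balance_honest[OF M_dom lam_pos M_ac _ detailed_balance dM sub]) (use M_pos in simp)
qed

end
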